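(* (Optimal control.) Let $(c,d)\in\mathcal S$. The process $C^*$ constructed in the context (starting from $(c,d)$) is an optimal state process for the value function at $(c,d)$, with corresponding optimal control $I^*=(I^{*,+},I^{*,-})$ defined by $I^*_t=C^*_t-c$; that is, $I^*\in\mathcal I$, $C^{c,I^*}=C^*$ and $G(c,d;I^* )=v(c,d)$.
   Context: Setting. $(\Omega,\mathcal F,\mathbb P)$ is a probability space with a filtration $\mathbb F=(\mathcal F_t)_{t\ge 0}$ satisfying the usual conditions and supporting a standard one-dimensional Brownian motion $W$. Let $\mathcal O=(d_{\min},d_{\max})$ with $-\infty\le d_{\min}<d_{\max}\le\infty$ and $\mathcal S=\mathbb R\times\mathcal O$. Demand: $\mathrm dD_t=\mu(D_t)\mathrm dt+\sigma(D_t)\mathrm dW_t$, $D_0=d$, where $\mu,\sigma:\mathcal O\to\mathbb R$ are continuous with at most linear growth; $\sigma^2>0$ on $\mathcal O$; for every $d\in\mathcal O$ there is a unique non-exploding continuous solution $D^d$ with values in $\mathcal O$; if $d_n\to d$ in $\mathcal O$ then $D^{d_n}_t\to D^d_t$ a.s. for every $t$; if $d\le d'$ then $D^d_t\le D^{d'}_t$ a.s. for every $t\ge0$; $D$ is a regular diffusion and $d_{\min},d_{\max}$ are natural boundaries (Feller's classification). Cost: $g:\mathcal S\to[0,\infty)$ is continuous, $g(\cdot,d)\in C^1(\mathbb R)$ is convex for every $d$, the partial derivative $g_c$ is continuous on $\mathcal S$, $g_c(c,\cdot)$ is nonincreasing for every $c$, and $|g(c,d)|+|g_c(c,d)|\le\gamma_0(c)+\eta_0(c)|d|^\nu$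 for some positive locally bounded $\gamma_0,\eta_0$ and some $\nu\ge0$. $K_0\ge0,K_1\in\mathbb R$ are constants such that $\mathbb E|D^d_t|^\nu\le K_0(1+|d|^\nu)e^{K_1t}$ for all $t,d$ (they exist by linear growth), and the discount rate satisfies $\rho>\max(K_1,0)$. The constants $q_0^+,q_0^-$ are in $(0,\infty)$. Controls: $\mathcal I$ is the set of càdlàg $\mathbb F$-adapted processes $I$ of bounded variation on bounded time intervals, with $I_{0^-}=0$; $I=I^+-I^-$ is the minimal decomposition ($I^\pm$ the positive/negative variations), also written $I=(I^+,I^-)$. Capacity: $C^{c,I}_t=c+I_t$. Define $$G(c,d;I)=\mathbb E\Big[\int_0^\infty e^{-\rho t}\big(g(C^{c,I}_t,D^d_t)\mathrm dt+q_0^+\mathrm dI^+_t+q_0^-\mathrm dI^-_t\big)\Big]$$ (a jump at time $0$ is counted), and $v(c,d)=\inf_{I\in\mathcal I}G(c,d;I)$. It is known that $v(\cdot,d)$ is convex and differentiable and $v_c$ is continuous on $\mathcal S$ with $-q_0^+\le v_c\le q_0^-$. Boundary functions $\mathcal O\to[-\infty,\infty]$: $\hat c_+(d)=\inf\{c\in\mathbb R: v_c(c,d)>-q_0^+\}$, $\hat c_-(d)=\sup\{c\in\mathbb R: v_c(c,d)<q_0^-\}$ (with $\inf\emptyset=\infty$, $\sup\emptyset=-\infty$). It is known that $\hat c_+<\infty$, $\hat c_->-\infty$, $\hat c_+<\hat c_-$, both are nondecreasing, $\hat c_+$ is right-continuous and $\hat c_-$ left-continuous. Construction of $C^*$. Fix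 $(c,d)\in\mathcal S$ and write $D=D^d$; $\inf\emptyset=\infty$. Let $\tau_0^+=\inf\{t\ge0: c<\hat c_+(D_t)\}$, $\tau_0^-=\inf\{t\ge0: c>\hat c_-(D_t)\}$, $\tau_0=\tau_0^+\wedge\tau_0^-$, $\tau_{-1}=0$, $\Omega_\infty=\{\tau_0=\infty\}$, $\Omega_+=\{\tau_0^+<\tau_0^-\}$, $\Omega_-=\{\tau_0^->\!\!\!\!/\ \tau_0^+\}\setminus\Omega_\infty=\{\tau_0^-<\tau_0^+\}$. Put $C^0_t=c$ for $t\ge0$. For $k\ge1$ and $t\ge\tau_{k-1}$ let $\overline D^k_t=\max_{s\in[\tau_{k-1},t]}D_s$, $\underline D^k_t=\min_{s\in[\tau_{k-1},t]}D_s$, and define recursively: - on $\Omega_\infty$: $C^k_t=c$, $\tau_k=\infty$; - if ($k$ is odd, on $\Omega_+$) or ($k$ is even, on $\Omega_-$): $C^k_t=\hat c_+(\overline D^k_t)$ for $t\ge\tau_{k-1}$, and $\tau_k=\inf\{t\ge\tau_{k-1}: C^k_t>\hat c_-(D_t)\}$; - if ($k$ is odd, on $\Omega_-$) or ($k$ is even, on $\Omega_+$): $C^k_t=\hat c_-(\underline D^k_t)$ for $t\ge\tau_{k-1}$, and $\tau_k=\inf\{t\ge\tau_{k-1}: C^k_t<\hat c_+(D_t)\}$ (with $\tau_k=\infty$ whenever $\tau_{k-1}=\infty$). Finally $C^*_t=\sum_{k=0}^\infty C^k_t\,\mathbf 1_{[\tau_{k-1},\tau_k)}(t)$, $t\ge0$.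 *)

theory Defs
  imports "HOL-Probability.Probability"
begin

section \<open>Filtrations, Brownian motion, stochastic integral\<close>

text \<open>
  Time is the half-line \<open>t \<ge> 0\<close> inside the type of reals. Nothing is ever assumed about
  \<open>F t\<close> or about processes at negative times; the library notions for filtrations, which are
  indexed by a whole type, are applied to the family \<open>\<lambda>t. F (max 0 t)\<close>.
\<close>

definition usual_filtration :: "'a measure \<Rightarrow> (real \<Rightarrow> 'a measure) \<Rightarrow> bool" where
  "usual_filtration M F \<longleftrightarrow>
     filtration (space M) (\<lambda>t. F (max 0 t)) \<and>
     (\<forall>t\<ge>0. subalgebra M (F t)) \<and>
     (\<forall>t\<ge>0. sets (F t) = (\<Inter>s\<in>{t<..}. sets (F s))) \<and>
     (\<forall>N\<in>null_sets M. \<forall>A. A \<subseteq> N \<longrightarrow> A \<in> sets (F 0))"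

definition adapted :: "(real \<Rightarrow> 'a measure) \<Rightarrow> (real \<Rightarrow> 'a \<Rightarrow> real) \<Rightarrow> bool" where
  "adapted F X \<longleftrightarrow> (\<forall>t\<ge>0. X t \<in> borel_measurable (F t))"

definition brownian_motion ::
  "'a measure \<Rightarrow> (real \<Rightarrow> 'a measure) \<Rightarrow> (real \<Rightarrow> 'a \<Rightarrow> real) \<Rightarrow> bool" where
  "brownian_motion M F W \<longleftrightarrow>
     adapted F W \<and>
     (AE \<omega> in M. W 0 \<omega> = 0) \<and>
     (AE \<omega> in M. continuous_on {0..} (\<lambda>t. W t \<omega>)) \<and>
     (\<forall>s t. 0 \<le> s \<and> s < t \<longrightarrow>
        distributed M lborel (\<lambda>\<omega>. W t \<omega> - W s \<omega>)
          (\<lambda>x. ennreal (normal_density 0 (sqrt (t - s)) x)) \<and>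
        prob_space.indep_set M (sets (F s))
          {(\<lambda>\<omega>. W t \<omega> - W s \<omega>) -` B \<inter> space M | B. B \<in> sets borel})"

definition null_in_prob :: "'a measure \<Rightarrow> (nat \<Rightarrow> 'a \<Rightarrow> ennreal) \<Rightarrow> bool" where
  "null_in_prob M Z \<longleftrightarrow>
     (\<forall>n. Z n \<in> borel_measurable M) \<and>
     (\<forall>e>0. (\<lambda>n. measure M {\<omega> \<in> space M. Z n \<omega> > ennreal e}) \<longlonglongrightarrow> 0)"

text \<open>
  A triple \<open>(n, s, \<xi>)\<close> stands for the simple integrand
  \<open>\<Sum>i<n. \<xi> i * indicator {s i<..s (i+1)}\<close>.
\<close>

type_synonym 'a simple_integrand = "nat \<times> (nat \<Rightarrow> real) \<times> (nat \<Rightarrow> 'a \<Rightarrow> real)"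

fun simple_integrand :: "(real \<Rightarrow> 'a measure) \<Rightarrow> 'a simple_integrand \<Rightarrow> bool" where
  "simple_integrand F (n, s, \<xi>) \<longleftrightarrow>
     0 \<le> s 0 \<and> (\<forall>i<n. s i \<le> s (Suc i)) \<and>
     (\<forall>i<n. \<xi> i \<in> borel_measurable (F (s i)) \<and> (\<exists>B. \<forall>\<omega>\<in>space (F (s i)). \<bar>\<xi> i \<omega>\<bar> \<le> B))"

fun simple_value :: "'a simple_integrand \<Rightarrow> real \<Rightarrow> 'a \<Rightarrow> real" where
  "simple_value (n, s, \<xi>) t \<omega> = (\<Sum>i<n. \<xi> i \<omega> * indicator {s i<..s (Suc i)} t)"

fun simple_integral ::
  "(real \<Rightarrow> 'a \<Rightarrow> real) \<Rightarrow> 'a simple_integrand \<Rightarrow> real \<Rightarrow> 'a \<Rightarrow> real" where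
  "simple_integral W (n, s, \<xi>) t \<omega> =
     (\<Sum>i<n. \<xi> i \<omega> * (W (min t (s (Suc i))) \<omega> - W (min t (s i)) \<omega>))"

text \<open>
  \<open>Y\<close> is a version of the Ito integral of \<open>H\<close> with respect to \<open>W\<close> over \<open>[0, t]\<close>: the limit in
  probability of integrals of simple integrands that converge to \<open>H\<close> in \<open>L\<^sup>2([0, t])\<close> in
  probability.
\<close>

definition has_ito_integral ::
  "'a measure \<Rightarrow> (real \<Rightarrow> 'a measure) \<Rightarrow> (real \<Rightarrow> 'a \<Rightarrow> real) \<Rightarrow> (real \<Rightarrow> 'a \<Rightarrow> real)
     \<Rightarrow> real \<Rightarrow> ('a \<Rightarrow> real) \<Rightarrow> bool" where
  "has_ito_integral M F W H t Y \<longleftrightarrow>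
     Y \<in> borel_measurable M \<and>
     (\<exists>S. (\<forall>n. simple_integrand F (S n)) \<and>
        null_in_prob M (\<lambda>n \<omega>. \<integral>\<^sup>+r\<in>{0..t}. ennreal ((simple_value (S n) r \<omega> - H r \<omega>)\<^sup>2) \<partial>lborel) \<and>
        null_in_prob M (\<lambda>n \<omega>. ennreal \<bar>simple_integral W (S n) t \<omega> - Y \<omega>\<bar>))"


section \<open>The demand diffusion\<close>

definition demand_space :: "ereal \<Rightarrow> ereal \<Rightarrow> real set" where
  "demand_space dmin dmax = {x. dmin < ereal x \<and> ereal x < dmax}"

definition sde_solution ::
  "'a measure \<Rightarrow> (real \<Rightarrow> 'a measure) \<Rightarrow> (real \<Rightarrow> 'a \<Rightarrow> real) \<Rightarrow> real set
     \<Rightarrow> (real \<Rightarrow> real) \<Rightarrow> (real \<Rightarrow> real) \<Rightarrow> real \<Rightarrow> (real \<Rightarrow> 'a \<Rightarrow> real) \<Rightarrow> bool" where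
  "sde_solution M F W Ob \<mu> \<sigma> d X \<longleftrightarrow>
     adapted F X \<and>
     (\<forall>\<omega>\<in>space M. continuous_on {0..} (\<lambda>t. X t \<omega>) \<and> (\<forall>t\<ge>0. X t \<omega> \<in> Ob)) \<and>
     (AE \<omega> in M. X 0 \<omega> = d) \<and>
     (\<forall>t\<ge>0. \<exists>Y. has_ito_integral M F W (\<lambda>r \<omega>. \<sigma> (X r \<omega>)) t Y \<and>
        (AE \<omega> in M. X t \<omega> = d + (LBINT r:{0..t}. \<mu> (X r \<omega>)) + Y \<omega>))"

text \<open>
  Regular diffusion: the family is strong Markov and reaches every state from every state with
  positive probability. It suffices to state the strong Markov property at finite stopping
  times and for bounded continuous test functions.
\<close>

definition strong_markov_family ::
  "'a measure \<Rightarrow> (real \<Rightarrow> 'a measure) \<Rightarrow> real set \<Rightarrow> (real \<Rightarrow> real \<Rightarrow> 'a \<Rightarrow> real) \<Rightarrow> bool" where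
  "strong_markov_family M F Ob D \<longleftrightarrow>
     (\<forall>d\<in>Ob. \<forall>T A t f.
        stopping_time (\<lambda>r. F (max 0 r)) T \<and> (\<forall>\<omega>\<in>space M. 0 \<le> T \<omega>) \<and>
        A \<in> sets (filtration.pre_sigma (space M) (\<lambda>r. F (max 0 r)) T) \<and> 0 \<le> t \<and>
        continuous_on UNIV f \<and> bounded (range f) \<longrightarrow>
        (LINT \<omega>:A|M. f (D d (T \<omega> + t) \<omega>)) =
        (LINT \<omega>:A|M. (LINT \<omega>'|M. (f (D (D d (T \<omega>) \<omega>) t \<omega>') :: real))))"

definition regular_diffusion ::
  "'a measure \<Rightarrow> (real \<Rightarrow> 'a measure) \<Rightarrow> real set \<Rightarrow> (real \<Rightarrow> real \<Rightarrow> 'a \<Rightarrow> real) \<Rightarrow> bool" where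
  "regular_diffusion M F Ob D \<longleftrightarrow>
     strong_markov_family M F Ob D \<and>
     (\<forall>x\<in>Ob. \<forall>y\<in>Ob. measure M {\<omega> \<in> space M. \<exists>t\<ge>0. D x t \<omega> = y} > 0)"

definition scale_density :: "(real \<Rightarrow> real) \<Rightarrow> (real \<Rightarrow> real) \<Rightarrow> real \<Rightarrow> real \<Rightarrow> real" where
  "scale_density \<mu> \<sigma> x0 y = exp (- (LBINT z=ereal x0..ereal y. 2 * \<mu> z / (\<sigma> z)\<^sup>2))"

definition speed_density :: "(real \<Rightarrow> real) \<Rightarrow> (real \<Rightarrow> real) \<Rightarrow> real \<Rightarrow> real \<Rightarrow> real" where
  "speed_density \<mu> \<sigma> x0 y = 2 / ((\<sigma> y)\<^sup>2 * scale_density \<mu> \<sigma> x0 y)"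

text \<open>
  Feller's test integrals on the set \<open>J\<close> of states between the base point \<open>x0\<close> and the boundary:
  an iterated integral of densities \<open>a\<close> (outer) and \<open>b\<close> (inner, between \<open>x0\<close> and \<open>y\<close>). A boundary
  is natural iff both the scale-speed and the speed-scale integral diverge.
\<close>

definition feller_integral ::
  "real set \<Rightarrow> real \<Rightarrow> (real \<Rightarrow> real) \<Rightarrow> (real \<Rightarrow> real) \<Rightarrow> ennreal" where
  "feller_integral J x0 a b =
     (\<integral>\<^sup>+y\<in>J. ennreal (a y) * (\<integral>\<^sup>+z\<in>closed_segment x0 y. ennreal (b z) \<partial>lborel) \<partial>lborel)"

definition natural_boundary_on ::
  "(real \<Rightarrow> real) \<Rightarrow> (real \<Rightarrow> real) \<Rightarrow> real set \<Rightarrow> real \<Rightarrow> bool" where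
  "natural_boundary_on \<mu> \<sigma> J x0 \<longleftrightarrow>
     feller_integral J x0 (scale_density \<mu> \<sigma> x0) (speed_density \<mu> \<sigma> x0) = \<infinity> \<and>
     feller_integral J x0 (speed_density \<mu> \<sigma> x0) (scale_density \<mu> \<sigma> x0) = \<infinity>"

definition natural_boundaries ::
  "(real \<Rightarrow> real) \<Rightarrow> (real \<Rightarrow> real) \<Rightarrow> ereal \<Rightarrow> ereal \<Rightarrow> bool" where
  "natural_boundaries \<mu> \<sigma> dmin dmax \<longleftrightarrow>
     (\<forall>x0\<in>demand_space dmin dmax.
        natural_boundary_on \<mu> \<sigma> {y. dmin < ereal y \<and> y < x0} x0 \<and>
        natural_boundary_on \<mu> \<sigma> {y. x0 < y \<and> ereal y < dmax} x0)"


section \<open>Controls\<close>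

definition cadlag :: "(real \<Rightarrow> real) \<Rightarrow> bool" where
  "cadlag f \<longleftrightarrow>
     (\<forall>t\<ge>0. continuous (at_right t) f) \<and> (\<forall>t>0. \<exists>l. (f \<longlongrightarrow> l) (at_left t))"

text \<open>
  The convention \<open>I\<^bsub>0-\<^esub> = 0\<close> is implemented by extending paths by \<open>0\<close> to negative times, so that
  variations over \<open>(-\<infinity>, t]\<close> of the extension count the jump at time \<open>0\<close>.
\<close>

definition extend0 :: "(real \<Rightarrow> real) \<Rightarrow> real \<Rightarrow> real" where
  "extend0 f t = (if t < 0 then 0 else f t)"

definition partitions_upto :: "real \<Rightarrow> (nat \<times> (nat \<Rightarrow> real)) set" where
  "partitions_upto t = {(n, s). (\<forall>i<n. s i \<le> s (Suc i)) \<and> s n = t}"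

definition pos_variation :: "(real \<Rightarrow> real) \<Rightarrow> real \<Rightarrow> ennreal" where
  "pos_variation f t =
     (SUP (n, s)\<in>partitions_upto t.
        \<Sum>i<n. ennreal (max 0 (extend0 f (s (Suc i)) - extend0 f (s i))))"

definition neg_variation :: "(real \<Rightarrow> real) \<Rightarrow> real \<Rightarrow> ennreal" where
  "neg_variation f t =
     (SUP (n, s)\<in>partitions_upto t.
        \<Sum>i<n. ennreal (max 0 (extend0 f (s i) - extend0 f (s (Suc i)))))"

definition total_variation :: "(real \<Rightarrow> real) \<Rightarrow> real \<Rightarrow> ennreal" where
  "total_variation f t =
     (SUP (n, s)\<in>partitions_upto t.
        \<Sum>i<n. ennreal \<bar>extend0 f (s (Suc i)) - extend0 f (s i)\<bar>)"

definition controls :: "'a measure \<Rightarrow> (real \<Rightarrow> 'a measure) \<Rightarrow> (real \<Rightarrow> 'a \<Rightarrow> real) set" where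
  "controls M F =
     {I. adapted F I \<and>
         (\<forall>\<omega>\<in>space M. cadlag (\<lambda>t. I t \<omega>) \<and> (\<forall>t\<ge>0. total_variation (\<lambda>s. I s \<omega>) t < \<infinity>))}"

definition dI_plus :: "(real \<Rightarrow> 'a \<Rightarrow> real) \<Rightarrow> 'a \<Rightarrow> real measure" where
  "dI_plus I \<omega> = interval_measure (\<lambda>t. enn2real (pos_variation (\<lambda>s. I s \<omega>) t))"

definition dI_minus :: "(real \<Rightarrow> 'a \<Rightarrow> real) \<Rightarrow> 'a \<Rightarrow> real measure" where
  "dI_minus I \<omega> = interval_measure (\<lambda>t. enn2real (neg_variation (\<lambda>s. I s \<omega>) t))"


section \<open>Cost functional and value function\<close>

definition capacity :: "real \<Rightarrow> (real \<Rightarrow> 'a \<Rightarrow> real) \<Rightarrow> real \<Rightarrow> 'a \<Rightarrow> real" where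
  "capacity c I t \<omega> = c + I t \<omega>"

definition cost ::
  "'a measure \<Rightarrow> (real \<Rightarrow> real \<Rightarrow> 'a \<Rightarrow> real) \<Rightarrow> (real \<Rightarrow> real \<Rightarrow> real) \<Rightarrow> real \<Rightarrow> real \<Rightarrow> real
     \<Rightarrow> real \<Rightarrow> real \<Rightarrow> (real \<Rightarrow> 'a \<Rightarrow> real) \<Rightarrow> ennreal" where
  "cost M D g \<rho> q0p q0m c d I =
     (\<integral>\<^sup>+\<omega>.
        (\<integral>\<^sup>+t\<in>{0..}. ennreal (exp (- \<rho> * t) * g (capacity c I t \<omega>) (D d t \<omega>)) \<partial>lborel)
        + (\<integral>\<^sup>+t\<in>{0..}. ennreal (exp (- \<rho> * t) * q0p) \<partial>(dI_plus I \<omega>))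
        + (\<integral>\<^sup>+t\<in>{0..}. ennreal (exp (- \<rho> * t) * q0m) \<partial>(dI_minus I \<omega>))
      \<partial>M)"

definition value_fun ::
  "'a measure \<Rightarrow> (real \<Rightarrow> 'a measure) \<Rightarrow> (real \<Rightarrow> real \<Rightarrow> 'a \<Rightarrow> real) \<Rightarrow> (real \<Rightarrow> real \<Rightarrow> real)
     \<Rightarrow> real \<Rightarrow> real \<Rightarrow> real \<Rightarrow> real \<Rightarrow> real \<Rightarrow> ennreal" where
  "value_fun M F D g \<rho> q0p q0m c d = (INF I\<in>controls M F. cost M D g \<rho> q0p q0m c d I)"

definition partial_c :: "(real \<Rightarrow> real \<Rightarrow> real) \<Rightarrow> real \<Rightarrow> real \<Rightarrow> real" where
  "partial_c f c d = deriv (\<lambda>x. f x d) c"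

definition value_c ::
  "'a measure \<Rightarrow> (real \<Rightarrow> 'a measure) \<Rightarrow> (real \<Rightarrow> real \<Rightarrow> 'a \<Rightarrow> real) \<Rightarrow> (real \<Rightarrow> real \<Rightarrow> real)
     \<Rightarrow> real \<Rightarrow> real \<Rightarrow> real \<Rightarrow> real \<Rightarrow> real \<Rightarrow> real" where
  "value_c M F D g \<rho> q0p q0m =
     partial_c (\<lambda>c d. enn2real (value_fun M F D g \<rho> q0p q0m c d))"

definition boundary_plus :: "(real \<Rightarrow> real \<Rightarrow> real) \<Rightarrow> real \<Rightarrow> real \<Rightarrow> ereal" where
  "boundary_plus vc q0p d = Inf (ereal ` {c. vc c d > - q0p})"

definition boundary_minus :: "(real \<Rightarrow> real \<Rightarrow> real) \<Rightarrow> real \<Rightarrow> real \<Rightarrow> ereal" where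
  "boundary_minus vc q0m d = Sup (ereal ` {c. vc c d < q0m})"


section \<open>Standing assumptions\<close>

text \<open>\<open>\<bar>x\<bar>\<^sup>\<nu>\<close> with \<open>0\<^sup>0 = 1\<close> (whereas \<open>0 powr 0 = 0\<close>).\<close>

definition abs_pow :: "real \<Rightarrow> real \<Rightarrow> real" where
  "abs_pow \<nu> x = (if \<nu> = 0 then 1 else \<bar>x\<bar> powr \<nu>)"

definition locally_bounded :: "(real \<Rightarrow> real) \<Rightarrow> bool" where
  "locally_bounded f \<longleftrightarrow> (\<forall>K. compact K \<longrightarrow> bounded (f ` K))"

locale capacity_problem = prob_space M
  for M :: "'a measure" +
  fixes F :: "real \<Rightarrow> 'a measure"
    and W :: "real \<Rightarrow> 'a \<Rightarrow> real"
    and dmin dmax :: ereal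
    and \<mu> \<sigma> :: "real \<Rightarrow> real"
    and D :: "real \<Rightarrow> real \<Rightarrow> 'a \<Rightarrow> real"
    and g :: "real \<Rightarrow> real \<Rightarrow> real"
    and \<gamma>0 \<eta>0 :: "real \<Rightarrow> real"
    and \<nu> K0 K1 \<rho> q0p q0m :: real
  assumes filtration: "usual_filtration M F"
    and brownian: "brownian_motion M F W"
    and interval: "dmin < dmax"
    and coeff_cont: "continuous_on (demand_space dmin dmax) \<mu>"
      "continuous_on (demand_space dmin dmax) \<sigma>"
    and coeff_growth: "\<exists>L. \<forall>x\<in>demand_space dmin dmax. \<bar>\<mu> x\<bar> + \<bar>\<sigma> x\<bar> \<le> L * (1 + \<bar>x\<bar>)"
    and coeff_nondeg: "\<forall>x\<in>demand_space dmin dmax. (\<sigma> x)\<^sup>2 > 0"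
    and demand_solution:
      "\<forall>d\<in>demand_space dmin dmax. sde_solution M F W (demand_space dmin dmax) \<mu> \<sigma> d (D d)"
    and demand_unique:
      "\<forall>d\<in>demand_space dmin dmax. \<forall>X.
         sde_solution M F W (demand_space dmin dmax) \<mu> \<sigma> d X \<longrightarrow>
         (AE \<omega> in M. \<forall>t\<ge>0. X t \<omega> = D d t \<omega>)"
    and demand_stable:
      "\<forall>d\<in>demand_space dmin dmax. \<forall>x. (\<forall>n. x n \<in> demand_space dmin dmax) \<and> x \<longlonglongrightarrow> d \<longrightarrow>
         (\<forall>t\<ge>0. AE \<omega> in M. (\<lambda>n. D (x n) t \<omega>) \<longlonglongrightarrow> D d t \<omega>)"
    and demand_mono:
      "\<forall>d\<in>demand_space dmin dmax. \<forall>d'\<in>demand_space dmin dmax. d \<le> d' \<longrightarrow>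
         (\<forall>t\<ge>0. AE \<omega> in M. D d t \<omega> \<le> D d' t \<omega>)"
    and demand_regular: "regular_diffusion M F (demand_space dmin dmax) D"
    and demand_natural: "natural_boundaries \<mu> \<sigma> dmin dmax"
    and g_nonneg: "\<forall>c. \<forall>d\<in>demand_space dmin dmax. 0 \<le> g c d"
    and g_cont: "continuous_on (UNIV \<times> demand_space dmin dmax) (\<lambda>(c, d). g c d)"
    and g_convex: "\<forall>d\<in>demand_space dmin dmax. convex_on UNIV (\<lambda>c. g c d)"
    and g_diff: "\<forall>d\<in>demand_space dmin dmax. \<forall>c. (\<lambda>x. g x d) field_differentiable (at c)"
    and g_c_cont: "continuous_on (UNIV \<times> demand_space dmin dmax) (\<lambda>(c, d). partial_c g c d)"
    and g_c_antimono: "\<forall>c. antimono_on (demand_space dmin dmax) (partial_c g c)"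
    and bounds_pos: "\<forall>c. 0 < \<gamma>0 c" "\<forall>c. 0 < \<eta>0 c"
    and bounds_local: "locally_bounded \<gamma>0" "locally_bounded \<eta>0"
    and g_growth:
      "\<forall>c. \<forall>d\<in>demand_space dmin dmax.
         \<bar>g c d\<bar> + \<bar>partial_c g c d\<bar> \<le> \<gamma>0 c + \<eta>0 c * abs_pow \<nu> d"
    and \<nu>_nonneg: "0 \<le> \<nu>"
    and K0_nonneg: "0 \<le> K0"
    and demand_moment:
      "\<forall>d\<in>demand_space dmin dmax. \<forall>t\<ge>0.
         (\<integral>\<^sup>+\<omega>. ennreal (abs_pow \<nu> (D d t \<omega>)) \<partial>M)
           \<le> ennreal (K0 * (1 + abs_pow \<nu> d) * exp (K1 * t))"
    and discount: "\<rho> > max K1 0"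
    and q0p_pos: "0 < q0p"
    and q0m_pos: "0 < q0m"

text \<open>
  Known properties of the value function and of the two boundaries under the standing
  assumptions; the construction of the optimal state relies on them.
\<close>

definition value_regularity ::
  "real set \<Rightarrow> (real \<Rightarrow> real \<Rightarrow> ennreal) \<Rightarrow> (real \<Rightarrow> real \<Rightarrow> real) \<Rightarrow> real \<Rightarrow> real \<Rightarrow> bool" where
  "value_regularity Ob v vc q0p q0m \<longleftrightarrow>
     (\<forall>d\<in>Ob. (\<forall>c. v c d < \<infinity>) \<and>
        convex_on UNIV (\<lambda>c. enn2real (v c d)) \<and>
        (\<forall>c. (\<lambda>x. enn2real (v x d)) field_differentiable (at c))) \<and>
     continuous_on (UNIV \<times> Ob) (\<lambda>(c, d). vc c d) \<and>
     (\<forall>c. \<forall>d\<in>Ob. - q0p \<le> vc c d \<and> vc c d \<le> q0m)"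

definition boundary_regularity ::
  "real set \<Rightarrow> (real \<Rightarrow> ereal) \<Rightarrow> (real \<Rightarrow> ereal) \<Rightarrow> bool" where
  "boundary_regularity Ob cp cm \<longleftrightarrow>
     (\<forall>d\<in>Ob. cp d < \<infinity> \<and> cm d > - \<infinity> \<and> cp d < cm d) \<and>
     mono_on Ob cp \<and> mono_on Ob cm \<and>
     (\<forall>d\<in>Ob. continuous (at_right d) cp) \<and> (\<forall>d\<in>Ob. continuous (at_left d) cm)"


section \<open>Construction of the optimal state\<close>

text \<open>
  Everything is defined path by path: \<open>cp\<close>, \<open>cm\<close> are the two boundary functions, \<open>c\<close> is the
  initial capacity and \<open>x\<close> a demand path. Levels and times take values in the extended reals;
  the infimum of the empty set is \<open>\<infinity>\<close>. Suprema and infima of \<open>x\<close> over compact time intervals are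
  the running maxima and minima, as demand paths are continuous.
\<close>

definition tau0_plus :: "(real \<Rightarrow> ereal) \<Rightarrow> real \<Rightarrow> (real \<Rightarrow> real) \<Rightarrow> ereal" where
  "tau0_plus cp c x = Inf (ereal ` {t. 0 \<le> t \<and> ereal c < cp (x t)})"

definition tau0_minus :: "(real \<Rightarrow> ereal) \<Rightarrow> real \<Rightarrow> (real \<Rightarrow> real) \<Rightarrow> ereal" where
  "tau0_minus cm c x = Inf (ereal ` {t. 0 \<le> t \<and> ereal c > cm (x t)})"

definition starts_plus ::
  "(real \<Rightarrow> ereal) \<Rightarrow> (real \<Rightarrow> ereal) \<Rightarrow> real \<Rightarrow> (real \<Rightarrow> real) \<Rightarrow> bool" where
  "starts_plus cp cm c x \<longleftrightarrow> tau0_plus cp c x < tau0_minus cm c x"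

definition starts_minus ::
  "(real \<Rightarrow> ereal) \<Rightarrow> (real \<Rightarrow> ereal) \<Rightarrow> real \<Rightarrow> (real \<Rightarrow> real) \<Rightarrow> bool" where
  "starts_minus cp cm c x \<longleftrightarrow> tau0_minus cm c x < tau0_plus cp c x"

definition phase_up ::
  "(real \<Rightarrow> ereal) \<Rightarrow> (real \<Rightarrow> ereal) \<Rightarrow> real \<Rightarrow> (real \<Rightarrow> real) \<Rightarrow> nat \<Rightarrow> bool" where
  "phase_up cp cm c x k \<longleftrightarrow>
     (odd k \<and> starts_plus cp cm c x) \<or> (even k \<and> starts_minus cp cm c x)"

definition phase_down ::
  "(real \<Rightarrow> ereal) \<Rightarrow> (real \<Rightarrow> ereal) \<Rightarrow> real \<Rightarrow> (real \<Rightarrow> real) \<Rightarrow> nat \<Rightarrow> bool" where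
  "phase_down cp cm c x k \<longleftrightarrow>
     (odd k \<and> starts_minus cp cm c x) \<or> (even k \<and> starts_plus cp cm c x)"

text \<open>
  \<open>level cp cm c x k s t\<close> is \<open>C\<^sup>k\<^sub>t\<close> for \<open>k \<ge> 1\<close> when \<open>\<tau>\<^bsub>k-1\<^esub> = s\<close>. If neither phase applies, the path
  lies in \<open>\<Omega>\<^sub>\<infinity>\<close>, because \<open>\<tau>\<^sub>0\<^sup>+ = \<tau>\<^sub>0\<^sup>-\<close> forces both to be infinite.
\<close>

definition level ::
  "(real \<Rightarrow> ereal) \<Rightarrow> (real \<Rightarrow> ereal) \<Rightarrow> real \<Rightarrow> (real \<Rightarrow> real) \<Rightarrow> nat \<Rightarrow> ereal \<Rightarrow> real \<Rightarrow> ereal" where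
  "level cp cm c x k s t =
     (if phase_up cp cm c x k then cp (SUP r\<in>{real_of_ereal s..t}. x r)
      else if phase_down cp cm c x k then cm (INF r\<in>{real_of_ereal s..t}. x r)
      else ereal c)"

primrec tau ::
  "(real \<Rightarrow> ereal) \<Rightarrow> (real \<Rightarrow> ereal) \<Rightarrow> real \<Rightarrow> (real \<Rightarrow> real) \<Rightarrow> nat \<Rightarrow> ereal" where
  "tau cp cm c x 0 = min (tau0_plus cp c x) (tau0_minus cm c x)"
| "tau cp cm c x (Suc k) =
     (let s = tau cp cm c x k in
      if s = \<infinity> then \<infinity>
      else if phase_up cp cm c x (Suc k) then
        Inf (ereal ` {t. s \<le> ereal t \<and> level cp cm c x (Suc k) s t > cm (x t)})
      else if phase_down cp cm c x (Suc k) then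
        Inf (ereal ` {t. s \<le> ereal t \<and> level cp cm c x (Suc k) s t < cp (x t)})
      else \<infinity>)"

definition tau_prev ::
  "(real \<Rightarrow> ereal) \<Rightarrow> (real \<Rightarrow> ereal) \<Rightarrow> real \<Rightarrow> (real \<Rightarrow> real) \<Rightarrow> nat \<Rightarrow> ereal" where
  "tau_prev cp cm c x k = (case k of 0 \<Rightarrow> 0 | Suc j \<Rightarrow> tau cp cm c x j)"

definition C_step ::
  "(real \<Rightarrow> ereal) \<Rightarrow> (real \<Rightarrow> ereal) \<Rightarrow> real \<Rightarrow> (real \<Rightarrow> real) \<Rightarrow> nat \<Rightarrow> real \<Rightarrow> ereal" where
  "C_step cp cm c x k t =
     (if k = 0 then ereal c else level cp cm c x k (tau_prev cp cm c x k) t)"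

text \<open>The intervals are pairwise disjoint, so the series has at most one nonzero term.\<close>

definition C_star ::
  "(real \<Rightarrow> ereal) \<Rightarrow> (real \<Rightarrow> ereal) \<Rightarrow> real \<Rightarrow> (real \<Rightarrow> real) \<Rightarrow> real \<Rightarrow> ereal" where
  "C_star cp cm c x t =
     (\<Sum>k. C_step cp cm c x k t *
        indicator {t. tau_prev cp cm c x k \<le> ereal t \<and> ereal t < tau cp cm c x k} t)"

end

theory Submission
  imports Defs
begin

text \<open>
  The control is allowed to act only at multiples of a mesh \<open>h\<close> and on levels in \<open>[-R, R]\<close>. The derivative in
  the capacity of the value of that problem is the fixed point \<open>game h\<close> of a contraction built from the
  transition operators of the demand, so that only the Markov property at deterministic times is needed.
  It is nondecreasing in the capacity and nonincreasing in the demand. A telescoping comparison of the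
  integrals of \<open>game h\<close> over levels shows that any policy that keeps the level between the two
  \<open>\<epsilon>\<close>-relaxed thresholds of \<open>game h\<close> with the least effort costs at most \<open>1 / (1 - \<eta>)\<close> times the optimum.

  Discretising near-optimal controls gives convergence of the discrete values, hence, by convexity and
  differentiability of \<open>v\<close> in the capacity, pointwise convergence of \<open>game h\<close> to \<open>v\<^sub>c\<close>. Monotonicity in the
  demand then replaces uniform convergence: for every demand path and every \<open>t\<close>, the relaxed policies
  converge to \<open>C\<^sup>*\<^sub>t\<close>, first as \<open>h\<close> tends to \<open>0\<close> and then as \<open>\<epsilon>\<close> tends to \<open>0\<close>. This yields adaptedness of \<open>C\<^sup>*\<close>
  (the filtration is right-continuous) and, because cost is lower semicontinuous by Fatou's lemma and by the
  lower semicontinuity of variation, the optimality of \<open>C\<^sup>*\<close>.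
\<close>

section \<open>Hysteresis between two boundaries\<close>

text \<open>On a grid, dynamic programming decouples the capacity levels: at each level the only
  question is whether the marginal value has reached \<open>- q0p\<close> or \<open>q0m\<close>.

  The relaxation by \<open>\<epsilon>\<close> is forced by the limit. At levels where
  \<open>vc\<close> equals an obstacle, \<open>game h\<close> need only approach it, so the exact
  thresholds of \<open>game h\<close> need not converge to the boundaries. The price is at most
  \<open>\<epsilon>\<close> per unit of capacity moved, a fraction \<open>\<eta>\<close> of the
  control cost itself, and can be absorbed.

  Control costs are rewritten as integrals of the variation against
  \<open>\<rho> * exp (- \<rho> * s)\<close>. Pointwise convergence of paths bounds the limit of
  variations from below, whereas the measures \<open>dI_plus\<close> and \<open>dI_minus\<close>
  need not converge.\<close>

text \<open>
  Certificates for \<open>C\<^sup>*\<^sub>t \<le> z\<close> and \<open>C\<^sup>*\<^sub>t \<ge> z\<close>: at some time \<open>r\<close> the state was pushed to a level on the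
  correct side of \<open>z\<close> (or started there), and since \<open>r\<close> the opposite boundary has never driven it past \<open>z\<close>.
  They determine \<open>C\<^sup>*\<^sub>t\<close> and, unlike the stopping times of its construction, do not refer to phases.
\<close>

definition below ::
  "(real \<Rightarrow> ereal) \<Rightarrow> (real \<Rightarrow> ereal) \<Rightarrow> real \<Rightarrow> (real \<Rightarrow> real) \<Rightarrow> ereal \<Rightarrow> real \<Rightarrow> bool" where
  "below cp cm c x z t \<longleftrightarrow>
     (\<exists>r\<in>{0..t}. (cm (x r) \<le> z \<or> r = 0 \<and> ereal c \<le> z) \<and> (\<forall>s\<in>{r..t}. cp (x s) \<le> z))"

definition above ::
  "(real \<Rightarrow> ereal) \<Rightarrow> (real \<Rightarrow> ereal) \<Rightarrow> real \<Rightarrow> (real \<Rightarrow> real) \<Rightarrow> ereal \<Rightarrow> real \<Rightarrow> bool" where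
  "above cp cm c x z t \<longleftrightarrow>
     (\<exists>r\<in>{0..t}. (z \<le> cp (x r) \<or> r = 0 \<and> z \<le> ereal c) \<and> (\<forall>s\<in>{r..t}. z \<le> cm (x s)))"

text \<open>Reflecting capacities, demands and levels exchanges the two boundaries and the two
  certificates, so that results on upward phases carry over to downward phases.\<close>

lemma above_neg:
  "above (\<lambda>y. - cm (- y)) (\<lambda>y. - cp (- y)) (- c) (\<lambda>t. - x t) (- z) t \<longleftrightarrow> below cp cm c x z t"
  unfolding above_def below_def by (simp add: uminus_ereal.simps[symmetric] del: uminus_ereal.simps)

lemma below_neg:
  "below (\<lambda>y. - cm (- y)) (\<lambda>y. - cp (- y)) (- c) (\<lambda>t. - x t) (- z) t \<longleftrightarrow> above cp cm c x z t"
  unfolding above_def below_def by (simp add: uminus_ereal.simps[symmetric] del: uminus_ereal.simps)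

section \<open>Boundaries along a continuous demand path\<close>

locale hysteresis =
  fixes Ob :: "real set" and cp cm :: "real \<Rightarrow> ereal" and c :: real and x :: "real \<Rightarrow> real"
  assumes cp_less_PInf: "d \<in> Ob \<Longrightarrow> cp d < \<infinity>"
    and cm_greater_MInf: "d \<in> Ob \<Longrightarrow> - \<infinity> < cm d"
    and cp_less_cm: "d \<in> Ob \<Longrightarrow> cp d < cm d"
    and mono_cp: "mono_on Ob cp" and mono_cm: "mono_on Ob cm"
    and cont_cp: "d \<in> Ob \<Longrightarrow> continuous (at_right d) cp"
    and cont_cm: "d \<in> Ob \<Longrightarrow> continuous (at_left d) cm"
    and cont_x: "continuous_on {0..} x" and x_in: "0 \<le> t \<Longrightarrow> x t \<in> Ob"
begin

text \<open>The assumptions are symmetric under reflection because right-continuity of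
  \<open>cp\<close> corresponds to left-continuity of \<open>cm\<close>.\<close>

lemma negate: "hysteresis (uminus ` Ob) (\<lambda>y. - cm (- y)) (\<lambda>y. - cp (- y)) (\<lambda>t. - x t)"
proof
  fix d assume "d \<in> uminus ` Ob"
  then have d: "- d \<in> Ob" by auto
  show "- cm (- d) < \<infinity>" using cm_greater_MInf[OF d] by (cases "cm (- d)") auto
  show "- \<infinity> < - cp (- d)" using cp_less_PInf[OF d] by simp
  show "- cm (- d) < - cp (- d)" using cp_less_cm[OF d] by simp
  have "(cm \<longlongrightarrow> cm (- d)) (at_left (- d))" using cont_cm[OF d] by (simp add: continuous_within)
  then have "((\<lambda>y. - cm (- y)) \<longlongrightarrow> - cm (- d)) (at_right d)"
    by (intro tendsto_uminus_ereal) (simp add: at_left_minus filterlim_filtermap)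
  then show "continuous (at_right d) (\<lambda>y. - cm (- y))" by (simp add: continuous_within)
  have "(cp \<longlongrightarrow> cp (- d)) (at_right (- d))" using cont_cp[OF d] by (simp add: continuous_within)
  then have "((\<lambda>y. - cp (- y)) \<longlongrightarrow> - cp (- d)) (at_left d)"
    by (intro tendsto_uminus_ereal) (simp add: at_right_minus filterlim_filtermap)
  then show "continuous (at_left d) (\<lambda>y. - cp (- y))" by (simp add: continuous_within)
next
  show "mono_on (uminus ` Ob) (\<lambda>y. - cm (- y))" "mono_on (uminus ` Ob) (\<lambda>y. - cp (- y))"
    using mono_cp mono_cm by (auto simp: mono_on_def)
  show "continuous_on {0..} (\<lambda>t. - x t)" using cont_x by (rule continuous_on_minus)
  show "\<And>t. 0 \<le> t \<Longrightarrow> - x t \<in> uminus ` Ob" using x_in by auto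
qed

text \<open>To the right of \<open>d\<close> the bound comes from right-continuity, to the left from
  monotonicity; it therefore holds at all smaller states, not only at nearby ones.\<close>

lemma cp_usc:
  assumes "d \<in> Ob" "cp d < r"
  obtains e where "0 < e" "\<And>y. y \<in> Ob \<Longrightarrow> y < d + e \<Longrightarrow> cp y < r"
proof -
  have "(cp \<longlongrightarrow> cp d) (at_right d)" using cont_cp[OF assms(1)] by (simp add: continuous_within)
  from order_tendstoD(2)[OF this assms(2)] obtain b where b: "b > d" "\<And>y. d < y \<Longrightarrow> y < b \<Longrightarrow> cp y < r"
    unfolding eventually_at_right_field by auto
  show thesis
  proof (rule that[of "b - d"])
    show "0 < b - d" using b by simp
    fix y assume y: "y \<in> Ob" "y < d + (b - d)"
    show "cp y < r"
    proof (cases "d < y")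
      case True then show ?thesis using b y by simp
    next
      case False
      then have "cp y \<le> cp d" using mono_cp y assms by (auto intro: mono_onD)
      then show ?thesis using assms by simp
    qed
  qed
qed

lemma cm_lsc:
  assumes "d \<in> Ob" "r < cm d"
  obtains e where "0 < e" "\<And>y. y \<in> Ob \<Longrightarrow> d - e < y \<Longrightarrow> r < cm y"
proof -
  interpret n: hysteresis "uminus ` Ob" "\<lambda>y. - cm (- y)" "\<lambda>y. - cp (- y)" "- c" "\<lambda>t. - x t"
    by (rule negate)
  have "- d \<in> uminus ` Ob" "- cm (- (- d)) < - r" using assms by auto
  from n.cp_usc[OF this] obtain e where e: "0 < e"
    "\<And>y. y \<in> uminus ` Ob \<Longrightarrow> y < - d + e \<Longrightarrow> - cm (- y) < - r" by metis
  show thesis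
  proof (rule that[OF e(1)])
    fix y assume "y \<in> Ob" "d - e < y"
    then show "r < cm y" using e(2)[of "- y"] by auto
  qed
qed

lemma near_x:
  assumes "0 \<le> t" "0 < e"
  obtains \<delta> where "0 < \<delta>" "\<And>s. 0 \<le> s \<Longrightarrow> \<bar>s - t\<bar> < \<delta> \<Longrightarrow> \<bar>x s - x t\<bar> < e"
  using cont_x assms unfolding continuous_on_iff dist_real_def by (metis atLeast_iff)

text \<open>Separation at two nearby times, not only at the same one. A value strictly between
  \<open>cp\<close> and \<open>cm\<close> at time \<open>s\<close> separates them throughout a
  neighbourhood, by semicontinuity, and the Lebesgue number of the resulting cover of
  \<open>{0..T}\<close> is the gap. It bounds the number of switches and supplies the blocks on
  which the state is monotone.\<close>

lemma uniform_gap: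
  obtains p where "0 < p"
    "\<And>s t. 0 \<le> s \<Longrightarrow> s \<le> T \<Longrightarrow> 0 \<le> t \<Longrightarrow> t \<le> T \<Longrightarrow> \<bar>s - t\<bar> < p \<Longrightarrow> cp (x s) < cm (x t)"
proof -
  have ex: "\<exists>\<delta>>0. \<forall>q r. 0 \<le> q \<and> 0 \<le> r \<and> \<bar>q - s\<bar> < \<delta> \<and> \<bar>r - s\<bar> < \<delta> \<longrightarrow> cp (x q) < cm (x r)"
    if s: "s \<in> {0..T}" for s
  proof -
    have s0: "0 \<le> s" using s by simp
    obtain b where b: "cp (x s) < b" "b < cm (x s)" using cp_less_cm[OF x_in[OF s0]] dense by blast
    obtain e1 where e1: "0 < e1" "\<And>y. y \<in> Ob \<Longrightarrow> y < x s + e1 \<Longrightarrow> cp y < b"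
      using cp_usc[OF x_in[OF s0] b(1)] by metis
    obtain e2 where e2: "0 < e2" "\<And>y. y \<in> Ob \<Longrightarrow> x s - e2 < y \<Longrightarrow> b < cm y"
      using cm_lsc[OF x_in[OF s0] b(2)] by metis
    obtain \<delta> where \<delta>: "0 < \<delta>" "\<And>q. 0 \<le> q \<Longrightarrow> \<bar>q - s\<bar> < \<delta> \<Longrightarrow> \<bar>x q - x s\<bar> < min e1 e2"
      using near_x[OF s0, of "min e1 e2"] e1 e2 by (metis min_less_iff_conj)
    show ?thesis
    proof (intro exI[of _ \<delta>] conjI allI impI \<delta>(1))
      fix q r assume A: "0 \<le> q \<and> 0 \<le> r \<and> \<bar>q - s\<bar> < \<delta> \<and> \<bar>r - s\<bar> < \<delta>"
      have "cp (x q) < b" using \<delta>(2)[of q] A by (intro e1(2) x_in) auto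
      also have "b < cm (x r)" using \<delta>(2)[of r] A by (intro e2(2) x_in) auto
      finally show "cp (x q) < cm (x r)" .
    qed
  qed
  then obtain \<delta> where \<delta>: "\<And>s. s \<in> {0..T} \<Longrightarrow> \<delta> s > 0"
    "\<And>s q r. s \<in> {0..T} \<Longrightarrow> 0 \<le> q \<Longrightarrow> 0 \<le> r \<Longrightarrow> \<bar>q - s\<bar> < \<delta> s \<Longrightarrow> \<bar>r - s\<bar> < \<delta> s \<Longrightarrow> cp (x q) < cm (x r)"
    by metis
  let ?G = "(\<lambda>s. ball s (\<delta> s)) ` {0..T}"
  have cover: "{0..T} \<subseteq> \<Union> ?G" using \<delta>(1) by fastforce
  have op: "open G" if "G \<in> ?G" for G using that by auto
  obtain e where e: "0 < e" "\<forall>s\<in>{0..T}. \<exists>G\<in>?G. ball s e \<subseteq> G"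
    using Heine_Borel_lemma[OF _ cover op] by (metis compact_Icc)
  show thesis
  proof (rule that[OF e(1)])
    fix s t assume A: "0 \<le> s" "s \<le> T" "0 \<le> t" "t \<le> T" "\<bar>s - t\<bar> < e"
    then have "s \<in> {0..T}" by simp
    then obtain u where u: "u \<in> {0..T}" "ball s e \<subseteq> ball u (\<delta> u)" using e(2) by blast
    have "s \<in> ball u (\<delta> u)" "t \<in> ball u (\<delta> u)" using u(2) A e by (auto simp: dist_real_def subset_eq)
    then show "cp (x s) < cm (x t)" using \<delta>(2)[OF u(1), of s t] A by (auto simp: dist_real_def)
  qed
qed

lemma SUP_attained:
  assumes "0 \<le> s" "s \<le> t"
  obtains r where "r \<in> {s..t}" "(SUP q\<in>{s..t}. x q) = x r" "\<And>q. q \<in> {s..t} \<Longrightarrow> x q \<le> x r"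
proof -
  have "continuous_on {s..t} x" using cont_x assms by (auto intro: continuous_on_subset)
  from continuous_attains_sup[OF _ _ this] obtain r where r: "r \<in> {s..t}" "\<And>q. q \<in> {s..t} \<Longrightarrow> x q \<le> x r"
    using assms by auto
  have "(SUP q\<in>{s..t}. x q) = x r" using r by (intro cSup_eq_maximum) auto
  with r that show thesis by blast
qed

text \<open>The later of the two certifying times decides: a push made then contradicts the
  constraint that the other certificate has imposed since its earlier time. Only a common start at
  time \<open>0\<close>, where \<open>c\<close> replaces a push, needs separate treatment. The
  certified value is therefore unique.\<close>

lemma not_below_above:
  assumes "below cp cm c x z t" "above cp cm c x z' t" shows "z' \<le> z"
proof (rule ccontr)
  assume "\<not> z' \<le> z"
  then have zz: "z < z'" by simp
  from assms(1) obtain r where r: "r \<in> {0..t}" "cm (x r) \<le> z \<or> r = 0 \<and> ereal c \<le> z" "\<And>s. s \<in> {r..t} \<Longrightarrow> cp (x s) \<le> z"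
    unfolding below_def by blast
  from assms(2) obtain q where q: "q \<in> {0..t}" "z' \<le> cp (x q) \<or> q = 0 \<and> z' \<le> ereal c" "\<And>s. s \<in> {q..t} \<Longrightarrow> z' \<le> cm (x s)"
    unfolding above_def by blast
  show False
  proof (cases "r \<le> q")
    case True
    have "cp (x q) < z'" using r(3)[of q] True q(1) zz by auto
    then have "q = 0" "z' \<le> c" using q(2) by auto
    then have "r = 0" using r(1) True by auto
    then have "cm (x r) < z'" "\<not> ereal c \<le> z" using r(2) zz \<open>z' \<le> c\<close> by auto
    then show False using q(3)[of 0] \<open>q = 0\<close> \<open>r = 0\<close> r(1) by auto
  next
    case False
    have "z' \<le> cm (x r)" using q(3)[of r] False r(1) by auto
    then have "r = 0" using r(2) zz by auto
    then show False using False q(1) by auto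
  qed
qed

lemma below_not_MInf: "below cp cm c x z t \<Longrightarrow> z \<noteq> - \<infinity>"
  unfolding below_def using cm_greater_MInf[OF x_in] by fastforce

lemma above_not_PInf: "above cp cm c x z t \<Longrightarrow> z \<noteq> \<infinity>"
  unfolding above_def using cp_less_PInf[OF x_in] by fastforce

definition hyst :: "ereal \<Rightarrow> real \<Rightarrow> bool" where
  "hyst y t \<longleftrightarrow> below cp cm c x y t \<and> above cp cm c x y t"

lemma hyst_finite: "hyst y t \<Longrightarrow> \<bar>y\<bar> \<noteq> \<infinity>"
  using below_not_MInf above_not_PInf by (cases y) (auto simp: hyst_def)

text \<open>\<open>above\<close> is certified at a time where the running maximum is attained, since
  the level has not exceeded \<open>cm\<close> so far in the phase. \<open>below\<close> extends the
  certificate available at the start, since \<open>cp\<close> at the running maximum dominates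
  \<open>cp\<close> along the phase.\<close>

lemma up_phase_hyst:
  assumes s: "0 \<le> s" and start: "below cp cm c x (cp (x s)) s"
    and t: "s \<le> t"
    and before: "ereal t < Inf (ereal ` {t. ereal s \<le> ereal t \<and> cp (SUP r\<in>{s..t}. x r) > cm (x t)})"
  shows "hyst (cp (SUP r\<in>{s..t}. x r)) t"
proof -
  let ?L = "\<lambda>t. cp (SUP r\<in>{s..t}. x r)"
  have le: "?L q \<le> cm (x q)" if "q \<in> {s..t}" for q
  proof (rule ccontr)
    assume "\<not> ?L q \<le> cm (x q)"
    then have "Inf (ereal ` {t. ereal s \<le> ereal t \<and> ?L t > cm (x t)}) \<le> ereal q"
      using that by (intro Inf_lower) auto
    with before that show False by (meson atLeastAtMost_iff ereal_less_eq(3) leD order_trans)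
  qed
  obtain m where m: "m \<in> {s..t}" "(SUP r\<in>{s..t}. x r) = x m" "\<And>q. q \<in> {s..t} \<Longrightarrow> x q \<le> x m"
    using SUP_attained[OF s t] by metis
  have cpm: "cp (x q) \<le> cp (x m)" if "q \<in> {s..t}" for q
    using m s that by (intro mono_onD[OF mono_cp] x_in) auto
  from start obtain r where r: "r \<in> {0..s}" "cm (x r) \<le> cp (x s) \<or> r = 0 \<and> ereal c \<le> cp (x s)"
    "\<And>q. q \<in> {r..s} \<Longrightarrow> cp (x q) \<le> cp (x s)" unfolding below_def by blast
  have sm: "cp (x s) \<le> cp (x m)" using cpm[of s] t by simp
  have "below cp cm c x (cp (x m)) t" unfolding below_def
  proof (intro bexI[of _ r] conjI ballI)
    show "r \<in> {0..t}" using r t by auto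
    show "cm (x r) \<le> cp (x m) \<or> r = 0 \<and> ereal c \<le> cp (x m)" using r(2) sm by auto
    fix q assume "q \<in> {r..t}"
    then show "cp (x q) \<le> cp (x m)" using r(3)[of q] cpm[of q] sm by (cases "q \<le> s") auto
  qed
  moreover have "above cp cm c x (cp (x m)) t" unfolding above_def
  proof (intro bexI[of _ m] conjI ballI)
    show "m \<in> {0..t}" using m s by auto
    show "cp (x m) \<le> cp (x m) \<or> m = 0 \<and> cp (x m) \<le> ereal c" by simp
    fix q assume q: "q \<in> {m..t}"
    have "(SUP r\<in>{s..q}. x r) = x m" using m q by (intro cSup_eq_maximum) auto
    then show "cp (x m) \<le> cm (x q)" using le[of q] q m by auto
  qed
  ultimately show ?thesis unfolding hyst_def m(2) by simp
qed

text \<open>The infimum defining the end need not be attained, because the boundaries are only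
  one-sided continuous. A non-strict crossing at the end time survives; it yields the start
  certificate of the next phase and, through the last claim, a lower bound on the length of a
  phase.\<close>

lemma up_phase_end:
  assumes s: "0 \<le> s"
    and end_t: "Inf (ereal ` {t. ereal s \<le> ereal t \<and> cp (SUP r\<in>{s..t}. x r) > cm (x t)}) = ereal t"
  shows "s \<le> t" "above cp cm c x (cm (x t)) t" "\<exists>r\<in>{s..t}. cm (x t) \<le> cp (x r)"
proof -
  let ?L = "\<lambda>t. cp (SUP r\<in>{s..t}. x r)"
  let ?B = "{t. ereal s \<le> ereal t \<and> ?L t > cm (x t)}"
  have "ereal s \<le> Inf (ereal ` ?B)" by (intro Inf_greatest) auto
  then show st: "s \<le> t" unfolding end_t by simp
  have t0: "0 \<le> t" using s st by simp
  have le: "?L q \<le> cm (x q)" if "s \<le> q" "q < t" for q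
  proof (rule ccontr)
    assume "\<not> ?L q \<le> cm (x q)"
    then have "Inf (ereal ` ?B) \<le> ereal q" using that by (intro Inf_lower) auto
    with end_t that show False by simp
  qed
  obtain m where m: "m \<in> {s..t}" "(SUP r\<in>{s..t}. x r) = x m" "\<And>q. q \<in> {s..t} \<Longrightarrow> x q \<le> x m"
    using SUP_attained[OF s st] by metis
  have m0: "0 \<le> m" using m(1) s by simp
  \<comment> \<open>Otherwise a value strictly between the two, which semicontinuity keeps between
    them for a while, would prevent the phase from ending before
    \<open>t + \<delta>\<close>.\<close>
  have key: "cm (x t) \<le> cp (x m)"
  proof (rule ccontr)
    assume "\<not> cm (x t) \<le> cp (x m)"
    then obtain b where b: "cp (x m) < b" "b < cm (x t)" using dense by (meson not_le)
    obtain e1 where e1: "0 < e1" "\<And>y. y \<in> Ob \<Longrightarrow> y < x m + e1 \<Longrightarrow> cp y < b"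
      using cp_usc[OF x_in[OF m0] b(1)] by metis
    obtain e2 where e2: "0 < e2" "\<And>y. y \<in> Ob \<Longrightarrow> x t - e2 < y \<Longrightarrow> b < cm y"
      using cm_lsc[OF x_in[OF t0] b(2)] by metis
    obtain \<delta> where \<delta>: "0 < \<delta>" "\<And>q. 0 \<le> q \<Longrightarrow> \<bar>q - t\<bar> < \<delta> \<Longrightarrow> \<bar>x q - x t\<bar> < min e1 e2"
      using near_x[OF t0, of "min e1 e2"] e1 e2 by (metis min_less_iff_conj)
    have "ereal (t + \<delta>) \<le> Inf (ereal ` ?B)"
    proof (intro Inf_greatest, clarsimp)
      fix u assume u: "s \<le> u" "cm (x u) < ?L u"
      show "t + \<delta> \<le> u"
      proof (rule ccontr)
        assume "\<not> t + \<delta> \<le> u"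
        then have ud: "u < t + \<delta>" by simp
        have tu: "t \<le> u" using le[of u] u by (meson leD not_le)
        obtain m' where m': "m' \<in> {s..u}" "(SUP r\<in>{s..u}. x r) = x m'"
          using SUP_attained[OF s u(1)] by metis
        have "x m' < x m + e1"
        proof (cases "m' \<le> t")
          case True then show ?thesis using m(3)[of m'] m' e1 by auto
        next
          case False
          then have "\<bar>x m' - x t\<bar> < e1" using \<delta>(2)[of m'] m' ud t0 by auto
          then show ?thesis using m(3)[of t] st by auto
        qed
        then have "cp (x m') < b" using e1(2)[OF x_in] m' s by auto
        moreover have "b < cm (x u)" using \<delta>(2)[of u] tu ud t0 by (intro e2(2) x_in) auto
        ultimately show False using u(2) m'(2) by simp
      qed
    qed
    then show False unfolding end_t using \<delta> by simp
  qed
  then show "\<exists>r\<in>{s..t}. cm (x t) \<le> cp (x r)" using m by blast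
  show "above cp cm c x (cm (x t)) t" unfolding above_def
  proof (intro bexI[of _ m] conjI ballI)
    show "m \<in> {0..t}" using m s by auto
    show "cm (x t) \<le> cp (x m) \<or> m = 0 \<and> cm (x t) \<le> ereal c" using key by simp
    fix q assume q: "q \<in> {m..t}"
    have "(SUP r\<in>{s..q}. x r) = x m" using m q by (intro cSup_eq_maximum) auto
    then show "cm (x t) \<le> cm (x q)" using le[of q] q m key by (cases "q < t") auto
  qed
qed

lemma neg_SUP:
  "- (INF r\<in>A. x r) = (SUP r\<in>A. - x r)"
  by (simp add: Inf_real_def image_image)

lemma down_phase_hyst:
  assumes s: "0 \<le> s" and start: "above cp cm c x (cm (x s)) s"
    and t: "s \<le> t"
    and before: "ereal t < Inf (ereal ` {t. ereal s \<le> ereal t \<and> cm (INF r\<in>{s..t}. x r) < cp (x t)})"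
  shows "hyst (cm (INF r\<in>{s..t}. x r)) t"
proof -
  interpret n: hysteresis "uminus ` Ob" "\<lambda>y. - cm (- y)" "\<lambda>y. - cp (- y)" "- c" "\<lambda>t. - x t"
    by (rule negate)
  have "n.hyst (- cm (- (SUP r\<in>{s..t}. - x r))) t"
    using start before by (intro n.up_phase_hyst s t) (simp_all add: below_neg neg_SUP[symmetric])
  then show ?thesis
    unfolding n.hyst_def hyst_def below_neg above_neg neg_SUP[symmetric] by simp
qed

lemma down_phase_end:
  assumes s: "0 \<le> s"
    and end_t: "Inf (ereal ` {t. ereal s \<le> ereal t \<and> cm (INF r\<in>{s..t}. x r) < cp (x t)}) = ereal t"
  shows "s \<le> t" "below cp cm c x (cp (x t)) t" "\<exists>r\<in>{s..t}. cm (x r) \<le> cp (x t)"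
proof -
  interpret n: hysteresis "uminus ` Ob" "\<lambda>y. - cm (- y)" "\<lambda>y. - cp (- y)" "- c" "\<lambda>t. - x t"
    by (rule negate)
  have e: "Inf (ereal ` {t. ereal s \<le> ereal t \<and> - cm (- (SUP r\<in>{s..t}. - x r)) > - cp (- (- x t))}) = ereal t"
    using end_t by (simp add: neg_SUP[symmetric])
  show "s \<le> t" by (rule n.up_phase_end(1)[OF s e])
  show "below cp cm c x (cp (x t)) t"
    using n.up_phase_end(2)[OF s e] by (simp add: above_neg)
  show "\<exists>r\<in>{s..t}. cm (x r) \<le> cp (x t)"
    using n.up_phase_end(3)[OF s e] by simp
qed

lemma initial_phase_hyst:
  assumes "0 \<le> t" "ereal t < tau0_plus cp c x" "ereal t < tau0_minus cm c x"
  shows "hyst (ereal c) t"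
proof -
  have 1: "cp (x q) \<le> ereal c" if "q \<in> {0..t}" for q
  proof (rule ccontr)
    assume "\<not> cp (x q) \<le> ereal c"
    then have "tau0_plus cp c x \<le> ereal q" using that unfolding tau0_plus_def by (intro Inf_lower) auto
    with assms(2) that show False by (meson atLeastAtMost_iff ereal_less_eq(3) leD order_trans)
  qed
  have 2: "ereal c \<le> cm (x q)" if "q \<in> {0..t}" for q
  proof (rule ccontr)
    assume "\<not> ereal c \<le> cm (x q)"
    then have "tau0_minus cm c x \<le> ereal q" using that unfolding tau0_minus_def by (intro Inf_lower) auto
    with assms(3) that show False by (meson atLeastAtMost_iff ereal_less_eq(3) leD order_trans)
  qed
  show ?thesis unfolding hyst_def below_def above_def using assms(1) 1 2 by (auto intro!: bexI[of _ 0])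
qed

lemma tau0_plus_end:
  assumes "tau0_plus cp c x = ereal t"
  shows "0 \<le> t" "ereal c \<le> cp (x t)" "below cp cm c x (cp (x t)) t"
proof -
  let ?B = "{t. 0 \<le> t \<and> ereal c < cp (x t)}"
  have eq: "Inf (ereal ` ?B) = ereal t" using assms unfolding tau0_plus_def .
  have "ereal 0 \<le> Inf (ereal ` ?B)" by (intro Inf_greatest) auto
  then show t0: "0 \<le> t" unfolding eq by simp
  have le: "cp (x q) \<le> ereal c" if "q \<in> {0..<t}" for q
  proof (rule ccontr)
    assume "\<not> cp (x q) \<le> ereal c"
    then have "Inf (ereal ` ?B) \<le> ereal q" using that by (intro Inf_lower) auto
    with eq that show False by simp
  qed
  \<comment> \<open>If \<open>cp (x t)\<close> were below \<open>c\<close>, upper semicontinuity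
    would delay the first passage beyond \<open>t\<close>.\<close>
  show key: "ereal c \<le> cp (x t)"
  proof (rule ccontr)
    assume "\<not> ereal c \<le> cp (x t)"
    then obtain e where e: "0 < e" "\<And>y. y \<in> Ob \<Longrightarrow> y < x t + e \<Longrightarrow> cp y < ereal c"
      using cp_usc[OF x_in[OF t0], of "ereal c"] by (metis not_le)
    obtain \<delta> where \<delta>: "0 < \<delta>" "\<And>q. 0 \<le> q \<Longrightarrow> \<bar>q - t\<bar> < \<delta> \<Longrightarrow> \<bar>x q - x t\<bar> < e"
      using near_x[OF t0 e(1)] by metis
    have "ereal (t + \<delta>) \<le> Inf (ereal ` ?B)"
    proof (intro Inf_greatest, clarsimp)
      fix u assume u: "0 \<le> u" "ereal c < cp (x u)"
      show "t + \<delta> \<le> u"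
      proof (rule ccontr)
        assume n: "\<not> t + \<delta> \<le> u"
        have "t \<le> u" using le[of u] u by (meson atLeastLessThan_iff leD not_le)
        then have "cp (x u) < ereal c" using \<delta>(2)[of u] u n by (intro e(2) x_in) auto
        with u show False by simp
      qed
    qed
    then show False unfolding eq using \<delta> by simp
  qed
  show "below cp cm c x (cp (x t)) t" unfolding below_def
  proof (intro bexI[of _ 0] conjI ballI)
    show "cm (x 0) \<le> cp (x t) \<or> 0 = (0::real) \<and> ereal c \<le> cp (x t)" using key by simp
    fix q assume "q \<in> {0..t}"
    then show "cp (x q) \<le> cp (x t)" using le[of q] key by (cases "q < t") auto
  qed (use t0 in auto)
qed

lemma tau0_minus_end:
  assumes "tau0_minus cm c x = ereal t"
  shows "0 \<le> t" "cm (x t) \<le> ereal c" "above cp cm c x (cm (x t)) t"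
proof -
  interpret n: hysteresis "uminus ` Ob" "\<lambda>y. - cm (- y)" "\<lambda>y. - cp (- y)" "- c" "\<lambda>t. - x t"
    by (rule negate)
  have e: "tau0_plus (\<lambda>y. - cm (- y)) (- c) (\<lambda>t. - x t) = ereal t"
    using assms unfolding tau0_plus_def tau0_minus_def
    by (simp add: uminus_ereal.simps[symmetric] del: uminus_ereal.simps)
  show "0 \<le> t" by (rule n.tau0_plus_end(1)[OF e])
  show "cm (x t) \<le> ereal c"
    using n.tau0_plus_end(2)[OF e] by (simp add: uminus_ereal.simps[symmetric] del: uminus_ereal.simps)
  show "above cp cm c x (cm (x t)) t"
    using n.tau0_plus_end(3)[OF e] by (simp add: below_neg)
qed

section \<open>The sequence of switching times\<close>

abbreviation "\<tau> \<equiv> tau cp cm c x"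

text \<open>A common finite value would give \<open>cm (x t) \<le> c \<le> cp (x t)\<close>. Hence a
  finite first time selects exactly one direction.\<close>

lemma tau0_ne: "tau0_plus cp c x = ereal t \<Longrightarrow> tau0_minus cm c x \<noteq> ereal t"
  using tau0_plus_end(1,2)[of t] tau0_minus_end(2)[of t] cp_less_cm[OF x_in[of t]]
  by (meson leD order_trans)

lemma tau0_nonneg: "0 \<le> tau0_plus cp c x" "0 \<le> tau0_minus cm c x"
  unfolding tau0_plus_def tau0_minus_def by (auto intro!: Inf_greatest)

lemma tau_nonneg: "0 \<le> \<tau> k"
proof (induction k)
  case 0 then show ?case using tau0_nonneg by simp
next
  case (Suc k)
  have "0 \<le> Inf (ereal ` {t. \<tau> k \<le> ereal t \<and> P t})" for P
  proof (rule Inf_greatest)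
    fix z assume "z \<in> ereal ` {t. \<tau> k \<le> ereal t \<and> P t}"
    then obtain t where "z = ereal t" "\<tau> k \<le> ereal t" by blast
    with Suc show "0 \<le> z" using order_trans by blast
  qed
  then show ?case unfolding tau.simps Let_def by auto
qed

text \<open>Invariant of the recursion: the certificate at the end of one phase is the start
  certificate of the opposite phase, and parity makes exactly one of the two phases active.\<close>

lemma tau_start:
  assumes "\<tau> k = ereal s"
  shows "0 \<le> s \<and> (phase_up cp cm c x (Suc k) \<and> \<not> phase_down cp cm c x (Suc k) \<and> below cp cm c x (cp (x s)) s
    \<or> phase_down cp cm c x (Suc k) \<and> \<not> phase_up cp cm c x (Suc k) \<and> above cp cm c x (cm (x s)) s)"
  using assms
proof (induction k arbitrary: s)
  case 0
  then have m: "min (tau0_plus cp c x) (tau0_minus cm c x) = ereal s" by simp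
  show ?case
  proof (cases "tau0_plus cp c x \<le> tau0_minus cm c x")
    case True
    then have p: "tau0_plus cp c x = ereal s" using m by (simp add: min_def)
    then have "tau0_plus cp c x < tau0_minus cm c x" using tau0_ne True by (metis order_le_less)
    then show ?thesis using tau0_plus_end[OF p]
      by (auto simp: phase_up_def phase_down_def starts_plus_def starts_minus_def)
  next
    case False
    then have p: "tau0_minus cm c x = ereal s" using m by (simp add: min_def)
    then show ?thesis using tau0_minus_end[OF p] False
      by (auto simp: phase_up_def phase_down_def starts_plus_def starts_minus_def)
  qed
next
  case (Suc k)
  have fin: "\<tau> k \<noteq> \<infinity>" using Suc.prems by (auto simp: Let_def)
  then obtain q where q: "\<tau> k = ereal q" using tau_nonneg[of k] by (cases "\<tau> k") auto
  from Suc.IH[OF q] consider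
    (up) "0 \<le> q" "phase_up cp cm c x (Suc k)" "\<not> phase_down cp cm c x (Suc k)" "below cp cm c x (cp (x q)) q"
    | (down) "0 \<le> q" "phase_down cp cm c x (Suc k)" "\<not> phase_up cp cm c x (Suc k)" "above cp cm c x (cm (x q)) q"
    by blast
  then show ?case
  proof cases
    case up
    then have "Inf (ereal ` {t. ereal q \<le> ereal t \<and> cp (SUP r\<in>{q..t}. x r) > cm (x t)}) = ereal s"
      using Suc.prems q by (simp add: level_def)
    from up_phase_end[OF up(1) this] up show ?thesis
      by (auto simp: phase_up_def phase_down_def)
  next
    case down
    then have "Inf (ereal ` {t. ereal q \<le> ereal t \<and> cm (INF r\<in>{q..t}. x r) < cp (x t)}) = ereal s"
      using Suc.prems q by (simp add: level_def)
    from down_phase_end[OF down(1) this] down show ?thesis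
      by (auto simp: phase_up_def phase_down_def)
  qed
qed

text \<open>Each completed phase contains a time whose \<open>cm\<close> lies at or below
  \<open>cp\<close> of another time of the phase; \<open>uniform_gap\<close> excludes this on short
  intervals.\<close>

lemma tau_gap:
  assumes k: "\<tau> k = ereal s" and Sk: "\<tau> (Suc k) = ereal t"
  shows "s \<le> t \<and> (\<exists>q\<in>{s..t}. \<exists>r\<in>{s..t}. cm (x q) \<le> cp (x r))"
proof -
  from tau_start[OF k] consider
    (up) "0 \<le> s" "phase_up cp cm c x (Suc k)" "\<not> phase_down cp cm c x (Suc k)"
    | (down) "0 \<le> s" "phase_down cp cm c x (Suc k)" "\<not> phase_up cp cm c x (Suc k)"
    by blast
  then show ?thesis
  proof cases
    case up
    then have "Inf (ereal ` {t. ereal s \<le> ereal t \<and> cp (SUP r\<in>{s..t}. x r) > cm (x t)}) = ereal t"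
      using Sk k by (simp add: level_def)
    note E = up_phase_end[OF up(1) this]
    then have "t \<in> {s..t}" by simp
    then show ?thesis using E by blast
  next
    case down
    then have "Inf (ereal ` {t. ereal s \<le> ereal t \<and> cm (INF r\<in>{s..t}. x r) < cp (x t)}) = ereal t"
      using Sk k by (simp add: level_def)
    note E = down_phase_end[OF down(1) this]
    then have "t \<in> {s..t}" by simp
    then show ?thesis using E by blast
  qed
qed

lemma tau_Suc_ge: "\<tau> k \<le> \<tau> (Suc k)"
proof (cases "\<tau> (Suc k) = \<infinity>")
  case False
  then obtain t where t: "\<tau> (Suc k) = ereal t" using tau_nonneg[of "Suc k"] by (cases "\<tau> (Suc k)") auto
  have "\<tau> k \<noteq> \<infinity>" using False by (auto simp: Let_def)
  then obtain s where s: "\<tau> k = ereal s" using tau_nonneg[of k] by (cases "\<tau> k") auto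
  show ?thesis using tau_gap[OF s t] s t by simp
qed simp

lemma mono_tau: "mono \<tau>"
  using tau_Suc_ge by (simp add: mono_iff_le_Suc)

lemma tau_unbounded: "\<exists>k. ereal T < \<tau> k"
proof (rule ccontr)
  assume "\<nexists>k. ereal T < \<tau> k"
  then have le: "\<tau> k \<le> ereal T" for k by (meson not_le)
  have "\<exists>r. \<tau> k = ereal r" for k using le[of k] tau_nonneg[of k] by (cases "\<tau> k") auto
  then obtain f where f: "\<And>k. \<tau> k = ereal (f k)" by metis
  have f0: "0 \<le> f k" "f k \<le> T" for k using le[of k] tau_nonneg[of k] by (auto simp: f)
  obtain p where p: "0 < p"
    "\<And>s t. 0 \<le> s \<Longrightarrow> s \<le> T \<Longrightarrow> 0 \<le> t \<Longrightarrow> t \<le> T \<Longrightarrow> \<bar>s - t\<bar> < p \<Longrightarrow> cp (x s) < cm (x t)"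
    using uniform_gap[of T] by metis
  \<comment> \<open>A phase shorter than \<open>p\<close> would contradict the uniform gap, so the
    switching times cannot accumulate before \<open>T\<close>.\<close>
  have step: "f k + p \<le> f (Suc k)" for k
  proof (rule ccontr)
    assume n: "\<not> f k + p \<le> f (Suc k)"
    obtain q r where qr: "q \<in> {f k..f (Suc k)}" "r \<in> {f k..f (Suc k)}" "cm (x q) \<le> cp (x r)"
      using tau_gap[OF f[of k] f[of "Suc k"]] by blast
    have "cp (x r) < cm (x q)" using qr n f0[of k] f0[of "Suc k"] by (intro p(2)) auto
    with qr show False by simp
  qed
  have "real k * p \<le> f k" for k
  proof (induction k)
    case (Suc k) then show ?case using step[of k] by (simp add: algebra_simps)
  qed (use f0(1) in simp)
  moreover obtain k :: nat where "T < real k * p" using reals_Archimedean3[OF p(1)] by blast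
  ultimately show False using f0(2)[of k] by (meson leD order_trans)
qed

theorem C_star_hyst:
  assumes t: "0 \<le> t" shows "hyst (C_star cp cm c x t) t"
proof -
  \<comment> \<open>Index of the interval that contains \<open>t\<close>; all other terms of the
    series vanish.\<close>
  define k where "k = (LEAST k. ereal t < \<tau> k)"
  have k: "ereal t < \<tau> k" unfolding k_def using tau_unbounded by (rule LeastI_ex)
  have less: "\<tau> j \<le> ereal t" if "j < k" for j using not_less_Least that unfolding k_def by (meson not_le)
  have prev: "tau_prev cp cm c x k \<le> ereal t"
    using less t by (cases k) (auto simp: tau_prev_def)
  have "C_star cp cm c x t =
    (\<Sum>j\<in>{k}. C_step cp cm c x j t *
        indicator {t. tau_prev cp cm c x j \<le> ereal t \<and> ereal t < tau cp cm c x j} t)"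
    unfolding C_star_def
  proof (rule suminf_finite)
    fix j assume "j \<notin> {k}"
    then consider "j < k" | "k < j" by fastforce
    then have "\<not> (tau_prev cp cm c x j \<le> ereal t \<and> ereal t < \<tau> j)"
    proof cases
      case 1 then show ?thesis using less by (simp add: leD)
    next
      case 2
      then obtain i where i: "j = Suc i" "k \<le> i" by (cases j) auto
      then have "ereal t < \<tau> i" using k monoD[OF mono_tau i(2)] by simp
      then show ?thesis using i by (simp add: tau_prev_def leD)
    qed
    then show "C_step cp cm c x j t * indicator {t. tau_prev cp cm c x j \<le> ereal t \<and> ereal t < \<tau> j} t = 0"
      by simp
  qed simp
  then have eq: "C_star cp cm c x t = C_step cp cm c x k t" using prev k by simp
  show ?thesis
  proof (cases k)
    case 0
    then show ?thesis unfolding eq using initial_phase_hyst[OF t] k by (simp add: C_step_def)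
  next
    case (Suc i)
    have i: "\<tau> i \<le> ereal t" using less Suc by simp
    then obtain s where s: "\<tau> i = ereal s" using tau_nonneg[of i] by (cases "\<tau> i") auto
    have st: "s \<le> t" using i s by simp
    from tau_start[OF s] consider
      (up) "0 \<le> s" "phase_up cp cm c x (Suc i)" "\<not> phase_down cp cm c x (Suc i)" "below cp cm c x (cp (x s)) s"
      | (down) "0 \<le> s" "phase_down cp cm c x (Suc i)" "\<not> phase_up cp cm c x (Suc i)" "above cp cm c x (cm (x s)) s"
      by blast
    then show ?thesis
    proof cases
      case up
      have "ereal t < Inf (ereal ` {t. ereal s \<le> ereal t \<and> cp (SUP r\<in>{s..t}. x r) > cm (x t)})"
        using k up s unfolding Suc by (simp add: level_def)
      from up_phase_hyst[OF up(1) up(4) st this] show ?thesis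
        unfolding eq using up s by (simp add: Suc C_step_def tau_prev_def level_def)
    next
      case down
      have "ereal t < Inf (ereal ` {t. ereal s \<le> ereal t \<and> cm (INF r\<in>{s..t}. x r) < cp (x t)})"
        using k down s unfolding Suc by (simp add: level_def)
      from down_phase_hyst[OF down(1) down(4) st this] show ?thesis
        unfolding eq using down s by (simp add: Suc C_step_def tau_prev_def level_def)
    qed
  qed
qed

end

section \<open>Variation of paths\<close>

lemma telescope_upto: "(\<Sum>i<n. p (s (Suc i)) - p (s i)) = p (s n) - (p (s 0) :: real)"
  by (induction n) auto

lemma partition_mono:
  assumes "\<forall>i<n. s i \<le> (s (Suc i) :: real)" "i \<le> j" "j \<le> n"
  shows "s i \<le> s j"
  using assms(2,3)
proof (induction j)
  case (Suc j)
  then show ?case using assms(1) by (cases "i = Suc j") (auto intro: order_trans)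
qed simp

text \<open>A function that dominates the increments telescopes along a partition. Partitions may
  start at any time, so the initial value \<open>p (s 0)\<close> is dropped by
  nonnegativity.\<close>

lemma partition_sum_le:
  assumes dom: "\<And>a b. a \<le> b \<Longrightarrow> b \<le> t \<Longrightarrow> (h a b :: real) \<le> p b - p a"
    and nonneg: "\<And>a b. 0 \<le> h a b" "\<And>a. 0 \<le> p a" and part: "(n, s) \<in> partitions_upto t"
  shows "(\<Sum>i<n. ennreal (h (s i) (s (Suc i)))) \<le> ennreal (p t)"
proof -
  have s: "\<forall>i<n. s i \<le> s (Suc i)" "s n = t" using part by (auto simp: partitions_upto_def)
  have "(\<Sum>i<n. h (s i) (s (Suc i))) \<le> (\<Sum>i<n. p (s (Suc i)) - p (s i))"
    using s partition_mono[OF s(1)] by (intro sum_mono dom) (auto simp: s(2)[symmetric])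
  also have "\<dots> \<le> p t" using nonneg(2)[of "s 0"] s(2) by (simp add: telescope_upto)
  finally show ?thesis using nonneg(1) by (subst sum_ennreal) (auto intro: ennreal_leI)
qed

lemma pos_variation_le:
  assumes "\<And>a b. a \<le> b \<Longrightarrow> b \<le> t \<Longrightarrow> max 0 (extend0 f b - extend0 f a) \<le> p b - p a" "\<And>a. 0 \<le> p a"
  shows "pos_variation f t \<le> ennreal (p t)"
  unfolding pos_variation_def
proof (intro SUP_least, clarify)
  fix n s assume "(n, s) \<in> partitions_upto t"
  from partition_sum_le[where h = "\<lambda>a b. max 0 (extend0 f b - extend0 f a)", OF assms(1) _ assms(2) this]
  show "(\<Sum>i<n. ennreal (max 0 (extend0 f (s (Suc i)) - extend0 f (s i)))) \<le> ennreal (p t)" by simp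
qed

lemma total_variation_le:
  assumes "\<And>a b. a \<le> b \<Longrightarrow> b \<le> t \<Longrightarrow> \<bar>extend0 f b - extend0 f a\<bar> \<le> p b - p a" "\<And>a. 0 \<le> p a"
  shows "total_variation f t \<le> ennreal (p t)"
  unfolding total_variation_def
proof (intro SUP_least, clarify)
  fix n s assume "(n, s) \<in> partitions_upto t"
  from partition_sum_le[where h = "\<lambda>a b. \<bar>extend0 f b - extend0 f a\<bar>", OF assms(1) _ assms(2) this]
  show "(\<Sum>i<n. ennreal \<bar>extend0 f (s (Suc i)) - extend0 f (s i)\<bar>) \<le> ennreal (p t)" by simp
qed

lemma neg_variation_eq: "neg_variation f t = pos_variation (\<lambda>s. - f s) t"
proof -
  have "extend0 (\<lambda>s. - f s) r = - extend0 f r" for r by (simp add: extend0_def)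
  then show ?thesis unfolding neg_variation_def pos_variation_def by (simp add: algebra_simps)
qed

lemma total_variation_neg: "total_variation (\<lambda>s. - f s) t = total_variation f t"
proof -
  have "extend0 (\<lambda>s. - f s) r = - extend0 f r" for r by (simp add: extend0_def)
  then have "\<bar>extend0 (\<lambda>s. - f s) r - extend0 (\<lambda>s. - f s) q\<bar> = \<bar>extend0 f r - extend0 f q\<bar>" for r q by simp
  then show ?thesis unfolding total_variation_def by simp
qed

lemma pos_variation_le_total: "pos_variation f t \<le> total_variation f t"
  unfolding pos_variation_def total_variation_def
proof (intro SUP_subset_mono subset_refl, clarify)
  fix n s
  show "(\<Sum>i<n. ennreal (max 0 (extend0 f (s (Suc i)) - extend0 f (s i))))
    \<le> (\<Sum>i<n. ennreal \<bar>extend0 f (s (Suc i)) - extend0 f (s i)\<bar>)"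
    by (intro sum_mono ennreal_leI) simp
qed

text \<open>Superadditivity: append \<open>b\<close> to an arbitrary partition that ends at
  \<open>a\<close>.\<close>

lemma pos_variation_step:
  assumes "a \<le> b"
  shows "pos_variation f a + ennreal (max 0 (extend0 f b - extend0 f a)) \<le> pos_variation f b"
proof -
  have ne: "partitions_upto a \<noteq> {}" unfolding partitions_upto_def by (auto intro!: exI[of _ 0] exI[of _ "\<lambda>_. a"])
  have "(SUP (n, s)\<in>partitions_upto a. \<Sum>i<n. ennreal (max 0 (extend0 f (s (Suc i)) - extend0 f (s i))))
     + ennreal (max 0 (extend0 f b - extend0 f a))
    = (SUP (n, s)\<in>partitions_upto a. (\<Sum>i<n. ennreal (max 0 (extend0 f (s (Suc i)) - extend0 f (s i))))
     + ennreal (max 0 (extend0 f b - extend0 f a)))"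
    using ne by (subst ennreal_SUP_add_left[symmetric]) (auto simp: case_prod_beta)
  also have "\<dots> \<le> pos_variation f b"
  proof (intro SUP_least, clarify)
    fix n s assume "(n, s) \<in> partitions_upto a"
    then have s: "\<forall>i<n. s i \<le> s (Suc i)" "s n = a" by (auto simp: partitions_upto_def)
    let ?s = "s(Suc n := b)"
    have "(Suc n, ?s) \<in> partitions_upto b" using s assms by (auto simp: partitions_upto_def less_Suc_eq)
    then have "(\<Sum>i<Suc n. ennreal (max 0 (extend0 f (?s (Suc i)) - extend0 f (?s i)))) \<le> pos_variation f b"
      unfolding pos_variation_def by (intro SUP_upper2[where i = "(Suc n, ?s)"]) auto
    moreover have "(\<Sum>i<n. ennreal (max 0 (extend0 f (?s (Suc i)) - extend0 f (?s i))))
      = (\<Sum>i<n. ennreal (max 0 (extend0 f (s (Suc i)) - extend0 f (s i))))" by (intro sum.cong) auto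
    ultimately show "(\<Sum>i<n. ennreal (max 0 (extend0 f (s (Suc i)) - extend0 f (s i))))
     + ennreal (max 0 (extend0 f b - extend0 f a)) \<le> pos_variation f b" using s(2) by simp
  qed
  finally show ?thesis unfolding pos_variation_def .
qed

lemma pos_variation_mono: "a \<le> b \<Longrightarrow> pos_variation f a \<le> pos_variation f b"
  using pos_variation_step[of a b f] by (meson add_increasing2 order.trans zero_le le_iff_add)

lemma pos_variation_negative: "t < 0 \<Longrightarrow> pos_variation f t = 0"
  using pos_variation_le[of t f "\<lambda>_. 0"] by (force simp: extend0_def)

lemma sum_le_pos_variation:
  assumes "\<And>i. i < n \<Longrightarrow> s i \<le> s (Suc i)" "s n \<le> t"
  shows "(\<Sum>i<n. ennreal (max 0 (extend0 f (s (Suc i)) - extend0 f (s i)))) \<le> pos_variation f t"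
proof -
  have "(n, s) \<in> partitions_upto (s n)" using assms by (auto simp: partitions_upto_def)
  then have "(\<Sum>i<n. ennreal (max 0 (extend0 f (s (Suc i)) - extend0 f (s i)))) \<le> pos_variation f (s n)"
    unfolding pos_variation_def by (intro SUP_upper2[where i = "(n, s)"]) auto
  with pos_variation_mono[OF assms(2)] show ?thesis using order_trans by blast
qed

lemma pos_variation_real:
  fixes f defines "p \<equiv> \<lambda>t. enn2real (pos_variation f t)"
  assumes fin: "\<And>t. pos_variation f t < \<infinity>"
  shows "pos_variation f t = ennreal (p t)" "0 \<le> p t" "t < 0 \<Longrightarrow> p t = 0"
    "a \<le> b \<Longrightarrow> max 0 (extend0 f b - extend0 f a) \<le> p b - p a"
proof -
  show "pos_variation f t = ennreal (p t)" for t using fin[of t] by (simp add: p_def)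
  show "0 \<le> p t" for t by (simp add: p_def)
  show "p t = 0" if "t < 0" for t using pos_variation_negative[OF that] by (simp add: p_def)
  assume "a \<le> b"
  from pos_variation_step[OF this, of f]
  have "ennreal (p a + max 0 (extend0 f b - extend0 f a)) \<le> ennreal (p b)"
    using fin unfolding p_def by (subst ennreal_plus) auto
  then show "max 0 (extend0 f b - extend0 f a) \<le> p b - p a" by (subst (asm) ennreal_le_iff) (auto simp: p_def)
qed

text \<open>The variation inherits right-continuity from the path. If it jumped immediately after
  \<open>t\<close>, removing that jump would leave a smaller function that still dominates all
  increments, against minimality of the variation. The property is what permits evaluating
  \<open>interval_measure\<close> on intervals.\<close>

lemma pos_variation_right_cont:
  assumes fin: "\<And>t. pos_variation f t < \<infinity>" and cont: "\<And>t. 0 \<le> t \<Longrightarrow> continuous (at_right t) f"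
  shows "continuous (at_right t) (\<lambda>t. enn2real (pos_variation f t))"
proof (cases "t < 0")
  case True
  have "eventually (\<lambda>s. enn2real (pos_variation f s) = 0) (at_right t)"
    unfolding eventually_at_right_field using True pos_variation_negative by (intro exI[of _ 0]) auto
  then show ?thesis unfolding continuous_within
    using True pos_variation_negative[OF True, of f] by (simp add: tendsto_eventually)
next
  case False
  then have t: "0 \<le> t" by simp
  define p where "p = (\<lambda>t. enn2real (pos_variation f t))"
  note pd = p_def
  have pt: "enn2real (pos_variation f t) = p t" for t by (simp add: p_def)
  note p = pos_variation_real[of f, OF fin, unfolded pt]
  have mono: "p a \<le> p b" if "a \<le> b" for a b using p(4)[OF that] by simp
  define L where "L = Inf (p ` {t<..})"
  have bdd: "bdd_below (p ` {t<..})" using p(2) by (intro bdd_belowI[of _ 0]) auto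
  have Lge: "p t \<le> L" unfolding L_def using mono by (intro cInf_greatest) auto
  have Lle: "L \<le> p s" if "t < s" for s unfolding L_def using bdd that by (intro cInf_lower) auto
  have lim: "(p \<longlongrightarrow> L) (at_right t)"
  proof (rule order_tendstoI)
    fix a assume "a < L"
    then show "eventually (\<lambda>s. a < p s) (at_right t)"
      using Lle unfolding eventually_at_right_field by (intro exI[of _ "t + 1"]) (auto intro: less_le_trans)
  next
    fix a assume "L < a"
    then obtain s where s: "t < s" "p s < a" unfolding L_def using bdd by (auto simp: cInf_less_iff)
    then show "eventually (\<lambda>r. p r < a) (at_right t)"
      unfolding eventually_at_right_field using mono s by (intro exI[of _ s]) (meson le_less_trans less_imp_le)
  qed
  have extcont: "(extend0 f \<longlongrightarrow> extend0 f t) (at_right t)"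
  proof -
    have "(f \<longlongrightarrow> f t) (at_right t)" using cont[OF t] by (simp add: continuous_within)
    moreover have "eventually (\<lambda>s. f s = extend0 f s) (at_right t)"
      unfolding eventually_at_right_field using t by (intro exI[of _ "t + 1"]) (auto simp: extend0_def)
    ultimately show ?thesis using t by (auto simp: extend0_def intro: Lim_transform_eventually)
  qed
  \<comment> \<open>The variation with the supposed jump of size \<open>L - p t\<close> removed
    after \<open>t\<close>.\<close>
  define p' where "p' = (\<lambda>s. if s \<le> t then p s else p s - (L - p t))"
  have dom: "max 0 (extend0 f b - extend0 f a) \<le> p' b - p' a" if ab: "a \<le> b" for a b
  proof (cases "a \<le> t \<and> t < b")
    case False then show ?thesis using p(4)[OF ab] ab by (auto simp: p'_def)
  next
    case True
    have "p' b - p' a \<ge> (extend0 f b - extend0 f t) + (extend0 f t - extend0 f a)"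
    proof -
      have "eventually (\<lambda>s. extend0 f b - extend0 f s \<le> p b - p s) (at_right t)"
        unfolding eventually_at_right_field using True p(4) by (intro exI[of _ b]) (force)
      moreover have "((\<lambda>s. extend0 f b - extend0 f s) \<longlongrightarrow> extend0 f b - extend0 f t) (at_right t)"
        "((\<lambda>s. p b - p s) \<longlongrightarrow> p b - L) (at_right t)" by (intro tendsto_intros extcont lim)+
      ultimately have "extend0 f b - extend0 f t \<le> p b - L"
        using tendsto_le[OF trivial_limit_at_right_real] by blast
      moreover have "extend0 f t - extend0 f a \<le> p t - p a" using p(4)[of a t] True by simp
      ultimately show ?thesis using True by (simp add: p'_def)
    qed
    moreover have "p' a \<le> p' b" using True Lle[of b] mono[of a t] by (simp add: p'_def)
    ultimately show ?thesis by simp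
  qed
  have nonneg: "0 \<le> p' s" for s using p(2)[of s] p(2)[of t] Lle[of s] by (auto simp: p'_def)
  have "p (t + 1) \<le> p' (t + 1)"
    using pos_variation_le[of "t + 1" f p', OF dom nonneg] p(1)[of "t + 1"] nonneg by simp
  then have "L \<le> p t" by (simp add: p'_def)
  then show ?thesis using lim Lge unfolding pd[symmetric] continuous_within by simp
qed

lemma exp_tail_integral:
  assumes "0 < \<rho>"
  shows "(\<integral>\<^sup>+s\<in>{t..}. ennreal (\<rho> * exp (- \<rho> * s)) \<partial>lborel) = ennreal (exp (- \<rho> * t))"
proof -
  have "(\<integral>\<^sup>+s. ennreal (\<rho> * exp (- \<rho> * s)) * indicator {t..} s \<partial>lborel) = ennreal (0 - (- exp (- \<rho> * t)))"
  proof (rule nn_integral_FTC_atLeast)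
    show "((\<lambda>s. - exp (- \<rho> * s)) \<longlongrightarrow> 0) at_top"
    proof -
      have "filterlim (\<lambda>s. - \<rho> * s) at_bot at_top"
        using assms by (intro filterlim_tendsto_neg_mult_at_bot[OF tendsto_const] filterlim_ident) auto
      from tendsto_minus[OF filterlim_compose[OF exp_at_bot this]] show ?thesis by simp
    qed
  qed (use assms in \<open>auto intro!: derivative_eq_intros\<close>)
  then show ?thesis by simp
qed

text \<open>Integration by parts through Fubini: \<open>exp (- \<rho> * t)\<close> is the tail
  integral of \<open>\<rho> * exp (- \<rho> * s)\<close>. In this form the cost depends on the path
  through its variation at each time, to which lower semicontinuity and Fatou's lemma apply.\<close>

lemma nn_integral_pos_variation:
  assumes fin: "\<And>t. pos_variation f t < \<infinity>" and cont: "\<And>t. 0 \<le> t \<Longrightarrow> continuous (at_right t) f"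
    and \<rho>: "0 < \<rho>" and q: "0 \<le> q"
  shows "(\<integral>\<^sup>+t\<in>{0..}. ennreal (exp (- \<rho> * t) * q) \<partial>interval_measure (\<lambda>t. enn2real (pos_variation f t)))
    = (\<integral>\<^sup>+s\<in>{0..}. ennreal (\<rho> * exp (- \<rho> * s)) * (ennreal q * pos_variation f s) \<partial>lborel)"
proof -
  define p where "p = (\<lambda>t. enn2real (pos_variation f t))"
  note pd = p_def
  have pt: "enn2real (pos_variation f t) = p t" for t by (simp add: p_def)
  note p = pos_variation_real[of f, OF fin, unfolded pt]
  have mono: "p a \<le> p b" if "a \<le> b" for a b using p(4)[OF that] by simp
  have rc: "continuous (at_right t) p" for t unfolding pd by (rule pos_variation_right_cont[OF fin cont])
  let ?m = "interval_measure p"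
  interpret m: sigma_finite_measure ?m by (rule sigma_finite_interval_measure) (auto intro: mono rc)
  interpret pair_sigma_finite ?m lborel ..
  have Ioc: "emeasure ?m {a<..b} = ennreal (p b - p a)" if "a \<le> b" for a b
    by (rule emeasure_interval_measure_Ioc) (auto intro: mono rc that)
  \<comment> \<open>Only intervals open on the left are evaluated directly. Starting at
    \<open>-1\<close> adds no mass, as the variation vanishes before \<open>0\<close>, and ensures
    that \<open>{0..s}\<close> carries the jump at time \<open>0\<close>.\<close>
  have neg: "emeasure ?m {-1<..<0} = 0"
  proof -
    have "{-1<..<0} = (\<Union>n. {-1<..- (1 / real (Suc n))})"
    proof (intro equalityI subsetI)
      fix y :: real assume y: "y \<in> {-1<..<0}"
      then obtain n where "inverse (real (Suc n)) < - y" using reals_Archimedean[of "- y"] by auto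
      then show "y \<in> (\<Union>n. {-1<..- (1 / real (Suc n))})" using y by (auto simp: inverse_eq_divide intro!: exI[of _ n])
    next
      fix y :: real assume "y \<in> (\<Union>n. {-1<..- (1 / real (Suc n))})"
      then obtain n where "-1 < y" "y \<le> - (1 / real (Suc n))" by auto
      moreover have "- (1 / real (Suc n)) < 0" by simp
      ultimately have "-1 < y" "y < 0" by linarith+
      then show "y \<in> {-1<..<0}" by simp
    qed
    moreover have "(\<Union>n. {-1<..- (1 / real (Suc n))}) \<in> null_sets ?m"
    proof (rule null_sets_UN, rule null_setsI)
      fix n show "emeasure ?m {-1<..- (1 / real (Suc n))} = 0"
        by (subst Ioc) (auto simp: p(3) field_simps)
    qed auto
    ultimately show ?thesis by auto
  qed
  have Icc: "emeasure ?m {0..s} = pos_variation f s" if s: "0 \<le> s" for s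
  proof -
    have "emeasure ?m {-1<..s} = emeasure ?m {-1<..<0} + emeasure ?m {0..s}"
      using s by (subst plus_emeasure) (auto intro!: arg_cong[where f = "emeasure ?m"])
    then show ?thesis using Ioc[of "-1" s] s neg p(1,3) by simp
  qed
  have "(\<integral>\<^sup>+t\<in>{0..}. ennreal (exp (- \<rho> * t) * q) \<partial>?m)
    = (\<integral>\<^sup>+t. \<integral>\<^sup>+s. ennreal q * ennreal (\<rho> * exp (- \<rho> * s)) * indicator {t..} s * indicator {0..} t \<partial>lborel \<partial>?m)"
  proof (intro nn_integral_cong)
    fix t
    have "(\<integral>\<^sup>+s. ennreal q * ennreal (\<rho> * exp (- \<rho> * s)) * indicator {t..} s * indicator {0..} t \<partial>lborel)
      = ennreal q * (\<integral>\<^sup>+s\<in>{t..}. ennreal (\<rho> * exp (- \<rho> * s)) \<partial>lborel) * indicator {0..} t"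
      by (subst nn_integral_multc, simp, subst mult.assoc, subst nn_integral_cmult) (auto simp: mult.assoc)
    also have "\<dots> = ennreal q * ennreal (exp (- \<rho> * t)) * indicator {0..} t" using exp_tail_integral[OF \<rho>, of t] by simp
    finally show "ennreal (exp (- \<rho> * t) * q) * indicator {0..} t
      = (\<integral>\<^sup>+s. ennreal q * ennreal (\<rho> * exp (- \<rho> * s)) * indicator {t..} s * indicator {0..} t \<partial>lborel)"
      using q by (simp add: ennreal_mult' mult.commute)
  qed
  also have "\<dots> = (\<integral>\<^sup>+s. \<integral>\<^sup>+t. ennreal q * ennreal (\<rho> * exp (- \<rho> * s)) * indicator {t..} s * indicator {0..} t \<partial>?m \<partial>lborel)"
  proof (rule Fubini'[symmetric])
    have "(\<lambda>(t, s). ennreal q * ennreal (\<rho> * exp (- \<rho> * s)) * indicator {z :: real \<times> real. fst z \<le> snd z \<and> 0 \<le> fst z} (t, s))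
      \<in> borel_measurable (?m \<Otimes>\<^sub>M lborel)" by measurable
    also have "(\<lambda>(t, s). ennreal q * ennreal (\<rho> * exp (- \<rho> * s)) * indicator {z :: real \<times> real. fst z \<le> snd z \<and> 0 \<le> fst z} (t, s))
      = (\<lambda>(t, s). ennreal q * ennreal (\<rho> * exp (- \<rho> * s)) * indicator {t..} s * indicator {0..} t)"
      by (auto simp: fun_eq_iff indicator_def)
    finally show "(\<lambda>(t, s). ennreal q * ennreal (\<rho> * exp (- \<rho> * s)) * indicator {t..} s * indicator {0..} t)
      \<in> borel_measurable (?m \<Otimes>\<^sub>M lborel)" .
  qed
  also have "\<dots> = (\<integral>\<^sup>+s\<in>{0..}. ennreal (\<rho> * exp (- \<rho> * s)) * (ennreal q * pos_variation f s) \<partial>lborel)"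
  proof (intro nn_integral_cong)
    fix s
    have "(\<integral>\<^sup>+t. ennreal q * ennreal (\<rho> * exp (- \<rho> * s)) * indicator {t..} s * indicator {0..} t \<partial>?m)
      = (\<integral>\<^sup>+t. ennreal q * ennreal (\<rho> * exp (- \<rho> * s)) * indicator {0..s} t \<partial>?m)"
      by (intro nn_integral_cong) (auto simp: indicator_def)
    also have "\<dots> = ennreal q * ennreal (\<rho> * exp (- \<rho> * s)) * emeasure ?m {0..s}" by (subst nn_integral_cmult_indicator) auto
    finally show "(\<integral>\<^sup>+t. ennreal q * ennreal (\<rho> * exp (- \<rho> * s)) * indicator {t..} s * indicator {0..} t \<partial>?m)
      = ennreal (\<rho> * exp (- \<rho> * s)) * (ennreal q * pos_variation f s) * indicator {0..} s"
      by (cases "0 \<le> s") (auto simp: Icc mult_ac)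
  qed
  finally show ?thesis unfolding pd .
qed

text \<open>Dominating functions of consecutive blocks are glued by freezing the earlier one at the
  end of its block.\<close>

lemma total_variation_blocks:
  assumes w: "0 < w"
    and blocks: "\<And>j. j < N \<Longrightarrow> mono_on {real j * w..real (Suc j) * w} f \<or> antimono_on {real j * w..real (Suc j) * w} f"
    and t: "t \<le> real N * w"
  shows "total_variation f t < \<infinity>"
proof -
  have "\<exists>P. (\<forall>a b. a \<le> b \<longrightarrow> b \<le> real n * w \<longrightarrow> \<bar>extend0 f b - extend0 f a\<bar> \<le> P b - P a) \<and> (\<forall>a. 0 \<le> (P a :: real))"
    if "n \<le> N" for n using that
  proof (induction n)
    case 0
    show ?case
    \<comment> \<open>Up to time \<open>0\<close> the only increment is the jump away from the
      extension value \<open>0\<close>.\<close>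
    proof (intro exI[of _ "\<lambda>a. if 0 \<le> a then \<bar>f 0\<bar> else 0"] conjI allI impI)
      fix a b :: real assume "a \<le> b" "b \<le> real 0 * w"
      then have "b \<le> 0" "a \<le> b" by auto
      then show "\<bar>extend0 f b - extend0 f a\<bar> \<le> (if 0 \<le> b then \<bar>f 0\<bar> else 0) - (if 0 \<le> a then \<bar>f 0\<bar> else 0)"
        by (cases "b = 0"; cases "a = 0") (auto simp: extend0_def)
    qed simp
  next
    case (Suc n)
    then obtain P where P: "\<And>a b. a \<le> b \<Longrightarrow> b \<le> real n * w \<Longrightarrow> \<bar>extend0 f b - extend0 f a\<bar> \<le> P b - P a" "\<And>a. 0 \<le> P a"
      by auto
    define u where "u = real n * w"
    define u' where "u' = real (Suc n) * w"
    have u: "0 \<le> u" "u \<le> u'" using w by (auto simp: u_def u'_def)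
    \<comment> \<open>For a monotone block of either direction the distance to the initial value is
      nondecreasing and dominates the increments.\<close>
    define h where "h = (\<lambda>a. if a \<le> u then 0 else \<bar>f (min a u') - f u\<bar>)"
    have bl: "mono_on {u..u'} f \<or> antimono_on {u..u'} f" using blocks[of n] Suc.prems unfolding u_def u'_def by simp
    have h: "\<bar>f b - f a\<bar> \<le> h b - h a" if "u \<le> a" "a \<le> b" "b \<le> u'" for a b
    proof -
      have 1: "h q = \<bar>f q - f u\<bar>" if "u \<le> q" "q \<le> u'" for q
        using that by (cases "q = u") (auto simp: h_def min_def)
      note 1 = 1[of a] 1[of b]
      from bl show ?thesis
      proof
        assume m: "mono_on {u..u'} f"
        then have "f u \<le> f a" "f a \<le> f b" using that u by (auto intro!: mono_onD[OF m])
        then show ?thesis using 1 that by simp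
      next
        assume m: "antimono_on {u..u'} f"
        then have "f a \<le> f u" "f b \<le> f a" using that u by (auto intro!: monotone_onD[OF m])
        then show ?thesis using 1 that by simp
      qed
    qed
    show ?case
    proof (intro exI[of _ "\<lambda>a. P (min a u) + h a"] conjI allI impI)
      fix a show "0 \<le> P (min a u) + h a" using P(2)[of "min a u"] by (auto simp: h_def)
    next
      fix a b :: real assume ab: "a \<le> b" "b \<le> real (Suc n) * w"
      consider "b \<le> u" | "u \<le> a" | "a < u" "u < b" by linarith
      then show "\<bar>extend0 f b - extend0 f a\<bar> \<le> P (min b u) + h b - (P (min a u) + h a)"
      proof cases
        case 1 then show ?thesis using P(1)[of a b] ab by (simp add: h_def u_def[symmetric])
      next
        case 2
        then have "extend0 f b = f b" "extend0 f a = f a" using u ab by (auto simp: extend0_def)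
        then show ?thesis using h[of a b] 2 ab u'_def by simp
      next
        case 3
        then have "extend0 f b = f b" "extend0 f u = f u" using u by (auto simp: extend0_def)
        then have "\<bar>extend0 f b - extend0 f u\<bar> \<le> h b" using h[of u b] 3 ab u'_def by (simp add: h_def)
        moreover have "\<bar>extend0 f u - extend0 f a\<bar> \<le> P u - P a" using P(1)[of a u] 3 by (simp add: u_def)
        ultimately show ?thesis using 3 by (simp add: h_def)
      qed
    qed
  qed
  from this[of N] obtain P where P: "\<And>a b. a \<le> b \<Longrightarrow> b \<le> real N * w \<Longrightarrow> \<bar>extend0 f b - extend0 f a\<bar> \<le> P b - P a" "\<And>a. 0 \<le> P a"
    by auto
  have "total_variation f t \<le> ennreal (P t)" using P t by (intro total_variation_le) auto
  then show ?thesis by (simp add: le_less_trans)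
qed

section \<open>Regularity of the optimal state as a path\<close>

context hysteresis
begin

definition C :: "real \<Rightarrow> real" where "C t = real_of_ereal (C_star cp cm c x t)"

lemma C_star_real: "0 \<le> t \<Longrightarrow> C_star cp cm c x t = ereal (C t)"
  using hyst_finite[OF C_star_hyst] by (simp add: ereal_real C_def)

lemma C_below: "0 \<le> t \<Longrightarrow> below cp cm c x (ereal (C t)) t"
  and C_above: "0 \<le> t \<Longrightarrow> above cp cm c x (ereal (C t)) t"
  using C_star_hyst C_star_real unfolding hyst_def by metis+

lemma cp_le_C: "0 \<le> t \<Longrightarrow> cp (x t) \<le> ereal (C t)"
  using C_below[of t] unfolding below_def by auto

lemma C_le_cm: "0 \<le> t \<Longrightarrow> ereal (C t) \<le> cm (x t)"
  using C_above[of t] unfolding above_def by auto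

lemma below_extend:
  assumes "below cp cm c x z s" "s \<le> t" "\<And>q. s < q \<Longrightarrow> q \<le> t \<Longrightarrow> cp (x q) \<le> z"
  shows "below cp cm c x z t"
proof -
  obtain r where "r \<in> {0..s}" "cm (x r) \<le> z \<or> r = 0 \<and> ereal c \<le> z" "\<forall>q\<in>{r..s}. cp (x q) \<le> z"
    using assms(1) unfolding below_def by blast
  with assms(2,3) show ?thesis unfolding below_def
    by (intro bexI[of _ r]) (auto simp: not_le[symmetric])
qed

lemma above_extend:
  assumes "above cp cm c x z s" "s \<le> t" "\<And>q. s < q \<Longrightarrow> q \<le> t \<Longrightarrow> z \<le> cm (x q)"
  shows "above cp cm c x z t"
proof -
  obtain r where "r \<in> {0..s}" "z \<le> cp (x r) \<or> r = 0 \<and> z \<le> ereal c" "\<forall>q\<in>{r..s}. z \<le> cm (x q)"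
    using assms(1) unfolding above_def by blast
  with assms(2,3) show ?thesis unfolding above_def
    by (intro bexI[of _ r]) (auto simp: not_le[symmetric])
qed

lemma below_weaken:
  assumes "below cp cm c x z t" "z \<le> z'" shows "below cp cm c x z' t"
proof -
  obtain r where "r \<in> {0..t}" "cm (x r) \<le> z \<or> r = 0 \<and> ereal c \<le> z" "\<forall>q\<in>{r..t}. cp (x q) \<le> z"
    using assms(1) unfolding below_def by blast
  then show ?thesis unfolding below_def using order_trans[OF _ assms(2)] by blast
qed

lemma above_weaken:
  assumes "above cp cm c x z t" "z' \<le> z" shows "above cp cm c x z' t"
proof -
  obtain r where "r \<in> {0..t}" "z \<le> cp (x r) \<or> r = 0 \<and> z \<le> ereal c" "\<forall>q\<in>{r..t}. z \<le> cm (x q)"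
    using assms(1) unfolding above_def by blast
  then show ?thesis unfolding above_def using order_trans[OF assms(2)] by blast
qed

lemma below_restrict:
  assumes "below cp cm c x z t" "0 \<le> s" "s \<le> t"
  shows "below cp cm c x z s \<or> (\<exists>r\<in>{s<..t}. cm (x r) \<le> z)"
proof -
  obtain r where r: "r \<in> {0..t}" "cm (x r) \<le> z \<or> r = 0 \<and> ereal c \<le> z" "\<forall>q\<in>{r..t}. cp (x q) \<le> z"
    using assms(1) unfolding below_def by blast
  show ?thesis
  proof (cases "r \<le> s")
    case True
    then have "below cp cm c x z s" unfolding below_def using r assms by (intro bexI[of _ r]) auto
    then show ?thesis ..
  next
    case False then show ?thesis using r assms by (intro disjI2 bexI[of _ r]) auto
  qed
qed

lemma above_restrict:
  assumes "above cp cm c x z t" "0 \<le> s" "s \<le> t"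
  shows "above cp cm c x z s \<or> (\<exists>r\<in>{s<..t}. z \<le> cp (x r))"
proof -
  obtain r where r: "r \<in> {0..t}" "z \<le> cp (x r) \<or> r = 0 \<and> z \<le> ereal c" "\<forall>q\<in>{r..t}. z \<le> cm (x q)"
    using assms(1) unfolding above_def by blast
  show ?thesis
  proof (cases "r \<le> s")
    case True
    then have "above cp cm c x z s" unfolding above_def using r assms by (intro bexI[of _ r]) auto
    then show ?thesis ..
  next
    case False then show ?thesis using r assms by (intro disjI2 bexI[of _ r]) auto
  qed
qed

text \<open>A constant \<open>\<zeta>\<close> separates the two boundaries throughout the block. A
  state that starts at or below \<open>\<zeta>\<close> cannot cross it, so \<open>cm\<close> never
  pushes it down and it can only rise; otherwise \<open>cp\<close> never pushes it up and it can
  only fall.\<close>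

lemma C_block_monotone:
  assumes a: "0 \<le> a" "a \<le> b" and gap: "\<And>s t. s \<in> {a..b} \<Longrightarrow> t \<in> {a..b} \<Longrightarrow> cp (x s) < cm (x t)"
  shows "mono_on {a..b} C \<or> antimono_on {a..b} C"
proof -
  obtain m where m: "m \<in> {a..b}" "\<And>q. q \<in> {a..b} \<Longrightarrow> x q \<le> x m"
    using SUP_attained[OF a] by metis
  have "continuous_on {a..b} x" using cont_x a by (auto intro: continuous_on_subset)
  from continuous_attains_inf[OF _ _ this] obtain m' where m': "m' \<in> {a..b}" "\<And>q. q \<in> {a..b} \<Longrightarrow> x m' \<le> x q"
    using a by auto
  obtain \<zeta> where z: "cp (x m) < \<zeta>" "\<zeta> < cm (x m')" using gap[OF m(1) m'(1)] dense by blast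
  have cpz: "cp (x q) < \<zeta>" if "q \<in> {a..b}" for q
    using z(1) mono_onD[OF mono_cp x_in x_in m(2)[OF that]] that m a by (auto intro: le_less_trans)
  have cmz: "\<zeta> < cm (x q)" if "q \<in> {a..b}" for q
    using z(2) mono_onD[OF mono_cm x_in x_in m'(2)[OF that]] that m' a by (auto intro: less_le_trans)
  show ?thesis
  proof (cases "ereal (C a) \<le> \<zeta>")
    case True
    have le: "ereal (C u) \<le> \<zeta>" if u: "u \<in> {a..b}" for u
    proof (rule ccontr)
      assume n: "\<not> ereal (C u) \<le> \<zeta>"
      have "above cp cm c x (ereal (C u)) a \<or> (\<exists>r\<in>{a<..u}. ereal (C u) \<le> cp (x r))"
        using u a by (intro above_restrict C_above) auto
      then show False
      proof
        assume "above cp cm c x (ereal (C u)) a"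
        then show False using not_below_above[OF C_below[OF a(1)]] True n by (meson order_trans)
      next
        assume "\<exists>r\<in>{a<..u}. ereal (C u) \<le> cp (x r)"
        then obtain r where "r \<in> {a<..u}" "ereal (C u) \<le> cp (x r)" by blast
        then have "r \<in> {a..b}" "ereal (C u) \<le> cp (x r)" using u by auto
        then show False using cpz[of r] n by (meson less_imp_le order_trans)
      qed
    qed
    have "C u \<le> C v" if uv: "u \<in> {a..b}" "v \<in> {a..b}" "u \<le> v" for u v
    proof (rule ccontr)
      assume n: "\<not> C u \<le> C v"
      have "below cp cm c x (ereal (C v)) u \<or> (\<exists>r\<in>{u<..v}. cm (x r) \<le> ereal (C v))"
        using uv a by (intro below_restrict C_below) auto
      then show False
      proof
        assume "below cp cm c x (ereal (C v)) u"
        then show False using not_below_above[OF _ C_above] n uv a by (metis atLeastAtMost_iff ereal_less_eq(3) order_trans)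
      next
        assume "\<exists>r\<in>{u<..v}. cm (x r) \<le> ereal (C v)"
        then obtain r where "r \<in> {u<..v}" "cm (x r) \<le> ereal (C v)" by blast
        then have "r \<in> {a..b}" "cm (x r) \<le> ereal (C v)" using uv by auto
        then show False using cmz[of r] le[OF uv(2)] by (meson leD order_trans)
      qed
    qed
    then show ?thesis by (auto intro: mono_onI)
  next
    case False
    then have F: "\<zeta> \<le> ereal (C a)" by simp
    have le: "\<zeta> \<le> ereal (C u)" if u: "u \<in> {a..b}" for u
    proof (rule ccontr)
      assume n: "\<not> \<zeta> \<le> ereal (C u)"
      have "below cp cm c x (ereal (C u)) a \<or> (\<exists>r\<in>{a<..u}. cm (x r) \<le> ereal (C u))"
        using u a by (intro below_restrict C_below) auto
      then show False
      proof
        assume "below cp cm c x (ereal (C u)) a"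
        then show False using not_below_above[OF _ C_above[OF a(1)]] F n by (meson order_trans)
      next
        assume "\<exists>r\<in>{a<..u}. cm (x r) \<le> ereal (C u)"
        then obtain r where "r \<in> {a<..u}" "cm (x r) \<le> ereal (C u)" by blast
        then have "r \<in> {a..b}" "cm (x r) \<le> ereal (C u)" using u by auto
        then show False using cmz[of r] n by (meson less_imp_le order_trans)
      qed
    qed
    have "C v \<le> C u" if uv: "u \<in> {a..b}" "v \<in> {a..b}" "u \<le> v" for u v
    proof (rule ccontr)
      assume n: "\<not> C v \<le> C u"
      have "above cp cm c x (ereal (C v)) u \<or> (\<exists>r\<in>{u<..v}. ereal (C v) \<le> cp (x r))"
        using uv a by (intro above_restrict C_above) auto
      then show False
      proof
        assume "above cp cm c x (ereal (C v)) u"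
        then show False using not_below_above[OF C_below] n uv a by (metis atLeastAtMost_iff ereal_less_eq(3) order_trans)
      next
        assume "\<exists>r\<in>{u<..v}. ereal (C v) \<le> cp (x r)"
        then obtain r where "r \<in> {u<..v}" "ereal (C v) \<le> cp (x r)" by blast
        then have "r \<in> {a..b}" "ereal (C v) \<le> cp (x r)" using uv by auto
        then show False using cpz[of r] le[OF uv(2)] by (meson leD order_trans)
      qed
    qed
    then show ?thesis by (auto intro: monotone_onI)
  qed
qed

lemma C_total_variation: "total_variation (\<lambda>t. C t - k) t < \<infinity>"
proof -
  define T where "T = \<bar>t\<bar> + 1"
  obtain p where p: "0 < p"
    "\<And>s t. 0 \<le> s \<Longrightarrow> s \<le> T \<Longrightarrow> 0 \<le> t \<Longrightarrow> t \<le> T \<Longrightarrow> \<bar>s - t\<bar> < p \<Longrightarrow> cp (x s) < cm (x t)"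
    using uniform_gap[of T] by metis
  obtain N :: nat where N: "T / p < real N" using reals_Archimedean2 by blast
  have T: "0 < T" by (simp add: T_def)
  have N0: "0 < real N" using N T p by (meson divide_pos_pos less_trans)
  \<comment> \<open>Blocks shorter than the uniform gap \<open>p\<close>, so that
    \<open>C_block_monotone\<close> applies to each of them.\<close>
  define w where "w = T / real N"
  have w: "0 < w" "w < p" using T N N0 p by (auto simp: w_def field_simps)
  have Nw: "real N * w = T" using N0 by (simp add: w_def)
  show ?thesis
  proof (rule total_variation_blocks[OF w(1)])
    show "t \<le> real N * w" unfolding Nw T_def by simp
    fix j assume j: "j < N"
    have jT: "real (Suc j) * w \<le> T" unfolding Nw[symmetric] using j w by (intro mult_right_mono) auto
    have "mono_on {real j * w..real (Suc j) * w} C \<or> antimono_on {real j * w..real (Suc j) * w} C"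
    proof (rule C_block_monotone)
      have eq: "real (Suc j) * w = real j * w + w" by (simp add: algebra_simps)
      show "real j * w \<le> real (Suc j) * w" using w unfolding eq by simp
      have j0: "0 \<le> real j * w" using w by simp
      then show "0 \<le> real j * w" .
      fix s t assume "s \<in> {real j * w..real (Suc j) * w}" "t \<in> {real j * w..real (Suc j) * w}"
      then show "cp (x s) < cm (x t)" using jT w order_trans[OF j0] unfolding eq by (intro p(2)) (force simp: abs_less_iff)+
    qed
    then show "mono_on {real j * w..real (Suc j) * w} (\<lambda>t. C t - k) \<or> antimono_on {real j * w..real (Suc j) * w} (\<lambda>t. C t - k)"
      by (auto simp: monotone_on_def)
  qed
qed

text \<open>A certificate with slack, for a level \<open>z'\<close> strictly beyond
  \<open>C t\<close>, stays valid for a short time by semicontinuity of the boundaries.\<close>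

lemma C_right_cont: assumes t: "0 \<le> t" shows "continuous (at_right t) C"
  unfolding continuous_within
proof (rule order_tendstoI)
  fix z assume "C t < z"
  then obtain z' where z': "C t < z'" "z' < z" using dense by blast
  have "cp (x t) < ereal z'" using cp_le_C[OF t] z' by (meson ereal_less_eq(3) le_less_trans less_ereal.simps(1))
  then obtain e where e: "0 < e" "\<And>y. y \<in> Ob \<Longrightarrow> y < x t + e \<Longrightarrow> cp y < ereal z'"
    using cp_usc[OF x_in[OF t]] by metis
  obtain \<delta> where \<delta>: "0 < \<delta>" "\<And>q. 0 \<le> q \<Longrightarrow> \<bar>q - t\<bar> < \<delta> \<Longrightarrow> \<bar>x q - x t\<bar> < e"
    using near_x[OF t e(1)] by metis
  have "C u < z" if u: "t < u" "u < t + \<delta>" for u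
  proof -
    have "below cp cm c x (ereal z') t"
      using z'(1) by (intro below_weaken[OF C_below[OF t]]) simp
    then have "below cp cm c x (ereal z') u"
    proof (rule below_extend)
      fix q assume "t < q" "q \<le> u"
      then have "cp (x q) < ereal z'" using \<delta>(2)[of q] u t by (intro e(2) x_in) auto
      then show "cp (x q) \<le> ereal z'" by simp
    qed (use u in simp)
    from not_below_above[OF this C_above] u t z' show ?thesis by simp
  qed
  then show "eventually (\<lambda>u. C u < z) (at_right t)"
    unfolding eventually_at_right_field using \<delta>(1) by (intro exI[of _ "t + \<delta>"]) auto
next
  fix z assume "z < C t"
  then obtain z' where z': "z' < C t" "z < z'" using dense by blast
  have "ereal z' < cm (x t)" using C_le_cm[OF t] z' by (meson ereal_less_eq(3) less_le_trans less_ereal.simps(1))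
  then obtain e where e: "0 < e" "\<And>y. y \<in> Ob \<Longrightarrow> x t - e < y \<Longrightarrow> ereal z' < cm y"
    using cm_lsc[OF x_in[OF t]] by metis
  obtain \<delta> where \<delta>: "0 < \<delta>" "\<And>q. 0 \<le> q \<Longrightarrow> \<bar>q - t\<bar> < \<delta> \<Longrightarrow> \<bar>x q - x t\<bar> < e"
    using near_x[OF t e(1)] by metis
  have "z < C u" if u: "t < u" "u < t + \<delta>" for u
  proof -
    have "above cp cm c x (ereal z') t"
      using z'(1) by (intro above_weaken[OF C_above[OF t]]) simp
    then have "above cp cm c x (ereal z') u"
    proof (rule above_extend)
      fix q assume "t < q" "q \<le> u"
      then have "ereal z' < cm (x q)" using \<delta>(2)[of q] u t by (intro e(2) x_in) auto
      then show "ereal z' \<le> cm (x q)" by simp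
    qed (use u in simp)
    from not_below_above[OF C_below this] u t z' show ?thesis by simp
  qed
  then show "eventually (\<lambda>u. z < C u) (at_right t)"
    unfolding eventually_at_right_field using \<delta>(1) by (intro exI[of _ "t + \<delta>"]) auto
qed

lemma mono_left_limit:
  fixes f :: "real \<Rightarrow> real"
  assumes "a < t" "mono_on {a..t} f" shows "\<exists>l. (f \<longlongrightarrow> l) (at_left t)"
proof (intro exI order_tendstoI)
  let ?l = "Sup (f ` {a..<t})"
  have bdd: "bdd_above (f ` {a..<t})" using assms by (intro bdd_aboveI[of _ "f t"]) (auto intro: mono_onD)
  fix z
  assume "z < ?l"
  then obtain s where s: "s \<in> {a..<t}" "z < f s" using bdd assms(1) by (auto simp: less_cSup_iff)
  then have "z < f q" if "s < q" "q < t" for q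
    using mono_onD[OF assms(2), of s q] that by auto
  then show "eventually (\<lambda>s. z < f s) (at_left t)"
    unfolding eventually_at_left_field using s by (intro exI[of _ s]) auto
next
  let ?l = "Sup (f ` {a..<t})"
  have bdd: "bdd_above (f ` {a..<t})" using assms by (intro bdd_aboveI[of _ "f t"]) (auto intro: mono_onD)
  fix z
  assume "?l < z"
  moreover have "f q \<le> ?l" if "a < q" "q < t" for q using bdd that by (intro cSup_upper) auto
  ultimately show "eventually (\<lambda>s. f s < z) (at_left t)"
    unfolding eventually_at_left_field using assms(1) by (intro exI[of _ a]) (auto intro: le_less_trans)
qed

lemma C_left_limit: assumes t: "0 < t" shows "\<exists>l. (C \<longlongrightarrow> l) (at_left t)"
proof -
  obtain p where p: "0 < p"
    "\<And>s q. 0 \<le> s \<Longrightarrow> s \<le> t \<Longrightarrow> 0 \<le> q \<Longrightarrow> q \<le> t \<Longrightarrow> \<bar>s - q\<bar> < p \<Longrightarrow> cp (x s) < cm (x q)"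
    using uniform_gap[of t] by metis
  define a where "a = max 0 (t - p / 2)"
  have a: "0 \<le> a" "a < t" "t - a < p" using t p by (auto simp: a_def)
  have "mono_on {a..t} C \<or> antimono_on {a..t} C"
    using a by (intro C_block_monotone p(2)) auto
  then show ?thesis
  proof
    assume "mono_on {a..t} C" then show ?thesis using mono_left_limit a by blast
  next
    assume "antimono_on {a..t} C"
    then have "mono_on {a..t} (\<lambda>s. - C s)" by (auto simp: monotone_on_def)
    from mono_left_limit[OF a(2) this] obtain l where "((\<lambda>s. - C s) \<longlongrightarrow> l) (at_left t)" by blast
    from tendsto_minus[OF this] show ?thesis unfolding minus_minus by blast
  qed
qed

lemma C_cadlag: "cadlag (\<lambda>t. C t - k)"
  unfolding cadlag_def
proof (intro conjI allI impI)
  show "continuous (at_right t) (\<lambda>t. C t - k)" if "0 \<le> t" for t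
    using C_right_cont[OF that] by (intro continuous_diff continuous_const)
  fix t :: real assume "0 < t"
  from C_left_limit[OF this] obtain l where "(C \<longlongrightarrow> l) (at_left t)" by blast
  then have "((\<lambda>t. C t - k) \<longlongrightarrow> l - k) (at_left t)" by (intro tendsto_intros)
  then show "\<exists>l. ((\<lambda>t. C t - k) \<longlongrightarrow> l) (at_left t)" by blast
qed

end

section \<open>The demand process\<close>

lemma measurable_right_continuous_process:
  fixes X :: "real \<Rightarrow> 'a \<Rightarrow> real"
  assumes meas: "\<And>t. X t \<in> borel_measurable M"
    and cont: "\<And>\<omega> t. \<omega> \<in> space M \<Longrightarrow> continuous (at_right t) (\<lambda>t. X t \<omega>)"
  shows "(\<lambda>(t, \<omega>). X t \<omega>) \<in> borel_measurable (borel \<Otimes>\<^sub>M M)"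
proof -
  \<comment> \<open>The path is read at the next grid point strictly after the given time, so the
    approximating times converge from the right and right-continuity suffices.\<close>
  define Y where "Y = (\<lambda>(n::nat) z. X ((of_int \<lfloor>real (Suc n) * fst z\<rfloor> + 1) / real (Suc n)) (snd z))"
  have Y: "Y n \<in> borel_measurable (borel \<Otimes>\<^sub>M M)" for n
    unfolding Y_def
  proof (rule measurable_compose_countable[where f = "\<lambda>k z. X ((of_int k + 1) / real (Suc n)) (snd z)"])
    show "(\<lambda>z. X ((of_int k + 1) / real (Suc n)) (snd z)) \<in> borel_measurable (borel \<Otimes>\<^sub>M M)" for k
      by (rule measurable_compose[OF measurable_snd meas])
    show "(\<lambda>z. \<lfloor>real (Suc n) * fst z\<rfloor>) \<in> measurable (borel \<Otimes>\<^sub>M M) (count_space UNIV)" by measurable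
  qed
  show ?thesis
  proof (rule borel_measurable_LIMSEQ_real[OF _ Y])
    fix z :: "real \<times> 'a" assume "z \<in> space (borel \<Otimes>\<^sub>M M)"
    then obtain t \<omega> where z: "z = (t, \<omega>)" "\<omega> \<in> space M" by (auto simp: space_pair_measure)
    define q where "q = (\<lambda>n. (of_int \<lfloor>real (Suc n) * t\<rfloor> + 1) / real (Suc n))"
    have gt: "t < q n" for n
    proof -
      have "real (Suc n) * t < of_int \<lfloor>real (Suc n) * t\<rfloor> + 1" by linarith
      then show ?thesis by (simp add: q_def field_simps)
    qed
    have le: "q n \<le> t + 1 / real (Suc n)" for n
    proof -
      have "of_int \<lfloor>real (Suc n) * t\<rfloor> + 1 \<le> real (Suc n) * t + 1" by linarith
      then have "q n \<le> (real (Suc n) * t + 1) / real (Suc n)" unfolding q_def by (intro divide_right_mono) auto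
      then show ?thesis by (simp add: add_divide_distrib)
    qed
    have "q \<longlonglongrightarrow> t"
    proof (rule tendsto_sandwich[OF _ _ tendsto_const])
      show "(\<lambda>n. t + 1 / real (Suc n)) \<longlonglongrightarrow> t"
        using tendsto_add[OF tendsto_const[of t] LIMSEQ_inverse_real_of_nat] by (simp add: inverse_eq_divide)
    qed (intro always_eventually allI less_imp_le[OF gt] le)+
    then have "filterlim q (at_right t) sequentially" using gt by (auto simp: filterlim_at less_imp_neq[THEN not_sym] intro!: always_eventually)
    moreover have "((\<lambda>t. X t \<omega>) \<longlongrightarrow> X t \<omega>) (at_right t)" using cont[OF z(2)] by (simp add: continuous_within)
    ultimately have "(\<lambda>n. X (q n) \<omega>) \<longlonglongrightarrow> X t \<omega>" using filterlim_compose by blast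
    then show "(\<lambda>n. Y n z) \<longlonglongrightarrow> (case z of (t, \<omega>) \<Rightarrow> X t \<omega>)" by (simp add: Y_def q_def z)
  qed
qed

lemma measurable_comp_continuous_on:
  fixes f :: "real \<Rightarrow> real \<Rightarrow> real"
  assumes f: "continuous_on (UNIV \<times> A) (\<lambda>(c, d). f c d)"
    and Z: "Z \<in> borel_measurable N" and Y: "Y \<in> borel_measurable N" "\<And>\<omega>. \<omega> \<in> space N \<Longrightarrow> Y \<omega> \<in> A"
  shows "(\<lambda>\<omega>. f (Z \<omega>) (Y \<omega>)) \<in> borel_measurable N"
proof -
  have "(\<lambda>\<omega>. (Z \<omega>, Y \<omega>)) \<in> measurable N (restrict_space borel (UNIV \<times> A))"
    using Y(2) by (intro measurable_restrict_space2 borel_measurable_Pair Z Y(1)) auto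
  from measurable_compose[OF this borel_measurable_continuous_on_restrict[OF f]] show ?thesis by simp
qed

lemma continuous_on_seqD2:
  fixes f :: "real \<Rightarrow> real \<Rightarrow> real"
  assumes f: "continuous_on (UNIV \<times> A) (\<lambda>(c, d). f c d)"
    and lims: "u \<longlonglongrightarrow> c" "w \<longlonglongrightarrow> d" and A: "\<And>n. w n \<in> A" "d \<in> A"
  shows "(\<lambda>n. f (u n) (w n)) \<longlonglongrightarrow> f c d"
proof -
  have "((\<lambda>(c, d). f c d) \<circ> (\<lambda>n. (u n, w n))) \<longlonglongrightarrow> (\<lambda>(c, d). f c d) (c, d)"
    using A lims by (intro f[unfolded continuous_on_sequentially, rule_format]) (auto intro!: tendsto_Pair)
  then show ?thesis by (simp add: comp_def)
qed

lemma continuous_on_seqI2: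
  fixes f :: "real \<Rightarrow> real \<Rightarrow> real"
  assumes "\<And>u w c d. u \<longlonglongrightarrow> c \<Longrightarrow> w \<longlonglongrightarrow> d \<Longrightarrow> (\<And>n. w n \<in> A) \<Longrightarrow> d \<in> A \<Longrightarrow> (\<lambda>n. f (u n) (w n)) \<longlonglongrightarrow> f c d"
  shows "continuous_on (UNIV \<times> A) (\<lambda>(c, d). f c d)"
  unfolding continuous_on_sequentially
proof (intro allI ballI impI, elim conjE)
  fix p :: "nat \<Rightarrow> real \<times> real" and a assume a: "a \<in> UNIV \<times> A" "\<forall>n. p n \<in> UNIV \<times> A" "p \<longlonglongrightarrow> a"
  have "(\<lambda>n. f (fst (p n)) (snd (p n))) \<longlonglongrightarrow> f (fst a) (snd a)"
    using a by (intro assms tendsto_fst tendsto_snd) (auto simp: mem_Times_iff)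
  then show "((\<lambda>(c, d). f c d) \<circ> p) \<longlonglongrightarrow> (\<lambda>(c, d). f c d) a" by (simp add: comp_def case_prod_beta)
qed

lemma abs_pow_nonneg [simp]: "0 \<le> abs_pow \<nu> y" by (simp add: abs_pow_def)

lemma continuous_on_abs_pow: "0 \<le> \<nu> \<Longrightarrow> continuous_on A (abs_pow \<nu>)"
  unfolding abs_pow_def by (cases "\<nu> = 0") (auto intro!: continuous_on_powr' continuous_on_rabs continuous_on_const continuous_on_id)

lemma measurable_abs_pow: "0 \<le> \<nu> \<Longrightarrow> abs_pow \<nu> \<in> borel_measurable borel"
  by (intro borel_measurable_continuous_onI continuous_on_abs_pow)

text \<open>Supplies integrable bounds for demand paths trapped between two others.\<close>

lemma abs_pow_between:
  assumes "0 \<le> \<nu>" "a \<le> y" "y \<le> b" shows "abs_pow \<nu> y \<le> abs_pow \<nu> a + abs_pow \<nu> b"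
proof (cases "\<nu> = 0")
  case False
  consider "\<bar>y\<bar> \<le> \<bar>a\<bar>" | "\<bar>y\<bar> \<le> \<bar>b\<bar>" using assms by linarith
  then show ?thesis
  proof cases
    case 1 then have "\<bar>y\<bar> powr \<nu> \<le> \<bar>a\<bar> powr \<nu>" using assms by (intro powr_mono2) auto
    then show ?thesis using False by (simp add: abs_pow_def add_increasing2)
  next
    case 2 then have "\<bar>y\<bar> powr \<nu> \<le> \<bar>b\<bar> powr \<nu>" using assms by (intro powr_mono2) auto
    then show ?thesis using False by (simp add: abs_pow_def add_increasing)
  qed
qed (simp add: abs_pow_def)

section \<open>Continuous dependence of the demand on time and initial state\<close>

context capacity_problem
begin

abbreviation "Ob \<equiv> demand_space dmin dmax"

lemma open_Ob: "open Ob"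
proof -
  have "Ob = ereal -` {dmin<..<dmax}" by (auto simp: demand_space_def)
  then show ?thesis by (simp add: open_ereal_vimage)
qed

lemma filtration_F: "filtration (space M) (\<lambda>t. F (max 0 t))"
  using filtration unfolding usual_filtration_def by blast

lemma subalg: "0 \<le> t \<Longrightarrow> subalgebra M (F t)"
  using filtration unfolding usual_filtration_def by blast

lemma space_F: "0 \<le> t \<Longrightarrow> space (F t) = space M"
  using subalg unfolding subalgebra_def by blast

lemma F_mono: "0 \<le> s \<Longrightarrow> s \<le> t \<Longrightarrow> sets (F s) \<subseteq> sets (F t)"
  using filtration.sets_F_mono[OF filtration_F, of s t] by (simp add: max_def)

lemma measurable_F_mono: "0 \<le> s \<Longrightarrow> s \<le> t \<Longrightarrow> f \<in> measurable (F s) N \<Longrightarrow> f \<in> measurable (F t) N"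
  using F_mono[of s t] space_F[of s] space_F[of t] unfolding measurable_def by auto

lemma measurable_F: "0 \<le> t \<Longrightarrow> f \<in> measurable (F t) N \<Longrightarrow> f \<in> measurable M N"
  using subalg measurable_from_subalg by blast

lemma D_adapted: "d \<in> Ob \<Longrightarrow> 0 \<le> t \<Longrightarrow> D d t \<in> borel_measurable (F t)"
  using demand_solution unfolding sde_solution_def adapted_def by blast

lemma D_meas: "d \<in> Ob \<Longrightarrow> 0 \<le> t \<Longrightarrow> D d t \<in> borel_measurable M"
  using D_adapted measurable_F by blast

lemma D_cont: "d \<in> Ob \<Longrightarrow> \<omega> \<in> space M \<Longrightarrow> continuous_on {0..} (\<lambda>t. D d t \<omega>)"
  using demand_solution unfolding sde_solution_def by blast

lemma D_in: "d \<in> Ob \<Longrightarrow> \<omega> \<in> space M \<Longrightarrow> 0 \<le> t \<Longrightarrow> D d t \<omega> \<in> Ob"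
  using demand_solution unfolding sde_solution_def by blast

lemma D_0: "d \<in> Ob \<Longrightarrow> AE \<omega> in M. D d 0 \<omega> = d"
  using demand_solution unfolding sde_solution_def by blast

text \<open>Paths are frozen before time \<open>0\<close>, so that they are continuous on the whole line.\<close>

definition X :: "real \<Rightarrow> real \<Rightarrow> 'a \<Rightarrow> real" where "X d t \<omega> = D d (max 0 t) \<omega>"

lemma X_eq: "0 \<le> t \<Longrightarrow> X d t \<omega> = D d t \<omega>" by (simp add: X_def)

lemma X_meas: "d \<in> Ob \<Longrightarrow> X d t \<in> borel_measurable M"
  unfolding X_def by (intro D_meas) auto

lemma X_in: "d \<in> Ob \<Longrightarrow> \<omega> \<in> space M \<Longrightarrow> X d t \<omega> \<in> Ob"
  unfolding X_def by (intro D_in) auto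

lemma X_cont: "d \<in> Ob \<Longrightarrow> \<omega> \<in> space M \<Longrightarrow> continuous_on UNIV (\<lambda>t. X d t \<omega>)"
  unfolding X_def by (rule continuous_on_compose2[OF D_cont]) (auto intro!: continuous_intros)

lemma X_joint: assumes "d \<in> Ob" shows "(\<lambda>(t, \<omega>). X d t \<omega>) \<in> borel_measurable (borel \<Otimes>\<^sub>M M)"
proof (rule measurable_right_continuous_process)
  fix \<omega> t assume "\<omega> \<in> space M"
  from X_cont[OF assms this] show "continuous (at_right t) (\<lambda>t. X d t \<omega>)"
    by (simp add: continuous_on_eq_continuous_at continuous_at_imp_continuous_within)
qed (rule X_meas[OF assms])

text \<open>Stability is assumed for one fixed time only. Monotonicity in the initial state traps
  \<open>X (y i) (s i)\<close> between countably many comparison paths \<open>lo m\<close> and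
  \<open>hi m\<close>; these are continuous in time, and stability is invoked only for them at time
  \<open>t\<close>.\<close>

lemma AE_X_tendsto:
  assumes y: "\<And>i. y i \<in> Ob" "d \<in> Ob" "y \<longlonglongrightarrow> d" and s: "s \<longlonglongrightarrow> t"
  shows "AE \<omega> in M. (\<lambda>i. X (y i) (s i) \<omega>) \<longlonglongrightarrow> X d t \<omega>"
proof -
  obtain e where e: "0 < e" "ball d e \<subseteq> Ob" using open_Ob y(2) open_contains_ball by blast
  define k where "k = (\<lambda>m. e / 2 * inverse (real (Suc m)))"
  define lo where "lo = (\<lambda>m. d - k m)"
  define hi where "hi = (\<lambda>m. d + k m)"
  have small: "k m < e" "0 < k m" for m
  proof -
    have "inverse (real (Suc m)) \<le> 1" by (simp add: inverse_le_1_iff)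
    then have "k m \<le> e / 2 * 1" unfolding k_def using e(1) by (intro mult_left_mono) auto
    then show "k m < e" using e(1) by simp
    show "0 < k m" using e(1) by (simp add: k_def)
  qed
  have lim: "k \<longlonglongrightarrow> 0"
    unfolding k_def using tendsto_mult[OF tendsto_const[of "e / 2"] LIMSEQ_inverse_real_of_nat] by simp
  have lo: "lo m \<in> Ob" "lo m < d" for m using e(2) small[of m] by (auto simp: lo_def dist_real_def subset_eq)
  have hi: "hi m \<in> Ob" "d < hi m" for m using e(2) small[of m] by (auto simp: hi_def dist_real_def subset_eq)
  have "lo \<longlonglongrightarrow> d" "hi \<longlonglongrightarrow> d" unfolding lo_def hi_def
    using tendsto_diff[OF tendsto_const lim, of d] tendsto_add[OF tendsto_const lim, of d] by auto
  then have A1: "AE \<omega> in M. (\<lambda>m. X (lo m) t \<omega>) \<longlonglongrightarrow> X d t \<omega>" "AE \<omega> in M. (\<lambda>m. X (hi m) t \<omega>) \<longlonglongrightarrow> X d t \<omega>"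
    unfolding X_def
    using demand_stable[rule_format, OF y(2), of lo "max 0 t"] demand_stable[rule_format, OF y(2), of hi "max 0 t"] lo(1) hi(1)
    by simp_all
  have A2: "AE \<omega> in M. \<forall>m i. lo m \<le> y i \<longrightarrow> X (lo m) (s i) \<omega> \<le> X (y i) (s i) \<omega>"
    "AE \<omega> in M. \<forall>m i. y i \<le> hi m \<longrightarrow> X (y i) (s i) \<omega> \<le> X (hi m) (s i) \<omega>"
    unfolding AE_all_countable X_def using demand_mono lo(1) hi(1) y(1) by (auto intro!: AE_impI)
  show ?thesis using A1 A2 AE_space
  proof eventually_elim
    case (elim \<omega>)
    have cont: "(\<lambda>i. X a (s i) \<omega>) \<longlonglongrightarrow> X a t \<omega>" if "a \<in> Ob" for a
      using X_cont[OF that elim(5)] s by (auto simp: continuous_on_eq_continuous_at intro: isCont_tendsto_compose)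
    show ?case
    proof (rule order_tendstoI)
      fix a assume "a < X d t \<omega>"
      then obtain m where m: "a < X (lo m) t \<omega>" using order_tendstoD(1)[OF elim(1)] by (auto simp: eventually_sequentially)
      have *: "a < X (y i) (s i) \<omega>" if "a < X (lo m) (s i) \<omega>" "lo m < y i" for i
        using elim(3)[rule_format, of m i] that by simp
      show "eventually (\<lambda>i. a < X (y i) (s i) \<omega>) sequentially"
        using order_tendstoD(1)[OF cont[OF lo(1)] m] order_tendstoD(1)[OF y(3) lo(2)[of m]]
        by eventually_elim (rule *)
    next
      fix a assume "X d t \<omega> < a"
      then obtain m where m: "X (hi m) t \<omega> < a" using order_tendstoD(2)[OF elim(2)] by (auto simp: eventually_sequentially)
      have *: "X (y i) (s i) \<omega> < a" if "X (hi m) (s i) \<omega> < a" "y i < hi m" for i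
        using elim(4)[rule_format, of i m] that by simp
      show "eventually (\<lambda>i. X (y i) (s i) \<omega> < a) sequentially"
        using order_tendstoD(2)[OF cont[OF hi(1)] m] order_tendstoD(2)[OF y(3) hi(2)[of m]]
        by eventually_elim (rule *)
    qed
  qed
qed

section \<open>Transition operators and the Markov property at deterministic times\<close>

definition bounded_cont :: "(real \<Rightarrow> real \<Rightarrow> real) \<Rightarrow> bool" where
  "bounded_cont f \<longleftrightarrow> continuous_on (UNIV \<times> Ob) (\<lambda>(c, d). f c d) \<and> (\<exists>B. \<forall>c. \<forall>d\<in>Ob. \<bar>f c d\<bar> \<le> B)"

lemma comp_X_meas:
  fixes f :: "real \<Rightarrow> real \<Rightarrow> real"
  assumes "continuous_on (UNIV \<times> Ob) (\<lambda>(c, d). f c d)" "d \<in> Ob" "Z \<in> borel_measurable M"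
  shows "(\<lambda>\<omega>. f (Z \<omega>) (X d t \<omega>)) \<in> borel_measurable M"
  by (rule measurable_comp_continuous_on[OF assms(1,3) X_meas[OF assms(2)]]) (rule X_in[OF assms(2)])

lemma expectation_tendsto:
  assumes f: "bounded_cont f" and y: "\<And>i. y i \<in> Ob" "d \<in> Ob" "y \<longlonglongrightarrow> d" and s: "s \<longlonglongrightarrow> t" and u: "u \<longlonglongrightarrow> c"
  shows "(\<lambda>i. LINT \<omega>|M. f (u i) (X (y i) (s i) \<omega>)) \<longlonglongrightarrow> (LINT \<omega>|M. f c (X d t \<omega>))"
proof -
  obtain B where B: "\<And>c d. d \<in> Ob \<Longrightarrow> \<bar>f c d\<bar> \<le> B" and fc: "continuous_on (UNIV \<times> Ob) (\<lambda>(c, d). f c d)"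
    using f unfolding bounded_cont_def by blast
  show ?thesis
  proof (rule integral_dominated_convergence[where w = "\<lambda>_. B"])
    show "AE \<omega> in M. (\<lambda>i. f (u i) (X (y i) (s i) \<omega>)) \<longlonglongrightarrow> f c (X d t \<omega>)"
      using AE_X_tendsto[OF y s] AE_space
      by eventually_elim (intro continuous_on_seqD2[OF fc u] X_in y)
    show "AE \<omega> in M. norm (f (u i) (X (y i) (s i) \<omega>)) \<le> B" for i
      using AE_space by eventually_elim (use B X_in y in auto)
  qed (auto intro!: comp_X_meas[OF fc] y)
qed

lemma integrable_bounded_cont:
  assumes "bounded_cont f" "d \<in> Ob" "Z \<in> borel_measurable M"
  shows "integrable M (\<lambda>\<omega>. f (Z \<omega>) (X d t \<omega>))"
proof -
  obtain B where B: "\<And>c d. d \<in> Ob \<Longrightarrow> \<bar>f c d\<bar> \<le> B" and fc: "continuous_on (UNIV \<times> Ob) (\<lambda>(c, d). f c d)"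
    using assms(1) unfolding bounded_cont_def by blast
  show ?thesis using B X_in assms
    by (intro integrable_const_bound[where B = B] comp_X_meas[OF fc]) auto
qed

lemma markov_global:
  assumes d: "d \<in> Ob" and st: "0 \<le> s" "0 \<le> t" and A: "A \<in> sets (F s)"
    and f: "continuous_on UNIV f" "\<And>y. \<bar>f y\<bar> \<le> (B :: real)"
  shows "(LINT \<omega>:A|M. f (X d (s + t) \<omega>)) = (LINT \<omega>:A|M. (LINT \<omega>'|M. f (X (X d s \<omega>) t \<omega>')))"
proof -
  interpret fl: filtration "space M" "\<lambda>t. F (max 0 t)" by (rule filtration_F)
  have st1: "stopping_time (\<lambda>r. F (max 0 r)) (\<lambda>_. s)" by (rule stopping_time_const)
  have "A \<in> sets (fl.pre_sigma (\<lambda>_. s))"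
  proof (rule fl.sets_pre_sigmaI[OF st1])
    fix t show "{\<omega> \<in> A. s \<le> t} \<in> sets (F (max 0 t))"
      using A F_mono[OF st(1), of "max 0 t"] by (cases "s \<le> t") (auto simp: le_max_iff_disj)
  qed
  moreover have "bounded (range f)" using f(2) by (intro boundedI[of _ B]) auto
  ultimately have "(LINT \<omega>:A|M. f (D d (s + t) \<omega>)) = (LINT \<omega>:A|M. (LINT \<omega>'|M. f (D (D d s \<omega>) t \<omega>')))"
    using demand_regular d st st1 f(1) unfolding regular_diffusion_def strong_markov_family_def by blast
  then show ?thesis using st by (simp add: X_eq)
qed

definition P :: "real \<Rightarrow> (real \<Rightarrow> real \<Rightarrow> real) \<Rightarrow> real \<Rightarrow> real \<Rightarrow> real" where
  "P t f c d = (LINT \<omega>|M. f c (X d t \<omega>))"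

lemma P_bound:
  assumes f: "bounded_cont f" and B: "\<And>c d. d \<in> Ob \<Longrightarrow> \<bar>f c d\<bar> \<le> B" and d: "d \<in> Ob"
  shows "\<bar>P t f c d\<bar> \<le> B"
proof -
  have int: "integrable M (\<lambda>\<omega>. f c (X d t \<omega>))" by (rule integrable_bounded_cont[OF f d]) simp
  have "\<bar>P t f c d\<bar> \<le> (LINT \<omega>|M. \<bar>f c (X d t \<omega>)\<bar>)" unfolding P_def by (rule integral_abs_bound)
  also have "\<dots> \<le> (LINT \<omega>|M. B)" using B X_in[OF d] by (intro integral_mono integrable_abs int) auto
  finally show ?thesis by (simp add: prob_space)
qed

lemma P_bounded_cont: assumes f: "bounded_cont f" shows "bounded_cont (P t f)"
proof -
  obtain B where B: "\<And>c d. d \<in> Ob \<Longrightarrow> \<bar>f c d\<bar> \<le> B" using f unfolding bounded_cont_def by blast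
  have "continuous_on (UNIV \<times> Ob) (\<lambda>(c, d). P t f c d)"
    unfolding P_def by (intro continuous_on_seqI2 expectation_tendsto[OF f]) auto
  then show ?thesis unfolding bounded_cont_def using P_bound[OF f B] by blast
qed

text \<open>Cut-off that vanishes within distance \<open>1 / j\<close> of the complement of
  \<open>Ob\<close> and equals \<open>1\<close> beyond distance \<open>2 / j\<close>. The Markov
  hypothesis is stated for test functions continuous on the whole line, while the functions at hand
  are continuous on \<open>Ob\<close>. The case \<open>Ob = UNIV\<close> is separate because
  \<open>infdist\<close> to the empty set is \<open>0\<close>.\<close>

definition cut :: "nat \<Rightarrow> real \<Rightarrow> real" where
  "cut j y = (if Ob = UNIV then 1 else max 0 (min 1 (real j * infdist y (- Ob) - 1)))"

lemma cut_bounds: "0 \<le> cut j y" "cut j y \<le> 1"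
  by (auto simp: cut_def)

lemma cut_eventually: assumes "y \<in> Ob" shows "eventually (\<lambda>j. cut j y = 1) sequentially"
proof (cases "Ob = UNIV")
  case False
  then have ne: "- Ob \<noteq> {}" by blast
  have "closed (- Ob)" using open_Ob by (simp add: closed_def)
  then have pos: "0 < infdist y (- Ob)" using assms ne by (metis Compl_iff infdist_pos_not_in_closed)
  obtain n where n: "2 < real n * infdist y (- Ob)" using reals_Archimedean3[OF pos] by blast
  have "cut j y = 1" if "n \<le> j" for j
  proof -
    have "real n * infdist y (- Ob) \<le> real j * infdist y (- Ob)" using that pos by (intro mult_right_mono) auto
    then show ?thesis using n False by (simp add: cut_def)
  qed
  then show ?thesis by (auto simp: eventually_sequentially)
qed (simp add: cut_def)

text \<open>Continuity is glued from two open sets: \<open>Ob\<close>, and the region near its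
  complement where the cut-off vanishes.\<close>

lemma cut_times_cont:
  assumes "continuous_on Ob f"
  shows "continuous_on UNIV (\<lambda>y. if y \<in> Ob then cut j y * f y else 0)"
proof (cases "Ob = UNIV")
  case True then show ?thesis using assms by (simp add: cut_def)
next
  case False
  let ?h = "\<lambda>y. if y \<in> Ob then cut j y * f y else 0"
  let ?U = "{y. real j * infdist y (- Ob) < 1}"
  have U: "open ?U" by (intro open_Collect_less continuous_intros)
  have "continuous_on Ob (\<lambda>y. max 0 (min 1 (real j * infdist y (- Ob) - 1)) * f y)"
    using assms by (intro continuous_intros)
  then have 1: "continuous_on Ob ?h" by (rule continuous_on_eq) (simp add: cut_def False)
  have 2: "continuous_on ?U ?h"
    by (rule continuous_on_eq[where f = "\<lambda>_. 0"]) (auto simp: cut_def False)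
  have "Ob \<union> ?U = UNIV" by auto
  then show ?thesis using continuous_on_open_Un[OF open_Ob U 1 2] by simp
qed

text \<open>The property holds for the cut-off functions \<open>h j\<close>, and dominated
  convergence removes the cut-off on both sides.\<close>

lemma markov_event:
  assumes d: "d \<in> Ob" and st: "0 \<le> s" "0 \<le> t" and A: "A \<in> sets (F s)" and f: "bounded_cont f"
  shows "(LINT \<omega>|M. indicator A \<omega> * f c (X d (s + t) \<omega>)) = (LINT \<omega>|M. indicator A \<omega> * P t f c (X d s \<omega>))"
proof -
  obtain B where B: "\<And>c d. d \<in> Ob \<Longrightarrow> \<bar>f c d\<bar> \<le> B" and fc: "continuous_on (UNIV \<times> Ob) (\<lambda>(c, d). f c d)"
    using f unfolding bounded_cont_def by blast
  have B0: "0 \<le> B" using B[OF d, of 0] by simp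
  have [measurable]: "A \<in> sets M" using A subalg[OF st(1)] unfolding subalgebra_def by blast
  have fc1: "continuous_on Ob (f c)"
  proof -
    have "continuous_on Ob (\<lambda>y. (c, y))" by (intro continuous_on_Pair continuous_on_const continuous_on_id)
    from continuous_on_compose2[OF fc this] show ?thesis by auto
  qed
  define h where "h = (\<lambda>j y. if y \<in> Ob then cut j y * f c y else 0)"
  have hc: "continuous_on UNIV (h j)" for j unfolding h_def by (rule cut_times_cont[OF fc1])
  have hB: "\<bar>h j y\<bar> \<le> B" for j y
  proof (cases "y \<in> Ob")
    case True
    have "\<bar>cut j y\<bar> * \<bar>f c y\<bar> \<le> 1 * B" using B[OF True] cut_bounds by (intro mult_mono) auto
    then show ?thesis by (simp add: h_def True abs_mult)
  qed (simp add: h_def B0)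
  have hb: "bounded_cont (\<lambda>_. h j)" for j
  proof -
    have "continuous_on (UNIV \<times> Ob) (\<lambda>p. h j (snd p))"
      by (rule continuous_on_compose2[OF hc]) (auto intro!: continuous_intros)
    then show ?thesis unfolding bounded_cont_def using hB by (auto simp: case_prod_beta)
  qed
  have hlim: "(\<lambda>j. h j y) \<longlonglongrightarrow> f c y" if "y \<in> Ob" for y
  proof (rule tendsto_eventually)
    show "eventually (\<lambda>j. h j y = f c y) sequentially"
      using cut_eventually[OF that] by eventually_elim (simp add: h_def that)
  qed
  have Plim: "(\<lambda>j. P t (\<lambda>_. h j) c y) \<longlonglongrightarrow> P t f c y" if y: "y \<in> Ob" for y
    unfolding P_def
  proof (rule integral_dominated_convergence[where w = "\<lambda>_. B"])
    show "(\<lambda>\<omega>. f c (X y t \<omega>)) \<in> borel_measurable M" by (rule comp_X_meas[OF fc y]) simp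
    show "(\<lambda>\<omega>. h j (X y t \<omega>)) \<in> borel_measurable M" for j
      using comp_X_meas[of "\<lambda>_. h j" y "\<lambda>_. 0"] hb[of j] y unfolding bounded_cont_def by auto
    show "AE \<omega> in M. (\<lambda>j. h j (X y t \<omega>)) \<longlonglongrightarrow> f c (X y t \<omega>)" using hlim X_in[OF y] by auto
  qed (use hB in auto)
  have 1: "(\<lambda>j. LINT \<omega>|M. indicator A \<omega> * h j (X d (s + t) \<omega>)) \<longlonglongrightarrow> (LINT \<omega>|M. indicator A \<omega> * f c (X d (s + t) \<omega>))"
  proof (rule integral_dominated_convergence[where w = "\<lambda>_. B"])
    have "(\<lambda>\<omega>. f c (X d (s + t) \<omega>)) \<in> borel_measurable M" by (rule comp_X_meas[OF fc d]) simp
    then show "(\<lambda>\<omega>. indicator A \<omega> * f c (X d (s + t) \<omega>)) \<in> borel_measurable M" by measurable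
    fix j
    have "(\<lambda>\<omega>. h j (X d (s + t) \<omega>)) \<in> borel_measurable M"
      using comp_X_meas[of "\<lambda>_. h j" d "\<lambda>_. 0"] hb[of j] d unfolding bounded_cont_def by auto
    then show "(\<lambda>\<omega>. indicator A \<omega> * h j (X d (s + t) \<omega>)) \<in> borel_measurable M" by measurable
    show "AE \<omega> in M. norm (indicator A \<omega> * h j (X d (s + t) \<omega>)) \<le> B"
      using hB B0 by (auto simp: indicator_def)
  next
    show "AE \<omega> in M. (\<lambda>j. indicator A \<omega> * h j (X d (s + t) \<omega>)) \<longlonglongrightarrow> indicator A \<omega> * f c (X d (s + t) \<omega>)"
      using hlim X_in[OF d] by (auto intro!: tendsto_mult)
  qed simp
  have 2: "(\<lambda>j. LINT \<omega>|M. indicator A \<omega> * P t (\<lambda>_. h j) c (X d s \<omega>)) \<longlonglongrightarrow> (LINT \<omega>|M. indicator A \<omega> * P t f c (X d s \<omega>))"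
  proof (rule integral_dominated_convergence[where w = "\<lambda>_. B"])
    have "(\<lambda>\<omega>. P t f c (X d s \<omega>)) \<in> borel_measurable M"
      using comp_X_meas[of "P t f" d "\<lambda>_. c"] P_bounded_cont[OF f, of t] d unfolding bounded_cont_def by auto
    then show "(\<lambda>\<omega>. indicator A \<omega> * P t f c (X d s \<omega>)) \<in> borel_measurable M" by measurable
    fix j
    have "(\<lambda>\<omega>. P t (\<lambda>_. h j) c (X d s \<omega>)) \<in> borel_measurable M"
      using comp_X_meas[of "P t (\<lambda>_. h j)" d "\<lambda>_. c"] P_bounded_cont[OF hb, of t j] d unfolding bounded_cont_def by auto
    then show "(\<lambda>\<omega>. indicator A \<omega> * P t (\<lambda>_. h j) c (X d s \<omega>)) \<in> borel_measurable M" by measurable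
    show "AE \<omega> in M. norm (indicator A \<omega> * P t (\<lambda>_. h j) c (X d s \<omega>)) \<le> B"
      using P_bound[OF hb hB X_in[OF d]] B0 by (auto simp: indicator_def)
  next
    show "AE \<omega> in M. (\<lambda>j. indicator A \<omega> * P t (\<lambda>_. h j) c (X d s \<omega>)) \<longlonglongrightarrow> indicator A \<omega> * P t f c (X d s \<omega>)"
      using Plim X_in[OF d] by (auto intro!: tendsto_mult)
  qed simp
  have "(LINT \<omega>|M. indicator A \<omega> * h j (X d (s + t) \<omega>)) = (LINT \<omega>|M. indicator A \<omega> * P t (\<lambda>_. h j) c (X d s \<omega>))" for j
    using markov_global[OF d st A hc hB, of j] by (simp add: set_lebesgue_integral_def P_def)
  with 1 2 show ?thesis using LIMSEQ_unique by auto
qed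

text \<open>A capacity known at time \<open>s\<close> may be treated as a constant. Rounding
  \<open>C\<close> down to multiples of \<open>1 / Suc m\<close> splits the space into finitely many
  events of \<open>F s\<close>, on each of which \<open>markov_event\<close> applies; continuity in
  the first argument removes the rounding.\<close>

lemma markov:
  assumes d: "d \<in> Ob" and st: "0 \<le> s" "0 \<le> t" and f: "bounded_cont f"
    and C: "C \<in> borel_measurable (F s)" "\<And>\<omega>. \<omega> \<in> space M \<Longrightarrow> \<bar>C \<omega>\<bar> \<le> R"
  shows "(LINT \<omega>|M. f (C \<omega>) (X d (s + t) \<omega>)) = (LINT \<omega>|M. P t f (C \<omega>) (X d s \<omega>))"
proof -
  obtain B where B: "\<And>c d. d \<in> Ob \<Longrightarrow> \<bar>f c d\<bar> \<le> B" and fc: "continuous_on (UNIV \<times> Ob) (\<lambda>(c, d). f c d)"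
    using f unfolding bounded_cont_def by blast
  have Pf: "bounded_cont (P t f)" by (rule P_bounded_cont[OF f])
  then have Pc: "continuous_on (UNIV \<times> Ob) (\<lambda>(c, d). P t f c d)" unfolding bounded_cont_def by blast
  have CM: "C \<in> borel_measurable M" using measurable_F[OF st(1) C(1)] .
  define q where "q = (\<lambda>(m::nat) \<omega>. \<lfloor>real (Suc m) * C \<omega>\<rfloor>)"
  define Cm where "Cm = (\<lambda>(m::nat) \<omega>. of_int (q m \<omega>) / real (Suc m))"
  have Cm_meas: "Cm m \<in> borel_measurable M" for m unfolding Cm_def q_def using CM by measurable
  have Cm_lim: "(\<lambda>m. Cm m \<omega>) \<longlonglongrightarrow> C \<omega>" for \<omega>
  proof (rule tendsto_sandwich[OF _ _ _ tendsto_const])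
    have 1: "of_int (q m \<omega>) \<le> real (Suc m) * C \<omega>" "real (Suc m) * C \<omega> - 1 \<le> of_int (q m \<omega>)" for m
      unfolding q_def by linarith+
    have "Cm m \<omega> \<le> (real (Suc m) * C \<omega>) / real (Suc m)" for m
      unfolding Cm_def using 1 by (intro divide_right_mono) auto
    then show "eventually (\<lambda>m. Cm m \<omega> \<le> C \<omega>) sequentially" by (simp del: of_nat_Suc)
    have "(real (Suc m) * C \<omega> - 1) / real (Suc m) \<le> Cm m \<omega>" for m
      unfolding Cm_def using 1 by (intro divide_right_mono) auto
    then have "C \<omega> - inverse (real (Suc m)) \<le> Cm m \<omega>" for m
      by (simp add: diff_divide_distrib inverse_eq_divide del: of_nat_Suc)
    then show "eventually (\<lambda>m. C \<omega> - inverse (real (Suc m)) \<le> Cm m \<omega>) sequentially" by simp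
    show "(\<lambda>m. C \<omega> - inverse (real (Suc m))) \<longlonglongrightarrow> C \<omega>"
      using tendsto_diff[OF tendsto_const[of "C \<omega>"] LIMSEQ_inverse_real_of_nat] by simp
  qed
  have step: "(LINT \<omega>|M. f (Cm m \<omega>) (X d (s + t) \<omega>)) = (LINT \<omega>|M. P t f (Cm m \<omega>) (X d s \<omega>))" for m
  proof -
    define N where "N = \<lceil>real (Suc m) * \<bar>R\<bar>\<rceil> + 1"
    have qN: "q m \<omega> \<in> {-N..N}" if "\<omega> \<in> space M" for \<omega>
    proof -
      have "\<bar>real (Suc m) * C \<omega>\<bar> \<le> real (Suc m) * \<bar>R\<bar>"
        using C(2)[OF that] by (simp add: abs_mult mult_left_mono del: of_nat_Suc)
      then show ?thesis unfolding q_def N_def by (simp del: of_nat_Suc) linarith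
    qed
    define A where "A = (\<lambda>k. {\<omega> \<in> space M. q m \<omega> = k})"
    have A: "A k \<in> sets (F s)" for k
    proof -
      have "{\<omega> \<in> space (F s). q m \<omega> = k} \<in> sets (F s)" unfolding q_def using C(1) by measurable
      then show ?thesis unfolding A_def using space_F[OF st(1)] by simp
    qed
    have AM[measurable]: "A k \<in> sets M" for k using A subalg[OF st(1)] unfolding subalgebra_def by blast
    have dec: "F' (Cm m \<omega>) y = (\<Sum>k\<in>{-N..N}. indicator (A k) \<omega> * F' (of_int k / real (Suc m)) y)"
      if "\<omega> \<in> space M" for F' :: "real \<Rightarrow> real \<Rightarrow> real" and y \<omega>
    proof -
      have "(\<Sum>k\<in>{-N..N}. indicator (A k) \<omega> * F' (of_int k / real (Suc m)) y)
        = (\<Sum>k\<in>{-N..N}. if k = q m \<omega> then F' (of_int k / real (Suc m)) y else 0)"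
        using that by (intro sum.cong) (auto simp: A_def)
      also have "\<dots> = F' (Cm m \<omega>) y" using qN[OF that] by (simp add: Cm_def)
      finally show ?thesis by simp
    qed
    have int1: "integrable M (\<lambda>\<omega>. indicator (A k) \<omega> * F' (of_int k / real (Suc m)) (X d r \<omega>))"
      if "bounded_cont F'" for F' k r
      using integrable_bounded_cont[OF that d, of "\<lambda>_. of_int k / real (Suc m)" r]
      by (intro integrable_mult_indicator[where 'b = real, simplified]) auto
    have "(LINT \<omega>|M. f (Cm m \<omega>) (X d (s + t) \<omega>))
      = (LINT \<omega>|M. (\<Sum>k\<in>{-N..N}. indicator (A k) \<omega> * f (of_int k / real (Suc m)) (X d (s + t) \<omega>)))"
      by (intro Bochner_Integration.integral_cong refl dec)
    also have "\<dots> = (\<Sum>k\<in>{-N..N}. LINT \<omega>|M. indicator (A k) \<omega> * f (of_int k / real (Suc m)) (X d (s + t) \<omega>))"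
      by (intro Bochner_Integration.integral_sum int1 f)
    also have "\<dots> = (\<Sum>k\<in>{-N..N}. LINT \<omega>|M. indicator (A k) \<omega> * P t f (of_int k / real (Suc m)) (X d s \<omega>))"
      by (intro sum.cong refl markov_event d st A f)
    also have "\<dots> = (LINT \<omega>|M. (\<Sum>k\<in>{-N..N}. indicator (A k) \<omega> * P t f (of_int k / real (Suc m)) (X d s \<omega>)))"
      by (intro Bochner_Integration.integral_sum[symmetric] int1 Pf)
    also have "\<dots> = (LINT \<omega>|M. P t f (Cm m \<omega>) (X d s \<omega>))"
      by (intro Bochner_Integration.integral_cong refl dec[symmetric])
    finally show ?thesis .
  qed
  have lim: "(\<lambda>m. LINT \<omega>|M. F' (Cm m \<omega>) (X d r \<omega>)) \<longlonglongrightarrow> (LINT \<omega>|M. F' (C \<omega>) (X d r \<omega>))"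
    if F': "bounded_cont F'" for F' r
  proof -
    obtain B where B: "\<And>c d. d \<in> Ob \<Longrightarrow> \<bar>F' c d\<bar> \<le> B" and fc: "continuous_on (UNIV \<times> Ob) (\<lambda>(c, d). F' c d)"
      using F' unfolding bounded_cont_def by blast
    show ?thesis
    proof (rule integral_dominated_convergence[where w = "\<lambda>_. B"])
      show "AE \<omega> in M. (\<lambda>m. F' (Cm m \<omega>) (X d r \<omega>)) \<longlonglongrightarrow> F' (C \<omega>) (X d r \<omega>)"
        using X_in[OF d] by (auto intro!: continuous_on_seqD2[OF fc Cm_lim])
    qed (use B X_in[OF d] in \<open>auto intro!: comp_X_meas[OF fc d] CM Cm_meas\<close>)
  qed
  show ?thesis using lim[OF f, of "s + t"] lim[OF Pf, of s] LIMSEQ_unique unfolding step by blast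
qed

section \<open>Functions of polynomial growth in the demand\<close>

definition growth :: "(real \<Rightarrow> real \<Rightarrow> real) \<Rightarrow> bool" where
  "growth f \<longleftrightarrow> continuous_on (UNIV \<times> Ob) (\<lambda>(c, d). f c d) \<and>
     (\<forall>R. \<exists>G\<ge>0. \<forall>c d. \<bar>c\<bar> \<le> R \<longrightarrow> d \<in> Ob \<longrightarrow> \<bar>f c d\<bar> \<le> G * (1 + abs_pow \<nu> d))"

lemma growth_cont: "growth f \<Longrightarrow> continuous_on (UNIV \<times> Ob) (\<lambda>(c, d). f c d)"
  by (simp add: growth_def)

lemma growthE:
  assumes "growth f"
  obtains G where "0 \<le> G" "\<And>c d. \<bar>c\<bar> \<le> R \<Longrightarrow> d \<in> Ob \<Longrightarrow> \<bar>f c d\<bar> \<le> G * (1 + abs_pow \<nu> d)"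
  using assms unfolding growth_def by metis

lemma growth_g_gc: "growth g" "growth (partial_c g)"
proof -
  have ex: "\<exists>G\<ge>0. \<forall>c d. \<bar>c\<bar> \<le> R \<longrightarrow> d \<in> Ob \<longrightarrow> \<bar>g c d\<bar> + \<bar>partial_c g c d\<bar> \<le> G * (1 + abs_pow \<nu> d)" for R
  proof -
    have loc: "\<exists>a. \<forall>c. \<bar>c\<bar> \<le> R \<longrightarrow> \<bar>f c\<bar> \<le> a" if "locally_bounded f" for f
    proof -
      have "bounded (f ` {-R..R})" using that compact_Icc unfolding locally_bounded_def by blast
      then obtain a where "\<forall>y\<in>f ` {-R..R}. norm y \<le> a" unfolding bounded_iff by blast
      then show ?thesis by (intro exI[of _ a]) (auto simp: abs_le_iff)
    qed
    obtain a where a: "\<And>c. \<bar>c\<bar> \<le> R \<Longrightarrow> \<bar>\<gamma>0 c\<bar> \<le> a" using loc[OF bounds_local(1)] by blast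
    obtain b where b: "\<And>c. \<bar>c\<bar> \<le> R \<Longrightarrow> \<bar>\<eta>0 c\<bar> \<le> b" using loc[OF bounds_local(2)] by blast
    show ?thesis
    proof (intro exI[of _ "max 0 (max a b)"] conjI allI impI)
      fix c d assume c: "\<bar>c\<bar> \<le> R" and d: "d \<in> Ob"
      have "\<bar>g c d\<bar> + \<bar>partial_c g c d\<bar> \<le> \<gamma>0 c + \<eta>0 c * abs_pow \<nu> d" using g_growth d by blast
      also have "\<dots> \<le> max 0 (max a b) + max 0 (max a b) * abs_pow \<nu> d"
        using a[OF c] b[OF c] by (intro add_mono mult_right_mono) auto
      finally show "\<bar>g c d\<bar> + \<bar>partial_c g c d\<bar> \<le> max 0 (max a b) * (1 + abs_pow \<nu> d)" by (simp add: algebra_simps)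
    qed simp
  qed
  have "\<exists>G\<ge>0. \<forall>c d. \<bar>c\<bar> \<le> R \<longrightarrow> d \<in> Ob \<longrightarrow> \<bar>g c d\<bar> \<le> G * (1 + abs_pow \<nu> d)"
    "\<exists>G\<ge>0. \<forall>c d. \<bar>c\<bar> \<le> R \<longrightarrow> d \<in> Ob \<longrightarrow> \<bar>partial_c g c d\<bar> \<le> G * (1 + abs_pow \<nu> d)" for R
  proof -
    obtain G where G: "0 \<le> G" "\<And>c d. \<bar>c\<bar> \<le> R \<Longrightarrow> d \<in> Ob \<Longrightarrow> \<bar>g c d\<bar> + \<bar>partial_c g c d\<bar> \<le> G * (1 + abs_pow \<nu> d)"
      using ex[of R] by blast
    show "\<exists>G\<ge>0. \<forall>c d. \<bar>c\<bar> \<le> R \<longrightarrow> d \<in> Ob \<longrightarrow> \<bar>g c d\<bar> \<le> G * (1 + abs_pow \<nu> d)"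
      "\<exists>G\<ge>0. \<forall>c d. \<bar>c\<bar> \<le> R \<longrightarrow> d \<in> Ob \<longrightarrow> \<bar>partial_c g c d\<bar> \<le> G * (1 + abs_pow \<nu> d)"
    proof (intro exI[of _ G] conjI allI impI G(1))
      fix c d assume "\<bar>c\<bar> \<le> R" "d \<in> Ob"
      from G(2)[OF this] show "\<bar>g c d\<bar> \<le> G * (1 + abs_pow \<nu> d)" by simp
    next
      show "\<exists>G\<ge>0. \<forall>c d. \<bar>c\<bar> \<le> R \<longrightarrow> d \<in> Ob \<longrightarrow> \<bar>partial_c g c d\<bar> \<le> G * (1 + abs_pow \<nu> d)"
      proof (intro exI[of _ G] conjI allI impI G(1))
        fix c d assume "\<bar>c\<bar> \<le> R" "d \<in> Ob"
        from G(2)[OF this] show "\<bar>partial_c g c d\<bar> \<le> G * (1 + abs_pow \<nu> d)" by simp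
      qed
    qed
  qed
  then show "growth g" "growth (partial_c g)" unfolding growth_def using g_cont g_c_cont by blast+
qed

lemma growth_bounded_cont:
  assumes "bounded_cont f" shows "growth f"
proof -
  obtain B where B: "\<And>c d. d \<in> Ob \<Longrightarrow> \<bar>f c d\<bar> \<le> B" using assms unfolding bounded_cont_def by blast
  have "\<bar>f c d\<bar> \<le> \<bar>B\<bar> * (1 + abs_pow \<nu> d)" if "d \<in> Ob" for c d
  proof -
    have "\<bar>f c d\<bar> \<le> \<bar>B\<bar> * 1" using B[OF that, of c] by simp
    also have "\<dots> \<le> \<bar>B\<bar> * (1 + abs_pow \<nu> d)" by (intro mult_left_mono) auto
    finally show ?thesis .
  qed
  then show ?thesis using assms unfolding growth_def bounded_cont_def by (auto intro!: exI[of _ "\<bar>B\<bar>"])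
qed

definition mom :: "real \<Rightarrow> real \<Rightarrow> real" where "mom d t = 1 + K0 * (1 + abs_pow \<nu> d) * exp (K1 * max 0 t)"

lemma mom_nonneg: "0 \<le> mom d t"
  using K0_nonneg by (simp add: mom_def)

lemma abs_pow_meas: "d \<in> Ob \<Longrightarrow> (\<lambda>\<omega>. abs_pow \<nu> (X d t \<omega>)) \<in> borel_measurable M"
  by (rule measurable_compose[OF X_meas measurable_abs_pow[OF \<nu>_nonneg]])

lemma moment_nn:
  assumes d: "d \<in> Ob"
  shows "(\<integral>\<^sup>+\<omega>. ennreal (1 + abs_pow \<nu> (X d t \<omega>)) \<partial>M) \<le> ennreal (mom d t)"
proof -
  have "(\<integral>\<^sup>+\<omega>. ennreal (1 + abs_pow \<nu> (X d t \<omega>)) \<partial>M) = (\<integral>\<^sup>+\<omega>. 1 + ennreal (abs_pow \<nu> (X d t \<omega>)) \<partial>M)"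
    by (intro nn_integral_cong, subst ennreal_plus) auto
  also have "\<dots> = 1 + (\<integral>\<^sup>+\<omega>. ennreal (abs_pow \<nu> (X d t \<omega>)) \<partial>M)"
    using abs_pow_meas[OF d] by (subst nn_integral_add) (auto simp: emeasure_space_1)
  also have "\<dots> \<le> 1 + ennreal (K0 * (1 + abs_pow \<nu> d) * exp (K1 * max 0 t))"
    using demand_moment[rule_format, OF d, of "max 0 t"] unfolding X_def by (intro add_left_mono) simp
  also have "\<dots> = ennreal (mom d t)"
    unfolding mom_def using K0_nonneg by (subst ennreal_plus) auto
  finally show ?thesis .
qed

lemma moment_integrable:
  assumes d: "d \<in> Ob"
  shows "integrable M (\<lambda>\<omega>. 1 + abs_pow \<nu> (X d t \<omega>))" "(LINT \<omega>|M. 1 + abs_pow \<nu> (X d t \<omega>)) \<le> mom d t"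
proof -
  have m: "(\<lambda>\<omega>. 1 + abs_pow \<nu> (X d t \<omega>)) \<in> borel_measurable M" using abs_pow_meas[OF d] by measurable
  show i: "integrable M (\<lambda>\<omega>. 1 + abs_pow \<nu> (X d t \<omega>))"
    using moment_nn[OF d, of t] m by (intro integrableI_bounded) (auto intro: le_less_trans)
  have "ennreal (LINT \<omega>|M. 1 + abs_pow \<nu> (X d t \<omega>)) \<le> ennreal (mom d t)"
    using moment_nn[OF d, of t] by (subst nn_integral_eq_integral[OF i, symmetric]) auto
  then show "(LINT \<omega>|M. 1 + abs_pow \<nu> (X d t \<omega>)) \<le> mom d t" using mom_nonneg by simp
qed

lemma growth_integrable:
  assumes f: "growth f" and d: "d \<in> Ob" and Z: "Z \<in> borel_measurable M" "\<And>\<omega>. \<omega> \<in> space M \<Longrightarrow> \<bar>Z \<omega>\<bar> \<le> R"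
  shows "integrable M (\<lambda>\<omega>. f (Z \<omega>) (X d t \<omega>))"
proof -
  obtain G where G: "0 \<le> G" "\<And>c d. \<bar>c\<bar> \<le> R \<Longrightarrow> d \<in> Ob \<Longrightarrow> \<bar>f c d\<bar> \<le> G * (1 + abs_pow \<nu> d)"
    using growthE[OF f, of R] by metis
  show ?thesis
  proof (rule Bochner_Integration.integrable_bound)
    show "integrable M (\<lambda>\<omega>. G * (1 + abs_pow \<nu> (X d t \<omega>)))" by (intro integrable_mult_right moment_integrable d)
    show "(\<lambda>\<omega>. f (Z \<omega>) (X d t \<omega>)) \<in> borel_measurable M" by (rule comp_X_meas[OF growth_cont[OF f] d Z(1)])
    show "AE \<omega> in M. norm (f (Z \<omega>) (X d t \<omega>)) \<le> norm (G * (1 + abs_pow \<nu> (X d t \<omega>)))"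
      using G Z(2) X_in[OF d] by (auto simp: abs_mult)
  qed
qed

lemma P_growth_bound:
  assumes f: "growth f" and d: "d \<in> Ob" and G: "0 \<le> G" "\<And>d. d \<in> Ob \<Longrightarrow> \<bar>f c d\<bar> \<le> G * (1 + abs_pow \<nu> d)"
  shows "\<bar>P t f c d\<bar> \<le> G * mom d t"
proof -
  have i: "integrable M (\<lambda>\<omega>. f c (X d t \<omega>))" by (rule growth_integrable[OF f d, where R = "\<bar>c\<bar>"]) auto
  have "\<bar>P t f c d\<bar> \<le> (LINT \<omega>|M. \<bar>f c (X d t \<omega>)\<bar>)" unfolding P_def by (rule integral_abs_bound)
  also have "\<dots> \<le> (LINT \<omega>|M. G * (1 + abs_pow \<nu> (X d t \<omega>)))"
    using G(2) X_in[OF d] by (intro integral_mono integrable_abs i integrable_mult_right moment_integrable d) auto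
  also have "\<dots> \<le> G * mom d t" using moment_integrable[OF d, of t] G(1) by (simp add: mult_left_mono)
  finally show ?thesis .
qed

lemma local_envelope:
  assumes "d \<in> Ob" "\<And>i. y i \<in> Ob" "y \<longlonglongrightarrow> d"
  obtains a b N where "a \<in> Ob" "b \<in> Ob" "\<And>i. N \<le> i \<Longrightarrow> a \<le> y i \<and> y i \<le> b"
proof -
  obtain e where e: "0 < e" "cball d e \<subseteq> Ob" using open_Ob assms(1) open_contains_cball by blast
  obtain N where N: "\<And>i. N \<le> i \<Longrightarrow> dist (y i) d < e" using assms(3) e(1) unfolding lim_sequentially by blast
  show thesis
  proof (rule that[of "d - e" "d + e" N])
    show "d - e \<in> Ob" "d + e \<in> Ob" using e by (auto simp: subset_eq dist_real_def)
    show "d - e \<le> y i \<and> y i \<le> d + e" if "N \<le> i" for i using N[OF that] by (auto simp: dist_real_def abs_less_iff)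
  qed
qed

lemma bounded_seq:
  assumes "u \<longlonglongrightarrow> (c :: real)" obtains R where "\<And>i. \<bar>u i\<bar> \<le> R" "\<bar>c\<bar> \<le> R"
proof -
  have "Bseq u" using assms convergentI convergent_imp_Bseq by blast
  then obtain R where R: "\<And>i. \<bar>u i\<bar> \<le> R" unfolding Bseq_def by auto
  have "\<bar>c\<bar> \<le> R" using R assms by (intro LIMSEQ_le_const2[OF tendsto_rabs]) auto
  with R that show thesis by blast
qed

text \<open>Demand paths from nearby starting points lie between those from \<open>a\<close> and
  \<open>b\<close>, and the moments of these two provide an integrable bound.\<close>

lemma P_growth_tendsto:
  assumes f: "growth f" and y: "\<And>i. y i \<in> Ob" "d \<in> Ob" "y \<longlonglongrightarrow> d" and u: "u \<longlonglongrightarrow> c"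
  shows "(\<lambda>i. P t f (u i) (y i)) \<longlonglongrightarrow> P t f c d"
proof -
  obtain a b N where ab: "a \<in> Ob" "b \<in> Ob" "\<And>i. N \<le> i \<Longrightarrow> a \<le> y i \<and> y i \<le> b"
    using local_envelope[OF y(2,1,3)] by metis
  obtain R where R: "\<And>i. \<bar>u i\<bar> \<le> R" "\<bar>c\<bar> \<le> R" using bounded_seq[OF u] by metis
  obtain G where G: "0 \<le> G" "\<And>c d. \<bar>c\<bar> \<le> R \<Longrightarrow> d \<in> Ob \<Longrightarrow> \<bar>f c d\<bar> \<le> G * (1 + abs_pow \<nu> d)"
    using growthE[OF f, of R] by metis
  let ?w = "\<lambda>\<omega>. G * ((1 + abs_pow \<nu> (X a t \<omega>)) + (1 + abs_pow \<nu> (X b t \<omega>)))"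
  have "(\<lambda>i. P t f (u (i + N)) (y (i + N))) \<longlonglongrightarrow> P t f c d"
    unfolding P_def
  proof (rule integral_dominated_convergence[where w = ?w])
    show "integrable M ?w" by (intro integrable_mult_right Bochner_Integration.integrable_add moment_integrable ab)
    show "(\<lambda>\<omega>. f c (X d t \<omega>)) \<in> borel_measurable M" by (rule comp_X_meas[OF growth_cont[OF f] y(2)]) simp
    show "(\<lambda>\<omega>. f (u (i + N)) (X (y (i + N)) t \<omega>)) \<in> borel_measurable M" for i
      by (rule comp_X_meas[OF growth_cont[OF f] y(1)]) simp
    have uN: "(\<lambda>i. u (i + N)) \<longlonglongrightarrow> c" "(\<lambda>i. y (i + N)) \<longlonglongrightarrow> d" using u y(3) by (auto intro: LIMSEQ_ignore_initial_segment)
    show "AE \<omega> in M. (\<lambda>i. f (u (i + N)) (X (y (i + N)) t \<omega>)) \<longlonglongrightarrow> f c (X d t \<omega>)"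
      using AE_X_tendsto[OF y(1,2) uN(2) tendsto_const[of t]] AE_space
      by eventually_elim (intro continuous_on_seqD2[OF growth_cont[OF f] uN(1)] X_in y)
    fix i
    have yi: "a \<le> y (i + N)" "y (i + N) \<le> b" using ab(3)[of "i + N"] by auto
    have "AE \<omega> in M. X a t \<omega> \<le> X (y (i + N)) t \<omega>" "AE \<omega> in M. X (y (i + N)) t \<omega> \<le> X b t \<omega>"
      unfolding X_def using demand_mono ab(1,2) y(1) yi by auto
    then show "AE \<omega> in M. norm (f (u (i + N)) (X (y (i + N)) t \<omega>)) \<le> ?w \<omega>"
      using AE_space
    proof eventually_elim
      case (elim \<omega>)
      have "\<bar>f (u (i + N)) (X (y (i + N)) t \<omega>)\<bar> \<le> G * (1 + abs_pow \<nu> (X (y (i + N)) t \<omega>))"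
        using R X_in[OF y(1) elim(3)] by (intro G(2)) auto
      also have "\<dots> \<le> ?w \<omega>"
        using abs_pow_between[OF \<nu>_nonneg elim(1,2)] G(1) by (intro mult_left_mono) auto
      finally show ?case by simp
    qed
  qed
  then show ?thesis by (rule LIMSEQ_offset)
qed

section \<open>Discounted integration over one grid cell\<close>

definition K :: "real \<Rightarrow> real measure" where
  "K h = density lborel (\<lambda>u. ennreal (exp (- \<rho> * u)) * indicator {0..<h} u)"

lemma rho_pos: "0 < \<rho>" using discount by simp

lemma sets_K [measurable_cong, simp]: "sets (K h) = sets borel" by (simp add: K_def)

lemma nn_integral_K:
  assumes "\<phi> \<in> borel_measurable borel"
  shows "(\<integral>\<^sup>+u. \<phi> u \<partial>K h) = (\<integral>\<^sup>+u\<in>{0..<h}. ennreal (exp (- \<rho> * u)) * \<phi> u \<partial>lborel)"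
  unfolding K_def using assms by (subst nn_integral_density) (auto intro!: nn_integral_cong simp: mult_ac)

lemma AE_K: "AE u in K h. u \<in> {0..<h}"
  unfolding K_def by (subst AE_density) (auto simp: indicator_def)

lemma finite_measure_K: "finite_measure (K h)"
proof
  have "emeasure (K h) (space (K h)) = (\<integral>\<^sup>+u. 1 \<partial>K h)" by simp
  also have "\<dots> = (\<integral>\<^sup>+u\<in>{0..<h}. ennreal (exp (- \<rho> * u)) * 1 \<partial>lborel)" by (rule nn_integral_K) simp
  also have "\<dots> \<le> (\<integral>\<^sup>+u\<in>{0..<h}. 1 \<partial>lborel)"
    using rho_pos by (intro nn_integral_mono) (auto simp: indicator_def ennreal_le_1 mult_nonneg_nonneg)
  also have "\<dots> < \<infinity>" by (cases "0 \<le> h") auto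
  finally show "emeasure (K h) (space (K h)) \<noteq> \<infinity>" by simp
qed

sublocale K: finite_measure "K h" for h by (rule finite_measure_K)

text \<open>With \<open>f = g\<close> this is the expected discounted running cost over one grid
  cell when the capacity stays at \<open>c\<close>.\<close>

definition L :: "real \<Rightarrow> (real \<Rightarrow> real \<Rightarrow> real) \<Rightarrow> real \<Rightarrow> real \<Rightarrow> real" where
  "L h f c d = (LINT u|K h. P u f c d)"

lemma comp_X_joint:
  fixes f :: "real \<Rightarrow> real \<Rightarrow> real"
  assumes f: "continuous_on (UNIV \<times> Ob) (\<lambda>(c, d). f c d)" and d: "d \<in> Ob"
  shows "(\<lambda>(u, \<omega>). f c (X d u \<omega>)) \<in> borel_measurable (borel \<Otimes>\<^sub>M M)"
proof -
  have "(\<lambda>p. f c (X d (fst p) (snd p))) \<in> borel_measurable (borel \<Otimes>\<^sub>M M)"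
    using X_joint[OF d] X_in[OF d]
    by (intro measurable_comp_continuous_on[OF f, of "\<lambda>_. c"]) (auto simp: case_prod_beta space_pair_measure)
  then show ?thesis by (simp add: case_prod_beta)
qed

lemma P_meas:
  assumes f: "growth f" and d: "d \<in> Ob"
  shows "(\<lambda>u. P u f c d) \<in> borel_measurable borel"
  unfolding P_def by (rule borel_measurable_lebesgue_integral[OF comp_X_joint[OF growth_cont[OF f] d]])

lemma mom_integrable: "integrable (K h) (\<lambda>u. mom d u)"
proof (rule K.integrable_const_bound[where B = "1 + K0 * (1 + abs_pow \<nu> d) * exp (\<bar>K1\<bar> * \<bar>h\<bar>)"])
  show "AE u in K h. norm (mom d u) \<le> 1 + K0 * (1 + abs_pow \<nu> d) * exp (\<bar>K1\<bar> * \<bar>h\<bar>)"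
    using AE_K[of h]
  proof eventually_elim
    case (elim u)
    have "K1 * max 0 u \<le> \<bar>K1\<bar> * \<bar>h\<bar>" using elim by (intro mult_mono) auto
    then have "K0 * (1 + abs_pow \<nu> d) * exp (K1 * max 0 u) \<le> K0 * (1 + abs_pow \<nu> d) * exp (\<bar>K1\<bar> * \<bar>h\<bar>)"
      using K0_nonneg by (intro mult_left_mono) auto
    then show ?case using mom_nonneg[of d u] by (simp add: mom_def)
  qed
qed (auto simp: mom_def)

lemma L_integrable:
  assumes f: "growth f" and d: "d \<in> Ob" shows "integrable (K h) (\<lambda>u. P u f c d)"
proof -
  obtain G where G: "0 \<le> G" "\<And>c' d. \<bar>c'\<bar> \<le> \<bar>c\<bar> \<Longrightarrow> d \<in> Ob \<Longrightarrow> \<bar>f c' d\<bar> \<le> G * (1 + abs_pow \<nu> d)"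
    using growthE[OF f, of "\<bar>c\<bar>"] by metis
  show ?thesis
  proof (rule Bochner_Integration.integrable_bound)
    show "integrable (K h) (\<lambda>u. G * mom d u)" by (intro integrable_mult_right mom_integrable)
    show "(\<lambda>u. P u f c d) \<in> borel_measurable (K h)" using P_meas[OF f d] by simp
    show "AE u in K h. norm (P u f c d) \<le> norm (G * mom d u)"
      using P_growth_bound[OF f d G(1), of c] G mom_nonneg[of d] by (auto simp: abs_mult)
  qed
qed

lemma L_tendsto:
  assumes f: "growth f" and y: "\<And>i. y i \<in> Ob" "d \<in> Ob" "y \<longlonglongrightarrow> d" and u: "u \<longlonglongrightarrow> c"
  shows "(\<lambda>i. L h f (u i) (y i)) \<longlonglongrightarrow> L h f c d"
proof -
  obtain a b N where ab: "a \<in> Ob" "b \<in> Ob" "\<And>i. N \<le> i \<Longrightarrow> a \<le> y i \<and> y i \<le> b"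
    using local_envelope[OF y(2,1,3)] by metis
  obtain R where R: "\<And>i. \<bar>u i\<bar> \<le> R" "\<bar>c\<bar> \<le> R" using bounded_seq[OF u] by metis
  obtain G where G: "0 \<le> G" "\<And>c d. \<bar>c\<bar> \<le> R \<Longrightarrow> d \<in> Ob \<Longrightarrow> \<bar>f c d\<bar> \<le> G * (1 + abs_pow \<nu> d)"
    using growthE[OF f, of R] by metis
  have "(\<lambda>i. L h f (u (i + N)) (y (i + N))) \<longlonglongrightarrow> L h f c d"
    unfolding L_def
  proof (rule integral_dominated_convergence[where w = "\<lambda>s. G * (mom a s + mom b s)"])
    show "integrable (K h) (\<lambda>s. G * (mom a s + mom b s))"
      by (intro integrable_mult_right Bochner_Integration.integrable_add mom_integrable)
    show "(\<lambda>s. P s f c d) \<in> borel_measurable (K h)" using P_meas[OF f y(2)] by simp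
    show "(\<lambda>s. P s f (u (i + N)) (y (i + N))) \<in> borel_measurable (K h)" for i using P_meas[OF f y(1)] by simp
    have uN: "(\<lambda>i. u (i + N)) \<longlonglongrightarrow> c" "(\<lambda>i. y (i + N)) \<longlonglongrightarrow> d" using u y(3) by (auto intro: LIMSEQ_ignore_initial_segment)
    show "AE s in K h. (\<lambda>i. P s f (u (i + N)) (y (i + N))) \<longlonglongrightarrow> P s f c d"
      by (intro AE_I2 P_growth_tendsto[OF f y(1,2) uN(2,1)])
    fix i
    show "AE s in K h. norm (P s f (u (i + N)) (y (i + N))) \<le> G * (mom a s + mom b s)"
    proof (intro AE_I2)
      fix s
      have "\<bar>P s f (u (i + N)) (y (i + N))\<bar> \<le> G * mom (y (i + N)) s"
        using R G by (intro P_growth_bound[OF f y(1) G(1)]) auto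
      also have "\<dots> \<le> G * (mom a s + mom b s)"
      proof (rule mult_left_mono[OF _ G(1)])
        have "abs_pow \<nu> (y (i + N)) \<le> abs_pow \<nu> a + abs_pow \<nu> b"
          using ab(3)[of "i + N"] by (intro abs_pow_between \<nu>_nonneg) auto
        then have "K0 * (1 + abs_pow \<nu> (y (i + N))) * exp (K1 * max 0 s)
          \<le> K0 * ((1 + abs_pow \<nu> a) + (1 + abs_pow \<nu> b)) * exp (K1 * max 0 s)"
          using K0_nonneg by (intro mult_right_mono mult_left_mono) auto
        then show "mom (y (i + N)) s \<le> mom a s + mom b s" by (simp add: mom_def algebra_simps)
      qed
      finally show "norm (P s f (u (i + N)) (y (i + N))) \<le> G * (mom a s + mom b s)" by simp
    qed
  qed
  then show ?thesis by (rule LIMSEQ_offset)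
qed

lemma L_cont: "growth f \<Longrightarrow> continuous_on (UNIV \<times> Ob) (\<lambda>(c, d). L h f c d)"
  by (intro continuous_on_seqI2 L_tendsto)

end

lemma SUP_ennreal_min: assumes "0 \<le> a" shows "(SUP j::nat. ennreal (min a (real j))) = ennreal a"
proof (rule antisym)
  show "(SUP j::nat. ennreal (min a (real j))) \<le> ennreal a" by (intro SUP_least ennreal_leI) simp
  obtain n :: nat where "a \<le> real n" using real_arch_simple by blast
  then show "ennreal a \<le> (SUP j::nat. ennreal (min a (real j)))" by (intro SUP_upper2[of n]) auto
qed

lemma convex_deriv_mono:
  fixes f :: "real \<Rightarrow> real"
  assumes "convex_on UNIV f" "\<And>c. f field_differentiable (at c)" "a \<le> b"
  shows "deriv f a \<le> deriv f b"
proof (cases "a = b")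
  case False
  have D: "(f has_field_derivative deriv f c) (at c)" for c
    using assms(2) DERIV_deriv_iff_field_differentiable by blast
  have "deriv f a * (b - a) \<le> f b - f a" "deriv f b * (a - b) \<le> f a - f b"
    by (intro convex_on_imp_above_tangent[OF assms(1)] D; simp)+
  then have "deriv f a * (b - a) \<le> deriv f b * (b - a)" by (simp add: algebra_simps)
  then show ?thesis using False assms(3) by (simp add: mult_le_cancel_right)
qed simp

context capacity_problem
begin

lemma P_nonneg: "d \<in> Ob \<Longrightarrow> (\<And>d. d \<in> Ob \<Longrightarrow> 0 \<le> f c d) \<Longrightarrow> 0 \<le> P u f c d"
  unfolding P_def using X_in by (intro Bochner_Integration.integral_nonneg) auto

lemma P_nn:
  assumes f: "growth f" and nn: "\<And>d. d \<in> Ob \<Longrightarrow> 0 \<le> f c d" and d: "d \<in> Ob"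
  shows "ennreal (P u f c d) = (\<integral>\<^sup>+\<omega>. ennreal (f c (X d u \<omega>)) \<partial>M)"
  unfolding P_def
  by (intro nn_integral_eq_integral[symmetric] growth_integrable[OF f d, where R = "\<bar>c\<bar>"] AE_I2 nn X_in d) auto

lemma L_nn:
  assumes f: "growth f" and nn: "\<And>d. d \<in> Ob \<Longrightarrow> 0 \<le> f c d" and d: "d \<in> Ob"
  shows "ennreal (L h f c d) = (\<integral>\<^sup>+u. ennreal (P u f c d) \<partial>K h)"
  unfolding L_def by (intro nn_integral_eq_integral[symmetric] L_integrable[OF f d] AE_I2 P_nonneg d nn)

lemma L_nonneg: "d \<in> Ob \<Longrightarrow> (\<And>d. d \<in> Ob \<Longrightarrow> 0 \<le> f c d) \<Longrightarrow> 0 \<le> L h f c d"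
  unfolding L_def by (intro Bochner_Integration.integral_nonneg P_nonneg)

lemma P_joint_measurable:
  assumes f: "bounded_cont f" and d: "d \<in> Ob" and C: "C \<in> borel_measurable M"
  shows "(\<lambda>(u, \<omega>). P u f (C \<omega>) (X d s \<omega>)) \<in> borel_measurable (borel \<Otimes>\<^sub>M M)"
proof (rule measurable_right_continuous_process)
  show "(\<lambda>\<omega>. P u f (C \<omega>) (X d s \<omega>)) \<in> borel_measurable M" for u
  proof (rule comp_X_meas[OF _ d C])
    show "continuous_on (UNIV \<times> Ob) (\<lambda>(c, d). P u f c d)"
      using P_bounded_cont[OF f, of u] unfolding bounded_cont_def by blast
  qed
  fix \<omega> t assume w: "\<omega> \<in> space M"
  have "isCont (\<lambda>u. P u f (C \<omega>) (X d s \<omega>)) t"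
    unfolding continuous_at_sequentially comp_def P_def
    using X_in[OF d w] by (auto intro!: expectation_tendsto[OF f])
  then show "continuous (at_right t) (\<lambda>u. P u f (C \<omega>) (X d s \<omega>))" by (rule continuous_at_imp_continuous_within)
qed

lemma markov_time_bounded:
  assumes d: "d \<in> Ob" and s: "0 \<le> s" and f: "bounded_cont f" and nn: "\<And>c d. d \<in> Ob \<Longrightarrow> 0 \<le> f c d"
    and C: "C \<in> borel_measurable (F s)" "\<And>\<omega>. \<omega> \<in> space M \<Longrightarrow> \<bar>C \<omega>\<bar> \<le> R"
  shows "(\<integral>\<^sup>+\<omega>. ennreal (L h f (C \<omega>) (X d s \<omega>)) \<partial>M)
    = (\<integral>\<^sup>+u. \<integral>\<^sup>+\<omega>. ennreal (f (C \<omega>) (X d (s + u) \<omega>)) \<partial>M \<partial>K h)"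
proof -
  interpret pair_sigma_finite "K h" M ..
  have CM: "C \<in> borel_measurable M" by (rule measurable_F[OF s C(1)])
  have gf: "growth f" by (rule growth_bounded_cont[OF f])
  have "(\<integral>\<^sup>+\<omega>. ennreal (L h f (C \<omega>) (X d s \<omega>)) \<partial>M)
    = (\<integral>\<^sup>+\<omega>. \<integral>\<^sup>+u. ennreal (P u f (C \<omega>) (X d s \<omega>)) \<partial>K h \<partial>M)"
    using X_in[OF d] by (intro nn_integral_cong L_nn[OF gf nn]) auto
  also have "\<dots> = (\<integral>\<^sup>+u. \<integral>\<^sup>+\<omega>. ennreal (P u f (C \<omega>) (X d s \<omega>)) \<partial>M \<partial>K h)"
  proof (rule Fubini')
    have "(\<lambda>p. case p of (u, \<omega>) \<Rightarrow> P u f (C \<omega>) (X d s \<omega>)) \<in> borel_measurable (K h \<Otimes>\<^sub>M M)"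
      using P_joint_measurable[OF f d CM, of s] by (simp cong: measurable_cong_sets sets_pair_measure_cong)
    then have "(\<lambda>p. ennreal (case p of (u, \<omega>) \<Rightarrow> P u f (C \<omega>) (X d s \<omega>))) \<in> borel_measurable (K h \<Otimes>\<^sub>M M)" by measurable
    then show "(\<lambda>(u, \<omega>). ennreal (P u f (C \<omega>) (X d s \<omega>))) \<in> borel_measurable (K h \<Otimes>\<^sub>M M)"
      by (simp add: case_prod_beta)
  qed
  also have "\<dots> = (\<integral>\<^sup>+u. \<integral>\<^sup>+\<omega>. ennreal (f (C \<omega>) (X d (s + u) \<omega>)) \<partial>M \<partial>K h)"
  proof (rule nn_integral_cong_AE)
    show "AE u in K h. (\<integral>\<^sup>+\<omega>. ennreal (P u f (C \<omega>) (X d s \<omega>)) \<partial>M) = (\<integral>\<^sup>+\<omega>. ennreal (f (C \<omega>) (X d (s + u) \<omega>)) \<partial>M)"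
      using AE_K
    proof eventually_elim
      case (elim u)
      have "(\<integral>\<^sup>+\<omega>. ennreal (P u f (C \<omega>) (X d s \<omega>)) \<partial>M) = ennreal (LINT \<omega>|M. P u f (C \<omega>) (X d s \<omega>))"
        using X_in[OF d] nn by (intro nn_integral_eq_integral integrable_bounded_cont[OF P_bounded_cont[OF f] d CM] AE_I2 P_nonneg) auto
      also have "\<dots> = ennreal (LINT \<omega>|M. f (C \<omega>) (X d (s + u) \<omega>))"
        using markov[OF d s _ f C] elim by simp
      also have "\<dots> = (\<integral>\<^sup>+\<omega>. ennreal (f (C \<omega>) (X d (s + u) \<omega>)) \<partial>M)"
        using X_in[OF d] nn by (intro nn_integral_eq_integral[symmetric] integrable_bounded_cont[OF f d CM] AE_I2) auto
      finally show ?case .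
    qed
  qed
  finally show ?thesis .
qed

lemma comp_X_joint2:
  fixes f :: "real \<Rightarrow> real \<Rightarrow> real"
  assumes f: "continuous_on (UNIV \<times> Ob) (\<lambda>(c, d). f c d)" and d: "d \<in> Ob" and C: "C \<in> borel_measurable M"
  shows "(\<lambda>(u, \<omega>). f (C \<omega>) (X d (s + u) \<omega>)) \<in> borel_measurable (borel \<Otimes>\<^sub>M M)"
proof -
  have 1: "(\<lambda>p. (s + fst p, snd p)) \<in> measurable (borel \<Otimes>\<^sub>M M) (borel \<Otimes>\<^sub>M M)" by measurable
  have "(\<lambda>p. X d (s + fst p) (snd p)) \<in> borel_measurable (borel \<Otimes>\<^sub>M M)"
    using measurable_compose[OF 1 X_joint[OF d]] by simp
  then have "(\<lambda>p. f (C (snd p)) (X d (s + fst p) (snd p))) \<in> borel_measurable (borel \<Otimes>\<^sub>M M)"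
    using C X_in[OF d]
    by (intro measurable_comp_continuous_on[OF f, of "\<lambda>p. C (snd p)"]) (auto simp: space_pair_measure)
  then show ?thesis by (simp add: case_prod_beta)
qed

text \<open>\<open>markov\<close> covers bounded functions only; the truncations \<open>fj j\<close>
  increase to \<open>f\<close>, and monotone convergence passes through each integral.\<close>

lemma markov_time:
  assumes d: "d \<in> Ob" and s: "0 \<le> s" and f: "growth f" and nn: "\<And>c d. d \<in> Ob \<Longrightarrow> 0 \<le> f c d"
    and C: "C \<in> borel_measurable (F s)" "\<And>\<omega>. \<omega> \<in> space M \<Longrightarrow> \<bar>C \<omega>\<bar> \<le> R"
  shows "(\<integral>\<^sup>+\<omega>. ennreal (L h f (C \<omega>) (X d s \<omega>)) \<partial>M)
    = (\<integral>\<^sup>+u. \<integral>\<^sup>+\<omega>. ennreal (f (C \<omega>) (X d (s + u) \<omega>)) \<partial>M \<partial>K h)"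
proof -
  have CM: "C \<in> borel_measurable M" by (rule measurable_F[OF s C(1)])
  define fj where "fj = (\<lambda>(j::nat) c d. min (f c d) (real j))"
  have fjc: "continuous_on (UNIV \<times> Ob) (\<lambda>(c, d). fj j c d)" for j
  proof -
    have "continuous_on (UNIV \<times> Ob) (\<lambda>p. min (case p of (c, d) \<Rightarrow> f c d) (real j))"
      by (intro continuous_on_min growth_cont[OF f] continuous_on_const)
    then show ?thesis by (simp add: fj_def case_prod_beta)
  qed
  have fjn: "0 \<le> fj j c d" if "d \<in> Ob" for j c d using nn[OF that] by (simp add: fj_def)
  have fjb: "bounded_cont (fj j)" for j
    unfolding bounded_cont_def using fjc fjn by (auto simp: fj_def intro!: exI[of _ "real j"])
  have SUPf: "(SUP j. ennreal (fj j c y)) = ennreal (f c y)" if "y \<in> Ob" for c y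
    unfolding fj_def by (rule SUP_ennreal_min[OF nn[OF that]])
  have inc: "incseq (\<lambda>j. ennreal (fj j c y))" for c y
    unfolding fj_def incseq_def by (auto intro!: ennreal_leI)
  have PS: "ennreal (P u f c y) = (SUP j. ennreal (P u (fj j) c y))" if y: "y \<in> Ob" for u c y
  proof -
    have m: "(\<lambda>\<omega>. ennreal (fj j c (X y u \<omega>))) \<in> borel_measurable M" for j
      by (rule measurable_compose[OF comp_X_meas[OF fjc y, of "\<lambda>_. c"] measurable_ennreal]) simp
    have "ennreal (P u f c y) = (\<integral>\<^sup>+\<omega>. ennreal (f c (X y u \<omega>)) \<partial>M)" by (rule P_nn[OF f _ y]) (rule nn)
    also have "\<dots> = (\<integral>\<^sup>+\<omega>. (SUP j. ennreal (fj j c (X y u \<omega>))) \<partial>M)"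
      using X_in[OF y] by (intro nn_integral_cong) (simp add: SUPf)
    also have "\<dots> = (SUP j. \<integral>\<^sup>+\<omega>. ennreal (fj j c (X y u \<omega>)) \<partial>M)"
      using inc m by (intro nn_integral_monotone_convergence_SUP) (auto simp: incseq_def le_fun_def)
    also have "\<dots> = (SUP j. ennreal (P u (fj j) c y))"
      by (intro SUP_cong refl P_nn[symmetric] growth_bounded_cont fjb y fjn)
    finally show ?thesis .
  qed
  have Pmono: "P u (fj i) c y \<le> P u (fj j) c y" if "i \<le> j" "y \<in> Ob" for i j u c y
    unfolding P_def by (intro integral_mono integrable_bounded_cont[OF fjb that(2)]) (use that in \<open>auto simp: fj_def\<close>)
  have LS: "ennreal (L h f c y) = (SUP j. ennreal (L h (fj j) c y))" if y: "y \<in> Ob" for c y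
  proof -
    have m: "(\<lambda>u. ennreal (P u (fj j) c y)) \<in> borel_measurable (K h)" for j
      using P_meas[OF growth_bounded_cont[OF fjb] y] by simp
    have "ennreal (L h f c y) = (\<integral>\<^sup>+u. ennreal (P u f c y) \<partial>K h)" by (rule L_nn[OF f _ y]) (rule nn)
    also have "\<dots> = (\<integral>\<^sup>+u. (SUP j. ennreal (P u (fj j) c y)) \<partial>K h)" unfolding PS[OF y] ..
    also have "\<dots> = (SUP j. \<integral>\<^sup>+u. ennreal (P u (fj j) c y) \<partial>K h)"
      using Pmono y m by (intro nn_integral_monotone_convergence_SUP) (auto simp: incseq_def le_fun_def intro!: ennreal_leI)
    also have "\<dots> = (SUP j. ennreal (L h (fj j) c y))"
      by (intro SUP_cong refl L_nn[symmetric] growth_bounded_cont fjb y fjn)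
    finally show ?thesis .
  qed
  have Lmono: "L h (fj i) c y \<le> L h (fj j) c y" if "i \<le> j" "y \<in> Ob" for i j c y
    unfolding L_def by (intro integral_mono L_integrable growth_bounded_cont fjb Pmono that)
  have mL: "(\<lambda>\<omega>. ennreal (L h (fj j) (C \<omega>) (X d s \<omega>))) \<in> borel_measurable M" for j
    by (rule measurable_compose[OF comp_X_meas[OF L_cont[OF growth_bounded_cont[OF fjb]] d CM] measurable_ennreal])
  have mf: "(\<lambda>(u, \<omega>). ennreal (fj j (C \<omega>) (X d (s + u) \<omega>))) \<in> borel_measurable (borel \<Otimes>\<^sub>M M)" for j
    using measurable_compose[OF comp_X_joint2[OF fjc d CM] measurable_ennreal] by (simp add: case_prod_beta)
  have mf1: "(\<lambda>\<omega>. ennreal (fj j (C \<omega>) (X d r \<omega>))) \<in> borel_measurable M" for j r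
    by (rule measurable_compose[OF comp_X_meas[OF fjc d CM] measurable_ennreal])
  have "(\<integral>\<^sup>+\<omega>. ennreal (L h f (C \<omega>) (X d s \<omega>)) \<partial>M) = (\<integral>\<^sup>+\<omega>. (SUP j. ennreal (L h (fj j) (C \<omega>) (X d s \<omega>))) \<partial>M)"
    using X_in[OF d] by (intro nn_integral_cong) (simp add: LS)
  \<comment> \<open>The indicator makes the sequence increasing at every point, since monotonicity
    in \<open>j\<close> is known only for states in \<open>Ob\<close>.\<close>
  also have "\<dots> = (\<integral>\<^sup>+\<omega>. (SUP j. ennreal (L h (fj j) (C \<omega>) (X d s \<omega>)) * indicator (space M) \<omega>) \<partial>M)"
    by (intro nn_integral_cong) simp
  also have "\<dots> = (SUP j. \<integral>\<^sup>+\<omega>. ennreal (L h (fj j) (C \<omega>) (X d s \<omega>)) * indicator (space M) \<omega> \<partial>M)"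
    using Lmono X_in[OF d] mL
    by (intro nn_integral_monotone_convergence_SUP)
       (auto simp: incseq_def le_fun_def indicator_def intro!: ennreal_leI)
  also have "\<dots> = (SUP j. \<integral>\<^sup>+\<omega>. ennreal (L h (fj j) (C \<omega>) (X d s \<omega>)) \<partial>M)"
    by (intro SUP_cong refl nn_integral_cong) simp
  also have "\<dots> = (SUP j. \<integral>\<^sup>+u. \<integral>\<^sup>+\<omega>. ennreal (fj j (C \<omega>) (X d (s + u) \<omega>)) \<partial>M \<partial>K h)"
    by (intro SUP_cong refl markov_time_bounded[OF d s fjb fjn C])
  also have "\<dots> = (\<integral>\<^sup>+u. (SUP j. \<integral>\<^sup>+\<omega>. ennreal (fj j (C \<omega>) (X d (s + u) \<omega>)) \<partial>M) \<partial>K h)"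
  proof (rule nn_integral_monotone_convergence_SUP[symmetric])
    show "incseq (\<lambda>j u. \<integral>\<^sup>+\<omega>. ennreal (fj j (C \<omega>) (X d (s + u) \<omega>)) \<partial>M)"
      unfolding incseq_def le_fun_def using inc by (auto intro!: nn_integral_mono simp: incseq_def)
    show "(\<lambda>u. \<integral>\<^sup>+\<omega>. ennreal (fj j (C \<omega>) (X d (s + u) \<omega>)) \<partial>M) \<in> borel_measurable (K h)" for j
      using borel_measurable_nn_integral[OF mf[of j]] by simp
  qed
  also have "\<dots> = (\<integral>\<^sup>+u. \<integral>\<^sup>+\<omega>. (SUP j. ennreal (fj j (C \<omega>) (X d (s + u) \<omega>))) \<partial>M \<partial>K h)"
    using inc mf1 by (intro nn_integral_cong nn_integral_monotone_convergence_SUP[symmetric]) (auto simp: incseq_def le_fun_def)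
  also have "\<dots> = (\<integral>\<^sup>+u. \<integral>\<^sup>+\<omega>. ennreal (f (C \<omega>) (X d (s + u) \<omega>)) \<partial>M \<partial>K h)"
    using X_in[OF d] by (intro nn_integral_cong) (simp add: SUPf)
  finally show ?thesis .
qed

text \<open>Primitive in the capacity variable, based at \<open>a\<close> and extended by \<open>0\<close> below \<open>a\<close>.\<close>

definition prim :: "real \<Rightarrow> (real \<Rightarrow> real \<Rightarrow> real) \<Rightarrow> real \<Rightarrow> real \<Rightarrow> real" where
  "prim a f c y = (LINT z|lborel. indicator {a..c} z * f z y)"

lemma section_cont:
  fixes f :: "real \<Rightarrow> real \<Rightarrow> real"
  assumes f: "continuous_on (UNIV \<times> Ob) (\<lambda>(c, d). f c d)" and y: "y \<in> Ob" shows "continuous_on UNIV (\<lambda>z. f z y)"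
proof -
  have "continuous_on UNIV (\<lambda>z. (z, y))" by (intro continuous_on_Pair continuous_on_const continuous_on_id)
  from continuous_on_compose2[OF f this] y show ?thesis by auto
qed

lemma prim_integrable:
  fixes f :: "real \<Rightarrow> real \<Rightarrow> real"
  assumes f: "continuous_on (UNIV \<times> Ob) (\<lambda>(c, d). f c d)" and y: "y \<in> Ob"
  shows "integrable lborel (\<lambda>z. indicator {a..b} z * f z y)"
  using borel_integrable_compact[of "{a..b}" "\<lambda>z. f z y"] section_cont[OF f y]
  by (auto intro: continuous_on_subset simp: indicator_def if_distrib cong: if_cong)

lemma prim_diff:
  fixes f :: "real \<Rightarrow> real \<Rightarrow> real"
  assumes f: "continuous_on (UNIV \<times> Ob) (\<lambda>(c, d). f c d)" and y: "y \<in> Ob" and abc: "a \<le> b" "b \<le> c"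
  shows "prim a f c y = prim a f b y + prim b f c y"
proof -
  have "prim a f b y + prim b f c y = (LINT z|lborel. indicator {a..b} z * f z y + indicator {b..c} z * f z y)"
    unfolding prim_def by (intro Bochner_Integration.integral_add[symmetric] prim_integrable[OF f y])
  also have "\<dots> = prim a f c y"
    unfolding prim_def
  proof (rule integral_cong_AE)
    show "AE z in lborel. indicator {a..b} z * f z y + indicator {b..c} z * f z y = indicator {a..c} z * f z y"
      using AE_lborel_singleton[of b] by eventually_elim (use abc in \<open>auto simp: indicator_def\<close>)
  qed (use borel_measurable_integrable[OF prim_integrable[OF f y]] in auto)
  finally show ?thesis by simp
qed

lemma prim_gc: assumes y: "y \<in> Ob" and "a \<le> c" shows "prim a (partial_c g) c y = g c y - g a y"
proof -
  have D: "DERIV (\<lambda>c. g c y) z :> partial_c g z y" for z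
    using g_diff y unfolding partial_c_def by (auto simp: DERIV_deriv_iff_field_differentiable)
  have "isCont (\<lambda>z. partial_c g z y) z" for z
    using section_cont[OF g_c_cont y] by (simp add: continuous_on_eq_continuous_at)
  from integral_FTC_Icc_real[OF assms(2) D this]
  show ?thesis unfolding prim_def by (simp add: mult.commute)
qed

lemma integrable_indicator_const: "integrable lborel (\<lambda>z :: real. indicator {a..b} z * (B :: real))"
  by (intro integrable_mult_left integrable_real_indicator) (auto simp: emeasure_lborel_Icc_eq)

lemma prim_bound:
  fixes f :: "real \<Rightarrow> real \<Rightarrow> real"
  assumes f: "continuous_on (UNIV \<times> Ob) (\<lambda>(c, d). f c d)" and y: "y \<in> Ob"
    and B: "\<And>z. a \<le> z \<Longrightarrow> z \<le> c \<Longrightarrow> \<bar>f z y\<bar> \<le> B" "0 \<le> B"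
  shows "\<bar>prim a f c y\<bar> \<le> \<bar>c - a\<bar> * B"
proof -
  have "\<bar>prim a f c y\<bar> \<le> (LINT z|lborel. \<bar>indicator {a..c} z * f z y\<bar>)" unfolding prim_def by (rule integral_abs_bound)
  also have "\<dots> \<le> (LINT z|lborel. indicator {a..c} z * B)"
    using B by (intro integral_mono integrable_abs prim_integrable[OF f y] integrable_indicator_const) (auto simp: indicator_def)
  also have "\<dots> \<le> \<bar>c - a\<bar> * B" using B(2) by (cases "a \<le> c") auto
  finally show ?thesis .
qed

lemma prim_growth:
  assumes f: "growth f" shows "growth (prim a f)"
  unfolding growth_def
proof (intro conjI allI)
  show "continuous_on (UNIV \<times> Ob) (\<lambda>(c, d). prim a f c d)"
  proof (rule continuous_on_seqI2)
    fix u y :: "nat \<Rightarrow> real" and c d :: real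
    assume u: "u \<longlonglongrightarrow> c" and y: "y \<longlonglongrightarrow> d" "\<And>n. y n \<in> Ob" "d \<in> Ob"
    obtain R where R: "\<And>i. \<bar>u i\<bar> \<le> R" "\<bar>c\<bar> \<le> R" using bounded_seq[OF u] by metis
    define R' where "R' = max R \<bar>a\<bar>"
    obtain G where G: "0 \<le> G" "\<And>c d. \<bar>c\<bar> \<le> R' \<Longrightarrow> d \<in> Ob \<Longrightarrow> \<bar>f c d\<bar> \<le> G * (1 + abs_pow \<nu> d)"
      using growthE[OF f, of R'] by metis
    have "(\<lambda>n. abs_pow \<nu> (y n)) \<longlonglongrightarrow> abs_pow \<nu> d"
      using continuous_on_abs_pow[OF \<nu>_nonneg, of UNIV] y(1) by (auto simp: continuous_on_eq_continuous_at intro: isCont_tendsto_compose)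
    from bounded_seq[OF this] obtain B where B: "\<And>n. abs_pow \<nu> (y n) \<le> B" "0 \<le> B" by (metis abs_le_D1 abs_ge_zero order_trans)
    show "(\<lambda>n. prim a f (u n) (y n)) \<longlonglongrightarrow> prim a f c d"
      unfolding prim_def
    proof (rule integral_dominated_convergence[where w = "\<lambda>z. indicator {-R'..R'} z * (G * (1 + B))"])
      show "integrable lborel (\<lambda>z. indicator {-R'..R'} z * (G * (1 + B)))" by (rule integrable_indicator_const)
      show "(\<lambda>z. indicator {a..c} z * f z d) \<in> borel_measurable lborel"
        using borel_measurable_integrable[OF prim_integrable[OF growth_cont[OF f] y(3)]] by blast
      show "(\<lambda>z. indicator {a..u n} z * f z (y n)) \<in> borel_measurable lborel" for n
        using borel_measurable_integrable[OF prim_integrable[OF growth_cont[OF f] y(2)]] by blast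
      show "AE z in lborel. (\<lambda>n. indicator {a..u n} z * f z (y n)) \<longlonglongrightarrow> indicator {a..c} z * f z d"
        using AE_lborel_singleton[of c]
      proof eventually_elim
        case (elim z)
        have "eventually (\<lambda>n. (indicator {a..u n} z :: real) = indicator {a..c} z) sequentially"
        proof (cases "z < c")
          case True
          from order_tendstoD(1)[OF u this] show ?thesis by eventually_elim (use True in \<open>auto simp: indicator_def\<close>)
        next
          case False
          then have cz: "c < z" using elim by simp
          from order_tendstoD(2)[OF u this] show ?thesis by eventually_elim (use cz in \<open>auto simp: indicator_def\<close>)
        qed
        then have "(\<lambda>n. indicator {a..u n} z :: real) \<longlonglongrightarrow> indicator {a..c} z" by (rule tendsto_eventually)
        then show ?case
          by (intro tendsto_mult continuous_on_seqD2[OF growth_cont[OF f] tendsto_const y(1)] y)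
      qed
      fix n
      show "AE z in lborel. norm (indicator {a..u n} z * f z (y n)) \<le> indicator {-R'..R'} z * (G * (1 + B))"
      proof (intro AE_I2)
        fix z
        show "norm (indicator {a..u n} z * f z (y n)) \<le> indicator {-R'..R'} z * (G * (1 + B))"
        proof (cases "z \<in> {a..u n}")
          case True
          then have z: "\<bar>z\<bar> \<le> R'" using R(1)[of n] by (auto simp: R'_def)
          have "\<bar>f z (y n)\<bar> \<le> G * (1 + abs_pow \<nu> (y n))" by (rule G(2)[OF z y(2)])
          also have "\<dots> \<le> G * (1 + B)" using B G(1) by (intro mult_left_mono) auto
          finally show ?thesis using True z by (simp add: indicator_def abs_le_iff)
        next
          case False
          have "0 \<le> G * (1 + B)" using G(1) B(2) by simp
          then show ?thesis using False by (auto simp: indicator_def)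
        qed
      qed
    qed
  qed
  fix R
  obtain G where G: "0 \<le> G" "\<And>c d. \<bar>c\<bar> \<le> max R \<bar>a\<bar> \<Longrightarrow> d \<in> Ob \<Longrightarrow> \<bar>f c d\<bar> \<le> G * (1 + abs_pow \<nu> d)"
    using growthE[OF f, of "max R \<bar>a\<bar>"] by metis
  show "\<exists>G\<ge>0. \<forall>c d. \<bar>c\<bar> \<le> R \<longrightarrow> d \<in> Ob \<longrightarrow> \<bar>prim a f c d\<bar> \<le> G * (1 + abs_pow \<nu> d)"
  proof (intro exI[of _ "(\<bar>R\<bar> + \<bar>a\<bar>) * G"] conjI allI impI)
    fix c d assume c: "\<bar>c\<bar> \<le> R" and d: "d \<in> Ob"
    have "\<bar>prim a f c d\<bar> \<le> \<bar>c - a\<bar> * (G * (1 + abs_pow \<nu> d))"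
      using c d G by (intro prim_bound[OF growth_cont[OF f] d]) auto
    also have "\<dots> \<le> (\<bar>R\<bar> + \<bar>a\<bar>) * (G * (1 + abs_pow \<nu> d))" using c G(1) by (intro mult_right_mono) auto
    finally show "\<bar>prim a f c d\<bar> \<le> (\<bar>R\<bar> + \<bar>a\<bar>) * G * (1 + abs_pow \<nu> d)" by (simp add: mult.assoc)
  qed (use G in simp)
qed

text \<open>Fubini: integrating over levels commutes with the transition operator. This turns the
  recursion for the derivative into a recursion for costs.\<close>

lemma prim_P:
  assumes f: "growth f" and d: "d \<in> Ob"
  shows "prim a (P u f) c d = P u (prim a f) c d"
proof -
  interpret pair_sigma_finite lborel M ..
  obtain G where G: "0 \<le> G" "\<And>z d. \<bar>z\<bar> \<le> max \<bar>a\<bar> \<bar>c\<bar> \<Longrightarrow> d \<in> Ob \<Longrightarrow> \<bar>f z d\<bar> \<le> G * (1 + abs_pow \<nu> d)"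
    using growthE[OF f, of "max \<bar>a\<bar> \<bar>c\<bar>"] by metis
  have Gz: "\<bar>f z d\<bar> \<le> G * (1 + abs_pow \<nu> d)" if "z \<in> {a..c}" "d \<in> Ob" for z d
    using G(2)[of z d] that by auto
  let ?f = "\<lambda>(z, \<omega>). indicator {a..c} z * f z (X d u \<omega>)"
  have m: "?f \<in> borel_measurable (lborel \<Otimes>\<^sub>M M)"
  proof -
    have "(\<lambda>p. f (fst p) (X d u (snd p))) \<in> borel_measurable (lborel \<Otimes>\<^sub>M M)"
      using X_in[OF d] measurable_compose[OF measurable_snd X_meas[OF d]]
      by (intro measurable_comp_continuous_on[OF growth_cont[OF f]]) (auto simp: space_pair_measure)
    then have "(\<lambda>p. indicator {a..c} (fst p) * f (fst p) (X d u (snd p))) \<in> borel_measurable (lborel \<Otimes>\<^sub>M M)" by measurable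
    then show ?thesis by (simp add: case_prod_beta)
  qed
  have i: "integrable M (\<lambda>\<omega>. f z (X d u \<omega>))" for z by (rule growth_integrable[OF f d, where R = "\<bar>z\<bar>"]) auto
  have "integrable (lborel \<Otimes>\<^sub>M M) ?f"
  proof (rule Fubini_integrable[OF m])
    show "AE z in lborel. integrable M (\<lambda>\<omega>. ?f (z, \<omega>))" by (auto intro!: i)
    show "integrable lborel (\<lambda>z. LINT \<omega>|M. norm (?f (z, \<omega>)))"
    proof (rule Bochner_Integration.integrable_bound)
      show "integrable lborel (\<lambda>z. indicator {a..c} z * (G * mom d u))" by (rule integrable_indicator_const)
      show "(\<lambda>z. LINT \<omega>|M. norm (?f (z, \<omega>))) \<in> borel_measurable lborel"
      proof (rule sigma_finite_measure.borel_measurable_lebesgue_integral)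
        show "sigma_finite_measure M" ..
        show "(\<lambda>(z, \<omega>). norm (?f (z, \<omega>))) \<in> borel_measurable (lborel \<Otimes>\<^sub>M M)"
          using measurable_compose[OF m borel_measurable_norm] by (simp add: case_prod_beta)
      qed
      show "AE z in lborel. norm (LINT \<omega>|M. norm (?f (z, \<omega>))) \<le> norm (indicator {a..c} z * (G * mom d u))"
      proof (intro AE_I2)
        fix z
        show "norm (LINT \<omega>|M. norm (?f (z, \<omega>))) \<le> norm (indicator {a..c} z * (G * mom d u))"
        proof (cases "z \<in> {a..c}")
          case True
          have "(LINT \<omega>|M. \<bar>f z (X d u \<omega>)\<bar>) \<le> (LINT \<omega>|M. G * (1 + abs_pow \<nu> (X d u \<omega>)))"
            using Gz[OF True] X_in[OF d] by (intro integral_mono integrable_abs i integrable_mult_right moment_integrable d) auto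
          also have "\<dots> \<le> G * mom d u" using moment_integrable[OF d, of u] G(1) by (simp add: mult_left_mono)
          finally show ?thesis using True G(1) mom_nonneg[of d u] by simp
        qed simp
      qed
    qed
  qed
  from Fubini_integral[OF this] show ?thesis unfolding prim_def P_def by simp
qed

lemma P_joint_measurable2:
  assumes f: "growth f" and d: "d \<in> Ob"
  shows "(\<lambda>p. P (snd p) f (fst p) d) \<in> borel_measurable (lborel \<Otimes>\<^sub>M borel)"
proof -
  have 1: "(\<lambda>(p, \<omega>). f (fst p) (X d (snd p) \<omega>)) \<in> borel_measurable ((lborel \<Otimes>\<^sub>M borel) \<Otimes>\<^sub>M M)"
  proof -
    have "(\<lambda>q. (snd (fst q), snd q)) \<in> measurable ((lborel \<Otimes>\<^sub>M borel) \<Otimes>\<^sub>M M) (borel \<Otimes>\<^sub>M M)" by measurable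
    from measurable_compose[OF this X_joint[OF d]]
    have "(\<lambda>q. X d (snd (fst q)) (snd q)) \<in> borel_measurable ((lborel \<Otimes>\<^sub>M borel) \<Otimes>\<^sub>M M)" by simp
    then have "(\<lambda>q. f (fst (fst q)) (X d (snd (fst q)) (snd q))) \<in> borel_measurable ((lborel \<Otimes>\<^sub>M borel) \<Otimes>\<^sub>M M)"
      using X_in[OF d]
      by (intro measurable_comp_continuous_on[OF growth_cont[OF f]]) (auto simp: space_pair_measure)
    then show ?thesis by (simp add: case_prod_beta)
  qed
  show ?thesis
    using borel_measurable_lebesgue_integral[OF 1] unfolding P_def .
qed

lemma prim_L:
  assumes f: "growth f" and d: "d \<in> Ob"
  shows "prim a (L h f) c d = L h (prim a f) c d"
proof -
  interpret pair_sigma_finite lborel "K h" ..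
  obtain G where G: "0 \<le> G" "\<And>z d. \<bar>z\<bar> \<le> max \<bar>a\<bar> \<bar>c\<bar> \<Longrightarrow> d \<in> Ob \<Longrightarrow> \<bar>f z d\<bar> \<le> G * (1 + abs_pow \<nu> d)"
    using growthE[OF f, of "max \<bar>a\<bar> \<bar>c\<bar>"] by metis
  have Gz: "\<bar>P u f z d\<bar> \<le> G * mom d u" if "z \<in> {a..c}" for z u
    using that G by (intro P_growth_bound[OF f d]) auto
  let ?f = "\<lambda>(z, u). indicator {a..c} z * P u f z d"
  have m: "?f \<in> borel_measurable (lborel \<Otimes>\<^sub>M K h)"
  proof -
    have "(\<lambda>p. P (snd p) f (fst p) d) \<in> borel_measurable (lborel \<Otimes>\<^sub>M borel)" by (rule P_joint_measurable2[OF f d])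
    then have "(\<lambda>p. indicator {a..c} (fst p) * P (snd p) f (fst p) d) \<in> borel_measurable (lborel \<Otimes>\<^sub>M borel)" by measurable
    then show ?thesis by (simp add: case_prod_beta cong: measurable_cong_sets sets_pair_measure_cong)
  qed
  have "integrable (lborel \<Otimes>\<^sub>M K h) ?f"
  proof (rule Fubini_integrable[OF m])
    show "AE z in lborel. integrable (K h) (\<lambda>u. ?f (z, u))" by (auto intro!: L_integrable[OF f d])
    show "integrable lborel (\<lambda>z. LINT u|K h. norm (?f (z, u)))"
    proof (rule Bochner_Integration.integrable_bound)
      show "integrable lborel (\<lambda>z. indicator {a..c} z * (LINT u|K h. G * mom d u))" by (rule integrable_indicator_const)
      show "(\<lambda>z. LINT u|K h. norm (?f (z, u))) \<in> borel_measurable lborel"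
      proof (rule sigma_finite_measure.borel_measurable_lebesgue_integral)
        show "sigma_finite_measure (K h)" ..
        show "(\<lambda>(z, u). norm (?f (z, u))) \<in> borel_measurable (lborel \<Otimes>\<^sub>M K h)"
          using measurable_compose[OF m borel_measurable_norm] by (simp add: case_prod_beta)
      qed
      show "AE z in lborel. norm (LINT u|K h. norm (?f (z, u))) \<le> norm (indicator {a..c} z * (LINT u|K h. G * mom d u))"
      proof (intro AE_I2)
        fix z
        show "norm (LINT u|K h. norm (?f (z, u))) \<le> norm (indicator {a..c} z * (LINT u|K h. G * mom d u))"
        proof (cases "z \<in> {a..c}")
          case True
          have "(LINT u|K h. \<bar>P u f z d\<bar>) \<le> (LINT u|K h. G * mom d u)"
            using Gz[OF True] by (intro integral_mono integrable_abs L_integrable[OF f d] integrable_mult_right mom_integrable) auto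
          then show ?thesis using True by simp
        qed simp
      qed
    qed
  qed
  from Fubini_integral[OF this]
  have "prim a (L h f) c d = (LINT u|K h. prim a (P u f) c d)" unfolding prim_def L_def by simp
  then show ?thesis unfolding prim_P[OF f d] L_def .
qed

section \<open>The derivative of the discretised value function\<close>

definition qb :: real where "qb = max q0p q0m"

lemma qb_pos: "0 < qb" using q0p_pos by (simp add: qb_def)

lemma P_mono_c:
  assumes f: "growth f" and d: "d \<in> Ob" and le: "\<And>d. d \<in> Ob \<Longrightarrow> f z d \<le> f z' d"
  shows "P t f z d \<le> P t f z' d"
  unfolding P_def
  by (intro integral_mono growth_integrable[OF f d, where R = "max \<bar>z\<bar> \<bar>z'\<bar>"] le X_in[OF d]) auto

lemma P_anti_d:
  assumes f: "growth f" and d: "d \<in> Ob" "d' \<in> Ob" "d \<le> d'"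
    and le: "\<And>d d'. d \<in> Ob \<Longrightarrow> d' \<in> Ob \<Longrightarrow> d \<le> d' \<Longrightarrow> f z d' \<le> f z d"
  shows "P t f z d' \<le> P t f z d"
  unfolding P_def
proof (intro integral_mono_AE growth_integrable[OF f, where R = "\<bar>z\<bar>"] d)
  have "AE \<omega> in M. X d t \<omega> \<le> X d' t \<omega>" unfolding X_def using demand_mono d by auto
  then show "AE \<omega> in M. f z (X d' t \<omega>) \<le> f z (X d t \<omega>)"
    using AE_space by eventually_elim (intro le X_in d)
qed auto

lemma L_mono_c:
  assumes f: "growth f" and d: "d \<in> Ob" and le: "\<And>d. d \<in> Ob \<Longrightarrow> f z d \<le> f z' d"
  shows "L h f z d \<le> L h f z' d"
  unfolding L_def by (intro integral_mono L_integrable[OF f d] P_mono_c[OF f d] le)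

lemma L_anti_d:
  assumes f: "growth f" and d: "d \<in> Ob" "d' \<in> Ob" "d \<le> d'"
    and le: "\<And>d d'. d \<in> Ob \<Longrightarrow> d' \<in> Ob \<Longrightarrow> d \<le> d' \<Longrightarrow> f z d' \<le> f z d"
  shows "L h f z d' \<le> L h f z d"
  unfolding L_def by (intro integral_mono L_integrable[OF f] d P_anti_d[OF f d] le)

lemma gc_mono: "d \<in> Ob \<Longrightarrow> z \<le> z' \<Longrightarrow> partial_c g z d \<le> partial_c g z' d"
  unfolding partial_c_def using g_convex g_diff by (intro convex_deriv_mono) auto

lemma gc_anti: "d \<in> Ob \<Longrightarrow> d' \<in> Ob \<Longrightarrow> d \<le> d' \<Longrightarrow> partial_c g z d' \<le> partial_c g z d"
  using g_c_antimono by (auto simp: monotone_on_def)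

text \<open>Marginal value of capacity when no adjustment is made at the current grid time.\<close>

definition CV :: "real \<Rightarrow> (real \<Rightarrow> real \<Rightarrow> real) \<Rightarrow> real \<Rightarrow> real \<Rightarrow> real" where
  "CV h v z d = L h (partial_c g) z d + exp (- \<rho> * h) * P h v z d"

text \<open>A unit can always be added at cost \<open>q0p\<close> or removed at cost
  \<open>q0m\<close>, which confines the marginal value to the interval between \<open>- q0p\<close>
  and \<open>q0m\<close>; the clamp expresses the optimal choice at a single level.\<close>

definition Bell :: "real \<Rightarrow> (real \<Rightarrow> real \<Rightarrow> real) \<Rightarrow> real \<Rightarrow> real \<Rightarrow> real" where
  "Bell h v z d = max (- q0p) (min q0m (CV h v z d))"

text \<open>
  \<open>game h\<close> is the derivative in the capacity of the value of the problem in which the capacity may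
  only be changed at multiples of \<open>h\<close>; it is the value of a Dynkin game in discrete time.
\<close>

primrec iter :: "real \<Rightarrow> nat \<Rightarrow> real \<Rightarrow> real \<Rightarrow> real" where
  "iter h 0 = (\<lambda>_ _. 0)"
| "iter h (Suc n) = Bell h (iter h n)"

definition game :: "real \<Rightarrow> real \<Rightarrow> real \<Rightarrow> real" where
  "game h z d = (\<Sum>i. iter h (Suc i) z d - iter h i z d)"

lemma Bell_bounds: "- q0p \<le> Bell h v z d" "Bell h v z d \<le> q0m"
  using q0p_pos q0m_pos by (auto simp: Bell_def)

lemma iter_bound: "\<bar>iter h n z d\<bar> \<le> qb"
proof (cases n)
  case 0 then show ?thesis using qb_pos by simp
next
  case (Suc m) then show ?thesis using Bell_bounds[of h "iter h m" z d] by (auto simp: qb_def abs_le_iff)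
qed

lemma CV_cont: "bounded_cont v \<Longrightarrow> continuous_on (UNIV \<times> Ob) (\<lambda>(z, d). CV h v z d)"
  using L_cont[OF growth_g_gc(2), of h] P_bounded_cont[of v h] unfolding CV_def bounded_cont_def
  by (auto simp: case_prod_beta intro!: continuous_intros)

lemma Bell_bounded_cont: assumes "bounded_cont v" shows "bounded_cont (Bell h v)"
  unfolding bounded_cont_def
proof (intro conjI exI allI ballI)
  have "continuous_on (UNIV \<times> Ob) (\<lambda>p. max (- q0p) (min q0m (case p of (z, d) \<Rightarrow> CV h v z d)))"
    by (intro continuous_on_max continuous_on_min continuous_on_const CV_cont assms)
  then show "continuous_on (UNIV \<times> Ob) (\<lambda>(z, d). Bell h v z d)" by (simp add: Bell_def case_prod_beta)
  show "\<bar>Bell h v z d\<bar> \<le> qb" for z d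
    using Bell_bounds[of h v z d] by (auto simp: qb_def abs_le_iff)
qed

lemma iter_bounded_cont: "bounded_cont (iter h n)"
proof (induction n)
  case 0 show ?case by (auto simp: bounded_cont_def case_prod_beta)
next
  case (Suc n) then show ?case by (simp add: Bell_bounded_cont)
qed

text \<open>Convexity of \<open>g\<close> in the capacity propagates through the recursion.\<close>

lemma iter_mono: "d \<in> Ob \<Longrightarrow> z \<le> z' \<Longrightarrow> iter h n z d \<le> iter h n z' d"
proof (induction n arbitrary: d)
  case (Suc n)
  have "CV h (iter h n) z d \<le> CV h (iter h n) z' d" unfolding CV_def
    using Suc by (intro add_mono mult_left_mono L_mono_c growth_g_gc P_mono_c growth_bounded_cont iter_bounded_cont gc_mono) auto
  then show ?case by (auto simp: Bell_def)
qed simp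

text \<open>Two facts are combined at each step: the marginal running cost is nonincreasing in the
  demand, and demand paths with ordered starting points stay ordered.\<close>

lemma iter_anti: "d \<in> Ob \<Longrightarrow> d' \<in> Ob \<Longrightarrow> d \<le> d' \<Longrightarrow> iter h n z d' \<le> iter h n z d"
proof (induction n arbitrary: d d')
  case (Suc n)
  have "CV h (iter h n) z d' \<le> CV h (iter h n) z d" unfolding CV_def
    using Suc by (intro add_mono mult_left_mono L_anti_d growth_g_gc P_anti_d growth_bounded_cont iter_bounded_cont gc_anti) auto
  then show ?case by (auto simp: Bell_def)
qed simp

lemma Bell_contract:
  assumes v: "bounded_cont v" "bounded_cont w" and B: "\<And>z d. d \<in> Ob \<Longrightarrow> \<bar>v z d - w z d\<bar> \<le> B" and d: "d \<in> Ob"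
  shows "\<bar>Bell h v z d - Bell h w z d\<bar> \<le> exp (- \<rho> * h) * B"
proof -
  have iv: "integrable M (\<lambda>\<omega>. v z (X d h \<omega>))" "integrable M (\<lambda>\<omega>. w z (X d h \<omega>))"
    using integrable_bounded_cont[OF v(1) d, of "\<lambda>_. z"] integrable_bounded_cont[OF v(2) d, of "\<lambda>_. z"] by auto
  have "\<bar>P h v z d - P h w z d\<bar> = \<bar>LINT \<omega>|M. v z (X d h \<omega>) - w z (X d h \<omega>)\<bar>"
    unfolding P_def using iv by simp
  also have "\<dots> \<le> (LINT \<omega>|M. \<bar>v z (X d h \<omega>) - w z (X d h \<omega>)\<bar>)" by (rule integral_abs_bound)
  also have "\<dots> \<le> (LINT \<omega>|M. B)"
    using B X_in[OF d] iv by (intro integral_mono integrable_abs Bochner_Integration.integrable_diff) auto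
  finally have "\<bar>P h v z d - P h w z d\<bar> \<le> B" by (simp add: prob_space)
  then have "exp (- \<rho> * h) * \<bar>P h v z d - P h w z d\<bar> \<le> exp (- \<rho> * h) * B" by (intro mult_left_mono) auto
  then have "\<bar>CV h v z d - CV h w z d\<bar> \<le> exp (- \<rho> * h) * B"
    unfolding CV_def by (simp add: abs_mult flip: right_diff_distrib)
  then show ?thesis unfolding Bell_def by linarith
qed

lemma iter_step:
  "d \<in> Ob \<Longrightarrow> \<bar>iter h (Suc n) z d - iter h n z d\<bar> \<le> qb * exp (- \<rho> * h) ^ n"
proof (induction n arbitrary: z d)
  case 0 then show ?case using iter_bound[of h 1 z d] by simp
next
  case (Suc n)
  have "\<bar>Bell h (iter h (Suc n)) z d - Bell h (iter h n) z d\<bar> \<le> exp (- \<rho> * h) * (qb * exp (- \<rho> * h) ^ n)"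
    by (rule Bell_contract[OF iter_bounded_cont iter_bounded_cont Suc.IH Suc.prems])
  then show ?case by (simp add: mult_ac)
qed

context
  fixes h :: real assumes h: "0 < h"
begin

lemma r_less_1: "exp (- \<rho> * h) < 1" "0 < exp (- \<rho> * h)" using h rho_pos by auto

lemma iter_uniform: "uniform_limit (UNIV \<times> Ob) (\<lambda>n p. iter h n (fst p) (snd p)) (\<lambda>p. game h (fst p) (snd p)) sequentially"
proof -
  \<comment> \<open>The telescoping series defining \<open>game h\<close> is dominated by a
    geometric series; the resulting uniform convergence preserves continuity in both
    variables.\<close>
  have sm: "summable (\<lambda>n. qb * exp (- \<rho> * h) ^ n)"
    using r_less_1 by (intro summable_mult summable_geometric) auto
  have "uniform_limit (UNIV \<times> Ob)
    (\<lambda>n p. \<Sum>i<n. iter h (Suc i) (fst p) (snd p) - iter h i (fst p) (snd p))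
    (\<lambda>p. \<Sum>i. iter h (Suc i) (fst p) (snd p) - iter h i (fst p) (snd p)) sequentially"
  proof (rule Weierstrass_m_test[OF _ sm])
    fix n and p :: "real \<times> real" assume "p \<in> UNIV \<times> Ob"
    then have "snd p \<in> Ob" by auto
    from iter_step[OF this] show "norm (iter h (Suc n) (fst p) (snd p) - iter h n (fst p) (snd p)) \<le> qb * exp (- \<rho> * h) ^ n"
      unfolding real_norm_def .
  qed
  moreover have "(\<Sum>i<n. iter h (Suc i) z d - iter h i z d) = iter h n z d" for n z d
    by (subst sum_lessThan_telescope) simp
  ultimately show ?thesis unfolding game_def by simp
qed

lemma iter_tendsto: "d \<in> Ob \<Longrightarrow> (\<lambda>n. iter h n z d) \<longlonglongrightarrow> game h z d"
  using tendsto_uniform_limitI[OF iter_uniform, of "(z, d)"] by simp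

lemma game_bound: "d \<in> Ob \<Longrightarrow> \<bar>game h z d\<bar> \<le> qb"
  using iter_bound by (intro LIMSEQ_le_const2[OF tendsto_rabs[OF iter_tendsto]]) auto

lemma game_bounded_cont: "bounded_cont (game h)"
proof -
  have "continuous_on (UNIV \<times> Ob) (\<lambda>p. game h (fst p) (snd p))"
  proof (rule uniform_limit_theorem[OF _ iter_uniform])
    show "\<forall>\<^sub>F n in sequentially. continuous_on (UNIV \<times> Ob) (\<lambda>p. iter h n (fst p) (snd p))"
      using iter_bounded_cont[of h] unfolding bounded_cont_def by (simp add: case_prod_beta)
  qed simp
  then show ?thesis unfolding bounded_cont_def using game_bound by (auto simp: case_prod_beta)
qed

lemma game_mono: "d \<in> Ob \<Longrightarrow> z \<le> z' \<Longrightarrow> game h z d \<le> game h z' d"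
  using iter_mono by (intro LIMSEQ_le[OF iter_tendsto iter_tendsto]) auto

lemma game_anti: "d \<in> Ob \<Longrightarrow> d' \<in> Ob \<Longrightarrow> d \<le> d' \<Longrightarrow> game h z d' \<le> game h z d"
  using iter_anti by (intro LIMSEQ_le[OF iter_tendsto iter_tendsto]) auto

lemma game_eq: assumes d: "d \<in> Ob" shows "game h z d = max (- q0p) (min q0m (CV h (game h) z d))"
proof -
  have "(\<lambda>n. P h (iter h n) z d) \<longlonglongrightarrow> P h (game h) z d" unfolding P_def
  proof (rule integral_dominated_convergence[where w = "\<lambda>_. qb"])
    show "AE \<omega> in M. (\<lambda>n. iter h n z (X d h \<omega>)) \<longlonglongrightarrow> game h z (X d h \<omega>)"
      by (intro AE_I2 iter_tendsto X_in d)
    show "(\<lambda>\<omega>. game h z (X d h \<omega>)) \<in> borel_measurable M"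
      using comp_X_meas[of "game h" d "\<lambda>_. z"] game_bounded_cont d unfolding bounded_cont_def by auto
    show "(\<lambda>\<omega>. iter h n z (X d h \<omega>)) \<in> borel_measurable M" for n
      using comp_X_meas[of "iter h n" d "\<lambda>_. z"] iter_bounded_cont[of h n] d unfolding bounded_cont_def by auto
  qed (use iter_bound in auto)
  then have "(\<lambda>n. iter h (Suc n) z d) \<longlonglongrightarrow> max (- q0p) (min q0m (CV h (game h) z d))"
    unfolding iter.simps Bell_def CV_def by (intro tendsto_intros)
  from LIMSEQ_unique[OF this LIMSEQ_Suc[OF iter_tendsto[OF d]]] show ?thesis by simp
qed

lemma game_bounds: "d \<in> Ob \<Longrightarrow> - q0p \<le> game h z d" "d \<in> Ob \<Longrightarrow> game h z d \<le> q0m"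
  using game_eq[of d z] q0p_pos q0m_pos by auto

lemma game_cont: "continuous_on (UNIV \<times> Ob) (\<lambda>(c, d). game h c d)"
  using game_bounded_cont by (simp add: bounded_cont_def)

lemma prim_nonneg:
  assumes f: "continuous_on (UNIV \<times> Ob) (\<lambda>(c, d). f c d)" and y: "y \<in> Ob"
    and nn: "\<And>z. a < z \<Longrightarrow> z < b \<Longrightarrow> (0 :: real) \<le> f z y"
  shows "0 \<le> prim a f b y"
  unfolding prim_def
proof (rule integral_nonneg_AE)
  show "AE z in lborel. 0 \<le> indicator {a..b} z * f z y"
    using AE_lborel_singleton[of a] AE_lborel_singleton[of b]
    by eventually_elim (use nn in \<open>auto simp: indicator_def\<close>)
qed

lemma prim_le:
  assumes f: "continuous_on (UNIV \<times> Ob) (\<lambda>(c, d). f c d)" and y: "y \<in> Ob" and ab: "a \<le> b"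
    and le: "\<And>z. a < z \<Longrightarrow> z < b \<Longrightarrow> f z y \<le> (B :: real)"
  shows "prim a f b y \<le> B * (b - a)"
proof -
  have "prim a f b y \<le> (LINT z|lborel. indicator {a..b} z * B)"
    unfolding prim_def
  proof (rule integral_mono_AE[OF prim_integrable[OF f y] integrable_indicator_const])
    show "AE z in lborel. indicator {a..b} z * f z y \<le> indicator {a..b} z * B"
      using AE_lborel_singleton[of a] AE_lborel_singleton[of b]
      by eventually_elim (use le in \<open>auto simp: indicator_def\<close>)
  qed
  then show ?thesis using ab by (simp add: mult.commute)
qed

lemma prim_ge:
  assumes f: "continuous_on (UNIV \<times> Ob) (\<lambda>(c, d). f c d)" and y: "y \<in> Ob" and ab: "a \<le> b"
    and le: "\<And>z. a < z \<Longrightarrow> z < b \<Longrightarrow> (B :: real) \<le> f z y"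
  shows "B * (b - a) \<le> prim a f b y"
proof -
  have "(LINT z|lborel. indicator {a..b} z * B) \<le> prim a f b y"
    unfolding prim_def
  proof (rule integral_mono_AE[OF integrable_indicator_const prim_integrable[OF f y]])
    show "AE z in lborel. indicator {a..b} z * B \<le> indicator {a..b} z * f z y"
      using AE_lborel_singleton[of a] AE_lborel_singleton[of b]
      by eventually_elim (use le in \<open>auto simp: indicator_def\<close>)
  qed
  then show ?thesis using ab by (simp add: mult.commute)
qed

text \<open>Candidate for the discrete value, up to a function of the demand alone. Clamping the
  capacity makes it bounded, so that \<open>markov\<close> applies; controls with values between
  \<open>- R\<close> and \<open>R\<close> do not notice the clamp.\<close>

definition Psi :: "real \<Rightarrow> real \<Rightarrow> real \<Rightarrow> real" where
  "Psi R c y = prim (- R) (game h) (max (- R) (min R c)) y"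

text \<open>
  Up to terms that do not depend on the control, the cost of a grid control is a sum of \<open>gain\<close> and of jump
  terms; \<open>Psi\<close> telescopes. Among all levels, those between the two thresholds minimise \<open>gain\<close>.
\<close>

definition gain :: "real \<Rightarrow> real \<Rightarrow> real \<Rightarrow> real" where
  "gain R c y = prim (- R) (\<lambda>z y. CV h (game h) z y - game h z y) c y"

lemma gain_cont: "continuous_on (UNIV \<times> Ob) (\<lambda>(z, y). CV h (game h) z y - game h z y)"
proof -
  have "continuous_on (UNIV \<times> Ob) (\<lambda>p. (case p of (z, y) \<Rightarrow> CV h (game h) z y) - (case p of (z, y) \<Rightarrow> game h z y))"
    by (intro continuous_on_diff CV_cont game_bounded_cont game_cont)
  then show ?thesis by (simp add: case_prod_beta)
qed

lemma Psi_bound: assumes "y \<in> Ob" "0 \<le> R" shows "\<bar>Psi R c y\<bar> \<le> 2 * R * qb"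
proof -
  have "\<bar>Psi R c y\<bar> \<le> \<bar>max (- R) (min R c) - (- R)\<bar> * qb"
    unfolding Psi_def using qb_pos game_bound assms by (intro prim_bound[OF game_cont]) auto
  also have "\<dots> \<le> 2 * R * qb" using qb_pos assms by (intro mult_right_mono) auto
  finally show ?thesis .
qed

lemma Psi_bounded_cont: assumes "0 \<le> R" shows "bounded_cont (Psi R)"
proof -
  have "continuous_on (UNIV \<times> Ob) (\<lambda>p. case (max (- R) (min R (fst p)), snd p) of (c, d) \<Rightarrow> prim (- R) (game h) c d)"
    by (rule continuous_on_compose2[OF growth_cont[OF prim_growth[OF growth_bounded_cont[OF game_bounded_cont]]]])
       (auto intro!: continuous_intros)
  then show ?thesis unfolding bounded_cont_def Psi_def[symmetric] using Psi_bound assms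
    by (auto simp: case_prod_beta Psi_def[symmetric])
qed

lemma Psi_diff:
  assumes "y \<in> Ob" "- R \<le> a" "a \<le> b" "b \<le> R"
  shows "Psi R b y - Psi R a y = prim a (game h) b y"
proof -
  have "max (- R) (min R q) = q" if "- R \<le> q" "q \<le> R" for q :: real using that by (simp add: min_def max_def)
  then show ?thesis using prim_diff[OF game_cont assms(1), of "- R" a b] assms by (simp add: Psi_def)
qed

text \<open>Integration over the levels from \<open>- R\<close> to \<open>c\<close>: the marginal
  running cost integrates to a difference of running costs, and the continuation term becomes the
  discounted expectation of \<open>Psi h R\<close>, by \<open>prim_L\<close>, \<open>prim_P\<close>
  and the fundamental theorem of calculus.\<close>

lemma gain_eq:
  assumes y: "y \<in> Ob" and c: "\<bar>c\<bar> \<le> R"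
  shows "gain R c y = L h g c y - L h g (- R) y + exp (- \<rho> * h) * P h (Psi R) c y - Psi R c y"
proof -
  have gc: "growth (partial_c g)" and gg: "growth g" by (rule growth_g_gc)+
  have gw: "growth (game h)" by (rule growth_bounded_cont[OF game_bounded_cont])
  have Rc: "- R \<le> c" "c \<le> R" using c by auto
  have i1: "integrable lborel (\<lambda>z. indicator {-R..c} z * L h (partial_c g) z y)"
    by (rule prim_integrable[OF L_cont[OF gc] y])
  have i2: "integrable lborel (\<lambda>z. indicator {-R..c} z * P h (game h) z y)"
    using P_bounded_cont[OF game_bounded_cont] y unfolding bounded_cont_def by (intro prim_integrable) auto
  have i3: "integrable lborel (\<lambda>z. indicator {-R..c} z * game h z y)" by (rule prim_integrable[OF game_cont y])
  have "gain R c y = (LINT z|lborel. indicator {-R..c} z * L h (partial_c g) z y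
      + exp (- \<rho> * h) * (indicator {-R..c} z * P h (game h) z y) - indicator {-R..c} z * game h z y)"
    unfolding gain_def prim_def CV_def by (intro Bochner_Integration.integral_cong) (auto simp: algebra_simps)
  also have "\<dots> = prim (- R) (L h (partial_c g)) c y + exp (- \<rho> * h) * prim (- R) (P h (game h)) c y - prim (- R) (game h) c y"
    unfolding prim_def using i1 i2 i3 by simp
  also have "prim (- R) (P h (game h)) c y = P h (prim (- R) (game h)) c y" by (rule prim_P[OF gw y])
  also have "P h (prim (- R) (game h)) c y = P h (Psi R) c y"
    unfolding P_def Psi_def using Rc by (simp add: min_def max_def)
  also have "prim (- R) (game h) c y = Psi R c y" unfolding Psi_def using Rc by (simp add: min_def max_def)
  also have "prim (- R) (L h (partial_c g)) c y = L h (prim (- R) (partial_c g)) c y" by (rule prim_L[OF gc y])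
  also have "\<dots> = (LINT u|K h. P u g c y - P u g (- R) y)"
    unfolding L_def
  proof (intro Bochner_Integration.integral_cong refl)
    fix u
    have "P u (prim (- R) (partial_c g)) c y = (LINT \<omega>|M. g c (X y u \<omega>) - g (- R) (X y u \<omega>))"
      unfolding P_def using Rc X_in[OF y] by (intro Bochner_Integration.integral_cong prim_gc) auto
    also have "\<dots> = P u g c y - P u g (- R) y"
      unfolding P_def by (intro Bochner_Integration.integral_diff growth_integrable[OF gg y, where R = R]) (use Rc in auto)
    finally show "P u (prim (- R) (partial_c g)) c y = P u g c y - P u g (- R) y" .
  qed
  also have "\<dots> = L h g c y - L h g (- R) y"
    unfolding L_def by (intro Bochner_Integration.integral_diff L_integrable[OF gg y])
  finally show ?thesis .
qed

end

section \<open>Verification on the time grid\<close>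

definition qc :: "real \<Rightarrow> real" where "qc x = q0p * max 0 x + q0m * max 0 (- x)"

lemma qc_nonneg: "0 \<le> qc x" using q0p_pos q0m_pos by (simp add: qc_def)

lemma qc_le: "qc x \<le> qb * \<bar>x\<bar>"
proof (cases "0 \<le> x")
  case True
  then have "qc x = q0p * x" by (simp add: qc_def)
  also have "\<dots> \<le> qb * x" using True by (intro mult_right_mono) (auto simp: qb_def)
  finally show ?thesis using True by simp
next
  case False
  then have "qc x = q0m * (- x)" by (simp add: qc_def)
  also have "\<dots> \<le> qb * (- x)" using False by (intro mult_right_mono) (auto simp: qb_def)
  finally show ?thesis using False by simp
qed

lemma qc_meas [measurable]: "qc \<in> borel_measurable borel" unfolding qc_def by measurable

definition prev :: "real \<Rightarrow> (nat \<Rightarrow> 'a \<Rightarrow> real) \<Rightarrow> nat \<Rightarrow> 'a \<Rightarrow> real" where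
  "prev c C k \<omega> = (case k of 0 \<Rightarrow> c | Suc j \<Rightarrow> C j \<omega>)"

definition grid_control :: "real \<Rightarrow> real \<Rightarrow> (nat \<Rightarrow> 'a \<Rightarrow> real) \<Rightarrow> bool" where
  "grid_control h R C \<longleftrightarrow> (\<forall>k. C k \<in> borel_measurable (F (real k * h))) \<and> (\<forall>k. \<forall>\<omega>\<in>space M. \<bar>C k \<omega>\<bar> \<le> R)"

definition grid_cost :: "real \<Rightarrow> real \<Rightarrow> real \<Rightarrow> (nat \<Rightarrow> 'a \<Rightarrow> real) \<Rightarrow> nat \<Rightarrow> real" where
  "grid_cost h d c C N = (\<Sum>k<N. exp (- \<rho> * h) ^ k *
     ((LINT \<omega>|M. L h g (C k \<omega>) (X d (real k * h) \<omega>)) + (LINT \<omega>|M. qc (C k \<omega> - prev c C k \<omega>))))"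

lemma growth_L: assumes f: "growth f" shows "growth (L h f)"
  unfolding growth_def
proof (intro conjI allI L_cont[OF f])
  fix R
  obtain G where G: "0 \<le> G" "\<And>c d. \<bar>c\<bar> \<le> R \<Longrightarrow> d \<in> Ob \<Longrightarrow> \<bar>f c d\<bar> \<le> G * (1 + abs_pow \<nu> d)"
    using growthE[OF f, of R] by metis
  \<comment> \<open>On one grid cell the moment bound \<open>mom d u\<close> is at most
    \<open>e * (1 + abs_pow \<nu> d)\<close>.\<close>
  define e where "e = 1 + K0 * exp (\<bar>K1\<bar> * \<bar>h\<bar>)"
  have e0: "0 \<le> e" using K0_nonneg by (simp add: e_def)
  let ?m = "measure (K h) (space (K h))"
  show "\<exists>G\<ge>0. \<forall>c d. \<bar>c\<bar> \<le> R \<longrightarrow> d \<in> Ob \<longrightarrow> \<bar>L h f c d\<bar> \<le> G * (1 + abs_pow \<nu> d)"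
  proof (intro exI[of _ "?m * G * e"] conjI allI impI)
    show "0 \<le> ?m * G * e" using G e0 by simp
    fix c d assume c: "\<bar>c\<bar> \<le> R" and d: "d \<in> Ob"
    have "\<bar>L h f c d\<bar> \<le> (LINT u|K h. \<bar>P u f c d\<bar>)" unfolding L_def by (rule integral_abs_bound)
    also have "\<dots> \<le> (LINT u|K h. G * (e * (1 + abs_pow \<nu> d)))"
    proof (intro integral_mono_AE integrable_abs L_integrable[OF f d])
      show "AE u in K h. \<bar>P u f c d\<bar> \<le> G * (e * (1 + abs_pow \<nu> d))"
        using AE_K
      proof eventually_elim
        case (elim u)
        have "\<bar>P u f c d\<bar> \<le> G * mom d u" using G c by (intro P_growth_bound[OF f d]) auto
        also have "\<dots> \<le> G * (e * (1 + abs_pow \<nu> d))"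
        proof (rule mult_left_mono[OF _ G(1)])
          have "K1 * max 0 u \<le> \<bar>K1\<bar> * \<bar>h\<bar>" using elim by (intro mult_mono) auto
          then have "K0 * (1 + abs_pow \<nu> d) * exp (K1 * max 0 u) \<le> K0 * (1 + abs_pow \<nu> d) * exp (\<bar>K1\<bar> * \<bar>h\<bar>)"
            using K0_nonneg by (intro mult_left_mono) auto
          moreover have "0 \<le> abs_pow \<nu> d" by simp
          moreover have "e * (1 + abs_pow \<nu> d) = 1 + abs_pow \<nu> d + K0 * (1 + abs_pow \<nu> d) * exp (\<bar>K1\<bar> * \<bar>h\<bar>)"
            by (simp add: e_def algebra_simps)
          ultimately show "mom d u \<le> e * (1 + abs_pow \<nu> d)" unfolding mom_def by linarith
        qed
        finally show ?case .
      qed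
    qed simp
    also have "\<dots> = ?m * G * e * (1 + abs_pow \<nu> d)" by (simp add: mult.assoc)
    finally show "\<bar>L h f c d\<bar> \<le> ?m * G * e * (1 + abs_pow \<nu> d)" .
  qed
qed

context
  fixes h :: real assumes h: "0 < h"
begin

lemma grid_meas: "grid_control h R C \<Longrightarrow> C k \<in> borel_measurable M"
  using measurable_F[of "real k * h" "C k"] h by (auto simp: grid_control_def)

lemma grid_bound: "grid_control h R C \<Longrightarrow> \<omega> \<in> space M \<Longrightarrow> \<bar>C k \<omega>\<bar> \<le> R"
  by (auto simp: grid_control_def)

lemma prev_meas: "grid_control h R C \<Longrightarrow> prev c C k \<in> borel_measurable M"
  using grid_meas unfolding prev_def by (cases k) auto

lemma prev_bound: "grid_control h R C \<Longrightarrow> \<bar>c\<bar> \<le> R \<Longrightarrow> \<omega> \<in> space M \<Longrightarrow> \<bar>prev c C k \<omega>\<bar> \<le> R"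
  using grid_bound unfolding prev_def by (cases k) auto

lemma qc_integrable:
  assumes C: "grid_control h R C" and c: "\<bar>c\<bar> \<le> R"
  shows "integrable M (\<lambda>\<omega>. qc (C k \<omega> - prev c C k \<omega>))"
proof (rule integrable_const_bound[where B = "qb * (2 * R)"])
  show "(\<lambda>\<omega>. qc (C k \<omega> - prev c C k \<omega>)) \<in> borel_measurable M"
    using grid_meas[OF C, of k] prev_meas[OF C, of c k] by measurable
  show "AE \<omega> in M. norm (qc (C k \<omega> - prev c C k \<omega>)) \<le> qb * (2 * R)"
  proof (intro AE_I2)
    fix \<omega> assume w: "\<omega> \<in> space M"
    have "qc (C k \<omega> - prev c C k \<omega>) \<le> qb * \<bar>C k \<omega> - prev c C k \<omega>\<bar>" by (rule qc_le)
    also have "\<dots> \<le> qb * (2 * R)"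
      using grid_bound[OF C w, of k] prev_bound[OF C c w, of k] qb_pos by (intro mult_left_mono) auto
    finally show "norm (qc (C k \<omega> - prev c C k \<omega>)) \<le> qb * (2 * R)" using qc_nonneg by simp
  qed
qed

text \<open>\<open>gain_eq\<close> is substituted at each step. \<open>markov\<close> identifies the
  expectation of \<open>P h (Psi h R)\<close> at step \<open>k\<close> with that of
  \<open>Psi h R\<close> at step \<open>k + 1\<close> before the next jump, so the discounted terms
  telescope.\<close>

lemma grid_cost_identity:
  assumes C: "grid_control h R C" and c: "\<bar>c\<bar> \<le> R" and d: "d \<in> Ob"
  shows "grid_cost h d c C N =
    (\<Sum>k<N. exp (- \<rho> * h) ^ k * ((LINT \<omega>|M. L h g (- R) (X d (real k * h) \<omega>))
      + (LINT \<omega>|M. gain h R (C k \<omega>) (X d (real k * h) \<omega>)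
          + (Psi h R (C k \<omega>) (X d (real k * h) \<omega>) - Psi h R (prev c C k \<omega>) (X d (real k * h) \<omega>)
             + qc (C k \<omega> - prev c C k \<omega>)))))
    + Psi h R c d - exp (- \<rho> * h) ^ N * (LINT \<omega>|M. Psi h R (prev c C N \<omega>) (X d (real N * h) \<omega>))"
proof (induction N)
  case 0
  have "(LINT \<omega>|M. Psi h R c (X d 0 \<omega>)) = (LINT \<omega>|M. Psi h R c d)"
  proof (rule integral_cong_AE)
    have R: "0 \<le> R" using c by linarith
    show "(\<lambda>\<omega>. Psi h R c (X d 0 \<omega>)) \<in> borel_measurable M"
      using integrable_bounded_cont[OF Psi_bounded_cont[OF h R] d, of "\<lambda>_. c" 0] by auto
    show "AE \<omega> in M. Psi h R c (X d 0 \<omega>) = Psi h R c d"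
      using D_0[OF d] by eventually_elim (simp add: X_def)
  qed simp
  then show ?case by (simp add: grid_cost_def prev_def prob_space)
next
  case (Suc N)
  let ?X = "\<lambda>k \<omega>. X d (real k * h) \<omega>" and ?r = "exp (- \<rho> * h)"
  have R: "0 \<le> R" using c by linarith
  have Pb: "bounded_cont (Psi h R)" by (rule Psi_bounded_cont[OF h R])
  have CM: "C N \<in> borel_measurable M" and pM: "prev c C N \<in> borel_measurable M"
    using grid_meas[OF C] prev_meas[OF C] by auto
  have iL: "integrable M (\<lambda>\<omega>. L h g (C N \<omega>) (?X N \<omega>))"
    by (rule growth_integrable[OF growth_L[OF growth_g_gc(1)] d CM grid_bound[OF C]])
  have iL0: "integrable M (\<lambda>\<omega>. L h g (- R) (?X N \<omega>))"
    by (rule growth_integrable[OF growth_L[OF growth_g_gc(1)] d, where R = "R"]) (use R in auto)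
  have iPP: "integrable M (\<lambda>\<omega>. P h (Psi h R) (C N \<omega>) (?X N \<omega>))"
    by (rule integrable_bounded_cont[OF P_bounded_cont[OF Pb] d CM])
  have iP: "integrable M (\<lambda>\<omega>. Psi h R (C N \<omega>) (?X N \<omega>))" by (rule integrable_bounded_cont[OF Pb d CM])
  have iPp: "integrable M (\<lambda>\<omega>. Psi h R (prev c C N \<omega>) (?X N \<omega>))" by (rule integrable_bounded_cont[OF Pb d pM])
  have iq: "integrable M (\<lambda>\<omega>. qc (C N \<omega> - prev c C N \<omega>))" by (rule qc_integrable[OF C c])
  have "(LINT \<omega>|M. gain h R (C N \<omega>) (?X N \<omega>)
          + (Psi h R (C N \<omega>) (?X N \<omega>) - Psi h R (prev c C N \<omega>) (?X N \<omega>) + qc (C N \<omega> - prev c C N \<omega>)))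
    = (LINT \<omega>|M. (L h g (C N \<omega>) (?X N \<omega>) - L h g (- R) (?X N \<omega>) + ?r * P h (Psi h R) (C N \<omega>) (?X N \<omega>))
        - Psi h R (prev c C N \<omega>) (?X N \<omega>) + qc (C N \<omega> - prev c C N \<omega>))"
    by (intro Bochner_Integration.integral_cong refl) (simp add: gain_eq[OF h X_in[OF d] grid_bound[OF C]])
  also have "\<dots> = (LINT \<omega>|M. L h g (C N \<omega>) (?X N \<omega>)) - (LINT \<omega>|M. L h g (- R) (?X N \<omega>))
      + ?r * (LINT \<omega>|M. P h (Psi h R) (C N \<omega>) (?X N \<omega>)) - (LINT \<omega>|M. Psi h R (prev c C N \<omega>) (?X N \<omega>))
      + (LINT \<omega>|M. qc (C N \<omega> - prev c C N \<omega>))"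
    using iL iL0 iPP iPp iq by simp
  also have "(LINT \<omega>|M. P h (Psi h R) (C N \<omega>) (?X N \<omega>)) = (LINT \<omega>|M. Psi h R (prev c C (Suc N) \<omega>) (?X (Suc N) \<omega>))"
  proof -
    have "C N \<in> borel_measurable (F (real N * h))" using C by (simp add: grid_control_def)
    from markov[OF d _ _ Pb this grid_bound[OF C]] h show ?thesis by (simp add: prev_def algebra_simps)
  qed
  finally have Suc_eq: "(LINT \<omega>|M. gain h R (C N \<omega>) (?X N \<omega>)
          + (Psi h R (C N \<omega>) (?X N \<omega>) - Psi h R (prev c C N \<omega>) (?X N \<omega>) + qc (C N \<omega> - prev c C N \<omega>)))
    = (LINT \<omega>|M. L h g (C N \<omega>) (?X N \<omega>)) - (LINT \<omega>|M. L h g (- R) (?X N \<omega>))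
      + ?r * (LINT \<omega>|M. Psi h R (prev c C (Suc N) \<omega>) (?X (Suc N) \<omega>)) - (LINT \<omega>|M. Psi h R (prev c C N \<omega>) (?X N \<omega>))
      + (LINT \<omega>|M. qc (C N \<omega> - prev c C N \<omega>))" .
  \<comment> \<open>The bookkeeping of the induction step, separated from the integrals.\<close>
  have alg: "G + rN * (EL + Eq) = S + rN * (E0 + E) + P0 - (r * rN) * P1"
    if "G = S + P0 - rN * PN" "E = EL - E0 + r * P1 - PN + Eq" for G rN EL Eq S E0 E P0 r P1 PN :: real
    unfolding that by (simp add: algebra_simps)
  have gS: "grid_cost h d c C (Suc N) = grid_cost h d c C N + ?r ^ N * ((LINT \<omega>|M. L h g (C N \<omega>) (?X N \<omega>)) + (LINT \<omega>|M. qc (C N \<omega> - prev c C N \<omega>)))"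
    unfolding grid_cost_def by simp
  show ?case unfolding gS sum.lessThan_Suc power_Suc by (rule alg[OF Suc.IH Suc_eq])
qed

text \<open>The identity is compared for a competitor \<open>C\<close> and a policy
  \<open>Y\<close>; the baseline at level \<open>- R\<close> is common to both. Jump terms of
  \<open>C\<close> are nonnegative because \<open>game h\<close> lies between \<open>- q0p\<close>
  and \<open>q0m\<close>. Those of \<open>Y\<close> are at most the fraction \<open>\<eta>\<close>
  of its control cost, which moves to the left-hand side. Each final term is at most
  \<open>2 * R * qb\<close>, whence the constant \<open>4\<close>.\<close>

lemma grid_cost_compare:
  assumes C: "grid_control h R C" and c': "\<bar>c'\<bar> \<le> R"
    and Y: "grid_control h R Y" and c: "\<bar>c\<bar> \<le> R" and d: "d \<in> Ob" and eta: "0 \<le> \<eta>"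
    and best: "\<And>k \<omega> b. \<omega> \<in> space M \<Longrightarrow> \<bar>b\<bar> \<le> R \<Longrightarrow>
      gain h R (Y k \<omega>) (X d (real k * h) \<omega>) \<le> gain h R b (X d (real k * h) \<omega>)"
    and jump: "\<And>k \<omega>. \<omega> \<in> space M \<Longrightarrow>
      Psi h R (Y k \<omega>) (X d (real k * h) \<omega>) - Psi h R (prev c Y k \<omega>) (X d (real k * h) \<omega>) + qc (Y k \<omega> - prev c Y k \<omega>)
        \<le> \<eta> * qc (Y k \<omega> - prev c Y k \<omega>)"
  shows "(1 - \<eta>) * grid_cost h d c Y N \<le> grid_cost h d c' C N + (Psi h R c d - Psi h R c' d) + exp (- \<rho> * h) ^ N * (4 * R * qb)"
proof -
  let ?X = "\<lambda>k \<omega>. X d (real k * h) \<omega>" and ?r = "exp (- \<rho> * h)"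
  have R: "0 \<le> R" using c by linarith
  have Pb: "bounded_cont (Psi h R)" by (rule Psi_bounded_cont[OF h R])
  have ig: "integrable M (\<lambda>\<omega>. gain h R (A k \<omega>) (?X k \<omega>))" if A: "grid_control h R A" for A k
  proof -
    have "integrable M (\<lambda>\<omega>. L h g (A k \<omega>) (?X k \<omega>) - L h g (- R) (?X k \<omega>)
        + ?r * P h (Psi h R) (A k \<omega>) (?X k \<omega>) - Psi h R (A k \<omega>) (?X k \<omega>))"
      using grid_meas[OF A, of k] grid_bound[OF A] R
      by (intro Bochner_Integration.integrable_diff Bochner_Integration.integrable_add integrable_mult_right
          integrable_bounded_cont[OF P_bounded_cont[OF Pb] d] integrable_bounded_cont[OF Pb d]
          growth_integrable[OF growth_L[OF growth_g_gc(1)] d, where R = R]) auto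
    then show ?thesis
      by (rule Bochner_Integration.integrable_cong[THEN iffD1, OF refl, rotated])
         (simp add: gain_eq[OF h X_in[OF d] grid_bound[OF A]])
  qed
  have iP: "integrable M (\<lambda>\<omega>. Psi h R (A k \<omega>) (?X k \<omega>) - Psi h R (prev b A k \<omega>) (?X k \<omega>) + qc (A k \<omega> - prev b A k \<omega>))"
    if A: "grid_control h R A" and b: "\<bar>b\<bar> \<le> R" for A b k
    using grid_meas[OF A, of k] prev_meas[OF A, of b k]
    by (intro Bochner_Integration.integrable_diff Bochner_Integration.integrable_add
          integrable_bounded_cont[OF Pb d] qc_integrable[OF A b])
  have tail: "\<bar>LINT \<omega>|M. Psi h R (prev b A N \<omega>) (?X N \<omega>)\<bar> \<le> 2 * R * qb" if A: "grid_control h R A" for A b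
  proof -
    have i: "integrable M (\<lambda>\<omega>. Psi h R (prev b A N \<omega>) (?X N \<omega>))"
      by (rule integrable_bounded_cont[OF Pb d prev_meas[OF A]])
    have "\<bar>LINT \<omega>|M. Psi h R (prev b A N \<omega>) (?X N \<omega>)\<bar> \<le> (LINT \<omega>|M. \<bar>Psi h R (prev b A N \<omega>) (?X N \<omega>)\<bar>)"
      by (rule integral_abs_bound)
    also have "\<dots> \<le> (LINT \<omega>|M. 2 * R * qb)"
      using Psi_bound[OF h X_in[OF d] R] by (intro integral_mono integrable_abs i) auto
    finally show ?thesis by (simp add: prob_space)
  qed
  have lowC: "0 \<le> Psi h R (C k \<omega>) (?X k \<omega>) - Psi h R (prev c' C k \<omega>) (?X k \<omega>) + qc (C k \<omega> - prev c' C k \<omega>)"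
    if w: "\<omega> \<in> space M" for k \<omega>
  proof -
    let ?a = "prev c' C k \<omega>" and ?b = "C k \<omega>" and ?y = "?X k \<omega>"
    have y: "?y \<in> Ob" by (rule X_in[OF d w])
    have ab: "- R \<le> ?a" "?a \<le> R" "- R \<le> ?b" "?b \<le> R" using grid_bound[OF C w, of k] prev_bound[OF C c' w, of k] by auto
    show ?thesis
    proof (cases "?a \<le> ?b")
      case True
      have "- q0p * (?b - ?a) \<le> prim ?a (game h) ?b ?y"
        using True game_bounds[OF h y] by (intro prim_ge[OF h game_cont[OF h] y]) auto
      then show ?thesis using Psi_diff[OF h y ab(1) True ab(4)] True by (simp add: qc_def algebra_simps)
    next
      case False
      then have F: "?b \<le> ?a" by simp
      have "prim ?b (game h) ?a ?y \<le> q0m * (?a - ?b)"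
        using F game_bounds[OF h y] by (intro prim_le[OF h game_cont[OF h] y]) auto
      then show ?thesis using Psi_diff[OF h y ab(3) F ab(2)] F by (simp add: qc_def algebra_simps)
    qed
  qed
  have per_step: "(LINT \<omega>|M. gain h R (Y k \<omega>) (?X k \<omega>)
          + (Psi h R (Y k \<omega>) (?X k \<omega>) - Psi h R (prev c Y k \<omega>) (?X k \<omega>) + qc (Y k \<omega> - prev c Y k \<omega>)))
      \<le> (LINT \<omega>|M. gain h R (C k \<omega>) (?X k \<omega>)
          + (Psi h R (C k \<omega>) (?X k \<omega>) - Psi h R (prev c' C k \<omega>) (?X k \<omega>) + qc (C k \<omega> - prev c' C k \<omega>)))
        + \<eta> * (LINT \<omega>|M. qc (Y k \<omega> - prev c Y k \<omega>))" for k
  proof -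
    have "(LINT \<omega>|M. gain h R (Y k \<omega>) (?X k \<omega>)
          + (Psi h R (Y k \<omega>) (?X k \<omega>) - Psi h R (prev c Y k \<omega>) (?X k \<omega>) + qc (Y k \<omega> - prev c Y k \<omega>)))
      \<le> (LINT \<omega>|M. (gain h R (C k \<omega>) (?X k \<omega>)
          + (Psi h R (C k \<omega>) (?X k \<omega>) - Psi h R (prev c' C k \<omega>) (?X k \<omega>) + qc (C k \<omega> - prev c' C k \<omega>)))
          + \<eta> * qc (Y k \<omega> - prev c Y k \<omega>))"
    proof (rule integral_mono[OF Bochner_Integration.integrable_add[OF ig[OF Y] iP[OF Y c]]
        Bochner_Integration.integrable_add[OF Bochner_Integration.integrable_add[OF ig[OF C] iP[OF C c']]
          integrable_mult_right[OF qc_integrable[OF Y c]]]])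
      fix \<omega> assume w: "\<omega> \<in> space M"
      show "gain h R (Y k \<omega>) (?X k \<omega>)
          + (Psi h R (Y k \<omega>) (?X k \<omega>) - Psi h R (prev c Y k \<omega>) (?X k \<omega>) + qc (Y k \<omega> - prev c Y k \<omega>))
        \<le> (gain h R (C k \<omega>) (?X k \<omega>)
          + (Psi h R (C k \<omega>) (?X k \<omega>) - Psi h R (prev c' C k \<omega>) (?X k \<omega>) + qc (C k \<omega> - prev c' C k \<omega>)))
          + \<eta> * qc (Y k \<omega> - prev c Y k \<omega>)"
        using best[OF w grid_bound[OF C w, of k], of k] jump[OF w, of k] lowC[OF w, of k] by linarith
    qed
    also have "\<dots> = (LINT \<omega>|M. gain h R (C k \<omega>) (?X k \<omega>)
          + (Psi h R (C k \<omega>) (?X k \<omega>) - Psi h R (prev c' C k \<omega>) (?X k \<omega>) + qc (C k \<omega> - prev c' C k \<omega>)))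
        + \<eta> * (LINT \<omega>|M. qc (Y k \<omega> - prev c Y k \<omega>))"
      by (subst Bochner_Integration.integral_add[OF Bochner_Integration.integrable_add[OF ig[OF C] iP[OF C c']]
            integrable_mult_right[OF qc_integrable[OF Y c]]], subst integral_mult_right_zero, rule refl)
    finally show ?thesis .
  qed
  define a where "a = (\<lambda>k. LINT \<omega>|M. gain h R (Y k \<omega>) (?X k \<omega>)
          + (Psi h R (Y k \<omega>) (?X k \<omega>) - Psi h R (prev c Y k \<omega>) (?X k \<omega>) + qc (Y k \<omega> - prev c Y k \<omega>)))"
  define b where "b = (\<lambda>k. LINT \<omega>|M. gain h R (C k \<omega>) (?X k \<omega>)
          + (Psi h R (C k \<omega>) (?X k \<omega>) - Psi h R (prev c' C k \<omega>) (?X k \<omega>) + qc (C k \<omega> - prev c' C k \<omega>)))"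
  define l where "l = (\<lambda>k. LINT \<omega>|M. L h g (- R) (?X k \<omega>))"
  define q where "q = (\<lambda>k. LINT \<omega>|M. qc (Y k \<omega> - prev c Y k \<omega>))"
  have "(\<Sum>k<N. ?r ^ k * (l k + a k)) \<le> (\<Sum>k<N. ?r ^ k * (l k + b k + \<eta> * q k))"
    using per_step unfolding a_def[symmetric] b_def[symmetric] q_def[symmetric]
    by (intro sum_mono mult_left_mono) (auto simp: a_def b_def q_def)
  also have "\<dots> = (\<Sum>k<N. ?r ^ k * (l k + b k)) + \<eta> * (\<Sum>k<N. ?r ^ k * q k)"
    by (simp add: sum.distrib sum_distrib_left algebra_simps)
  \<comment> \<open>The control cost is part of the full cost, and the remaining running cost is
    nonnegative.\<close>
  also have "(\<Sum>k<N. ?r ^ k * q k) \<le> grid_cost h d c Y N"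
    unfolding grid_cost_def q_def
    using g_nonneg X_in[OF d]
    by (intro sum_mono mult_left_mono) (auto intro!: Bochner_Integration.integral_nonneg L_nonneg)
  finally have main: "(\<Sum>k<N. ?r ^ k * (l k + a k)) \<le> (\<Sum>k<N. ?r ^ k * (l k + b k)) + \<eta> * grid_cost h d c Y N"
    using eta by (simp add: mult_left_mono)
  have Yid: "grid_cost h d c Y N = (\<Sum>k<N. ?r ^ k * (l k + a k)) + Psi h R c d - ?r ^ N * (LINT \<omega>|M. Psi h R (prev c Y N \<omega>) (?X N \<omega>))"
    unfolding a_def l_def by (rule grid_cost_identity[OF Y c d])
  have Cid: "grid_cost h d c' C N = (\<Sum>k<N. ?r ^ k * (l k + b k)) + Psi h R c' d - ?r ^ N * (LINT \<omega>|M. Psi h R (prev c' C N \<omega>) (?X N \<omega>))"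
    unfolding b_def l_def by (rule grid_cost_identity[OF C c' d])
  have "?r ^ N * ((LINT \<omega>|M. Psi h R (prev c' C N \<omega>) (?X N \<omega>)) - (LINT \<omega>|M. Psi h R (prev c Y N \<omega>) (?X N \<omega>)))
     \<le> ?r ^ N * (4 * R * qb)"
    using tail[OF Y, of c] tail[OF C, of c'] by (intro mult_left_mono) (auto simp: abs_le_iff)
  then have "?r ^ N * (LINT \<omega>|M. Psi h R (prev c' C N \<omega>) (?X N \<omega>)) - ?r ^ N * (LINT \<omega>|M. Psi h R (prev c Y N \<omega>) (?X N \<omega>))
     \<le> ?r ^ N * (4 * R * qb)" by (simp only: right_diff_distrib)
  moreover have "(1 - \<eta>) * grid_cost h d c Y N = grid_cost h d c Y N - \<eta> * grid_cost h d c Y N"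
    by (simp add: left_diff_distrib)
  ultimately show ?thesis using main Yid Cid by linarith
qed

lemma grid_cost_mono: assumes d: "d \<in> Ob" and "N \<le> N'" shows "grid_cost h d c C N \<le> grid_cost h d c C N'"
  unfolding grid_cost_def
  using g_nonneg X_in[OF d] assms(2)
  by (intro sum_mono2) (auto intro!: mult_nonneg_nonneg add_nonneg_nonneg Bochner_Integration.integral_nonneg L_nonneg qc_nonneg)

text \<open>
  The thresholds of the relaxed game: shifting the obstacles by \<open>\<epsilon>\<close> costs a factor \<open>1 - \<eta>\<close> at most, and
  lets pointwise convergence of \<open>game h\<close> decide on which side of a threshold a level eventually lies.
\<close>

definition al :: "real \<Rightarrow> real \<Rightarrow> real \<Rightarrow> real" where
  "al R \<epsilon> y = Sup {z. - R \<le> z \<and> z \<le> R \<and> (z = - R \<or> game h z y \<le> - q0p + \<epsilon>)}"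

definition be :: "real \<Rightarrow> real \<Rightarrow> real \<Rightarrow> real" where
  "be R \<epsilon> y = Inf {z. - R \<le> z \<and> z \<le> R \<and> (z = R \<or> q0m - \<epsilon> \<le> game h z y)}"

text \<open>Projection of the previous level onto the interval between the thresholds at the current
  demand, which is the least adjustment. The term \<open>real 0 * h\<close> keeps both equations in
  the common form of \<open>pol_eq\<close>.\<close>

primrec pol :: "real \<Rightarrow> real \<Rightarrow> real \<Rightarrow> real \<Rightarrow> nat \<Rightarrow> 'a \<Rightarrow> real" where
  "pol R \<epsilon> d c 0 = (\<lambda>\<omega>. max (al R \<epsilon> (X d (real 0 * h) \<omega>)) (min (be R \<epsilon> (X d (real 0 * h) \<omega>)) c))"
| "pol R \<epsilon> d c (Suc k) = (\<lambda>\<omega>. max (al R \<epsilon> (X d (real (Suc k) * h) \<omega>)) (min (be R \<epsilon> (X d (real (Suc k) * h) \<omega>)) (pol R \<epsilon> d c k \<omega>)))"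

lemma pol_eq: "pol R \<epsilon> d c k \<omega> =
  max (al R \<epsilon> (X d (real k * h) \<omega>)) (min (be R \<epsilon> (X d (real k * h) \<omega>)) (prev c (pol R \<epsilon> d c) k \<omega>))"
  by (cases k) (simp_all add: prev_def)

text \<open>The levels in question form an interval starting at \<open>- R\<close>, by monotonicity
  of \<open>game h\<close>, and the interval is closed by continuity. The endpoint
  \<open>- R\<close> belongs to it by convention and is excluded here. Thresholds are thus compared
  through values of \<open>game h\<close> at a fixed level, which also gives their
  measurability.\<close>

lemma al_ge_iff:
  assumes y: "y \<in> Ob" and R: "0 \<le> R" and z: "- R < z" "z \<le> R"
  shows "z \<le> al R \<epsilon> y \<longleftrightarrow> game h z y \<le> - q0p + \<epsilon>"
proof
  let ?A = "{z. - R \<le> z \<and> z \<le> R \<and> (z = - R \<or> game h z y \<le> - q0p + \<epsilon>)}"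
  have bdd: "bdd_above ?A" by (rule bdd_aboveI[of _ R]) auto
  have ne: "- R \<in> ?A" using R by simp
  show "z \<le> al R \<epsilon> y" if "game h z y \<le> - q0p + \<epsilon>"
    unfolding al_def using that z bdd by (intro cSup_upper) auto
  assume a: "z \<le> al R \<epsilon> y"
  show "game h z y \<le> - q0p + \<epsilon>"
  proof (rule ccontr)
    assume n: "\<not> game h z y \<le> - q0p + \<epsilon>"
    have "isCont (\<lambda>z. game h z y) z"
      using section_cont[OF game_cont[OF h] y] by (simp add: continuous_on_eq_continuous_at)
    then have "eventually (\<lambda>q. - q0p + \<epsilon> < game h q y) (at_left z)"
      using n by (intro order_tendstoD(1)[where y = "game h z y"]) (auto simp: isCont_def filterlim_at_split)
    then obtain b where b: "b < z" "\<And>q. b < q \<Longrightarrow> q < z \<Longrightarrow> - q0p + \<epsilon> < game h q y"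
      unfolding eventually_at_left_field by blast
    define q where "q = (max b (- R) + z) / 2"
    have q: "b < q" "- R < q" "q < z" using b(1) z(1) by (auto simp: q_def max_def field_simps)
    have "al R \<epsilon> y \<le> q" unfolding al_def
    proof (rule cSup_least)
      show "?A \<noteq> {}" using ne by blast
      fix w assume w: "w \<in> ?A"
      show "w \<le> q"
      proof (rule ccontr)
        assume "\<not> w \<le> q"
        then have "game h q y \<le> game h w y" by (intro game_mono[OF h y]) simp
        then show False using w b(2)[OF q(1,3)] \<open>\<not> w \<le> q\<close> q(2) by auto
      qed
    qed
    then show False using a q(3) by simp
  qed
qed

lemma be_le_iff:
  assumes y: "y \<in> Ob" and R: "0 \<le> R" and z: "- R \<le> z" "z < R"
  shows "be R \<epsilon> y \<le> z \<longleftrightarrow> q0m - \<epsilon> \<le> game h z y"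
proof
  let ?A = "{z. - R \<le> z \<and> z \<le> R \<and> (z = R \<or> q0m - \<epsilon> \<le> game h z y)}"
  have bdd: "bdd_below ?A" by (rule bdd_belowI[of _ "- R"]) auto
  have ne: "R \<in> ?A" using R by simp
  show "be R \<epsilon> y \<le> z" if "q0m - \<epsilon> \<le> game h z y"
    unfolding be_def using that z bdd by (intro cInf_lower) auto
  assume a: "be R \<epsilon> y \<le> z"
  show "q0m - \<epsilon> \<le> game h z y"
  proof (rule ccontr)
    assume n: "\<not> q0m - \<epsilon> \<le> game h z y"
    have "isCont (\<lambda>z. game h z y) z"
      using section_cont[OF game_cont[OF h] y] by (simp add: continuous_on_eq_continuous_at)
    then have "eventually (\<lambda>q. game h q y < q0m - \<epsilon>) (at_right z)"
      using n by (intro order_tendstoD(2)[where y = "game h z y"]) (auto simp: isCont_def filterlim_at_split)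
    then obtain b where b: "z < b" "\<And>q. z < q \<Longrightarrow> q < b \<Longrightarrow> game h q y < q0m - \<epsilon>"
      unfolding eventually_at_right_field by blast
    define q where "q = (min b R + z) / 2"
    have q: "q < b" "q < R" "z < q" using b(1) z(2) by (auto simp: q_def min_def field_simps)
    have "q \<le> be R \<epsilon> y" unfolding be_def
    proof (rule cInf_greatest)
      show "?A \<noteq> {}" using ne by blast
      fix w assume w: "w \<in> ?A"
      show "q \<le> w"
      proof (rule ccontr)
        assume "\<not> q \<le> w"
        then have "game h w y \<le> game h q y" by (intro game_mono[OF h y]) simp
        then show False using w b(2)[OF q(3,1)] \<open>\<not> q \<le> w\<close> q(2) by auto
      qed
    qed
    then show False using a q(3) by simp
  qed
qed

lemma al_bounds: assumes "0 \<le> R" shows "- R \<le> al R \<epsilon> y" "al R \<epsilon> y \<le> R"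
proof -
  let ?A = "{z. - R \<le> z \<and> z \<le> R \<and> (z = - R \<or> game h z y \<le> - q0p + \<epsilon>)}"
  have "bdd_above ?A" by (rule bdd_aboveI[of _ R]) auto
  moreover have "- R \<in> ?A" using assms by simp
  ultimately show "- R \<le> al R \<epsilon> y" unfolding al_def by (rule cSup_upper[rotated])
  have "?A \<noteq> {}" using \<open>- R \<in> ?A\<close> by blast
  then show "al R \<epsilon> y \<le> R" unfolding al_def by (rule cSup_least) auto
qed

lemma be_bounds: assumes "0 \<le> R" shows "- R \<le> be R \<epsilon> y" "be R \<epsilon> y \<le> R"
proof -
  let ?A = "{z. - R \<le> z \<and> z \<le> R \<and> (z = R \<or> q0m - \<epsilon> \<le> game h z y)}"
  have "bdd_below ?A" by (rule bdd_belowI[of _ "- R"]) auto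
  moreover have "R \<in> ?A" using assms by simp
  ultimately show "be R \<epsilon> y \<le> R" unfolding be_def by (rule cInf_lower[rotated])
  have "?A \<noteq> {}" using \<open>R \<in> ?A\<close> by blast
  then show "- R \<le> be R \<epsilon> y" unfolding be_def by (rule cInf_greatest) auto
qed

text \<open>At a level strictly between reversed thresholds, \<open>game h z y\<close> would be at
  most \<open>- q0p + \<epsilon>\<close> and at least \<open>q0m - \<epsilon>\<close>.\<close>

lemma al_le_be:
  assumes y: "y \<in> Ob" and R: "0 \<le> R" and eps: "2 * \<epsilon> < q0p + q0m"
  shows "al R \<epsilon> y \<le> be R \<epsilon> y"
proof (rule ccontr)
  assume "\<not> al R \<epsilon> y \<le> be R \<epsilon> y"
  then obtain z where z: "be R \<epsilon> y < z" "z < al R \<epsilon> y" using dense by (meson not_le)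
  have zR: "- R < z" "z < R" using z al_bounds[OF R, of \<epsilon> y] be_bounds[OF R, of \<epsilon> y] by auto
  have "game h z y \<le> - q0p + \<epsilon>" using al_ge_iff[OF y R zR(1), of \<epsilon>] zR z by simp
  moreover have "q0m - \<epsilon> \<le> game h z y" using be_le_iff[OF y R _ zR(2), of \<epsilon>] zR z by simp
  ultimately show False using eps by simp
qed

lemma al_meas:
  assumes d: "d \<in> Ob" and t: "0 \<le> t" and R: "0 \<le> R"
  shows "(\<lambda>\<omega>. al R \<epsilon> (X d t \<omega>)) \<in> borel_measurable (F t)" "(\<lambda>\<omega>. be R \<epsilon> (X d t \<omega>)) \<in> borel_measurable (F t)"
proof -
  have XF: "X d t \<in> borel_measurable (F t)" using D_adapted[OF d t] t unfolding X_def by (simp add: max_def)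
  have XO: "X d t \<omega> \<in> Ob" if "\<omega> \<in> space (F t)" for \<omega> using X_in[OF d] that space_F[OF t] by simp
  have gm: "(\<lambda>\<omega>. game h z (X d t \<omega>)) \<in> borel_measurable (F t)" for z
    by (rule measurable_comp_continuous_on[OF game_cont[OF h] _ XF XO, of "\<lambda>_. z"]) auto
  show "(\<lambda>\<omega>. al R \<epsilon> (X d t \<omega>)) \<in> borel_measurable (F t)"
    unfolding borel_measurable_iff_ge
  proof
    fix z
    consider "z \<le> - R" | "R < z" | "- R < z" "z \<le> R" by linarith
    then show "{\<omega> \<in> space (F t). z \<le> al R \<epsilon> (X d t \<omega>)} \<in> sets (F t)"
    proof cases
      case 1
      then have "{\<omega> \<in> space (F t). z \<le> al R \<epsilon> (X d t \<omega>)} = space (F t)" using al_bounds[OF R] by (auto intro: order_trans)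
      then show ?thesis by simp
    next
      case 2
      then have "{\<omega> \<in> space (F t). z \<le> al R \<epsilon> (X d t \<omega>)} = {}" using al_bounds(2)[OF R] by (auto simp: not_le intro: le_less_trans)
      then show ?thesis by (simp only: sets.empty_sets)
    next
      case 3
      have "{\<omega> \<in> space (F t). z \<le> al R \<epsilon> (X d t \<omega>)} = {\<omega> \<in> space (F t). game h z (X d t \<omega>) \<le> - q0p + \<epsilon>}"
        using al_ge_iff[OF XO R 3] by auto
      also have "\<dots> \<in> sets (F t)" using gm[of z] by measurable
      finally show ?thesis .
    qed
  qed
  show "(\<lambda>\<omega>. be R \<epsilon> (X d t \<omega>)) \<in> borel_measurable (F t)"
    unfolding borel_measurable_iff_le
  proof
    fix z
    consider "z < - R" | "R \<le> z" | "- R \<le> z" "z < R" by linarith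
    then show "{\<omega> \<in> space (F t). be R \<epsilon> (X d t \<omega>) \<le> z} \<in> sets (F t)"
    proof cases
      case 1
      then have "{\<omega> \<in> space (F t). be R \<epsilon> (X d t \<omega>) \<le> z} = {}" using be_bounds(1)[OF R] by (auto simp: not_le intro: less_le_trans)
      then show ?thesis by (simp only: sets.empty_sets)
    next
      case 2
      then have "{\<omega> \<in> space (F t). be R \<epsilon> (X d t \<omega>) \<le> z} = space (F t)" using be_bounds(2)[OF R] by (auto intro: order_trans)
      then show ?thesis by simp
    next
      case 3
      have "{\<omega> \<in> space (F t). be R \<epsilon> (X d t \<omega>) \<le> z} = {\<omega> \<in> space (F t). q0m - \<epsilon> \<le> game h z (X d t \<omega>)}"
        using be_le_iff[OF XO R 3] by auto
      also have "\<dots> \<in> sets (F t)" using gm[of z] by measurable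
      finally show ?thesis .
    qed
  qed
qed

lemma pol_grid:
  assumes d: "d \<in> Ob" and R: "0 \<le> R"
  shows "grid_control h R (pol R \<epsilon> d c)"
  unfolding grid_control_def
proof (intro conjI allI ballI)
  show "pol R \<epsilon> d c k \<in> borel_measurable (F (real k * h))" for k
  proof (induction k)
    case 0
    have t: "0 \<le> real 0 * h" using h by simp
    show ?case unfolding pol.simps using al_meas[OF d t R, of \<epsilon>] by measurable
  next
    case (Suc k)
    have t: "0 \<le> real (Suc k) * h" "0 \<le> real k * h" "real k * h \<le> real (Suc k) * h"
      using h by (auto simp: algebra_simps)
    have "pol R \<epsilon> d c k \<in> borel_measurable (F (real (Suc k) * h))" by (rule measurable_F_mono[OF t(2,3) Suc])
    then show ?case unfolding pol.simps using al_meas[OF d t(1) R, of \<epsilon>] by measurable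
  qed
  show "\<bar>pol R \<epsilon> d c k \<omega>\<bar> \<le> R" for k \<omega>
    using al_bounds[OF R, of \<epsilon> "X d (real k * h) \<omega>"] be_bounds[OF R, of \<epsilon> "X d (real k * h) \<omega>"]
    unfolding pol_eq[of R \<epsilon> d c k \<omega>] by (auto simp: abs_le_iff)
qed

text \<open>The integrand of \<open>gain\<close> is nonnegative above \<open>v\<close> and
  nonpositive below it. Where it is negative, \<open>game h\<close> sits at \<open>- q0p\<close>, so
  the level is at most \<open>al\<close>; where it is positive, \<open>game h\<close> sits at
  \<open>q0m\<close>, so the level is at least \<open>be\<close>.\<close>

lemma pol_best:
  assumes d: "d \<in> Ob" and R: "0 \<le> R" and eps: "0 \<le> \<epsilon>" "2 * \<epsilon> < q0p + q0m" and y: "y \<in> Ob" and b: "\<bar>b\<bar> \<le> R"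
    and v: "v = max (al R \<epsilon> y) (min (be R \<epsilon> y) p)"
  shows "gain h R v y \<le> gain h R b y"
proof -
  let ?f = "\<lambda>z y. CV h (game h) z y - game h z y"
  have v1: "al R \<epsilon> y \<le> v" "v \<le> be R \<epsilon> y" using al_le_be[OF y R eps(2)] by (auto simp: v)
  have vR: "- R \<le> v" "v \<le> R" using v1 al_bounds[OF R, of \<epsilon> y] be_bounds[OF R, of \<epsilon> y] by auto
  \<comment> \<open>A fixed point of the clamp differs from the continuation value only by sitting
    at an obstacle, and the sign of the difference tells which one.\<close>
  have clamp: "a < b \<Longrightarrow> b = - q0p" "b < a \<Longrightarrow> b = q0m" if "b = max (- q0p) (min q0m a)" for a b
    using that q0p_pos q0m_pos by (auto simp: max_def min_def split: if_splits)
  have up: "0 \<le> ?f z y" if "v < z" "z < R" for z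
  proof (rule ccontr)
    assume "\<not> 0 \<le> ?f z y"
    then have "game h z y = - q0p" using clamp(1)[OF game_eq[OF h y, of z]] by simp
    then have "z \<le> al R \<epsilon> y" using al_ge_iff[OF y R, of z \<epsilon>] that vR eps by simp
    then show False using v1 that by simp
  qed
  have dn: "?f z y \<le> 0" if "- R < z" "z < v" for z
  proof (rule ccontr)
    assume "\<not> ?f z y \<le> 0"
    then have "game h z y = q0m" using clamp(2)[OF game_eq[OF h y, of z]] by simp
    then have "be R \<epsilon> y \<le> z" using be_le_iff[OF y R, of z \<epsilon>] that vR eps by simp
    then show False using v1 that by simp
  qed
  note gcont = gain_cont[OF h]
  show ?thesis
  proof (cases "v \<le> b")
    case True
    have "gain h R b y = gain h R v y + prim v ?f b y" unfolding gain_def[OF h] using vR True by (intro prim_diff[OF gcont y])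
    moreover have "0 \<le> prim v ?f b y" using up b by (intro prim_nonneg[OF h gcont y]) auto
    ultimately show ?thesis by simp
  next
    case False
    have "gain h R v y = gain h R b y + prim b ?f v y" unfolding gain_def[OF h] using b False by (intro prim_diff[OF gcont y]) auto
    moreover have "prim b ?f v y \<le> 0 * (v - b)" using dn b False by (intro prim_le[OF h gcont y]) auto
    ultimately show ?thesis by simp
  qed
qed

text \<open>A jump of the policy crosses only levels where \<open>game h\<close> is within
  \<open>\<epsilon>\<close> of the relevant obstacle, so the jump term is at most
  \<open>\<epsilon> * \<bar>v - p\<bar>\<close>.\<close>

lemma pol_jump:
  assumes d: "d \<in> Ob" and R: "0 \<le> R" and eps: "0 \<le> \<epsilon>" "2 * \<epsilon> < q0p + q0m" and y: "y \<in> Ob" and p: "\<bar>p\<bar> \<le> R"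
    and v: "v = max (al R \<epsilon> y) (min (be R \<epsilon> y) p)" and eta: "\<epsilon> \<le> \<eta> * q0p" "\<epsilon> \<le> \<eta> * q0m"
  shows "Psi h R v y - Psi h R p y + qc (v - p) \<le> \<eta> * qc (v - p)"
proof -
  have ab: "al R \<epsilon> y \<le> be R \<epsilon> y" by (rule al_le_be[OF y R eps(2)])
  have vR: "- R \<le> v" "v \<le> R" using ab v al_bounds[OF R, of \<epsilon> y] be_bounds[OF R, of \<epsilon> y] by auto
  consider "v = p" | "p < v" | "v < p" by linarith
  then show ?thesis
  proof cases
    case 1 then show ?thesis by (simp add: qc_def)
  next
    case 2
    then have va: "v = al R \<epsilon> y" using v by (auto simp: max_def min_def split: if_splits)
    have "prim p (game h) v y \<le> (- q0p + \<epsilon>) * (v - p)"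
    proof (rule prim_le[OF h game_cont[OF h] y])
      fix z assume "p < z" "z < v"
      then show "game h z y \<le> - q0p + \<epsilon>" using al_ge_iff[OF y R, of z \<epsilon>] va p vR by auto
    qed (use 2 in simp)
    then have "Psi h R v y - Psi h R p y + qc (v - p) \<le> \<epsilon> * (v - p)"
      using Psi_diff[OF h y _ _ vR(2), of p] 2 p by (simp add: qc_def algebra_simps)
    also have "\<dots> \<le> \<eta> * q0p * (v - p)" using eta 2 by (intro mult_right_mono) auto
    finally show ?thesis using 2 by (simp add: qc_def algebra_simps)
  next
    case 3
    then have vb: "v = be R \<epsilon> y" using v ab by (auto simp: max_def min_def split: if_splits)
    have "(q0m - \<epsilon>) * (p - v) \<le> prim v (game h) p y"
    proof (rule prim_ge[OF h game_cont[OF h] y])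
      fix z assume "v < z" "z < p"
      then show "q0m - \<epsilon> \<le> game h z y" using be_le_iff[OF y R, of z \<epsilon>] vb p vR by auto
    qed (use 3 in simp)
    then have "Psi h R v y - Psi h R p y + qc (v - p) \<le> \<epsilon> * (p - v)"
      using Psi_diff[OF h y vR(1), of p] 3 p by (simp add: qc_def algebra_simps)
    also have "\<dots> \<le> \<eta> * q0m * (p - v)" using eta 3 by (intro mult_right_mono) auto
    finally show ?thesis using 3 by (simp add: qc_def algebra_simps)
  qed
qed

text \<open>Two initial levels serve two purposes: \<open>c = c'\<close> gives near-optimality,
  whereas \<open>\<epsilon> = \<eta> = 0\<close> compares the values at two capacities and leads to
  the derivative.\<close>

theorem pol_near_optimal:
  assumes d: "d \<in> Ob" and c: "\<bar>c\<bar> \<le> R" "\<bar>c'\<bar> \<le> R" and eps: "0 \<le> \<epsilon>" "2 * \<epsilon> < q0p + q0m"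
    and eta: "0 \<le> \<eta>" "\<eta> \<le> 1" "\<epsilon> \<le> \<eta> * q0p" "\<epsilon> \<le> \<eta> * q0m"
    and C: "grid_control h R C" and B: "\<And>N. grid_cost h d c' C N \<le> B"
  shows "(1 - \<eta>) * grid_cost h d c (pol R \<epsilon> d c) N \<le> B + (Psi h R c d - Psi h R c' d)"
proof -
  have R: "0 \<le> R" using c by linarith
  let ?Y = "pol R \<epsilon> d c"
  have Y: "grid_control h R ?Y" by (rule pol_grid[OF d R])
  have le: "(1 - \<eta>) * grid_cost h d c ?Y N' \<le> B + (Psi h R c d - Psi h R c' d) + exp (- \<rho> * h) ^ N' * (4 * R * qb)" for N'
    using grid_cost_compare[OF C c(2) Y c(1) d eta(1), of N'] B[of N']
      pol_best[OF d R eps X_in[OF d] _ pol_eq] pol_jump[OF d R eps X_in[OF d] prev_bound[OF Y c(1)] pol_eq eta(3,4)]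
    by force
  have "(\<lambda>N'. B + (Psi h R c d - Psi h R c' d) + exp (- \<rho> * h) ^ N' * (4 * R * qb)) \<longlonglongrightarrow> B + (Psi h R c d - Psi h R c' d) + 0 * (4 * R * qb)"
    using r_less_1[OF h] by (intro tendsto_intros LIMSEQ_realpow_zero) auto
  \<comment> \<open>Costs increase with the horizon, so the bound at \<open>N\<close> follows from
    those at larger \<open>N'\<close>, where the final term vanishes in the limit.\<close>
  moreover have "eventually (\<lambda>N'. (1 - \<eta>) * grid_cost h d c ?Y N \<le> B + (Psi h R c d - Psi h R c' d) + exp (- \<rho> * h) ^ N' * (4 * R * qb)) sequentially"
    unfolding eventually_sequentially
  proof (intro exI[of _ N] allI impI)
    fix N' assume "N \<le> N'"
    then have "(1 - \<eta>) * grid_cost h d c ?Y N \<le> (1 - \<eta>) * grid_cost h d c ?Y N'"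
      using eta by (intro mult_left_mono grid_cost_mono[OF d]) auto
    with le[of N'] show "(1 - \<eta>) * grid_cost h d c ?Y N \<le> B + (Psi h R c d - Psi h R c' d) + exp (- \<rho> * h) ^ N' * (4 * R * qb)" by simp
  qed
  ultimately show ?thesis using tendsto_lowerbound[OF _ _ sequentially_bot] by fastforce
qed

end

end

section \<open>Grid controls as admissible controls\<close>

lemma jump_increment:
  fixes Z :: "nat \<Rightarrow> real"
  assumes "i \<le> j"
  shows "max 0 (Z j - Z i) \<le> (\<Sum>k<j. max 0 (Z (Suc k) - Z k)) - (\<Sum>k<i. max 0 (Z (Suc k) - Z k))"
  using assms
proof (induction j rule: dec_induct)
  case (step j) then show ?case by (simp add: max_def split: if_splits)
qed simp

lemma pos_variation_jump_path:
  fixes Z :: "nat \<Rightarrow> real"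
  assumes m: "mono m" and e: "\<And>t. extend0 f t = Z (m t)"
  shows "pos_variation f t \<le> ennreal (\<Sum>k<m t. max 0 (Z (Suc k) - Z k))"
proof (rule pos_variation_le)
  fix a b :: real assume "a \<le> b"
  then show "max 0 (extend0 f b - extend0 f a) \<le> (\<Sum>k<m b. max 0 (Z (Suc k) - Z k)) - (\<Sum>k<m a. max 0 (Z (Suc k) - Z k))"
    unfolding e by (intro jump_increment monoD[OF m])
qed (simp add: sum_nonneg)

lemma neg_variation_jump_path:
  fixes Z :: "nat \<Rightarrow> real"
  assumes m: "mono m" and e: "\<And>t. extend0 f t = Z (m t)"
  shows "neg_variation f t \<le> ennreal (\<Sum>k<m t. max 0 (Z k - Z (Suc k)))"
proof -
  have "extend0 (\<lambda>s. - f s) t = - Z (m t)" for t using e[of t] by (auto simp: extend0_def split: if_splits)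
  from pos_variation_jump_path[OF m this, of t] show ?thesis unfolding neg_variation_eq by simp
qed

lemma total_variation_jump_path:
  fixes Z :: "nat \<Rightarrow> real"
  assumes m: "mono m" and e: "\<And>t. extend0 f t = Z (m t)"
  shows "total_variation f t < \<infinity>"
proof -
  have "total_variation f t \<le> ennreal ((\<Sum>k<m t. max 0 (Z (Suc k) - Z k)) + (\<Sum>k<m t. max 0 (- Z (Suc k) - (- Z k))))"
  proof (rule total_variation_le)
    fix a b :: real assume "a \<le> b"
    then have "m a \<le> m b" by (rule monoD[OF m])
    from jump_increment[OF this, of Z] jump_increment[OF this, of "\<lambda>k. - Z k"]
    show "\<bar>extend0 f b - extend0 f a\<bar> \<le>
      (\<Sum>k<m b. max 0 (Z (Suc k) - Z k)) + (\<Sum>k<m b. max 0 (- Z (Suc k) - (- Z k)))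
      - ((\<Sum>k<m a. max 0 (Z (Suc k) - Z k)) + (\<Sum>k<m a. max 0 (- Z (Suc k) - (- Z k))))"
      unfolding e by (simp add: abs_le_iff)
  qed (simp add: sum_nonneg add_nonneg_nonneg)
  then show ?thesis by (simp add: le_less_trans)
qed

lemma nat_floor_le_iff: assumes "0 < (h :: real)" "0 \<le> t" shows "k \<le> nat \<lfloor>t / h\<rfloor> \<longleftrightarrow> real k * h \<le> t"
proof -
  have "k \<le> nat \<lfloor>t / h\<rfloor> \<longleftrightarrow> real k \<le> t / h" using assms by (subst le_nat_iff) (auto simp: le_floor_iff)
  then show ?thesis using assms by (simp add: pos_le_divide_eq)
qed

lemma nat_floor_eq_iff:
  assumes "0 < (h :: real)" "0 \<le> t" shows "nat \<lfloor>t / h\<rfloor> = k \<longleftrightarrow> t \<in> {real k * h..<real (Suc k) * h}"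
  using nat_floor_le_iff[OF assms, of k] nat_floor_le_iff[OF assms, of "Suc k"] by (auto simp del: of_nat_Suc)

text \<open>Counterpart of \<open>nn_integral_pos_variation\<close> for jumps at grid times, again
  through tail integrals of the exponential density.\<close>

lemma jump_sum_integral:
  assumes \<rho>: "0 < \<rho>" and h: "0 < h"
  shows "(\<integral>\<^sup>+s\<in>{0..}. ennreal (\<rho> * exp (- \<rho> * s)) * (\<Sum>k. a k * indicator {real k * h..} s) \<partial>lborel)
    = (\<Sum>k. ennreal (exp (- \<rho> * h) ^ k) * a k)"
proof -
  have "(\<integral>\<^sup>+s\<in>{0..}. ennreal (\<rho> * exp (- \<rho> * s)) * (\<Sum>k. a k * indicator {real k * h..} s) \<partial>lborel)
    = (\<integral>\<^sup>+s. (\<Sum>k. a k * (ennreal (\<rho> * exp (- \<rho> * s)) * indicator {real k * h..} s)) \<partial>lborel)"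
  proof (intro nn_integral_cong)
    fix s
    have "ennreal (\<rho> * exp (- \<rho> * s)) * (\<Sum>k. a k * indicator {real k * h..} s) * indicator {0..} s
      = (\<Sum>k. ennreal (\<rho> * exp (- \<rho> * s)) * indicator {0..} s * (a k * indicator {real k * h..} s))"
      by (subst ennreal_suminf_cmult) (simp add: mult_ac)
    also have "\<dots> = (\<Sum>k. a k * (ennreal (\<rho> * exp (- \<rho> * s)) * indicator {real k * h..} s))"
    proof (intro suminf_cong)
      fix k
      have "0 \<le> real k * h" using h by simp
      then show "ennreal (\<rho> * exp (- \<rho> * s)) * indicator {0..} s * (a k * indicator {real k * h..} s)
        = a k * (ennreal (\<rho> * exp (- \<rho> * s)) * indicator {real k * h..} s)"
        by (auto simp: indicator_def mult_ac)
    qed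
    finally show "ennreal (\<rho> * exp (- \<rho> * s)) * (\<Sum>k. a k * indicator {real k * h..} s) * indicator {0..} s
      = (\<Sum>k. a k * (ennreal (\<rho> * exp (- \<rho> * s)) * indicator {real k * h..} s))" .
  qed
  also have "\<dots> = (\<Sum>k. a k * (\<integral>\<^sup>+s\<in>{real k * h..}. ennreal (\<rho> * exp (- \<rho> * s)) \<partial>lborel))"
    by (subst nn_integral_suminf) (auto simp: nn_integral_cmult)
  also have "\<dots> = (\<Sum>k. ennreal (exp (- \<rho> * h) ^ k) * a k)"
  proof (intro suminf_cong)
    fix k
    have "exp (- \<rho> * (real k * h)) = exp (- \<rho> * h) ^ k" by (simp add: exp_of_nat_mult[symmetric] mult_ac)
    then show "a k * (\<integral>\<^sup>+s\<in>{real k * h..}. ennreal (\<rho> * exp (- \<rho> * s)) \<partial>lborel) = ennreal (exp (- \<rho> * h) ^ k) * a k"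
      using exp_tail_integral[OF \<rho>, of "real k * h"] by (simp add: mult.commute)
  qed
  finally show ?thesis .
qed

context capacity_problem
begin

definition gpath :: "real \<Rightarrow> real \<Rightarrow> (nat \<Rightarrow> 'a \<Rightarrow> real) \<Rightarrow> 'a \<Rightarrow> ennreal" where
  "gpath h d C \<omega> = (\<integral>\<^sup>+t\<in>{0..}. ennreal (exp (- \<rho> * t) * g (C (nat \<lfloor>t / h\<rfloor>) \<omega>) (D d t \<omega>)) \<partial>lborel)"

definition vpath :: "real \<Rightarrow> real \<Rightarrow> (nat \<Rightarrow> 'a \<Rightarrow> real) \<Rightarrow> 'a \<Rightarrow> ennreal" where
  "vpath h c C \<omega> = (\<Sum>k. ennreal (exp (- \<rho> * h) ^ k) * ennreal (qc (C k \<omega> - prev c C k \<omega>)))"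

lemma g_comp_meas:
  assumes d: "d \<in> Ob" and w: "\<omega> \<in> space M"
  shows "(\<lambda>t. ennreal (exp (- \<rho> * t) * g b (X d (s + t) \<omega>))) \<in> borel_measurable borel"
proof -
  have "(\<lambda>t. X d (s + t) \<omega>) \<in> borel_measurable borel"
    by (intro borel_measurable_continuous_onI continuous_on_compose2[OF X_cont[OF d w]] continuous_intros) auto
  then have "(\<lambda>t. g b (X d (s + t) \<omega>)) \<in> borel_measurable borel"
    using X_in[OF d w] by (intro measurable_comp_continuous_on[OF g_cont, of "\<lambda>_. b"]) auto
  then show ?thesis by measurable
qed

lemma gpath_blocks:
  assumes h: "0 < h" and d: "d \<in> Ob" and w: "\<omega> \<in> space M"
  shows "gpath h d C \<omega> = (\<Sum>k. ennreal (exp (- \<rho> * h) ^ k) * (\<integral>\<^sup>+u. ennreal (g (C k \<omega>) (X d (real k * h + u) \<omega>)) \<partial>K h))"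
proof -
  let ?\<phi> = "\<lambda>k t. ennreal (exp (- \<rho> * t) * g (C k \<omega>) (X d t \<omega>))"
  have m: "?\<phi> k \<in> borel_measurable borel" for k using g_comp_meas[OF d w, of "C k \<omega>" 0] by simp
  have "gpath h d C \<omega> = (\<integral>\<^sup>+t. (\<Sum>k. ?\<phi> k t * indicator {real k * h..<real (Suc k) * h} t) \<partial>lborel)"
    unfolding gpath_def
  proof (intro nn_integral_cong)
    fix t :: real
    show "ennreal (exp (- \<rho> * t) * g (C (nat \<lfloor>t / h\<rfloor>) \<omega>) (D d t \<omega>)) * indicator {0..} t
      = (\<Sum>k. ?\<phi> k t * indicator {real k * h..<real (Suc k) * h} t)"
    proof (cases "0 \<le> t")
      case True
      have "(\<Sum>k. ?\<phi> k t * indicator {real k * h..<real (Suc k) * h} t)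
        = (\<Sum>k\<in>{nat \<lfloor>t / h\<rfloor>}. ?\<phi> k t * indicator {real k * h..<real (Suc k) * h} t)"
      proof (rule suminf_finite)
        fix k assume "k \<notin> {nat \<lfloor>t / h\<rfloor>}"
        then have "t \<notin> {real k * h..<real (Suc k) * h}" using nat_floor_eq_iff[OF h True, of k] by auto
        then show "?\<phi> k t * indicator {real k * h..<real (Suc k) * h} t = 0" by simp
      qed simp
      also have "\<dots> = ?\<phi> (nat \<lfloor>t / h\<rfloor>) t" using nat_floor_eq_iff[OF h True, of "nat \<lfloor>t / h\<rfloor>"] by simp
      finally show ?thesis using True by (simp add: X_eq)
    next
      case False
      have "t \<notin> {real k * h..<real (Suc k) * h}" for k
      proof -
        have "0 \<le> real k * h" using h by simp
        then show ?thesis using False by (simp del: of_nat_Suc)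
      qed
      then show ?thesis using False by simp
    qed
  qed
  also have "\<dots> = (\<Sum>k. \<integral>\<^sup>+t. ?\<phi> k t * indicator {real k * h..<real (Suc k) * h} t \<partial>lborel)"
    using m by (intro nn_integral_suminf) auto
  also have "\<dots> = (\<Sum>k. ennreal (exp (- \<rho> * h) ^ k) * (\<integral>\<^sup>+u. ennreal (g (C k \<omega>) (X d (real k * h + u) \<omega>)) \<partial>K h))"
  proof (intro suminf_cong)
    fix k
    have mg: "(\<lambda>u. ennreal (g (C k \<omega>) (X d (real k * h + u) \<omega>))) \<in> borel_measurable borel"
    proof -
      have "(\<lambda>t. X d (real k * h + t) \<omega>) \<in> borel_measurable borel"
        by (intro borel_measurable_continuous_onI continuous_on_compose2[OF X_cont[OF d w]] continuous_intros) auto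
      then have "(\<lambda>t. g (C k \<omega>) (X d (real k * h + t) \<omega>)) \<in> borel_measurable borel"
        using X_in[OF d w] by (intro measurable_comp_continuous_on[OF g_cont, of "\<lambda>_. C k \<omega>"]) auto
      then show ?thesis by measurable
    qed
    have "(\<integral>\<^sup>+t. ?\<phi> k t * indicator {real k * h..<real (Suc k) * h} t \<partial>lborel)
      = (\<integral>\<^sup>+u. ?\<phi> k (real k * h + u) * indicator {real k * h..<real (Suc k) * h} (real k * h + u) \<partial>lborel)"
      using m[of k] nn_integral_real_affine[of "\<lambda>t. ?\<phi> k t * indicator {real k * h..<real (Suc k) * h} t" 1 "real k * h"] by simp
    also have "\<dots> = (\<integral>\<^sup>+u. ennreal (exp (- \<rho> * h) ^ k) * (ennreal (exp (- \<rho> * u)) * ennreal (g (C k \<omega>) (X d (real k * h + u) \<omega>)) * indicator {0..<h} u) \<partial>lborel)"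
    proof (intro nn_integral_cong)
      fix u
      have "exp (- \<rho> * (real k * h + u)) = exp (- \<rho> * h) ^ k * exp (- \<rho> * u)"
        by (simp add: exp_of_nat_mult[symmetric] exp_add[symmetric] algebra_simps)
      moreover have "indicator {real k * h..<real (Suc k) * h} (real k * h + u) = (indicator {0..<h} u :: ennreal)"
        by (auto simp: indicator_def algebra_simps)
      ultimately show "?\<phi> k (real k * h + u) * indicator {real k * h..<real (Suc k) * h} (real k * h + u)
        = ennreal (exp (- \<rho> * h) ^ k) * (ennreal (exp (- \<rho> * u)) * ennreal (g (C k \<omega>) (X d (real k * h + u) \<omega>)) * indicator {0..<h} u)"
        by (simp add: ennreal_mult' mult.assoc)
    qed
    also have "\<dots> = ennreal (exp (- \<rho> * h) ^ k) * (\<integral>\<^sup>+u. ennreal (g (C k \<omega>) (X d (real k * h + u) \<omega>)) \<partial>K h)"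
      using mg by (subst nn_integral_K) (auto intro!: nn_integral_cmult)
    finally show "(\<integral>\<^sup>+t. ?\<phi> k t * indicator {real k * h..<real (Suc k) * h} t \<partial>lborel)
      = ennreal (exp (- \<rho> * h) ^ k) * (\<integral>\<^sup>+u. ennreal (g (C k \<omega>) (X d (real k * h + u) \<omega>)) \<partial>K h)" .
  qed
  finally show ?thesis .
qed

lemma K_path_meas:
  assumes d: "d \<in> Ob" and C: "C \<in> borel_measurable M"
  shows "(\<lambda>(u, \<omega>). ennreal (g (C \<omega>) (X d (s + u) \<omega>))) \<in> borel_measurable (K h \<Otimes>\<^sub>M M)"
proof -
  have "(\<lambda>p. ennreal (case p of (u, \<omega>) \<Rightarrow> g (C \<omega>) (X d (s + u) \<omega>))) \<in> borel_measurable (borel \<Otimes>\<^sub>M M)"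
    by (rule measurable_compose[OF comp_X_joint2[OF g_cont d C] measurable_ennreal])
  then show ?thesis by (simp add: case_prod_beta cong: measurable_cong_sets sets_pair_measure_cong)
qed

lemma K_path_int_meas:
  assumes d: "d \<in> Ob" and C: "C \<in> borel_measurable M"
  shows "(\<lambda>\<omega>. \<integral>\<^sup>+u. ennreal (g (C \<omega>) (X d (s + u) \<omega>)) \<partial>K h) \<in> borel_measurable M"
proof (rule sigma_finite_measure.borel_measurable_nn_integral)
  show "sigma_finite_measure (K h)" ..
  show "(\<lambda>(\<omega>, u). ennreal (g (C \<omega>) (X d (s + u) \<omega>))) \<in> borel_measurable (M \<Otimes>\<^sub>M K h)"
    using measurable_pair_swap[OF K_path_meas[OF d C, of s h]] by (simp add: case_prod_beta)
qed

lemma vpath_meas: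
  assumes h: "0 < h" and C: "grid_control h R C" shows "vpath h c C \<in> borel_measurable M"
proof -
  have "(\<lambda>\<omega>. ennreal (exp (- \<rho> * h) ^ k) * ennreal (qc (C k \<omega> - prev c C k \<omega>))) \<in> borel_measurable M" for k
    using grid_meas[OF h C, of k] prev_meas[OF h C, of c k] by measurable
  then show ?thesis unfolding vpath_def by measurable
qed

lemma gpath_meas:
  assumes h: "0 < h" and d: "d \<in> Ob" and C: "grid_control h R C" shows "gpath h d C \<in> borel_measurable M"
proof -
  have "(\<lambda>\<omega>. \<integral>\<^sup>+u. ennreal (g (C k \<omega>) (X d (real k * h + u) \<omega>)) \<partial>K h) \<in> borel_measurable M" for k
    by (rule K_path_int_meas[OF d grid_meas[OF h C]])
  then have "(\<lambda>\<omega>. \<Sum>k. ennreal (exp (- \<rho> * h) ^ k) * (\<integral>\<^sup>+u. ennreal (g (C k \<omega>) (X d (real k * h + u) \<omega>)) \<partial>K h)) \<in> borel_measurable M"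
    by measurable
  then show ?thesis by (rule measurable_cong[THEN iffD1, rotated]) (simp add: gpath_blocks[OF h d])
qed

text \<open>Bridge from operators to paths: Fubini and \<open>markov_time\<close> reduce the
  expected cost over each cell to \<open>L h g\<close> at its grid point. Values in
  \<open>ennreal\<close> accommodate an infinite total cost.\<close>

lemma grid_cost_nn:
  assumes h: "0 < h" and d: "d \<in> Ob" and C: "grid_control h R C" and c: "\<bar>c\<bar> \<le> R"
  shows "(\<integral>\<^sup>+\<omega>. gpath h d C \<omega> \<partial>M) + (\<integral>\<^sup>+\<omega>. vpath h c C \<omega> \<partial>M) = (SUP N. ennreal (grid_cost h d c C N))"
proof -
  interpret pair_sigma_finite "K h" M ..
  let ?r = "exp (- \<rho> * h)"
  define l where "l = (\<lambda>k. LINT \<omega>|M. L h g (C k \<omega>) (X d (real k * h) \<omega>))"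
  define q where "q = (\<lambda>k. LINT \<omega>|M. qc (C k \<omega> - prev c C k \<omega>))"
  have l0: "0 \<le> l k" for k unfolding l_def using g_nonneg X_in[OF d] by (auto intro!: Bochner_Integration.integral_nonneg L_nonneg)
  have q0: "0 \<le> q k" for k unfolding q_def by (auto intro!: Bochner_Integration.integral_nonneg qc_nonneg)
  have gn: "0 \<le> g c d" if "d \<in> Ob" for c d using g_nonneg that by blast
  have CM: "C k \<in> borel_measurable M" for k by (rule grid_meas[OF h C])
  have kh: "0 \<le> real k * h" for k using h by simp
  have CF: "C k \<in> borel_measurable (F (real k * h))" for k using C by (simp add: grid_control_def)
  have gm: "(\<lambda>\<omega>. \<integral>\<^sup>+u. ennreal (g (C k \<omega>) (X d (real k * h + u) \<omega>)) \<partial>K h) \<in> borel_measurable M" for k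
    by (rule K_path_int_meas[OF d CM])
  have G: "(\<integral>\<^sup>+\<omega>. gpath h d C \<omega> \<partial>M) = (\<Sum>k. ennreal (?r ^ k * l k))"
  proof -
    have "(\<integral>\<^sup>+\<omega>. gpath h d C \<omega> \<partial>M)
      = (\<integral>\<^sup>+\<omega>. (\<Sum>k. ennreal (?r ^ k) * (\<integral>\<^sup>+u. ennreal (g (C k \<omega>) (X d (real k * h + u) \<omega>)) \<partial>K h)) \<partial>M)"
      by (intro nn_integral_cong) (simp add: gpath_blocks[OF h d])
    also have "\<dots> = (\<Sum>k. ennreal (?r ^ k) * (\<integral>\<^sup>+\<omega>. \<integral>\<^sup>+u. ennreal (g (C k \<omega>) (X d (real k * h + u) \<omega>)) \<partial>K h \<partial>M))"
      using gm by (subst nn_integral_suminf) (auto intro!: suminf_cong nn_integral_cmult)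
    also have "\<dots> = (\<Sum>k. ennreal (?r ^ k) * ennreal (l k))"
    proof (intro suminf_cong)
      fix k
      have "(\<integral>\<^sup>+\<omega>. \<integral>\<^sup>+u. ennreal (g (C k \<omega>) (X d (real k * h + u) \<omega>)) \<partial>K h \<partial>M)
        = (\<integral>\<^sup>+u. \<integral>\<^sup>+\<omega>. ennreal (g (C k \<omega>) (X d (real k * h + u) \<omega>)) \<partial>M \<partial>K h)"
        by (rule Fubini'[OF K_path_meas[OF d CM]])
      also have "\<dots> = (\<integral>\<^sup>+\<omega>. ennreal (L h g (C k \<omega>) (X d (real k * h) \<omega>)) \<partial>M)"
        by (rule markov_time[OF d kh growth_g_gc(1) gn CF grid_bound[OF h C], symmetric])
      also have "\<dots> = ennreal (l k)" unfolding l_def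
        using gn X_in[OF d]
        by (intro nn_integral_eq_integral growth_integrable[OF growth_L[OF growth_g_gc(1)] d CM grid_bound[OF h C]] AE_I2 L_nonneg) auto
      finally show "ennreal (?r ^ k) * (\<integral>\<^sup>+\<omega>. \<integral>\<^sup>+u. ennreal (g (C k \<omega>) (X d (real k * h + u) \<omega>)) \<partial>K h \<partial>M) = ennreal (?r ^ k) * ennreal (l k)" by simp
    qed
    finally show ?thesis using l0 by (simp add: ennreal_mult')
  qed
  have V: "(\<integral>\<^sup>+\<omega>. vpath h c C \<omega> \<partial>M) = (\<Sum>k. ennreal (?r ^ k * q k))"
  proof -
    have qm: "(\<lambda>\<omega>. ennreal (qc (C k \<omega> - prev c C k \<omega>))) \<in> borel_measurable M" for k
      using CM[of k] prev_meas[OF h C, of c k] by measurable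
    have "(\<integral>\<^sup>+\<omega>. vpath h c C \<omega> \<partial>M) = (\<Sum>k. ennreal (?r ^ k) * (\<integral>\<^sup>+\<omega>. ennreal (qc (C k \<omega> - prev c C k \<omega>)) \<partial>M))"
      unfolding vpath_def using qm by (subst nn_integral_suminf) (auto intro!: suminf_cong nn_integral_cmult)
    also have "\<dots> = (\<Sum>k. ennreal (?r ^ k) * ennreal (q k))"
    proof -
      have "(\<integral>\<^sup>+\<omega>. ennreal (qc (C k \<omega> - prev c C k \<omega>)) \<partial>M) = ennreal (q k)" for k
        unfolding q_def by (intro nn_integral_eq_integral qc_integrable[OF h C c] AE_I2 qc_nonneg)
      then show ?thesis by simp
    qed
    finally show ?thesis using q0 by (simp add: ennreal_mult')
  qed
  have "(\<integral>\<^sup>+\<omega>. gpath h d C \<omega> \<partial>M) + (\<integral>\<^sup>+\<omega>. vpath h c C \<omega> \<partial>M) = (\<Sum>k. ennreal (?r ^ k * l k) + ennreal (?r ^ k * q k))"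
    unfolding G V by (rule suminf_add) auto
  also have "\<dots> = (\<Sum>k. ennreal (?r ^ k * (l k + q k)))"
    using l0 q0 by (intro suminf_cong) (simp add: ennreal_plus[symmetric] distrib_left del: ennreal_plus)
  also have "\<dots> = (SUP N. \<Sum>k<N. ennreal (?r ^ k * (l k + q k)))" by (rule suminf_eq_SUP)
  also have "\<dots> = (SUP N. ennreal (grid_cost h d c C N))"
  proof -
    have "grid_cost h d c C N = (\<Sum>k<N. ?r ^ k * (l k + q k))" for N by (simp add: grid_cost_def l_def q_def)
    then show ?thesis using l0 q0 by (auto intro!: SUP_cong sum_ennreal)
  qed
  finally show ?thesis .
qed

definition step_control :: "real \<Rightarrow> real \<Rightarrow> (nat \<Rightarrow> 'a \<Rightarrow> real) \<Rightarrow> real \<Rightarrow> 'a \<Rightarrow> real" where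
  "step_control h c C t \<omega> = C (nat \<lfloor>t / h\<rfloor>) \<omega> - c"

lemma jumps_as_sum:
  assumes h: "0 < h" and s: "0 \<le> s" and a: "\<And>k. 0 \<le> a k"
  shows "ennreal (\<Sum>k<Suc (nat \<lfloor>s / h\<rfloor>). a k) = (\<Sum>k. ennreal (a k) * indicator {real k * h..} s)"
proof -
  have "(\<Sum>k. ennreal (a k) * indicator {real k * h..} s) = (\<Sum>k<Suc (nat \<lfloor>s / h\<rfloor>). ennreal (a k) * indicator {real k * h..} s)"
  proof (rule suminf_finite)
    fix k assume "k \<notin> {..<Suc (nat \<lfloor>s / h\<rfloor>)}"
    then have "\<not> real k * h \<le> s" using nat_floor_le_iff[OF h s, of k] by auto
    then show "ennreal (a k) * indicator {real k * h..} s = 0" by simp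
  qed simp
  also have "\<dots> = (\<Sum>k<Suc (nat \<lfloor>s / h\<rfloor>). ennreal (a k))"
    using nat_floor_le_iff[OF h s] by (intro sum.cong) (auto simp: less_Suc_eq_le)
  also have "\<dots> = ennreal (\<Sum>k<Suc (nat \<lfloor>s / h\<rfloor>). a k)" using a by (intro sum_ennreal) auto
  finally show ?thesis by simp
qed

text \<open>Brings the jump costs into the form produced by \<open>controls_var_cost\<close>, so
  that costs of step paths and of general controls are compared integrand by integrand.\<close>

lemma vpath_eq_integral:
  assumes h: "0 < h"
  shows "vpath h c C \<omega> = (\<integral>\<^sup>+s\<in>{0..}. ennreal (\<rho> * exp (- \<rho> * s)) *
     (ennreal q0p * ennreal (\<Sum>k<Suc (nat \<lfloor>s / h\<rfloor>). max 0 (C k \<omega> - prev c C k \<omega>))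
      + ennreal q0m * ennreal (\<Sum>k<Suc (nat \<lfloor>s / h\<rfloor>). max 0 (prev c C k \<omega> - C k \<omega>))) \<partial>lborel)"
proof -
  have "vpath h c C \<omega> = (\<integral>\<^sup>+s\<in>{0..}. ennreal (\<rho> * exp (- \<rho> * s)) * (\<Sum>k. ennreal (qc (C k \<omega> - prev c C k \<omega>)) * indicator {real k * h..} s) \<partial>lborel)"
    unfolding vpath_def by (rule jump_sum_integral[OF rho_pos h, symmetric])
  also have "\<dots> = (\<integral>\<^sup>+s\<in>{0..}. ennreal (\<rho> * exp (- \<rho> * s)) *
     (ennreal q0p * ennreal (\<Sum>k<Suc (nat \<lfloor>s / h\<rfloor>). max 0 (C k \<omega> - prev c C k \<omega>))
      + ennreal q0m * ennreal (\<Sum>k<Suc (nat \<lfloor>s / h\<rfloor>). max 0 (prev c C k \<omega> - C k \<omega>))) \<partial>lborel)"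
  proof (intro nn_integral_cong)
    fix s :: real
    show "ennreal (\<rho> * exp (- \<rho> * s)) * (\<Sum>k. ennreal (qc (C k \<omega> - prev c C k \<omega>)) * indicator {real k * h..} s) * indicator {0..} s
      = ennreal (\<rho> * exp (- \<rho> * s)) * (ennreal q0p * ennreal (\<Sum>k<Suc (nat \<lfloor>s / h\<rfloor>). max 0 (C k \<omega> - prev c C k \<omega>))
      + ennreal q0m * ennreal (\<Sum>k<Suc (nat \<lfloor>s / h\<rfloor>). max 0 (prev c C k \<omega> - C k \<omega>))) * indicator {0..} s"
    proof (cases "0 \<le> s")
      case True
      have "(\<Sum>k. ennreal (qc (C k \<omega> - prev c C k \<omega>)) * indicator {real k * h..} s)
        = ennreal (\<Sum>k<Suc (nat \<lfloor>s / h\<rfloor>). qc (C k \<omega> - prev c C k \<omega>))"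
        by (rule jumps_as_sum[OF h True qc_nonneg, symmetric])
      also have "(\<Sum>k<Suc (nat \<lfloor>s / h\<rfloor>). qc (C k \<omega> - prev c C k \<omega>))
        = q0p * (\<Sum>k<Suc (nat \<lfloor>s / h\<rfloor>). max 0 (C k \<omega> - prev c C k \<omega>)) + q0m * (\<Sum>k<Suc (nat \<lfloor>s / h\<rfloor>). max 0 (prev c C k \<omega> - C k \<omega>))"
        unfolding qc_def sum.distrib sum_distrib_left by simp
      also have "ennreal \<dots> = ennreal q0p * ennreal (\<Sum>k<Suc (nat \<lfloor>s / h\<rfloor>). max 0 (C k \<omega> - prev c C k \<omega>))
        + ennreal q0m * ennreal (\<Sum>k<Suc (nat \<lfloor>s / h\<rfloor>). max 0 (prev c C k \<omega> - C k \<omega>))"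
        using q0p_pos q0m_pos by (subst ennreal_plus) (auto simp: ennreal_mult' sum_nonneg simp del: sum.lessThan_Suc)
      finally show ?thesis by (simp only:)
    qed simp
  qed
  finally show ?thesis .
qed

lemma controls_var_cost:
  assumes I: "I \<in> controls M F" and w: "\<omega> \<in> space M"
  shows "(\<integral>\<^sup>+t\<in>{0..}. ennreal (exp (- \<rho> * t) * q0p) \<partial>(dI_plus I \<omega>))
     + (\<integral>\<^sup>+t\<in>{0..}. ennreal (exp (- \<rho> * t) * q0m) \<partial>(dI_minus I \<omega>))
    = (\<integral>\<^sup>+s\<in>{0..}. ennreal (\<rho> * exp (- \<rho> * s)) * (ennreal q0p * pos_variation (\<lambda>s. I s \<omega>) s) \<partial>lborel)
     + (\<integral>\<^sup>+s\<in>{0..}. ennreal (\<rho> * exp (- \<rho> * s)) * (ennreal q0m * neg_variation (\<lambda>s. I s \<omega>) s) \<partial>lborel)"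
proof -
  have rc: "continuous (at_right t) (\<lambda>s. I s \<omega>)" if "0 \<le> t" for t
    using I w that unfolding controls_def cadlag_def by blast
  have tv: "total_variation (\<lambda>s. I s \<omega>) t < \<infinity>" for t
  proof (cases "0 \<le> t")
    case True then show ?thesis using I w unfolding controls_def by blast
  next
    case False
    then have "total_variation (\<lambda>s. I s \<omega>) t \<le> ennreal 0"
      by (intro total_variation_le[where p = "\<lambda>_. 0"]) (auto simp: extend0_def)
    then show ?thesis by (simp add: le_less_trans)
  qed
  have p: "pos_variation (\<lambda>s. I s \<omega>) t < \<infinity>" for t using pos_variation_le_total tv by (rule le_less_trans)
  have n: "pos_variation (\<lambda>s. - I s \<omega>) t < \<infinity>" for t
    using le_less_trans[OF pos_variation_le_total, of "\<lambda>s. - I s \<omega>"] tv by (simp add: total_variation_neg)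
  have rcn: "continuous (at_right t) (\<lambda>s. - I s \<omega>)" if "0 \<le> t" for t using rc[OF that] by (rule continuous_minus)
  show ?thesis
    unfolding dI_plus_def dI_minus_def neg_variation_eq
    using q0p_pos q0m_pos nn_integral_pos_variation[OF p rc rho_pos, of q0p] nn_integral_pos_variation[OF n rcn rho_pos, of q0m] by simp
qed

lemma eventually_floor_right:
  assumes h: "0 < h" shows "eventually (\<lambda>s. \<lfloor>s / h\<rfloor> = \<lfloor>t / h\<rfloor>) (at_right (t :: real))"
proof -
  have "t < (of_int \<lfloor>t / h\<rfloor> + 1) * h" using h by (simp add: pos_divide_less_eq[symmetric])
  moreover have "\<lfloor>s / h\<rfloor> = \<lfloor>t / h\<rfloor>" if s: "t < s" "s < (of_int \<lfloor>t / h\<rfloor> + 1) * h" for s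
  proof -
    have "t / h \<le> s / h" using s h by (intro divide_right_mono) auto
    moreover have "s / h < of_int \<lfloor>t / h\<rfloor> + 1" using s h by (simp add: pos_divide_less_eq)
    ultimately show ?thesis by linarith
  qed
  ultimately show ?thesis unfolding eventually_at_right_field by blast
qed

lemma eventually_floor_left:
  assumes h: "0 < h" shows "\<exists>m. eventually (\<lambda>s. \<lfloor>s / h\<rfloor> = m) (at_left (t :: real))"
proof (intro exI)
  have l: "(of_int \<lceil>t / h\<rceil> - 1) * h < t"
  proof -
    have "of_int \<lceil>t / h\<rceil> - 1 < t / h" by linarith
    then show ?thesis using h by (simp add: pos_less_divide_eq)
  qed
  have "\<lfloor>s / h\<rfloor> = \<lceil>t / h\<rceil> - 1" if s: "(of_int \<lceil>t / h\<rceil> - 1) * h < s" "s < t" for s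
  proof -
    have "s / h < t / h" using s h by (intro divide_strict_right_mono) auto
    moreover have "of_int \<lceil>t / h\<rceil> - 1 < s / h" using s h by (simp add: pos_less_divide_eq)
    ultimately show ?thesis by linarith
  qed
  then show "eventually (\<lambda>s. \<lfloor>s / h\<rfloor> = \<lceil>t / h\<rceil> - 1) (at_left t)"
    unfolding eventually_at_left_field using l by blast
qed

text \<open>
  Index \<open>0\<close> of \<open>jump_value\<close> is the extension of the path to negative times; \<open>i\<close> in \<open>jump_count\<close> is a shift
  of the path by \<open>i\<close> grid steps towards time \<open>0\<close>.
\<close>

definition jump_value :: "real \<Rightarrow> (nat \<Rightarrow> 'a \<Rightarrow> real) \<Rightarrow> 'a \<Rightarrow> nat \<Rightarrow> real" where
  "jump_value c C \<omega> k = (case k of 0 \<Rightarrow> 0 | Suc j \<Rightarrow> C j \<omega> - c)"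

lemma jump_value_diff: "jump_value c C \<omega> (Suc k) - jump_value c C \<omega> k = C k \<omega> - prev c C k \<omega>"
  by (cases k) (auto simp: jump_value_def prev_def)

definition jump_count :: "nat \<Rightarrow> real \<Rightarrow> real \<Rightarrow> nat" where
  "jump_count i h t = (if t < 0 then 0 else Suc (nat \<lfloor>t / h\<rfloor>) + i)"

lemma mono_jump_count: assumes h: "0 < h" shows "mono (jump_count i h)"
proof (rule monoI)
  fix a b :: real assume "a \<le> b"
  then have "a / h \<le> b / h" using h by (intro divide_right_mono) auto
  then have "nat \<lfloor>a / h\<rfloor> \<le> nat \<lfloor>b / h\<rfloor>" by (intro nat_mono floor_mono)
  then show "jump_count i h a \<le> jump_count i h b" using \<open>a \<le> b\<close> by (auto simp: jump_count_def)
qed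

lemma step_control_jump: "extend0 (\<lambda>s. step_control h c C s \<omega>) t = jump_value c C \<omega> (jump_count 0 h t)"
  by (auto simp: extend0_def step_control_def jump_value_def jump_count_def)

lemma step_control_variation:
  assumes h: "0 < h" and t: "0 \<le> t"
  shows "pos_variation (\<lambda>s. step_control h c C s \<omega>) t \<le> ennreal (\<Sum>k<Suc (nat \<lfloor>t / h\<rfloor>). max 0 (C k \<omega> - prev c C k \<omega>))"
    "neg_variation (\<lambda>s. step_control h c C s \<omega>) t \<le> ennreal (\<Sum>k<Suc (nat \<lfloor>t / h\<rfloor>). max 0 (prev c C k \<omega> - C k \<omega>))"
    "total_variation (\<lambda>s. step_control h c C s \<omega>) t < \<infinity>"
proof -
  have J3: "jump_value c C \<omega> k - jump_value c C \<omega> (Suc k) = prev c C k \<omega> - C k \<omega>" for k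
    using jump_value_diff[of c C \<omega> k] by linarith
  have jc: "jump_count 0 h t = Suc (nat \<lfloor>t / h\<rfloor>)" using t by (simp add: jump_count_def)
  show "pos_variation (\<lambda>s. step_control h c C s \<omega>) t \<le> ennreal (\<Sum>k<Suc (nat \<lfloor>t / h\<rfloor>). max 0 (C k \<omega> - prev c C k \<omega>))"
    using pos_variation_jump_path[OF mono_jump_count[OF h] step_control_jump, of c C \<omega> t] unfolding jump_value_diff jc .
  show "neg_variation (\<lambda>s. step_control h c C s \<omega>) t \<le> ennreal (\<Sum>k<Suc (nat \<lfloor>t / h\<rfloor>). max 0 (prev c C k \<omega> - C k \<omega>))"
    using neg_variation_jump_path[OF mono_jump_count[OF h] step_control_jump, of c C \<omega> t] unfolding J3 jc .
  show "total_variation (\<lambda>s. step_control h c C s \<omega>) t < \<infinity>"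
    by (rule total_variation_jump_path[OF mono_jump_count[OF h] step_control_jump])
qed

lemma step_control_in_controls:
  assumes h: "0 < h" and C: "grid_control h R C"
  shows "step_control h c C \<in> controls M F"
  unfolding controls_def
proof (intro CollectI conjI ballI allI impI)
  show "adapted F (step_control h c C)"
    unfolding adapted_def
  proof (intro allI impI)
    fix t :: real assume t: "0 \<le> t"
    let ?k = "nat \<lfloor>t / h\<rfloor>"
    have "real ?k * h \<le> t" using nat_floor_le_iff[OF h t, of ?k] by simp
    moreover have "C ?k \<in> borel_measurable (F (real ?k * h))" using C by (simp add: grid_control_def)
    ultimately have "C ?k \<in> borel_measurable (F t)" using h by (intro measurable_F_mono[of "real ?k * h" t]) auto
    then show "step_control h c C t \<in> borel_measurable (F t)" unfolding step_control_def by measurable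
  qed
  fix \<omega> assume "\<omega> \<in> space M"
  show "cadlag (\<lambda>t. step_control h c C t \<omega>)"
    unfolding cadlag_def
  proof (intro conjI allI impI)
    fix t :: real
    have "eventually (\<lambda>s. step_control h c C s \<omega> = step_control h c C t \<omega>) (at_right t)"
      using eventually_floor_right[OF h, of t] by eventually_elim (simp add: step_control_def)
    then show "continuous (at_right t) (\<lambda>s. step_control h c C s \<omega>)"
      unfolding continuous_within by (rule tendsto_eventually)
  next
    fix t :: real
    obtain m where m: "eventually (\<lambda>s. \<lfloor>s / h\<rfloor> = m) (at_left t)" using eventually_floor_left[OF h] by blast
    have "eventually (\<lambda>s. step_control h c C s \<omega> = C (nat m) \<omega> - c) (at_left t)"
      using m by eventually_elim (simp add: step_control_def)
    then show "\<exists>l. ((\<lambda>s. step_control h c C s \<omega>) \<longlongrightarrow> l) (at_left t)"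
      by (intro exI[of _ "C (nat m) \<omega> - c"] tendsto_eventually)
  qed
  show "total_variation (\<lambda>s. step_control h c C s \<omega>) t < \<infinity>" if "0 \<le> t" for t
    by (rule step_control_variation(3)[OF h that])
qed

text \<open>A grid control is an admissible step path whose variation is at most the sum of its
  jumps, so its cost is at most the supremum of the grid costs.\<close>

lemma value_le_grid:
  assumes h: "0 < h" and d: "d \<in> Ob" and C: "grid_control h R C" and c: "\<bar>c\<bar> \<le> R"
    and B: "\<And>N. grid_cost h d c C N \<le> B"
  shows "value_fun M F D g \<rho> q0p q0m c d \<le> ennreal B"
proof -
  let ?I = "step_control h c C"
  have I: "?I \<in> controls M F" by (rule step_control_in_controls[OF h C])
  have le: "(\<integral>\<^sup>+t\<in>{0..}. ennreal (exp (- \<rho> * t) * g (capacity c ?I t \<omega>) (D d t \<omega>)) \<partial>lborel)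
        + (\<integral>\<^sup>+t\<in>{0..}. ennreal (exp (- \<rho> * t) * q0p) \<partial>(dI_plus ?I \<omega>))
        + (\<integral>\<^sup>+t\<in>{0..}. ennreal (exp (- \<rho> * t) * q0m) \<partial>(dI_minus ?I \<omega>))
      \<le> gpath h d C \<omega> + vpath h c C \<omega>" if w: "\<omega> \<in> space M" for \<omega>
  proof -
    let ?a = "\<lambda>s. \<Sum>k<Suc (nat \<lfloor>s / h\<rfloor>). max 0 (C k \<omega> - prev c C k \<omega>)"
    let ?b = "\<lambda>s. \<Sum>k<Suc (nat \<lfloor>s / h\<rfloor>). max 0 (prev c C k \<omega> - C k \<omega>)"
    have m: "?a \<in> borel_measurable borel" "?b \<in> borel_measurable borel"
    proof -
      have "(\<lambda>s. \<lfloor>s / h\<rfloor>) \<in> measurable borel (count_space UNIV)" by measurable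
      from measurable_compose[OF this, of "\<lambda>i. \<Sum>k<Suc (nat i). max 0 (C k \<omega> - prev c C k \<omega>)" borel]
        measurable_compose[OF this, of "\<lambda>i. \<Sum>k<Suc (nat i). max 0 (prev c C k \<omega> - C k \<omega>)" borel]
      show "?a \<in> borel_measurable borel" "?b \<in> borel_measurable borel" by auto
    qed
    have "(\<integral>\<^sup>+s\<in>{0..}. ennreal (\<rho> * exp (- \<rho> * s)) * (ennreal q0p * pos_variation (\<lambda>s. ?I s \<omega>) s) \<partial>lborel)
       + (\<integral>\<^sup>+s\<in>{0..}. ennreal (\<rho> * exp (- \<rho> * s)) * (ennreal q0m * neg_variation (\<lambda>s. ?I s \<omega>) s) \<partial>lborel)
      \<le> (\<integral>\<^sup>+s\<in>{0..}. ennreal (\<rho> * exp (- \<rho> * s)) * (ennreal q0p * ennreal (?a s)) \<partial>lborel)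
       + (\<integral>\<^sup>+s\<in>{0..}. ennreal (\<rho> * exp (- \<rho> * s)) * (ennreal q0m * ennreal (?b s)) \<partial>lborel)"
      using step_control_variation(1,2)[OF h, of _ c C \<omega>]
      by (intro add_mono nn_integral_mono) (auto simp: indicator_def intro!: mult_left_mono simp del: sum.lessThan_Suc)
    also have "\<dots> = (\<integral>\<^sup>+s. ennreal (\<rho> * exp (- \<rho> * s)) * (ennreal q0p * ennreal (?a s)) * indicator {0..} s
        + ennreal (\<rho> * exp (- \<rho> * s)) * (ennreal q0m * ennreal (?b s)) * indicator {0..} s \<partial>lborel)"
      using m by (intro nn_integral_add[symmetric]) auto
    also have "\<dots> = vpath h c C \<omega>"
      unfolding vpath_eq_integral[OF h] by (intro nn_integral_cong) (simp add: algebra_simps del: sum.lessThan_Suc)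
    finally have "(\<integral>\<^sup>+t\<in>{0..}. ennreal (exp (- \<rho> * t) * q0p) \<partial>(dI_plus ?I \<omega>))
        + (\<integral>\<^sup>+t\<in>{0..}. ennreal (exp (- \<rho> * t) * q0m) \<partial>(dI_minus ?I \<omega>)) \<le> vpath h c C \<omega>"
      unfolding controls_var_cost[OF I w] .
    moreover have "(\<integral>\<^sup>+t\<in>{0..}. ennreal (exp (- \<rho> * t) * g (capacity c ?I t \<omega>) (D d t \<omega>)) \<partial>lborel) = gpath h d C \<omega>"
      unfolding gpath_def capacity_def step_control_def by simp
    ultimately show ?thesis by (simp add: add.assoc add_left_mono)
  qed
  have "value_fun M F D g \<rho> q0p q0m c d \<le> cost M D g \<rho> q0p q0m c d ?I"
    unfolding value_fun_def using I by (rule INF_lower)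
  also have "\<dots> \<le> (\<integral>\<^sup>+\<omega>. gpath h d C \<omega> + vpath h c C \<omega> \<partial>M)" unfolding cost_def by (intro nn_integral_mono le)
  also have "\<dots> = (SUP N. ennreal (grid_cost h d c C N))"
    using grid_cost_nn[OF h d C c] gpath_meas[OF h d C] vpath_meas[OF h C] by (simp add: nn_integral_add)
  also have "\<dots> \<le> ennreal B" using B by (intro SUP_least ennreal_leI)
  finally show ?thesis .
qed

definition clamp :: "real \<Rightarrow> real \<Rightarrow> real" where "clamp R x = max (- R) (min R x)"

definition disc :: "real \<Rightarrow> real \<Rightarrow> real \<Rightarrow> (real \<Rightarrow> 'a \<Rightarrow> real) \<Rightarrow> nat \<Rightarrow> 'a \<Rightarrow> real" where
  "disc h R c I k \<omega> = clamp R (c + I (real k * h) \<omega>)"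

lemma disc_grid:
  assumes h: "0 < h" and I: "I \<in> controls M F" and R: "0 \<le> R" shows "grid_control h R (disc h R c I)"
  unfolding grid_control_def
proof (intro conjI allI ballI)
  fix k
  have "I (real k * h) \<in> borel_measurable (F (real k * h))" using I h by (simp add: controls_def adapted_def)
  then show "disc h R c I k \<in> borel_measurable (F (real k * h))" unfolding disc_def clamp_def by measurable
  show "\<bar>disc h R c I k \<omega>\<bar> \<le> R" for \<omega> using R by (auto simp: disc_def clamp_def abs_le_iff)
qed

text \<open>Sampling at grid times passes to a partition, and the clamp is a nondecreasing
  contraction, so neither kind of variation can increase. Since the clamp fixes \<open>c\<close>,
  this includes the jump at time \<open>0\<close>.\<close>

lemma disc_variation:
  assumes h: "0 < h" and c: "\<bar>c\<bar> \<le> R" and s: "0 \<le> s"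
  shows "ennreal (\<Sum>k<Suc (nat \<lfloor>s / h\<rfloor>). max 0 (disc h R c I k \<omega> - prev c (disc h R c I) k \<omega>)) \<le> pos_variation (\<lambda>s. I s \<omega>) s"
    "ennreal (\<Sum>k<Suc (nat \<lfloor>s / h\<rfloor>). max 0 (prev c (disc h R c I) k \<omega> - disc h R c I k \<omega>)) \<le> neg_variation (\<lambda>s. I s \<omega>) s"
proof -
  define e where "e = extend0 (\<lambda>s. I s \<omega>)"
  \<comment> \<open>Index \<open>0\<close> stands for a time before \<open>0\<close>, where the
    extended path is \<open>0\<close>; the first increment is then the jump at time
    \<open>0\<close>.\<close>
  define p where "p = (\<lambda>k. case k of 0 \<Rightarrow> (-1 :: real) | Suc j \<Rightarrow> real j * h)"
  have cl: "clamp R c = c" using c by (simp add: clamp_def abs_le_iff)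
  have j0: "0 \<le> real j * h" for j using h by simp
  have D: "disc h R c I k \<omega> = clamp R (c + e (p (Suc k)))" "prev c (disc h R c I) k \<omega> = clamp R (c + e (p k))" for k
  proof -
    have e: "e (p 0) = 0" "e (p (Suc j)) = I (real j * h) \<omega>" for j
      using j0[of j] by (simp_all add: e_def p_def extend0_def)
    show "disc h R c I k \<omega> = clamp R (c + e (p (Suc k)))" by (simp only: disc_def e)
    show "prev c (disc h R c I) k \<omega> = clamp R (c + e (p k))"
      by (cases k) (simp_all only: prev_def nat.case disc_def e add_0_right cl)
  qed
  have mx: "max 0 (clamp R (c + a) - clamp R (c + b)) \<le> max 0 (a - b)" for a b
    unfolding clamp_def by (simp add: max_def min_def)
  let ?n = "Suc (nat \<lfloor>s / h\<rfloor>)"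
  have pm: "p i \<le> p (Suc i)" for i using h by (cases i) (auto simp: p_def algebra_simps)
  have pn: "p ?n \<le> s" using nat_floor_le_iff[OF h s, of "nat \<lfloor>s / h\<rfloor>"] by (simp add: p_def)
  have "(\<Sum>k<?n. max 0 (disc h R c I k \<omega> - prev c (disc h R c I) k \<omega>)) \<le> (\<Sum>k<?n. max 0 (e (p (Suc k)) - e (p k)))"
    unfolding D by (intro sum_mono mx)
  then have "ennreal (\<Sum>k<?n. max 0 (disc h R c I k \<omega> - prev c (disc h R c I) k \<omega>)) \<le> (\<Sum>k<?n. ennreal (max 0 (e (p (Suc k)) - e (p k))))"
    by (subst sum_ennreal) (auto intro: ennreal_leI)
  also have "\<dots> \<le> pos_variation (\<lambda>s. I s \<omega>) s" unfolding e_def by (rule sum_le_pos_variation) (rule pm pn)+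
  finally show "ennreal (\<Sum>k<?n. max 0 (disc h R c I k \<omega> - prev c (disc h R c I) k \<omega>)) \<le> pos_variation (\<lambda>s. I s \<omega>) s" .
  have ne: "extend0 (\<lambda>s. - I s \<omega>) r = - e r" for r by (simp add: e_def extend0_def)
  have "(\<Sum>k<?n. max 0 (prev c (disc h R c I) k \<omega> - disc h R c I k \<omega>)) \<le> (\<Sum>k<?n. max 0 (- e (p (Suc k)) - (- e (p k))))"
    unfolding D by (intro sum_mono) (use mx in simp)
  then have "ennreal (\<Sum>k<?n. max 0 (prev c (disc h R c I) k \<omega> - disc h R c I k \<omega>)) \<le> (\<Sum>k<?n. ennreal (max 0 (- e (p (Suc k)) - (- e (p k)))))"
    by (subst sum_ennreal) (auto intro: ennreal_leI)
  also have "\<dots> \<le> pos_variation (\<lambda>s. - I s \<omega>) s"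
    using sum_le_pos_variation[of ?n p s "\<lambda>s. - I s \<omega>"] pm pn unfolding ne by blast
  finally show "ennreal (\<Sum>k<?n. max 0 (prev c (disc h R c I) k \<omega> - disc h R c I k \<omega>)) \<le> neg_variation (\<lambda>s. I s \<omega>) s"
    unfolding neg_variation_eq .
qed

lemma disc_vpath:
  assumes h: "0 < h" and c: "\<bar>c\<bar> \<le> R" and I: "I \<in> controls M F" and w: "\<omega> \<in> space M"
  shows "vpath h c (disc h R c I) \<omega> \<le> (\<integral>\<^sup>+t\<in>{0..}. ennreal (exp (- \<rho> * t) * q0p) \<partial>(dI_plus I \<omega>))
        + (\<integral>\<^sup>+t\<in>{0..}. ennreal (exp (- \<rho> * t) * q0m) \<partial>(dI_minus I \<omega>))"
proof -
  let ?C = "disc h R c I"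
  let ?a = "\<lambda>s. \<Sum>k<Suc (nat \<lfloor>s / h\<rfloor>). max 0 (?C k \<omega> - prev c ?C k \<omega>)"
  let ?b = "\<lambda>s. \<Sum>k<Suc (nat \<lfloor>s / h\<rfloor>). max 0 (prev c ?C k \<omega> - ?C k \<omega>)"
  have m: "?a \<in> borel_measurable borel" "?b \<in> borel_measurable borel"
  proof -
    have "(\<lambda>s. \<lfloor>s / h\<rfloor>) \<in> measurable borel (count_space UNIV)" by measurable
    from measurable_compose[OF this, of "\<lambda>i. \<Sum>k<Suc (nat i). max 0 (?C k \<omega> - prev c ?C k \<omega>)" borel]
      measurable_compose[OF this, of "\<lambda>i. \<Sum>k<Suc (nat i). max 0 (prev c ?C k \<omega> - ?C k \<omega>)" borel]
    show "?a \<in> borel_measurable borel" "?b \<in> borel_measurable borel" by auto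
  qed
  have "vpath h c ?C \<omega> = (\<integral>\<^sup>+s. ennreal (\<rho> * exp (- \<rho> * s)) * (ennreal q0p * ennreal (?a s)) * indicator {0..} s
      + ennreal (\<rho> * exp (- \<rho> * s)) * (ennreal q0m * ennreal (?b s)) * indicator {0..} s \<partial>lborel)"
    unfolding vpath_eq_integral[OF h] by (intro nn_integral_cong) (simp add: algebra_simps del: sum.lessThan_Suc)
  also have "\<dots> = (\<integral>\<^sup>+s\<in>{0..}. ennreal (\<rho> * exp (- \<rho> * s)) * (ennreal q0p * ennreal (?a s)) \<partial>lborel)
       + (\<integral>\<^sup>+s\<in>{0..}. ennreal (\<rho> * exp (- \<rho> * s)) * (ennreal q0m * ennreal (?b s)) \<partial>lborel)"
    using m by (intro nn_integral_add) auto
  also have "\<dots> \<le> (\<integral>\<^sup>+s\<in>{0..}. ennreal (\<rho> * exp (- \<rho> * s)) * (ennreal q0p * pos_variation (\<lambda>s. I s \<omega>) s) \<partial>lborel)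
       + (\<integral>\<^sup>+s\<in>{0..}. ennreal (\<rho> * exp (- \<rho> * s)) * (ennreal q0m * neg_variation (\<lambda>s. I s \<omega>) s) \<partial>lborel)"
    using disc_variation[OF h c, of _ I \<omega>]
    by (intro add_mono nn_integral_mono) (auto simp: indicator_def intro!: mult_left_mono simp del: sum.lessThan_Suc)
  finally show ?thesis unfolding controls_var_cost[OF I w] .
qed

section \<open>Convergence of the discretised problem\<close>

text \<open>Dominated convergence is used once in time and once in \<open>\<omega>\<close>, because
  convergence is available path by path for almost every time.\<close>

lemma double_dominated:
  fixes f :: "nat \<Rightarrow> real \<Rightarrow> 'a \<Rightarrow> ennreal"
  assumes f: "\<And>n. (\<lambda>(t, \<omega>). f n t \<omega>) \<in> borel_measurable (lborel \<Otimes>\<^sub>M M)"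
    and f': "(\<lambda>(t, \<omega>). f' t \<omega>) \<in> borel_measurable (lborel \<Otimes>\<^sub>M M)"
    and w: "(\<lambda>(t, \<omega>). w t \<omega>) \<in> borel_measurable (lborel \<Otimes>\<^sub>M M)"
    and dom: "\<And>n \<omega> t. \<omega> \<in> space M \<Longrightarrow> f n t \<omega> \<le> w t \<omega>"
    and lim: "\<And>\<omega>. \<omega> \<in> space M \<Longrightarrow> AE t in lborel. (\<lambda>n. f n t \<omega>) \<longlonglongrightarrow> f' t \<omega>"
    and fin: "(\<integral>\<^sup>+\<omega>. \<integral>\<^sup>+t. w t \<omega> \<partial>lborel \<partial>M) < \<infinity>"
  shows "(\<lambda>n. \<integral>\<^sup>+\<omega>. \<integral>\<^sup>+t. f n t \<omega> \<partial>lborel \<partial>M) \<longlonglongrightarrow> (\<integral>\<^sup>+\<omega>. \<integral>\<^sup>+t. f' t \<omega> \<partial>lborel \<partial>M)"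
proof -
  have outer: "(\<lambda>\<omega>. \<integral>\<^sup>+t. h t \<omega> \<partial>lborel) \<in> borel_measurable M"
    if h: "(\<lambda>(t, \<omega>). h t \<omega>) \<in> borel_measurable (lborel \<Otimes>\<^sub>M M)" for h :: "real \<Rightarrow> 'a \<Rightarrow> ennreal"
  proof (rule lborel.borel_measurable_nn_integral)
    show "(\<lambda>(\<omega>, t). h t \<omega>) \<in> borel_measurable (M \<Otimes>\<^sub>M lborel)"
      using measurable_pair_swap[OF h] by (simp add: case_prod_beta)
  qed
  have inner: "(\<lambda>t. h t \<omega>) \<in> borel_measurable lborel"
    if h: "(\<lambda>(t, \<omega>). h t \<omega>) \<in> borel_measurable (lborel \<Otimes>\<^sub>M M)" and "\<omega> \<in> space M" for h :: "real \<Rightarrow> 'a \<Rightarrow> ennreal" and \<omega>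
    using measurable_compose[OF measurable_Pair2'[OF that(2)] h] by simp
  have AEfin: "AE \<omega> in M. (\<integral>\<^sup>+t. w t \<omega> \<partial>lborel) \<noteq> \<infinity>"
    using fin outer[OF w] by (intro nn_integral_PInf_AE) auto
  show ?thesis
  proof (rule nn_integral_dominated_convergence[where w = "\<lambda>\<omega>. \<integral>\<^sup>+t. w t \<omega> \<partial>lborel"])
    show "AE \<omega> in M. (\<integral>\<^sup>+t. f n t \<omega> \<partial>lborel) \<le> (\<integral>\<^sup>+t. w t \<omega> \<partial>lborel)" for n
      using dom by (intro AE_I2 nn_integral_mono) auto
    show "AE \<omega> in M. (\<lambda>n. \<integral>\<^sup>+t. f n t \<omega> \<partial>lborel) \<longlonglongrightarrow> (\<integral>\<^sup>+t. f' t \<omega> \<partial>lborel)"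
      using AEfin AE_space
    proof eventually_elim
      case (elim \<omega>)
      show ?case
      proof (rule nn_integral_dominated_convergence[where w = "\<lambda>t. w t \<omega>"])
        show "(\<integral>\<^sup>+t. w t \<omega> \<partial>lborel) < \<infinity>" using elim(1) by (simp add: less_top)
        show "AE t in lborel. (\<lambda>n. f n t \<omega>) \<longlonglongrightarrow> f' t \<omega>" by (rule lim[OF elim(2)])
      qed (use inner[OF f elim(2)] inner[OF f' elim(2)] inner[OF w elim(2)] dom[OF elim(2)] in auto)
    qed
  qed (use outer[OF f] outer[OF f'] outer[OF w] fin in auto)
qed

lemma g_joint:
  assumes d: "d \<in> Ob" and Z: "(\<lambda>(t, \<omega>). Z t \<omega>) \<in> borel_measurable (lborel \<Otimes>\<^sub>M M)"
  shows "(\<lambda>(t, \<omega>). ennreal (exp (- \<rho> * t) * g (Z t \<omega>) (X d t \<omega>)) * indicator {0..} t) \<in> borel_measurable (lborel \<Otimes>\<^sub>M M)"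
proof -
  have "(\<lambda>p. X d (fst p) (snd p)) \<in> borel_measurable (lborel \<Otimes>\<^sub>M M)"
    using X_joint[OF d] by (simp add: case_prod_beta cong: measurable_cong_sets sets_pair_measure_cong)
  then have "(\<lambda>p. g (Z (fst p) (snd p)) (X d (fst p) (snd p))) \<in> borel_measurable (lborel \<Otimes>\<^sub>M M)"
    using Z X_in[OF d] by (intro measurable_comp_continuous_on[OF g_cont, of "\<lambda>p. Z (fst p) (snd p)"])
      (auto simp: case_prod_beta space_pair_measure)
  then have "(\<lambda>p. ennreal (exp (- \<rho> * fst p) * g (Z (fst p) (snd p)) (X d (fst p) (snd p))) * indicator {0..} (fst p)) \<in> borel_measurable (lborel \<Otimes>\<^sub>M M)"
    by measurable
  then show ?thesis by (simp add: case_prod_beta)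
qed

text \<open>Freezing the control before time \<open>0\<close> makes its paths right-continuous on
  the whole line.\<close>

lemma control_joint:
  assumes I: "I \<in> controls M F"
  shows "(\<lambda>(t, \<omega>). I (max 0 t) \<omega>) \<in> borel_measurable (lborel \<Otimes>\<^sub>M M)"
proof -
  have "(\<lambda>(t, \<omega>). I (max 0 t) \<omega>) \<in> borel_measurable (borel \<Otimes>\<^sub>M M)"
  proof (rule measurable_right_continuous_process)
    show "I (max 0 t) \<in> borel_measurable M" for t
    proof -
      have "I (max 0 t) \<in> borel_measurable (F (max 0 t))" using I unfolding controls_def adapted_def by simp
      then show ?thesis by (rule measurable_F[rotated]) simp
    qed
    fix \<omega> t assume w: "\<omega> \<in> space M"
    show "continuous (at_right t) (\<lambda>t. I (max 0 t) \<omega>)"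
    proof (cases "0 \<le> t")
      case True
      then have "((\<lambda>s. I s \<omega>) \<longlongrightarrow> I t \<omega>) (at_right t)" using I w unfolding controls_def cadlag_def continuous_within by blast
      moreover have "eventually (\<lambda>s. I s \<omega> = I (max 0 s) \<omega>) (at_right t)"
        unfolding eventually_at_right_field using True by (intro exI[of _ "t + 1"]) auto
      ultimately show ?thesis using True unfolding continuous_within by (auto intro: Lim_transform_eventually)
    next
      case False
      then have "eventually (\<lambda>s. I (max 0 s) \<omega> = I (max 0 t) \<omega>) (at_right t)"
        unfolding eventually_at_right_field by (intro exI[of _ 0]) auto
      then show ?thesis unfolding continuous_within by (rule tendsto_eventually)
    qed
  qed
  then show ?thesis by (simp cong: measurable_cong_sets sets_pair_measure_cong)
qed

text \<open>The extended path is a difference of two monotone functions, each with at most countably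
  many discontinuities.\<close>

lemma control_AE_cont:
  assumes I: "I \<in> controls M F" and w: "\<omega> \<in> space M"
  shows "AE t in lborel. 0 < t \<longrightarrow> isCont (\<lambda>s. I s \<omega>) t"
proof -
  let ?f = "\<lambda>s. I s \<omega>"
  have tv: "total_variation ?f t < \<infinity>" for t
  proof (cases "0 \<le> t")
    case True then show ?thesis using I w unfolding controls_def by blast
  next
    case False
    then have "total_variation ?f t \<le> ennreal 0"
      by (intro total_variation_le[where p = "\<lambda>_. 0"]) (auto simp: extend0_def)
    then show ?thesis by (simp add: le_less_trans)
  qed
  have fin: "pos_variation ?f t < \<infinity>" for t using pos_variation_le_total tv by (rule le_less_trans)
  define p where "p = (\<lambda>t. enn2real (pos_variation ?f t))"
  have dom: "max 0 (extend0 ?f b - extend0 ?f a) \<le> p b - p a" if "a \<le> b" for a b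
    unfolding p_def by (rule pos_variation_real(4)[OF fin that])
  define q where "q = (\<lambda>t. p t - extend0 ?f t)"
  have mp: "mono p" by (rule monoI) (use dom in force)
  have mq: "mono q" unfolding q_def by (rule monoI) (use dom in force)
  have "countable ({t. \<not> isCont p t} \<union> {t. \<not> isCont q t})"
    using mono_ctble_discont[OF mp] mono_ctble_discont[OF mq] by (rule countable_Un)
  from countable_imp_null_set_lborel[OF this]
  have "AE t in lborel. t \<notin> {t. \<not> isCont p t} \<union> {t. \<not> isCont q t}" by (rule AE_not_in)
  then show ?thesis
  proof eventually_elim
    case (elim t)
    show ?case
    proof
      assume t: "0 < t"
      have "isCont (\<lambda>s. p s - q s) t" using elim by (intro continuous_intros) auto
      then have c: "isCont (extend0 ?f) t" by (simp add: q_def)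
      have "eventually (\<lambda>s. s \<in> {0<..}) (nhds t)" using t by (intro eventually_nhds_in_open) auto
      then have "eventually (\<lambda>s. extend0 ?f s = ?f s) (nhds t)" by eventually_elim (simp add: extend0_def)
      from isCont_cong[OF this] c show "isCont ?f t" by simp
    qed
  qed
qed

definition hn :: "nat \<Rightarrow> real" where "hn n = 1 / (real n + 1)"

lemma hn_pos: "0 < hn n" by (simp add: hn_def)

lemma hn_lim: "hn \<longlonglongrightarrow> 0"
  using LIMSEQ_inverse_real_of_nat unfolding hn_def by (simp add: inverse_eq_divide add.commute)

lemma grid_point_tendsto: "0 \<le> t \<Longrightarrow> (\<lambda>n. real (nat \<lfloor>t / hn n\<rfloor>) * hn n) \<longlonglongrightarrow> t"
proof (rule tendsto_sandwich[OF _ _ _ tendsto_const])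
  assume t: "0 \<le> t"
  have "t - hn n \<le> real (nat \<lfloor>t / hn n\<rfloor>) * hn n" for n
  proof -
    have "t < real (Suc (nat \<lfloor>t / hn n\<rfloor>)) * hn n"
      using nat_floor_eq_iff[OF hn_pos t, of n "nat \<lfloor>t / hn n\<rfloor>"] by (simp del: of_nat_Suc)
    also have "\<dots> = real (nat \<lfloor>t / hn n\<rfloor>) * hn n + hn n" by (simp add: distrib_right)
    finally show ?thesis by linarith
  qed
  then show "\<forall>\<^sub>F n in sequentially. t - hn n \<le> real (nat \<lfloor>t / hn n\<rfloor>) * hn n" by simp
  show "\<forall>\<^sub>F n in sequentially. real (nat \<lfloor>t / hn n\<rfloor>) * hn n \<le> t"
    by (intro always_eventually allI, subst nat_floor_le_iff[OF hn_pos t, symmetric]) simp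
  show "(\<lambda>n. t - hn n) \<longlonglongrightarrow> t" using tendsto_diff[OF tendsto_const[of t] hn_lim] by simp
qed

text \<open>The discounted moment bound is a sum of two exponentials with rates
  \<open>\<rho>\<close> and \<open>\<rho> - K1\<close>, both positive by the assumption on the
  discount rate.\<close>

lemma mom_discounted: "(\<integral>\<^sup>+t\<in>{0..}. ennreal (exp (- \<rho> * t) * mom d t) \<partial>lborel) < \<infinity>"
proof -
  define a where "a = K0 * (1 + abs_pow \<nu> d)"
  have a0: "0 \<le> a" using K0_nonneg by (simp add: a_def)
  have rK: "0 < \<rho> - K1" using discount by simp
  have "(\<integral>\<^sup>+t\<in>{0..}. ennreal (exp (- \<rho> * t) * mom d t) \<partial>lborel)
    = (\<integral>\<^sup>+t. ennreal (1 / \<rho>) * (ennreal (\<rho> * exp (- \<rho> * t)) * indicator {0..} t)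
      + ennreal (a / (\<rho> - K1)) * (ennreal ((\<rho> - K1) * exp (- (\<rho> - K1) * t)) * indicator {0..} t) \<partial>lborel)"
  proof (intro nn_integral_cong)
    fix t :: real
    show "ennreal (exp (- \<rho> * t) * mom d t) * indicator {0..} t
      = ennreal (1 / \<rho>) * (ennreal (\<rho> * exp (- \<rho> * t)) * indicator {0..} t)
      + ennreal (a / (\<rho> - K1)) * (ennreal ((\<rho> - K1) * exp (- (\<rho> - K1) * t)) * indicator {0..} t)"
    proof (cases "0 \<le> t")
      case True
      have "exp (- \<rho> * t) * mom d t = exp (- \<rho> * t) + a * exp (- (\<rho> - K1) * t)"
        using True by (simp add: mom_def a_def algebra_simps exp_add[symmetric])
      also have "\<dots> = (1 / \<rho>) * (\<rho> * exp (- \<rho> * t)) + (a / (\<rho> - K1)) * ((\<rho> - K1) * exp (- (\<rho> - K1) * t))"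
        using rho_pos rK by simp
      finally have "ennreal (exp (- \<rho> * t) * mom d t) = ennreal ((1 / \<rho>) * (\<rho> * exp (- \<rho> * t)) + (a / (\<rho> - K1)) * ((\<rho> - K1) * exp (- (\<rho> - K1) * t)))" by simp
      also have "\<dots> = ennreal ((1 / \<rho>) * (\<rho> * exp (- \<rho> * t))) + ennreal ((a / (\<rho> - K1)) * ((\<rho> - K1) * exp (- (\<rho> - K1) * t)))"
        using rho_pos rK a0 by (intro ennreal_plus) auto
      also have "\<dots> = ennreal (1 / \<rho>) * ennreal (\<rho> * exp (- \<rho> * t)) + ennreal (a / (\<rho> - K1)) * ennreal ((\<rho> - K1) * exp (- (\<rho> - K1) * t))"
        using rho_pos rK a0 by (simp only: ennreal_mult' divide_nonneg_nonneg less_imp_le zero_le_one)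
      finally show ?thesis using True by simp
    qed simp
  qed
  also have "\<dots> = ennreal (1 / \<rho>) * (\<integral>\<^sup>+t\<in>{0..}. ennreal (\<rho> * exp (- \<rho> * t)) \<partial>lborel)
      + ennreal (a / (\<rho> - K1)) * (\<integral>\<^sup>+t\<in>{0..}. ennreal ((\<rho> - K1) * exp (- (\<rho> - K1) * t)) \<partial>lborel)"
    by (subst nn_integral_add) (auto simp: nn_integral_cmult)
  also have "\<dots> < \<infinity>"
    using exp_tail_integral[OF rho_pos, of 0] exp_tail_integral[OF rK, of 0] by (simp add: ennreal_mult_less_top)
  finally show ?thesis .
qed

lemma envelope_joint:
  assumes d: "d \<in> Ob"
  shows "(\<lambda>(t, \<omega>). ennreal (exp (- \<rho> * t) * (G * (1 + abs_pow \<nu> (X d t \<omega>)))) * indicator {0..} t) \<in> borel_measurable (lborel \<Otimes>\<^sub>M M)"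
proof -
  have "(\<lambda>p. X d (fst p) (snd p)) \<in> borel_measurable (lborel \<Otimes>\<^sub>M M)"
    using X_joint[OF d] by (simp add: case_prod_beta cong: measurable_cong_sets sets_pair_measure_cong)
  from measurable_compose[OF this measurable_abs_pow[OF \<nu>_nonneg]]
  have "(\<lambda>p. abs_pow \<nu> (X d (fst p) (snd p))) \<in> borel_measurable (lborel \<Otimes>\<^sub>M M)" .
  then have "(\<lambda>p. ennreal (exp (- \<rho> * fst p) * (G * (1 + abs_pow \<nu> (X d (fst p) (snd p))))) * indicator {0..} (fst p)) \<in> borel_measurable (lborel \<Otimes>\<^sub>M M)"
    by measurable
  then show ?thesis by (simp add: case_prod_beta)
qed

lemma envelope_finite:
  assumes d: "d \<in> Ob" and G: "0 \<le> G"
  shows "(\<integral>\<^sup>+\<omega>. \<integral>\<^sup>+t. ennreal (exp (- \<rho> * t) * (G * (1 + abs_pow \<nu> (X d t \<omega>)))) * indicator {0..} t \<partial>lborel \<partial>M) < \<infinity>"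
proof -
  interpret pair_sigma_finite lborel M ..
  have "(\<integral>\<^sup>+\<omega>. \<integral>\<^sup>+t. ennreal (exp (- \<rho> * t) * (G * (1 + abs_pow \<nu> (X d t \<omega>)))) * indicator {0..} t \<partial>lborel \<partial>M)
    = (\<integral>\<^sup>+t. \<integral>\<^sup>+\<omega>. ennreal (exp (- \<rho> * t) * (G * (1 + abs_pow \<nu> (X d t \<omega>)))) * indicator {0..} t \<partial>M \<partial>lborel)"
    by (rule Fubini'[OF envelope_joint[OF d]])
  also have "\<dots> \<le> (\<integral>\<^sup>+t. ennreal G * (ennreal (exp (- \<rho> * t) * mom d t) * indicator {0..} t) \<partial>lborel)"
  proof (intro nn_integral_mono)
    fix t :: real
    have m: "(\<lambda>\<omega>. ennreal (1 + abs_pow \<nu> (X d t \<omega>))) \<in> borel_measurable M" using abs_pow_meas[OF d, of t] by measurable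
    have "(\<integral>\<^sup>+\<omega>. ennreal (exp (- \<rho> * t) * (G * (1 + abs_pow \<nu> (X d t \<omega>)))) * indicator {0..} t \<partial>M)
      = (\<integral>\<^sup>+\<omega>. (ennreal G * ennreal (exp (- \<rho> * t)) * indicator {0..} t) * ennreal (1 + abs_pow \<nu> (X d t \<omega>)) \<partial>M)"
    proof (intro nn_integral_cong)
      fix \<omega>
      have "ennreal (exp (- \<rho> * t) * (G * (1 + abs_pow \<nu> (X d t \<omega>)))) = ennreal (exp (- \<rho> * t)) * (ennreal G * ennreal (1 + abs_pow \<nu> (X d t \<omega>)))"
        using G by (simp only: ennreal_mult mult_nonneg_nonneg abs_pow_nonneg add_nonneg_nonneg zero_le_one exp_ge_zero)
      then show "ennreal (exp (- \<rho> * t) * (G * (1 + abs_pow \<nu> (X d t \<omega>)))) * indicator {0..} t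
        = (ennreal G * ennreal (exp (- \<rho> * t)) * indicator {0..} t) * ennreal (1 + abs_pow \<nu> (X d t \<omega>))"
        by (simp only: mult_ac)
    qed
    also have "\<dots> = (ennreal G * ennreal (exp (- \<rho> * t)) * indicator {0..} t) * (\<integral>\<^sup>+\<omega>. ennreal (1 + abs_pow \<nu> (X d t \<omega>)) \<partial>M)"
      by (rule nn_integral_cmult[OF m])
    also have "\<dots> \<le> (ennreal G * ennreal (exp (- \<rho> * t)) * indicator {0..} t) * ennreal (mom d t)"
      by (intro mult_left_mono moment_nn d) simp
    also have "\<dots> = ennreal G * (ennreal (exp (- \<rho> * t) * mom d t) * indicator {0..} t)"
      by (simp add: ennreal_mult' mult_ac)
    finally show "(\<integral>\<^sup>+\<omega>. ennreal (exp (- \<rho> * t) * (G * (1 + abs_pow \<nu> (X d t \<omega>)))) * indicator {0..} t \<partial>M)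
      \<le> ennreal G * (ennreal (exp (- \<rho> * t) * mom d t) * indicator {0..} t)" .
  qed
  also have "\<dots> = ennreal G * (\<integral>\<^sup>+t\<in>{0..}. ennreal (exp (- \<rho> * t) * mom d t) \<partial>lborel)"
    by (rule nn_integral_cmult) (simp add: mom_def)
  also have "\<dots> < \<infinity>" using mom_discounted[of d] by (simp add: ennreal_mult_less_top)
  finally show ?thesis .
qed

definition run_cost :: "real \<Rightarrow> (real \<Rightarrow> 'a \<Rightarrow> real) \<Rightarrow> ennreal" where
  "run_cost d Z = (\<integral>\<^sup>+\<omega>. \<integral>\<^sup>+t. ennreal (exp (- \<rho> * t) * g (Z t \<omega>) (X d t \<omega>)) * indicator {0..} t \<partial>lborel \<partial>M)"

lemma disc_joint:
  assumes I: "I \<in> controls M F" and h: "0 < h"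
  shows "(\<lambda>(t, \<omega>). disc h R c I (nat \<lfloor>t / h\<rfloor>) \<omega>) \<in> borel_measurable (lborel \<Otimes>\<^sub>M M)"
proof -
  have m: "disc h R c I k \<in> borel_measurable M" for k
  proof -
    have "I (real k * h) \<in> borel_measurable M"
      using I h measurable_F[of "real k * h" "I (real k * h)"] unfolding controls_def adapted_def by simp
    then show ?thesis unfolding disc_def clamp_def by measurable
  qed
  have "(\<lambda>p. disc h R c I (nat \<lfloor>fst p / h\<rfloor>) (snd p)) \<in> borel_measurable (lborel \<Otimes>\<^sub>M M)"
  proof (rule measurable_compose_countable[where f = "\<lambda>k p. disc h R c I (nat k) (snd p)" and g = "\<lambda>p. \<lfloor>fst p / h\<rfloor>"])
    show "(\<lambda>p. disc h R c I (nat k) (snd p)) \<in> borel_measurable (lborel \<Otimes>\<^sub>M M)" for k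
      by (rule measurable_compose[OF measurable_snd m])
    show "(\<lambda>p. \<lfloor>fst p / h\<rfloor>) \<in> measurable (lborel \<Otimes>\<^sub>M M) (count_space UNIV)" by measurable
  qed
  then show ?thesis by (simp add: case_prod_beta)
qed

lemma gpath_run_cost: "(\<integral>\<^sup>+\<omega>. gpath h d C \<omega> \<partial>M) = run_cost d (\<lambda>t. C (nat \<lfloor>t / h\<rfloor>))"
  unfolding gpath_def run_cost_def by (intro nn_integral_cong) (simp add: indicator_def X_eq)

text \<open>The sampling points converge to \<open>t\<close>, the control is continuous at almost
  every \<open>t\<close>, and the clamp keeps capacities bounded, so that a moment bound
  dominates.\<close>

lemma disc_run_cost_tendsto:
  assumes I: "I \<in> controls M F" and d: "d \<in> Ob" and R: "0 \<le> R"
  shows "(\<lambda>n. run_cost d (\<lambda>t. disc (hn n) R c I (nat \<lfloor>t / hn n\<rfloor>))) \<longlonglongrightarrow> run_cost d (\<lambda>t \<omega>. clamp R (c + I (max 0 t) \<omega>))"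
proof -
  obtain G where G: "0 \<le> G" "\<And>c d. \<bar>c\<bar> \<le> R \<Longrightarrow> d \<in> Ob \<Longrightarrow> \<bar>g c d\<bar> \<le> G * (1 + abs_pow \<nu> d)"
    using growthE[OF growth_g_gc(1), of R] by metis
  have cR: "\<bar>clamp R y\<bar> \<le> R" for y using R by (auto simp: clamp_def abs_le_iff)
  show ?thesis
    unfolding run_cost_def
  proof (rule double_dominated[where w = "\<lambda>t \<omega>. ennreal (exp (- \<rho> * t) * (G * (1 + abs_pow \<nu> (X d t \<omega>)))) * indicator {0..} t"])
    show "(\<lambda>(t, \<omega>). ennreal (exp (- \<rho> * t) * g (disc (hn n) R c I (nat \<lfloor>t / hn n\<rfloor>) \<omega>) (X d t \<omega>)) * indicator {0..} t) \<in> borel_measurable (lborel \<Otimes>\<^sub>M M)" for n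
      by (rule g_joint[OF d disc_joint[OF I hn_pos]])
    have "(\<lambda>p. clamp R (c + (case p of (t, \<omega>) \<Rightarrow> I (max 0 t) \<omega>))) \<in> borel_measurable (lborel \<Otimes>\<^sub>M M)"
      using control_joint[OF I] unfolding clamp_def by measurable
    then show "(\<lambda>(t, \<omega>). ennreal (exp (- \<rho> * t) * g (clamp R (c + I (max 0 t) \<omega>)) (X d t \<omega>)) * indicator {0..} t) \<in> borel_measurable (lborel \<Otimes>\<^sub>M M)"
      by (intro g_joint[OF d]) (simp add: case_prod_beta)
    show "(\<lambda>(t, \<omega>). ennreal (exp (- \<rho> * t) * (G * (1 + abs_pow \<nu> (X d t \<omega>)))) * indicator {0..} t) \<in> borel_measurable (lborel \<Otimes>\<^sub>M M)"
      by (rule envelope_joint[OF d])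
    show "ennreal (exp (- \<rho> * t) * g (disc (hn n) R c I (nat \<lfloor>t / hn n\<rfloor>) \<omega>) (X d t \<omega>)) * indicator {0..} t
      \<le> ennreal (exp (- \<rho> * t) * (G * (1 + abs_pow \<nu> (X d t \<omega>)))) * indicator {0..} t" if "\<omega> \<in> space M" for n \<omega> t
      using G(2)[OF cR X_in[OF d that]] by (intro mult_right_mono ennreal_leI mult_left_mono) (auto simp: disc_def intro: abs_le_D1)
    show "(\<integral>\<^sup>+\<omega>. \<integral>\<^sup>+t. ennreal (exp (- \<rho> * t) * (G * (1 + abs_pow \<nu> (X d t \<omega>)))) * indicator {0..} t \<partial>lborel \<partial>M) < \<infinity>"
      by (rule envelope_finite[OF d G(1)])
    fix \<omega> assume w: "\<omega> \<in> space M"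
    show "AE t in lborel. (\<lambda>n. ennreal (exp (- \<rho> * t) * g (disc (hn n) R c I (nat \<lfloor>t / hn n\<rfloor>) \<omega>) (X d t \<omega>)) * indicator {0..} t)
      \<longlonglongrightarrow> ennreal (exp (- \<rho> * t) * g (clamp R (c + I (max 0 t) \<omega>)) (X d t \<omega>)) * indicator {0..} t"
      using control_AE_cont[OF I w] AE_lborel_singleton[of 0]
    proof eventually_elim
      case (elim t)
      show ?case
      proof (cases "0 < t")
        case True
        have "(\<lambda>n. I (real (nat \<lfloor>t / hn n\<rfloor>) * hn n) \<omega>) \<longlonglongrightarrow> I t \<omega>"
          using elim True grid_point_tendsto[of t] by (intro isCont_tendsto_compose[of t "\<lambda>s. I s \<omega>"]) auto
        then have l: "(\<lambda>n. disc (hn n) R c I (nat \<lfloor>t / hn n\<rfloor>) \<omega>) \<longlonglongrightarrow> clamp R (c + I (max 0 t) \<omega>)"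
          using True unfolding disc_def clamp_def by (auto intro!: tendsto_intros)
        have "(\<lambda>n. g (disc (hn n) R c I (nat \<lfloor>t / hn n\<rfloor>) \<omega>) (X d t \<omega>)) \<longlonglongrightarrow> g (clamp R (c + I (max 0 t) \<omega>)) (X d t \<omega>)"
          by (rule continuous_on_seqD2[OF g_cont l tendsto_const X_in[OF d w] X_in[OF d w]])
        then show ?thesis using True by (auto intro!: tendsto_ennrealI tendsto_intros)
      qed (use elim in auto)
    qed
  qed
qed

text \<open>Since \<open>\<bar>c\<bar> \<le> R m\<close>, the clamped capacity lies between
  \<open>c\<close> and the original one, and convexity bounds its running cost by the sum of the two
  costs. This is an integrable bound even when the control is unbounded.\<close>

lemma clamp_run_cost_tendsto:
  assumes I: "I \<in> controls M F" and d: "d \<in> Ob" and fin: "run_cost d (\<lambda>t \<omega>. c + I (max 0 t) \<omega>) < \<infinity>"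
    and R0: "\<And>m. \<bar>c\<bar> \<le> R m" and R: "filterlim R at_top sequentially"
  shows "(\<lambda>m. run_cost d (\<lambda>t \<omega>. clamp (R m) (c + I (max 0 t) \<omega>))) \<longlonglongrightarrow> run_cost d (\<lambda>t \<omega>. c + I (max 0 t) \<omega>)"
proof -
  obtain G where G: "0 \<le> G" "\<And>c' d. \<bar>c'\<bar> \<le> \<bar>c\<bar> \<Longrightarrow> d \<in> Ob \<Longrightarrow> \<bar>g c' d\<bar> \<le> G * (1 + abs_pow \<nu> d)"
    using growthE[OF growth_g_gc(1), of "\<bar>c\<bar>"] by metis
  let ?e = "\<lambda>t \<omega>. ennreal (exp (- \<rho> * t) * (G * (1 + abs_pow \<nu> (X d t \<omega>)))) * indicator {0..} t"
  let ?f = "\<lambda>t \<omega>. ennreal (exp (- \<rho> * t) * g (c + I (max 0 t) \<omega>) (X d t \<omega>)) * indicator {0..} t"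
  have mI: "(\<lambda>p. case p of (t, \<omega>) \<Rightarrow> I (max 0 t) \<omega>) \<in> borel_measurable (lborel \<Otimes>\<^sub>M M)" by (rule control_joint[OF I])
  have mf: "(\<lambda>(t, \<omega>). ?f t \<omega>) \<in> borel_measurable (lborel \<Otimes>\<^sub>M M)"
  proof -
    have "(\<lambda>p. c + (case p of (t, \<omega>) \<Rightarrow> I (max 0 t) \<omega>)) \<in> borel_measurable (lborel \<Otimes>\<^sub>M M)" using mI by measurable
    then show ?thesis by (intro g_joint[OF d]) (simp add: case_prod_beta)
  qed
  show ?thesis
    unfolding run_cost_def
  proof (rule double_dominated[where w = "\<lambda>t \<omega>. ?f t \<omega> + ?e t \<omega>"])
    show "(\<lambda>(t, \<omega>). ennreal (exp (- \<rho> * t) * g (clamp (R m) (c + I (max 0 t) \<omega>)) (X d t \<omega>)) * indicator {0..} t) \<in> borel_measurable (lborel \<Otimes>\<^sub>M M)" for m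
    proof -
      have "(\<lambda>p. clamp (R m) (c + (case p of (t, \<omega>) \<Rightarrow> I (max 0 t) \<omega>))) \<in> borel_measurable (lborel \<Otimes>\<^sub>M M)"
        using mI unfolding clamp_def by measurable
      then show ?thesis by (intro g_joint[OF d]) (simp add: case_prod_beta)
    qed
    show "(\<lambda>(t, \<omega>). ?f t \<omega>) \<in> borel_measurable (lborel \<Otimes>\<^sub>M M)" by (rule mf)
    have "(\<lambda>p. (case p of (t, \<omega>) \<Rightarrow> ?f t \<omega>) + (case p of (t, \<omega>) \<Rightarrow> ?e t \<omega>)) \<in> borel_measurable (lborel \<Otimes>\<^sub>M M)"
      by (intro borel_measurable_add mf envelope_joint[OF d])
    then show "(\<lambda>(t, \<omega>). ?f t \<omega> + ?e t \<omega>) \<in> borel_measurable (lborel \<Otimes>\<^sub>M M)" by (simp add: case_prod_beta)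
    have "(\<integral>\<^sup>+\<omega>. \<integral>\<^sup>+t. ?f t \<omega> + ?e t \<omega> \<partial>lborel \<partial>M) = (\<integral>\<^sup>+\<omega>. (\<integral>\<^sup>+t. ?f t \<omega> \<partial>lborel) + (\<integral>\<^sup>+t. ?e t \<omega> \<partial>lborel) \<partial>M)"
    proof (intro nn_integral_cong nn_integral_add)
      fix \<omega> assume w: "\<omega> \<in> space M"
      show "(\<lambda>t. ?f t \<omega>) \<in> borel_measurable lborel"
        using measurable_compose[OF measurable_Pair2'[OF w] mf] by simp
      show "(\<lambda>t. ?e t \<omega>) \<in> borel_measurable lborel"
        using measurable_compose[OF measurable_Pair2'[OF w] envelope_joint[OF d]] by simp
    qed
    also have "\<dots> = (\<integral>\<^sup>+\<omega>. (\<integral>\<^sup>+t. ?f t \<omega> \<partial>lborel) \<partial>M) + (\<integral>\<^sup>+\<omega>. (\<integral>\<^sup>+t. ?e t \<omega> \<partial>lborel) \<partial>M)"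
    proof (rule nn_integral_add)
      show "(\<lambda>\<omega>. \<integral>\<^sup>+t. ?f t \<omega> \<partial>lborel) \<in> borel_measurable M"
        by (rule lborel.borel_measurable_nn_integral) (use measurable_pair_swap[OF mf] in \<open>simp add: case_prod_beta\<close>)
      show "(\<lambda>\<omega>. \<integral>\<^sup>+t. ?e t \<omega> \<partial>lborel) \<in> borel_measurable M"
        by (rule lborel.borel_measurable_nn_integral) (use measurable_pair_swap[OF envelope_joint[OF d]] in \<open>simp add: case_prod_beta\<close>)
    qed
    also have "\<dots> < \<infinity>" using fin envelope_finite[OF d G(1)] unfolding run_cost_def by simp
    finally show "(\<integral>\<^sup>+\<omega>. \<integral>\<^sup>+t. ?f t \<omega> + ?e t \<omega> \<partial>lborel \<partial>M) < \<infinity>" .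
  next
    fix m \<omega> t assume w: "\<omega> \<in> space M"
    let ?y = "X d t \<omega>" and ?a = "c + I (max 0 t) \<omega>"
    have y: "?y \<in> Ob" by (rule X_in[OF d w])
    have gn: "0 \<le> g b ?y" for b using g_nonneg y by blast
    have "g (clamp (R m) ?a) ?y \<le> max (g ?a ?y) (g c ?y)"
    proof -
      have cl: "clamp (R m) ?a \<in> {min ?a c..max ?a c}"
        using R0[of m] by (auto simp: clamp_def abs_le_iff min_def max_def)
      have "convex_on {min ?a c..max ?a c} (\<lambda>c. g c ?y)"
        using g_convex y by (auto intro: convex_on_subset)
      from convex_on_le_max[OF this cl] show ?thesis by (cases "?a \<le> c") (auto simp: min_def max_def split: if_splits)
    qed
    also have "\<dots> \<le> g ?a ?y + g c ?y" using gn[of ?a] gn[of c] by simp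
    also have "\<dots> \<le> g ?a ?y + G * (1 + abs_pow \<nu> ?y)" using G(2)[of c ?y] y by simp
    finally have le: "exp (- \<rho> * t) * g (clamp (R m) ?a) ?y \<le> exp (- \<rho> * t) * g ?a ?y + exp (- \<rho> * t) * (G * (1 + abs_pow \<nu> ?y))"
      by (simp add: distrib_left[symmetric])
    have "ennreal (exp (- \<rho> * t) * g (clamp (R m) ?a) ?y) \<le> ennreal (exp (- \<rho> * t) * g ?a ?y) + ennreal (exp (- \<rho> * t) * (G * (1 + abs_pow \<nu> ?y)))"
      using ennreal_leI[OF le] gn[of ?a] G(1) by (subst (asm) ennreal_plus) auto
    then show "ennreal (exp (- \<rho> * t) * g (clamp (R m) ?a) ?y) * indicator {0..} t \<le> ?f t \<omega> + ?e t \<omega>"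
      by (simp add: distrib_right[symmetric] mult_right_mono)
  next
    fix \<omega> assume w: "\<omega> \<in> space M"
    show "AE t in lborel. (\<lambda>m. ennreal (exp (- \<rho> * t) * g (clamp (R m) (c + I (max 0 t) \<omega>)) (X d t \<omega>)) * indicator {0..} t) \<longlonglongrightarrow> ?f t \<omega>"
    proof (intro AE_I2)
      fix t
      have "eventually (\<lambda>m. \<bar>c + I (max 0 t) \<omega>\<bar> \<le> R m) sequentially" using R unfolding filterlim_at_top by blast
      then have "eventually (\<lambda>m. clamp (R m) (c + I (max 0 t) \<omega>) = c + I (max 0 t) \<omega>) sequentially"
        by eventually_elim (auto simp: clamp_def abs_le_iff)
      then have "eventually (\<lambda>m. ennreal (exp (- \<rho> * t) * g (clamp (R m) (c + I (max 0 t) \<omega>)) (X d t \<omega>)) * indicator {0..} t = ?f t \<omega>) sequentially"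
        by eventually_elim simp
      then show "(\<lambda>m. ennreal (exp (- \<rho> * t) * g (clamp (R m) (c + I (max 0 t) \<omega>)) (X d t \<omega>)) * indicator {0..} t) \<longlonglongrightarrow> ?f t \<omega>"
        by (rule tendsto_eventually)
    qed
  qed
qed

lemma grid_control_mono: "grid_control h R C \<Longrightarrow> R \<le> R' \<Longrightarrow> grid_control h R' C"
  unfolding grid_control_def by (meson order_trans)

text \<open>A clamp level \<open>R m\<close>, and for it a mesh, are chosen so that the running cost
  grows by less than \<open>\<delta>\<close>; the control cost does not grow. For large
  \<open>n\<close> the bound \<open>real n\<close> exceeds the clamp level, so a single parameter
  governs mesh and range.\<close>

lemma discretise:
  assumes I: "I \<in> controls M F" and d: "d \<in> Ob" and fin: "cost M D g \<rho> q0p q0m c d I < \<infinity>" and \<delta>: "0 < \<delta>"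
  shows "\<exists>n0. \<forall>n\<ge>n0. \<exists>C. grid_control (hn n) (real n) C \<and>
    (\<forall>N. grid_cost (hn n) d c C N \<le> enn2real (cost M D g \<rho> q0p q0m c d I) + \<delta>)"
proof -
  let ?Z = "\<lambda>t \<omega>. c + I (max 0 t) \<omega>"
  let ?V = "\<lambda>\<omega>. (\<integral>\<^sup>+t\<in>{0..}. ennreal (exp (- \<rho> * t) * q0p) \<partial>(dI_plus I \<omega>))
        + (\<integral>\<^sup>+t\<in>{0..}. ennreal (exp (- \<rho> * t) * q0m) \<partial>(dI_minus I \<omega>))"
  let ?G = "\<lambda>\<omega>. \<integral>\<^sup>+t. ennreal (exp (- \<rho> * t) * g (?Z t \<omega>) (X d t \<omega>)) * indicator {0..} t \<partial>lborel"
  have cost_eq: "cost M D g \<rho> q0p q0m c d I = (\<integral>\<^sup>+\<omega>. ?G \<omega> + ?V \<omega> \<partial>M)"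
    unfolding cost_def add.assoc
    by (intro nn_integral_cong arg_cong2[where f = "(+)"] refl) (auto simp: indicator_def capacity_def X_eq)
  have run_le: "run_cost d ?Z \<le> cost M D g \<rho> q0p q0m c d I"
    unfolding run_cost_def cost_eq by (intro nn_integral_mono) simp
  then have run_fin: "run_cost d ?Z < \<infinity>" using fin by (rule le_less_trans)
  have less: "run_cost d ?Z < run_cost d ?Z + ennreal \<delta>" using run_fin \<delta> by (simp add: ennreal_add_left_cancel_less[of _ 0, simplified])
  define R where "R = (\<lambda>m::nat. \<bar>c\<bar> + real m)"
  have R: "\<bar>c\<bar> \<le> R m" "0 \<le> R m" for m by (auto simp: R_def)
  have "filterlim R at_top sequentially" unfolding R_def
    by (intro filterlim_tendsto_add_at_top[OF tendsto_const] filterlim_real_sequentially)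
  from order_tendstoD(2)[OF clamp_run_cost_tendsto[OF I d run_fin R(1) this] less]
  obtain m where m: "run_cost d (\<lambda>t \<omega>. clamp (R m) (?Z t \<omega>)) < run_cost d ?Z + ennreal \<delta>"
    by (auto simp: eventually_sequentially)
  from order_tendstoD(2)[OF disc_run_cost_tendsto[OF I d R(2)[of m]] this]
  obtain n1 where n1: "\<And>n. n1 \<le> n \<Longrightarrow> run_cost d (\<lambda>t. disc (hn n) (R m) c I (nat \<lfloor>t / hn n\<rfloor>)) < run_cost d ?Z + ennreal \<delta>"
    by (auto simp: eventually_sequentially)
  obtain n2 :: nat where n2: "R m \<le> real n2" using real_arch_simple by blast
  show ?thesis
  proof (intro exI[of _ "max n1 n2"] allI impI)
    fix n assume n: "max n1 n2 \<le> n"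
    let ?C = "disc (hn n) (R m) c I"
    have C: "grid_control (hn n) (R m) ?C" by (rule disc_grid[OF hn_pos I R(2)])
    have Rn: "R m \<le> real n" using n n2 by auto
    have vm: "vpath (hn n) c ?C \<in> borel_measurable M" by (rule vpath_meas[OF hn_pos C])
    have Gm: "?G \<in> borel_measurable M"
    proof -
      have "(\<lambda>p. c + (case p of (t, \<omega>) \<Rightarrow> I (max 0 t) \<omega>)) \<in> borel_measurable (lborel \<Otimes>\<^sub>M M)"
        using control_joint[OF I] by measurable
      then have "(\<lambda>(t, \<omega>). ennreal (exp (- \<rho> * t) * g (?Z t \<omega>) (X d t \<omega>)) * indicator {0..} t) \<in> borel_measurable (lborel \<Otimes>\<^sub>M M)"
        by (intro g_joint[OF d]) (simp add: case_prod_beta)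
      from measurable_pair_swap[OF this] show ?thesis
        by (intro lborel.borel_measurable_nn_integral) (simp add: case_prod_beta)
    qed
    have "(SUP N. ennreal (grid_cost (hn n) d c ?C N)) = (\<integral>\<^sup>+\<omega>. gpath (hn n) d ?C \<omega> \<partial>M) + (\<integral>\<^sup>+\<omega>. vpath (hn n) c ?C \<omega> \<partial>M)"
      by (rule grid_cost_nn[OF hn_pos d C R(1), symmetric])
    also have "\<dots> \<le> (run_cost d ?Z + ennreal \<delta>) + (\<integral>\<^sup>+\<omega>. vpath (hn n) c ?C \<omega> \<partial>M)"
      unfolding gpath_run_cost using n1[of n] n by (intro add_right_mono) auto
    also have "\<dots> = (\<integral>\<^sup>+\<omega>. ?G \<omega> + vpath (hn n) c ?C \<omega> \<partial>M) + ennreal \<delta>"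
      unfolding run_cost_def nn_integral_add[OF Gm vm] by (simp add: add_ac)
    also have "\<dots> \<le> cost M D g \<rho> q0p q0m c d I + ennreal \<delta>"
      unfolding cost_eq by (intro add_right_mono nn_integral_mono add_left_mono disc_vpath[OF hn_pos R(1) I])
    also have "\<dots> = ennreal (enn2real (cost M D g \<rho> q0p q0m c d I) + \<delta>)"
      using fin \<delta> by (subst ennreal_plus) auto
    finally have S: "(SUP N. ennreal (grid_cost (hn n) d c ?C N)) \<le> ennreal (enn2real (cost M D g \<rho> q0p q0m c d I) + \<delta>)" .
    have "grid_cost (hn n) d c ?C N \<le> enn2real (cost M D g \<rho> q0p q0m c d I) + \<delta>" for N
    proof -
      have "ennreal (grid_cost (hn n) d c ?C N) \<le> ennreal (enn2real (cost M D g \<rho> q0p q0m c d I) + \<delta>)"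
        using S by (rule order_trans[OF SUP_upper, rotated]) simp
      then show ?thesis using \<delta> by (subst (asm) ennreal_le_iff) (auto intro: add_nonneg_nonneg)
    qed
    then show "\<exists>C. grid_control (hn n) (real n) C \<and> (\<forall>N. grid_cost (hn n) d c C N \<le> enn2real (cost M D g \<rho> q0p q0m c d I) + \<delta>)"
      using grid_control_mono[OF C Rn] by blast
  qed
qed

section \<open>Convergence of the discrete derivative to the marginal value\<close>

abbreviation "val c d \<equiv> enn2real (value_fun M F D g \<rho> q0p q0m c d)"

abbreviation "vc \<equiv> value_c M F D g \<rho> q0p q0m"

context
  assumes reg: "value_regularity Ob (value_fun M F D g \<rho> q0p q0m) vc q0p q0m"
begin

lemma near_value:
  assumes d: "d \<in> Ob" and \<delta>: "0 < \<delta>"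
  shows "\<exists>n0. \<forall>n\<ge>n0. \<exists>C. grid_control (hn n) (real n) C \<and> (\<forall>N. grid_cost (hn n) d c C N \<le> val c d + \<delta>)"
proof -
  have fin: "value_fun M F D g \<rho> q0p q0m c d < \<infinity>" using reg d unfolding value_regularity_def by blast
  then have "value_fun M F D g \<rho> q0p q0m c d < value_fun M F D g \<rho> q0p q0m c d + ennreal (\<delta> / 2)"
    using \<delta> by (simp add: ennreal_add_left_cancel_less[of _ 0, simplified])
  then obtain I where I: "I \<in> controls M F" "cost M D g \<rho> q0p q0m c d I < value_fun M F D g \<rho> q0p q0m c d + ennreal (\<delta> / 2)"
    unfolding value_fun_def INF_less_iff by blast
  have eq: "value_fun M F D g \<rho> q0p q0m c d + ennreal (\<delta> / 2) = ennreal (val c d + \<delta> / 2)"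
    using fin \<delta> by (subst ennreal_plus) auto
  have cf: "cost M D g \<rho> q0p q0m c d I < \<infinity>" using I(2) unfolding eq by (rule less_trans) simp
  have le: "enn2real (cost M D g \<rho> q0p q0m c d I) \<le> val c d + \<delta> / 2"
    using I(2) \<delta> unfolding eq by (intro enn2real_leI) auto
  from discretise[OF I(1) d cf, of "\<delta> / 2"] \<delta>
  obtain n0 where "\<forall>n\<ge>n0. \<exists>C. grid_control (hn n) (real n) C \<and>
    (\<forall>N. grid_cost (hn n) d c C N \<le> enn2real (cost M D g \<rho> q0p q0m c d I) + \<delta> / 2)" by auto
  moreover have "enn2real (cost M D g \<rho> q0p q0m c d I) + \<delta> / 2 \<le> val c d + \<delta>" using le by simp
  ultimately show ?thesis by (meson order_trans)
qed

text \<open>The unrelaxed policy started at \<open>c\<close> is compared with a nearly optimal grid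
  control started at \<open>c'\<close>; being admissible, the policy bounds the value at
  \<open>c\<close> from above.\<close>

lemma val_diff:
  assumes d: "d \<in> Ob" and \<delta>: "0 < \<delta>"
  shows "\<exists>n0. \<forall>n\<ge>n0. val c d - val c' d \<le> Psi (hn n) (real n) c d - Psi (hn n) (real n) c' d + \<delta>"
proof -
  from near_value[OF d \<delta>, of c'] obtain n0 where n0: "\<And>n. n0 \<le> n \<Longrightarrow> \<exists>C. grid_control (hn n) (real n) C \<and>
    (\<forall>N. grid_cost (hn n) d c' C N \<le> val c' d + \<delta>)" by blast
  obtain n1 :: nat where n1: "max \<bar>c\<bar> \<bar>c'\<bar> \<le> real n1" using real_arch_simple by blast
  show ?thesis
  proof (intro exI[of _ "max n0 n1"] allI impI)
    fix n assume n: "max n0 n1 \<le> n"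
    then obtain C where C: "grid_control (hn n) (real n) C" "\<And>N. grid_cost (hn n) d c' C N \<le> val c' d + \<delta>"
      using n0[of n] by auto
    have cn: "\<bar>c\<bar> \<le> real n" "\<bar>c'\<bar> \<le> real n" using n n1 by auto
    let ?B = "(val c' d + \<delta>) + (Psi (hn n) (real n) c d - Psi (hn n) (real n) c' d)"
    have le: "grid_cost (hn n) d c (pol (hn n) (real n) 0 d c) N \<le> ?B" for N
      using pol_near_optimal[OF hn_pos d cn _ _ _ _ _ _ C(1), of 0 0 "val c' d + \<delta>" N] C(2) q0p_pos q0m_pos by simp
    have B0: "0 \<le> ?B" using le[of 0] by (simp add: grid_cost_def)
    have "value_fun M F D g \<rho> q0p q0m c d \<le> ennreal ?B"
      by (rule value_le_grid[OF hn_pos d pol_grid[OF hn_pos d] cn(1) le]) simp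
    then have "val c d \<le> ?B" using B0 by (intro enn2real_leI) auto
    then show "val c d - val c' d \<le> Psi (hn n) (real n) c d - Psi (hn n) (real n) c' d + \<delta>" by simp
  qed
qed

text \<open>Monotonicity of \<open>game\<close> in the level bounds it by difference quotients of
  \<open>Psi\<close>, which \<open>val_diff\<close> compares with those of the value. Quotients to
  the right give the upper bound, quotients to the left the lower one, and differentiability of the
  value makes the two agree.\<close>

lemma game_tendsto:
  assumes d: "d \<in> Ob" shows "(\<lambda>n. game (hn n) z d) \<longlonglongrightarrow> vc z d"
proof -
  let ?f = "\<lambda>x. val x d"
  have D: "(?f has_real_derivative vc z d) (at z)"
    using reg d unfolding value_regularity_def value_c_def partial_c_def by (simp add: DERIV_deriv_iff_field_differentiable)
  have quot: "((\<lambda>b. (?f (z + b) - ?f z) / b) \<longlongrightarrow> vc z d) (at 0)" using D unfolding DERIV_def .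
  have big: "\<exists>n1::nat. \<forall>n\<ge>n1. \<bar>a\<bar> \<le> real n \<and> \<bar>b\<bar> \<le> real n" for a b :: real
  proof -
    obtain n1 :: nat where "max \<bar>a\<bar> \<bar>b\<bar> \<le> real n1" using real_arch_simple by blast
    then show ?thesis by (intro exI[of _ n1]) auto
  qed
  show ?thesis
  proof (rule order_tendstoI)
    fix a assume a: "vc z d < a"
    have "eventually (\<lambda>b. (?f (z + b) - ?f z) / b < a) (at_right 0)"
      using quot a order_tendstoD(2) filterlim_at_split by blast
    then obtain b where b: "0 < b" "(?f (z + b) - ?f z) / b < a"
      unfolding eventually_at_right_field by (metis dense)
    \<comment> \<open>Half of the slack in the strict inequality for the difference quotient,
      multiplied out by \<open>b\<close>.\<close>
    define \<delta> where "\<delta> = (a * b - (?f (z + b) - ?f z)) / 2"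
    have \<delta>: "0 < \<delta>" using b by (simp add: \<delta>_def divide_less_eq)
    from val_diff[OF d \<delta>, of z "z + b"] obtain n0 where n0: "\<And>n. n0 \<le> n \<Longrightarrow>
      ?f z - ?f (z + b) \<le> Psi (hn n) (real n) z d - Psi (hn n) (real n) (z + b) d + \<delta>" by blast
    obtain n1 where n1: "\<forall>n\<ge>n1. \<bar>z\<bar> \<le> real n \<and> \<bar>z + b\<bar> \<le> real n" using big by blast
    have "game (hn n) z d < a" if n: "max n0 n1 \<le> n" for n
    proof -
      have zn: "\<bar>z\<bar> \<le> real n" "\<bar>z + b\<bar> \<le> real n" using n1 n by auto
      have "game (hn n) z d * (z + b - z) \<le> prim z (game (hn n)) (z + b) d"
        using b game_mono[OF hn_pos d] by (intro prim_ge[OF hn_pos game_cont[OF hn_pos] d]) auto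
      also have "\<dots> = Psi (hn n) (real n) (z + b) d - Psi (hn n) (real n) z d"
        using zn b by (intro Psi_diff[OF hn_pos d, symmetric]) auto
      also have "\<dots> \<le> ?f (z + b) - ?f z + \<delta>" using n0[of n] n by simp
      also have "\<dots> < a * b" using \<delta> by (simp add: \<delta>_def field_simps)
      finally show ?thesis using b by simp
    qed
    then show "eventually (\<lambda>n. game (hn n) z d < a) sequentially" unfolding eventually_sequentially by blast
  next
    fix a assume a: "a < vc z d"
    have "eventually (\<lambda>b. a < (?f (z + b) - ?f z) / b) (at_left 0)"
      using quot a order_tendstoD(1) filterlim_at_split by blast
    then obtain b where b: "b < 0" "a < (?f (z + b) - ?f z) / b"
      unfolding eventually_at_left_field by (metis dense)
    define \<delta> where "\<delta> = (?f z - ?f (z + b) - a * (- b)) / 2"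
    have \<delta>: "0 < \<delta>" using b by (simp add: \<delta>_def less_divide_eq)
    from val_diff[OF d \<delta>, of z "z + b"] obtain n0 where n0: "\<And>n. n0 \<le> n \<Longrightarrow>
      ?f z - ?f (z + b) \<le> Psi (hn n) (real n) z d - Psi (hn n) (real n) (z + b) d + \<delta>" by blast
    obtain n1 where n1: "\<forall>n\<ge>n1. \<bar>z\<bar> \<le> real n \<and> \<bar>z + b\<bar> \<le> real n" using big by blast
    have "a < game (hn n) z d" if n: "max n0 n1 \<le> n" for n
    proof -
      have zn: "\<bar>z\<bar> \<le> real n" "\<bar>z + b\<bar> \<le> real n" using n1 n by auto
      have "a * (- b) < ?f z - ?f (z + b) - \<delta>" using \<delta> by (simp add: \<delta>_def field_simps)
      also have "\<dots> \<le> Psi (hn n) (real n) z d - Psi (hn n) (real n) (z + b) d" using n0[of n] n by simp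
      also have "\<dots> = prim (z + b) (game (hn n)) z d"
        using zn b by (intro Psi_diff[OF hn_pos d]) auto
      also have "\<dots> \<le> game (hn n) z d * (z - (z + b))"
        using b game_mono[OF hn_pos d] by (intro prim_le[OF hn_pos game_cont[OF hn_pos] d]) auto
      finally show ?thesis using b by (simp add: mult_less_cancel_right)
    qed
    then show "eventually (\<lambda>n. a < game (hn n) z d) sequentially" unfolding eventually_sequentially by blast
  qed
qed

end

end

section \<open>Convergence of the threshold policies\<close>

text \<open>\<open>nat \<lceil>r / h\<rceil>\<close> indexes the first grid point not before
  \<open>r\<close>, and \<open>Suc (nat \<lfloor>t / h\<rfloor>)\<close> the first one after
  \<open>t\<close>.\<close>

lemma grid_bracket:
  fixes h r t :: real
  assumes h: "0 < h" and r: "0 \<le> r" "r \<le> t"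
  shows "r \<le> real (nat \<lceil>r / h\<rceil>) * h" "real (nat \<lceil>r / h\<rceil>) * h < r + h"
    "nat \<lceil>r / h\<rceil> \<le> Suc (nat \<lfloor>t / h\<rfloor>)" "real (Suc (nat \<lfloor>t / h\<rfloor>)) * h \<le> t + h"
proof -
  have q: "0 \<le> r / h" "r / h \<le> t / h" using h r by (auto intro: divide_right_mono)
  have k: "real (nat \<lceil>r / h\<rceil>) = of_int \<lceil>r / h\<rceil>" using q by simp
  have m: "real (nat \<lfloor>t / h\<rfloor>) = of_int \<lfloor>t / h\<rfloor>" using q by simp
  have "r / h \<le> real (nat \<lceil>r / h\<rceil>)" unfolding k by simp
  then show "r \<le> real (nat \<lceil>r / h\<rceil>) * h" using h by (simp add: pos_divide_le_eq)
  have "real (nat \<lceil>r / h\<rceil>) < r / h + 1" unfolding k by linarith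
  then have "real (nat \<lceil>r / h\<rceil>) * h < (r / h + 1) * h" using h by (intro mult_strict_right_mono)
  then show "real (nat \<lceil>r / h\<rceil>) * h < r + h" using h by (simp add: distrib_right)
  have "\<lceil>r / h\<rceil> \<le> \<lceil>t / h\<rceil>" using q by (intro ceiling_mono)
  also have "\<lceil>t / h\<rceil> \<le> \<lfloor>t / h\<rfloor> + 1" by linarith
  finally show "nat \<lceil>r / h\<rceil> \<le> Suc (nat \<lfloor>t / h\<rfloor>)" using q by (simp add: nat_le_iff)
  have "real (Suc (nat \<lfloor>t / h\<rfloor>)) \<le> t / h + 1" using m by linarith
  then have "real (Suc (nat \<lfloor>t / h\<rfloor>)) * h \<le> (t / h + 1) * h" using h by (intro mult_right_mono) auto
  then show "real (Suc (nat \<lfloor>t / h\<rfloor>)) * h \<le> t + h" using h by (simp add: distrib_right)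
qed

context capacity_problem
begin

abbreviation "bp \<equiv> boundary_plus vc q0p"
abbreviation "bm \<equiv> boundary_minus vc q0m"

definition Cs :: "real \<Rightarrow> real \<Rightarrow> real \<Rightarrow> 'a \<Rightarrow> real" where
  "Cs c d t \<omega> = real_of_ereal (C_star bp bm c (\<lambda>s. D d s \<omega>) t)"

context
  assumes reg: "value_regularity Ob (value_fun M F D g \<rho> q0p q0m) vc q0p q0m"
    and breg: "boundary_regularity Ob bp bm"
begin

section \<open>The boundaries as level sets of the marginal value\<close>

lemma vc_cont: "continuous_on (UNIV \<times> Ob) (\<lambda>(c, d). vc c d)"
  using reg unfolding value_regularity_def by blast

lemma vc_bounds: "d \<in> Ob \<Longrightarrow> - q0p \<le> vc c d" "d \<in> Ob \<Longrightarrow> vc c d \<le> q0m"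
  using reg unfolding value_regularity_def by blast+

lemma vc_mono: "d \<in> Ob \<Longrightarrow> z \<le> z' \<Longrightarrow> vc z d \<le> vc z' d"
  using game_mono[OF hn_pos] by (intro LIMSEQ_le[OF game_tendsto[OF reg] game_tendsto[OF reg]]) auto

lemma vc_section_cont: assumes y: "y \<in> Ob" shows "isCont (vc z) y"
proof -
  have pc: "continuous_on Ob (\<lambda>y. (z, y))" by (intro continuous_on_Pair continuous_on_const continuous_on_id)
  have "continuous_on Ob (vc z)" using continuous_on_compose2[OF vc_cont pc] by auto
  then show ?thesis using y open_Ob by (simp add: continuous_on_eq_continuous_at)
qed

lemma above_bp: assumes "y \<in> Ob" "bp y \<le> ereal b" "b < z" shows "- q0p < vc z y"
proof -
  have "bp y < ereal z" using assms(2,3) by (meson ereal_less_eq(3) le_less_trans less_ereal.simps(1))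
  then obtain c where "vc c y > - q0p" "c < z" unfolding boundary_plus_def by (auto simp: Inf_less_iff)
  then show ?thesis using vc_mono[OF assms(1), of c z] by simp
qed

lemma above_bm: assumes "y \<in> Ob" "bm y \<le> ereal b" "b < z" shows "vc z y = q0m"
proof (rule ccontr)
  assume "vc z y \<noteq> q0m"
  then have "vc z y < q0m" using vc_bounds(2)[OF assms(1), of z] by simp
  then have "ereal z \<le> bm y" unfolding boundary_minus_def by (intro Sup_upper) auto
  with assms show False by (meson ereal_less_eq(3) leD order_trans)
qed

lemma below_bm: assumes "y \<in> Ob" "ereal b \<le> bm y" "z < b" shows "vc z y < q0m"
proof -
  have "ereal z < bm y" using assms(2,3) by (meson less_le_trans less_ereal.simps(1))
  then obtain c where "vc c y < q0m" "z < c" unfolding boundary_minus_def by (auto simp: less_Sup_iff)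
  then show ?thesis using vc_mono[OF assms(1), of z c] by simp
qed

lemma below_bp: assumes "y \<in> Ob" "ereal b \<le> bp y" "z < b" shows "vc z y = - q0p"
proof (rule ccontr)
  assume "vc z y \<noteq> - q0p"
  then have "- q0p < vc z y" using vc_bounds(1)[OF assms(1), of z] by simp
  then have "bp y \<le> ereal z" unfolding boundary_plus_def by (intro Inf_lower) auto
  with assms show False by (meson ereal_less_eq(3) leD order_trans)
qed

text \<open>\<open>game\<close> is nonincreasing in the demand, so its convergence at the single
  state \<open>y + \<delta>\<close> controls it from below at all demands up to that state.\<close>

lemma shift_right:
  assumes y: "y \<in> Ob" and a: "a < vc z y"
  obtains \<delta> where "0 < \<delta>" "y + \<delta> \<in> Ob" "a < vc z (y + \<delta>)"
proof -
  have "eventually (\<lambda>q. a < vc z q) (nhds y)"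
    using vc_section_cont[OF y, of z] a unfolding isCont_def by (metis order_tendstoD(1) tendsto_at_iff_tendsto_nhds)
  moreover have "eventually (\<lambda>q. q \<in> Ob) (nhds y)" using open_Ob y by (rule eventually_nhds_in_open)
  ultimately have "eventually (\<lambda>q. a < vc z q \<and> q \<in> Ob) (nhds y)" by (rule eventually_conj)
  then obtain e where e: "0 < e" "\<And>q. dist q y < e \<Longrightarrow> a < vc z q \<and> q \<in> Ob" unfolding eventually_nhds_metric by blast
  show thesis using e(1) e(2)[of "y + e / 2"] by (intro that[of "e / 2"]) (auto simp: dist_real_def)
qed

lemma shift_left:
  assumes y: "y \<in> Ob" and a: "vc z y < a"
  obtains \<delta> where "0 < \<delta>" "y - \<delta> \<in> Ob" "vc z (y - \<delta>) < a"
proof -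
  have "eventually (\<lambda>q. vc z q < a) (nhds y)"
    using vc_section_cont[OF y, of z] a unfolding isCont_def by (metis order_tendstoD(2) tendsto_at_iff_tendsto_nhds)
  moreover have "eventually (\<lambda>q. q \<in> Ob) (nhds y)" using open_Ob y by (rule eventually_nhds_in_open)
  ultimately have "eventually (\<lambda>q. vc z q < a \<and> q \<in> Ob) (nhds y)" by (rule eventually_conj)
  then obtain e where e: "0 < e" "\<And>q. dist q y < e \<Longrightarrow> vc z q < a \<and> q \<in> Ob" unfolding eventually_nhds_metric by blast
  show thesis using e(1) e(2)[of "y - e / 2"] by (intro that[of "e / 2"]) (auto simp: dist_real_def)
qed

lemma hysteresis_path:
  assumes d: "d \<in> Ob" and w: "\<omega> \<in> space M"
  shows "hysteresis Ob bp bm (\<lambda>t. D d t \<omega>)"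
  using breg D_cont[OF d w] D_in[OF d w] unfolding boundary_regularity_def by unfold_locales blast+

lemma hn_eventually_less: "0 < e \<Longrightarrow> eventually (\<lambda>n. hn n < e) sequentially"
  using order_tendstoD(2)[OF hn_lim] .

lemma real_eventually_gt: "eventually (\<lambda>n. (b :: real) < real n) sequentially"
  using filterlim_real_sequentially unfolding filterlim_at_top_dense by blast

text \<open>The certificate \<open>C_below\<close> is transferred to the grid. From time
  \<open>r\<close> on, the demand stays below one state at which \<open>game\<close> exceeds
  \<open>- q0p + \<epsilon>\<close>, so the lower threshold remains below \<open>z\<close>. At the
  first grid point not before \<open>r\<close> the policy is below \<open>z\<close>, either pushed
  there by the upper threshold or by its start, and an induction over grid points preserves the
  bound.\<close>

lemma pol_upper:
  assumes d: "d \<in> Ob" and w: "\<omega> \<in> space M" and t: "0 \<le> t" and z: "Cs c d t \<omega> < z"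
  shows "\<exists>e0>0. \<forall>\<epsilon>. 0 < \<epsilon> \<and> \<epsilon> < e0 \<longrightarrow>
    eventually (\<lambda>n. pol (hn n) (real n) \<epsilon> d c (Suc (nat \<lfloor>t / hn n\<rfloor>)) \<omega> \<le> z) sequentially"
proof -
  define x where "x = (\<lambda>s. D d s \<omega>)"
  interpret hy: hysteresis Ob bp bm c x unfolding x_def by (rule hysteresis_path[OF d w])
  define y where "y = Cs c d t \<omega>"
  have yC: "y = hy.C t" unfolding y_def Cs_def hy.C_def by (simp add: x_def)
  obtain r where r: "r \<in> {0..t}" "bm (x r) \<le> ereal y \<or> r = 0 \<and> ereal c \<le> ereal y" "\<And>s. s \<in> {r..t} \<Longrightarrow> bp (x s) \<le> ereal y"
    using hy.C_below[OF t] unfolding yC below_def by blast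
  have r0: "0 \<le> r" "r \<le> t" using r(1) by auto
  obtain m where m: "m \<in> {r..t}" "\<And>q. q \<in> {r..t} \<Longrightarrow> x q \<le> x m" using hy.SUP_attained[OF r0] by metis
  have mO: "x m \<in> Ob" using m r0 by (intro hy.x_in) auto
  have gap: "- q0p < vc z (x m)" using above_bp[OF mO r(3)[OF m(1)]] z y_def by simp
  \<comment> \<open>Half of the gap, so that the strict inequality survives relaxation by every
    \<open>\<epsilon>\<close> below \<open>e1\<close>.\<close>
  define e1 where "e1 = (vc z (x m) + q0p) / 2"
  have e1: "0 < e1" "- q0p + e1 < vc z (x m)" using gap by (auto simp: e1_def field_simps)
  obtain \<delta> where \<delta>: "0 < \<delta>" "x m + \<delta> \<in> Ob" "- q0p + e1 < vc z (x m + \<delta>)" using shift_right[OF mO e1(2)] by metis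
  obtain \<eta> where \<eta>: "0 < \<eta>" "\<And>s. 0 \<le> s \<Longrightarrow> \<bar>s - t\<bar> < \<eta> \<Longrightarrow> \<bar>x s - x t\<bar> < \<delta>" using hy.near_x[OF t \<delta>(1)] by metis
  \<comment> \<open>The policy is read at the first grid point after \<open>t\<close>, so the demand
    must be controlled slightly beyond \<open>t\<close>.\<close>
  have xle: "x s \<le> x m + \<delta>" if "r \<le> s" "s < t + \<eta>" for s
  proof (cases "s \<le> t")
    case True then show ?thesis using m(2)[of s] that \<delta>(1) by simp
  next
    case False
    then have "\<bar>x s - x t\<bar> < \<delta>" using that t by (intro \<eta>(2)) auto
    then show ?thesis using m(2)[of t] r0 by simp
  qed
  show ?thesis
  proof (intro exI[of _ "min e1 ((q0p + q0m) / 2)"] conjI allI impI)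
    show "0 < min e1 ((q0p + q0m) / 2)" using e1 q0p_pos q0m_pos by simp
    fix \<epsilon> assume eps: "0 < \<epsilon> \<and> \<epsilon> < min e1 ((q0p + q0m) / 2)"
    then have eps2: "2 * \<epsilon> < q0p + q0m" by simp
    have "- q0p + \<epsilon> < vc z (x m + \<delta>)" using \<delta>(3) eps by simp
    then have ev1: "eventually (\<lambda>n. - q0p + \<epsilon> < game (hn n) z (x m + \<delta>)) sequentially"
      using order_tendstoD(1)[OF game_tendsto[OF reg \<delta>(2)]] by blast
    have ev2: "\<exists>\<theta>>0. bm (x r) \<le> ereal y \<longrightarrow> (x r + \<theta> \<in> Ob \<and> eventually (\<lambda>n. q0m - \<epsilon> < game (hn n) z (x r + \<theta>)) sequentially)"
    proof (cases "bm (x r) \<le> ereal y")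
      case True
      have rO: "x r \<in> Ob" using r0 by (intro hy.x_in)
      \<comment> \<open>The marginal value equals the obstacle here, so convergence alone would not
        place \<open>game\<close> on a definite side of it; the positive \<open>\<epsilon>\<close>
        supplies the slack.\<close>
      have "vc z (x r) = q0m" using above_bm[OF rO True] z y_def by simp
      then have "q0m - \<epsilon> < vc z (x r)" using eps by simp
      then obtain \<theta> where \<theta>: "0 < \<theta>" "x r + \<theta> \<in> Ob" "q0m - \<epsilon> < vc z (x r + \<theta>)" using shift_right[OF rO] by metis
      then show ?thesis using order_tendstoD(1)[OF game_tendsto[OF reg \<theta>(2)] \<theta>(3)] by blast
    qed (auto intro: exI[of _ 1])
    then obtain \<theta> where \<theta>: "0 < \<theta>" "bm (x r) \<le> ereal y \<Longrightarrow> x r + \<theta> \<in> Ob"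
      "bm (x r) \<le> ereal y \<Longrightarrow> eventually (\<lambda>n. q0m - \<epsilon> < game (hn n) z (x r + \<theta>)) sequentially" by blast
    obtain \<kappa> where \<kappa>: "0 < \<kappa>" "\<And>s. 0 \<le> s \<Longrightarrow> \<bar>s - r\<bar> < \<kappa> \<Longrightarrow> \<bar>x s - x r\<bar> < \<theta>" using hy.near_x[OF r0(1) \<theta>(1)] by metis
    have ev3: "eventually (\<lambda>n. bm (x r) \<le> ereal y \<longrightarrow> q0m - \<epsilon> < game (hn n) z (x r + \<theta>)) sequentially"
      using \<theta>(3) by (cases "bm (x r) \<le> ereal y") auto
    show "eventually (\<lambda>n. pol (hn n) (real n) \<epsilon> d c (Suc (nat \<lfloor>t / hn n\<rfloor>)) \<omega> \<le> z) sequentially"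
      using ev1 ev3 hn_eventually_less[OF \<eta>(1)] hn_eventually_less[OF \<kappa>(1)] real_eventually_gt[of "\<bar>z\<bar>"]
    proof eventually_elim
      case (elim n)
      let ?h = "hn n" and ?p = "\<lambda>k. pol (hn n) (real n) \<epsilon> d c k \<omega>" and ?K = "Suc (nat \<lfloor>t / hn n\<rfloor>)"
      define k0 where "k0 = nat \<lceil>r / ?h\<rceil>"
      note B = grid_bracket[OF hn_pos r0, of n, folded k0_def]
      have Xx: "X d (real k * ?h) \<omega> = x (real k * ?h)" for k using hn_pos[of n] by (simp add: X_eq x_def)
      have xO: "x (real k * ?h) \<in> Ob" for k using hn_pos[of n] by (intro hy.x_in) simp
      have pe: "?p k = max (al ?h (real n) \<epsilon> (x (real k * ?h))) (min (be ?h (real n) \<epsilon> (x (real k * ?h))) (prev c (pol ?h (real n) \<epsilon> d c) k \<omega>))" for k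
        using pol_eq[OF hn_pos, of n "real n" \<epsilon> d c k \<omega>] unfolding Xx .
      have zR: "- real n < z" "z \<le> real n" "z < real n" "- real n \<le> z" using elim(5) by auto
      have al: "al ?h (real n) \<epsilon> (x (real k * ?h)) \<le> z" if k: "k0 \<le> k" "k \<le> ?K" for k
      proof -
        have "real k0 * ?h \<le> real k * ?h" "real k * ?h \<le> real ?K * ?h" using k hn_pos[of n] by (auto intro!: mult_right_mono)
        then have "r \<le> real k * ?h" "real k * ?h < t + \<eta>" using B(1,4) elim(3) by linarith+
        then have "x (real k * ?h) \<le> x m + \<delta>" by (rule xle)
        from game_anti[OF hn_pos xO \<delta>(2) this, of n z] elim(1)
        have "\<not> game ?h z (x (real k * ?h)) \<le> - q0p + \<epsilon>" by simp
        then show ?thesis using al_ge_iff[OF hn_pos[of n] xO[of k] _ zR(1,2), of \<epsilon>] by simp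
      qed
      have start: "?p k0 \<le> z"
      proof (cases "bm (x r) \<le> ereal y")
        case True
        have "\<bar>x (real k0 * ?h) - x r\<bar> < \<theta>" using B(1,2) elim(4) r0 by (intro \<kappa>(2)) auto
        then have le: "x (real k0 * ?h) \<le> x r + \<theta>" by simp
        have "q0m - \<epsilon> \<le> game ?h z (x (real k0 * ?h))"
          using game_anti[OF hn_pos xO \<theta>(2)[OF True] le, of n z] elim(2) True by simp
        then have "be ?h (real n) \<epsilon> (x (real k0 * ?h)) \<le> z" using be_le_iff[OF hn_pos[of n] xO[of k0] _ zR(4,3), of \<epsilon>] by simp
        moreover have "al ?h (real n) \<epsilon> (x (real k0 * ?h)) \<le> be ?h (real n) \<epsilon> (x (real k0 * ?h))"
          by (rule al_le_be[OF hn_pos xO _ eps2]) simp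
        ultimately show ?thesis using pe[of k0] by simp
      next
        case False
        \<comment> \<open>The certificate rests on the initial capacity instead of a push, so
          \<open>k0 = 0\<close>, and projecting \<open>c\<close> can raise it at most to the lower
          threshold.\<close>
        then have "r = 0" "c \<le> y" using r(2) by auto
        then have k0: "k0 = 0" "c \<le> z" using z y_def by (auto simp: k0_def)
        then show ?thesis using al[of 0] pe[of 0] k0 by (simp add: prev_def)
      qed
      have "?p k \<le> z" if "k0 \<le> k" "k \<le> ?K" for k
        using that
      proof (induction k rule: dec_induct)
        case (step k)
        have "?p (Suc k) \<le> max (al ?h (real n) \<epsilon> (x (real (Suc k) * ?h))) (?p k)"
          using pe[of "Suc k"] by (simp add: prev_def)
        also have "\<dots> \<le> z" using al[of "Suc k"] step by simp
        finally show ?case .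
      qed (use start in simp)
      then show ?case using B(3) by simp
    qed
  qed
qed

text \<open>Mirror image of \<open>pol_upper\<close>: the demand stays above one state at which
  \<open>game\<close> is below \<open>q0m - \<epsilon>\<close>, so the upper threshold cannot push
  the policy below \<open>z\<close>.\<close>

lemma pol_lower:
  assumes d: "d \<in> Ob" and w: "\<omega> \<in> space M" and t: "0 \<le> t" and z: "z < Cs c d t \<omega>"
  shows "\<exists>e0>0. \<forall>\<epsilon>. 0 < \<epsilon> \<and> \<epsilon> < e0 \<longrightarrow>
    eventually (\<lambda>n. z \<le> pol (hn n) (real n) \<epsilon> d c (Suc (nat \<lfloor>t / hn n\<rfloor>)) \<omega>) sequentially"
proof -
  define x where "x = (\<lambda>s. D d s \<omega>)"
  interpret hy: hysteresis Ob bp bm c x unfolding x_def by (rule hysteresis_path[OF d w])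
  define y where "y = Cs c d t \<omega>"
  have yC: "y = hy.C t" unfolding y_def Cs_def hy.C_def by (simp add: x_def)
  obtain r where r: "r \<in> {0..t}" "ereal y \<le> bp (x r) \<or> r = 0 \<and> ereal y \<le> ereal c" "\<And>s. s \<in> {r..t} \<Longrightarrow> ereal y \<le> bm (x s)"
    using hy.C_above[OF t] unfolding yC above_def by blast
  have r0: "0 \<le> r" "r \<le> t" using r(1) by auto
  have "continuous_on {r..t} x" using hy.cont_x r0 by (auto intro: continuous_on_subset)
  from continuous_attains_inf[OF _ _ this] obtain m where m: "m \<in> {r..t}" "\<And>q. q \<in> {r..t} \<Longrightarrow> x m \<le> x q"
    using r0 by auto
  have mO: "x m \<in> Ob" using m r0 by (intro hy.x_in) auto
  have gap: "vc z (x m) < q0m" using below_bm[OF mO r(3)[OF m(1)]] z y_def by simp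
  define e1 where "e1 = (q0m - vc z (x m)) / 2"
  have e1: "0 < e1" "vc z (x m) < q0m - e1" using gap by (auto simp: e1_def field_simps)
  obtain \<delta> where \<delta>: "0 < \<delta>" "x m - \<delta> \<in> Ob" "vc z (x m - \<delta>) < q0m - e1" using shift_left[OF mO e1(2)] by metis
  obtain \<eta> where \<eta>: "0 < \<eta>" "\<And>s. 0 \<le> s \<Longrightarrow> \<bar>s - t\<bar> < \<eta> \<Longrightarrow> \<bar>x s - x t\<bar> < \<delta>" using hy.near_x[OF t \<delta>(1)] by metis
  have xle: "x m - \<delta> \<le> x s" if "r \<le> s" "s < t + \<eta>" for s
  proof (cases "s \<le> t")
    case True then show ?thesis using m(2)[of s] that \<delta>(1) by simp
  next
    case False
    then have "\<bar>x s - x t\<bar> < \<delta>" using that t by (intro \<eta>(2)) auto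
    then show ?thesis using m(2)[of t] r0 by simp
  qed
  show ?thesis
  proof (intro exI[of _ "min e1 ((q0p + q0m) / 2)"] conjI allI impI)
    show "0 < min e1 ((q0p + q0m) / 2)" using e1 q0p_pos q0m_pos by simp
    fix \<epsilon> assume eps: "0 < \<epsilon> \<and> \<epsilon> < min e1 ((q0p + q0m) / 2)"
    then have eps2: "2 * \<epsilon> < q0p + q0m" by simp
    have "vc z (x m - \<delta>) < q0m - \<epsilon>" using \<delta>(3) eps by simp
    then have ev1: "eventually (\<lambda>n. game (hn n) z (x m - \<delta>) < q0m - \<epsilon>) sequentially"
      using order_tendstoD(2)[OF game_tendsto[OF reg \<delta>(2)]] by blast
    have ev2: "\<exists>\<theta>>0. ereal y \<le> bp (x r) \<longrightarrow> (x r - \<theta> \<in> Ob \<and> eventually (\<lambda>n. game (hn n) z (x r - \<theta>) < - q0p + \<epsilon>) sequentially)"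
    proof (cases "ereal y \<le> bp (x r)")
      case True
      have rO: "x r \<in> Ob" using r0 by (intro hy.x_in)
      have "vc z (x r) = - q0p" using below_bp[OF rO True] z y_def by simp
      then have "vc z (x r) < - q0p + \<epsilon>" using eps by simp
      then obtain \<theta> where \<theta>: "0 < \<theta>" "x r - \<theta> \<in> Ob" "vc z (x r - \<theta>) < - q0p + \<epsilon>" using shift_left[OF rO] by metis
      then show ?thesis using order_tendstoD(2)[OF game_tendsto[OF reg \<theta>(2)] \<theta>(3)] by blast
    qed (auto intro: exI[of _ 1])
    then obtain \<theta> where \<theta>: "0 < \<theta>" "ereal y \<le> bp (x r) \<Longrightarrow> x r - \<theta> \<in> Ob"
      "ereal y \<le> bp (x r) \<Longrightarrow> eventually (\<lambda>n. game (hn n) z (x r - \<theta>) < - q0p + \<epsilon>) sequentially" by blast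
    obtain \<kappa> where \<kappa>: "0 < \<kappa>" "\<And>s. 0 \<le> s \<Longrightarrow> \<bar>s - r\<bar> < \<kappa> \<Longrightarrow> \<bar>x s - x r\<bar> < \<theta>" using hy.near_x[OF r0(1) \<theta>(1)] by metis
    have ev3: "eventually (\<lambda>n. ereal y \<le> bp (x r) \<longrightarrow> game (hn n) z (x r - \<theta>) < - q0p + \<epsilon>) sequentially"
      using \<theta>(3) by (cases "ereal y \<le> bp (x r)") auto
    show "eventually (\<lambda>n. z \<le> pol (hn n) (real n) \<epsilon> d c (Suc (nat \<lfloor>t / hn n\<rfloor>)) \<omega>) sequentially"
      using ev1 ev3 hn_eventually_less[OF \<eta>(1)] hn_eventually_less[OF \<kappa>(1)] real_eventually_gt[of "\<bar>z\<bar>"]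
    proof eventually_elim
      case (elim n)
      let ?h = "hn n" and ?p = "\<lambda>k. pol (hn n) (real n) \<epsilon> d c k \<omega>" and ?K = "Suc (nat \<lfloor>t / hn n\<rfloor>)"
      define k0 where "k0 = nat \<lceil>r / ?h\<rceil>"
      note B = grid_bracket[OF hn_pos r0, of n, folded k0_def]
      have Xx: "X d (real k * ?h) \<omega> = x (real k * ?h)" for k using hn_pos[of n] by (simp add: X_eq x_def)
      have xO: "x (real k * ?h) \<in> Ob" for k using hn_pos[of n] by (intro hy.x_in) simp
      have pe: "?p k = max (al ?h (real n) \<epsilon> (x (real k * ?h))) (min (be ?h (real n) \<epsilon> (x (real k * ?h))) (prev c (pol ?h (real n) \<epsilon> d c) k \<omega>))" for k
        using pol_eq[OF hn_pos, of n "real n" \<epsilon> d c k \<omega>] unfolding Xx .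
      have zR: "- real n < z" "z \<le> real n" "z < real n" "- real n \<le> z" using elim(5) by auto
      have be: "z \<le> be ?h (real n) \<epsilon> (x (real k * ?h))" if k: "k0 \<le> k" "k \<le> ?K" for k
      proof -
        have "real k0 * ?h \<le> real k * ?h" "real k * ?h \<le> real ?K * ?h" using k hn_pos[of n] by (auto intro!: mult_right_mono)
        then have "r \<le> real k * ?h" "real k * ?h < t + \<eta>" using B(1,4) elim(3) by linarith+
        then have "x m - \<delta> \<le> x (real k * ?h)" by (rule xle)
        from game_anti[OF hn_pos \<delta>(2) xO this, of n z] elim(1)
        have "\<not> q0m - \<epsilon> \<le> game ?h z (x (real k * ?h))" by simp
        then show ?thesis using be_le_iff[OF hn_pos[of n] xO[of k] _ zR(4,3), of \<epsilon>] by simp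
      qed
      have start: "z \<le> ?p k0"
      proof (cases "ereal y \<le> bp (x r)")
        case True
        have "\<bar>x (real k0 * ?h) - x r\<bar> < \<theta>" using B(1,2) elim(4) r0 by (intro \<kappa>(2)) auto
        then have le: "x r - \<theta> \<le> x (real k0 * ?h)" by simp
        have "game ?h z (x (real k0 * ?h)) \<le> - q0p + \<epsilon>"
          using game_anti[OF hn_pos \<theta>(2)[OF True] xO le, of n z] elim(2) True by simp
        then have "z \<le> al ?h (real n) \<epsilon> (x (real k0 * ?h))" using al_ge_iff[OF hn_pos[of n] xO[of k0] _ zR(1,2), of \<epsilon>] by simp
        then show ?thesis using pe[of k0] by simp
      next
        case False
        then have "r = 0" "y \<le> c" using r(2) by auto
        then have k0: "k0 = 0" "z \<le> c" using z y_def by (auto simp: k0_def)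
        then show ?thesis using be[of 0] pe[of 0] k0 by (simp add: prev_def)
      qed
      have "z \<le> ?p k" if "k0 \<le> k" "k \<le> ?K" for k
        using that
      proof (induction k rule: dec_induct)
        case (step k)
        have "z \<le> min (be ?h (real n) \<epsilon> (x (real (Suc k) * ?h))) (?p k)" using be[of "Suc k"] step by simp
        also have "\<dots> \<le> ?p (Suc k)"
          using pe[of "Suc k"] by (simp add: prev_def)
        finally show ?case .
      qed (use start in simp)
      then show ?case using B(3) by simp
    qed
  qed
qed

end

end

section \<open>Optimality of the limit\<close>

text \<open>
  The iterated limit: the second component tends to infinity first.
\<close>

definition iter_seq :: "(nat \<times> nat) filter" where
  "iter_seq = Abs_filter (\<lambda>P. eventually (\<lambda>j. eventually (\<lambda>n. P (j, n)) sequentially) sequentially)"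

lemma eventually_iter_seq:
  "eventually P iter_seq \<longleftrightarrow> eventually (\<lambda>j. eventually (\<lambda>n. P (j, n)) sequentially) sequentially"
  unfolding iter_seq_def
proof (rule eventually_Abs_filter, rule is_filter.intro)
  fix P Q :: "nat \<times> nat \<Rightarrow> bool"
  assume "eventually (\<lambda>j. eventually (\<lambda>n. P (j, n)) sequentially) sequentially"
    "eventually (\<lambda>j. eventually (\<lambda>n. Q (j, n)) sequentially) sequentially"
  then show "eventually (\<lambda>j. eventually (\<lambda>n. P (j, n) \<and> Q (j, n)) sequentially) sequentially"
    by eventually_elim (rule eventually_conj)
next
  fix P Q :: "nat \<times> nat \<Rightarrow> bool"
  assume PQ: "\<forall>x. P x \<longrightarrow> Q x" and "eventually (\<lambda>j. eventually (\<lambda>n. P (j, n)) sequentially) sequentially"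
  from this(2) show "eventually (\<lambda>j. eventually (\<lambda>n. Q (j, n)) sequentially) sequentially"
    by eventually_elim (use PQ in \<open>auto elim: eventually_mono\<close>)
qed simp

lemma filterlim_snd_iter_seq: "filterlim snd sequentially iter_seq"
  unfolding filterlim_iff eventually_iter_seq by simp

lemma filterlim_fst_iter_seq: "filterlim fst sequentially iter_seq"
  unfolding filterlim_iff eventually_iter_seq by (auto elim!: eventually_mono)

abbreviation iter_liminf :: "(nat \<times> nat \<Rightarrow> 'b :: complete_lattice) \<Rightarrow> 'b" where
  "iter_liminf f \<equiv> liminf (\<lambda>j. liminf (\<lambda>n. f (j, n)))"

lemma iter_liminf_ge:
  fixes f :: "nat \<times> nat \<Rightarrow> 'b :: {complete_linorder, dense_linorder, linorder_topology}"
  assumes "(f \<longlongrightarrow> a) iter_seq" shows "a \<le> iter_liminf f"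
proof (rule dense_le)
  fix b assume "b < a"
  then have "eventually (\<lambda>p. b < f p) iter_seq" by (rule order_tendstoD(1)[OF assms])
  then show "b \<le> iter_liminf f" unfolding eventually_iter_seq
    by (intro Liminf_bounded) (auto elim!: eventually_mono intro!: Liminf_bounded)
qed

lemma iter_liminf_mono: "eventually (\<lambda>p. f p \<le> g p) iter_seq \<Longrightarrow> iter_liminf f \<le> iter_liminf g"
  unfolding eventually_iter_seq by (intro Liminf_mono) (auto elim!: eventually_mono intro!: Liminf_mono)

lemma iter_liminf_le:
  fixes f :: "nat \<times> nat \<Rightarrow> 'b :: {complete_linorder, dense_linorder, linorder_topology}"
  assumes "(f \<longlongrightarrow> a) iter_seq" shows "iter_liminf f \<le> a"
proof (rule dense_ge)
  fix b assume "a < b"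
  then have "eventually (\<lambda>p. f p < b) iter_seq" by (rule order_tendstoD(2)[OF assms])
  then have "eventually (\<lambda>p. f p \<le> b) iter_seq" by (rule eventually_mono) simp
  from iter_liminf_mono[OF this] show "iter_liminf f \<le> b" by (simp add: Liminf_const)
qed

lemma iter_liminf_eq:
  fixes f :: "nat \<times> nat \<Rightarrow> 'b :: {complete_linorder, dense_linorder, linorder_topology}"
  shows "(f \<longlongrightarrow> a) iter_seq \<Longrightarrow> iter_liminf f = a"
  using iter_liminf_ge iter_liminf_le by (intro antisym)

text \<open>Fatou's lemma is applied to the inner and to the outer sequence; this is why lower
  limits are nested along sequences instead of being taken along \<open>iter_seq\<close>.\<close>

lemma nn_integral_iter_liminf:
  assumes f: "\<And>p. f p \<in> borel_measurable N"
  shows "(\<integral>\<^sup>+x. iter_liminf (\<lambda>p. f p x) \<partial>N) \<le> iter_liminf (\<lambda>p. \<integral>\<^sup>+x. f p x \<partial>N)"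
proof -
  have "(\<integral>\<^sup>+x. iter_liminf (\<lambda>p. f p x) \<partial>N) \<le> liminf (\<lambda>j. \<integral>\<^sup>+x. liminf (\<lambda>n. f (j, n) x) \<partial>N)"
    using f by (intro nn_integral_liminf) measurable
  also have "\<dots> \<le> iter_liminf (\<lambda>p. \<integral>\<^sup>+x. f p x \<partial>N)"
    using f by (intro Liminf_mono always_eventually allI nn_integral_liminf)
  finally show ?thesis .
qed

text \<open>Allows the suprema in the two variations to be taken one at a time inside the cost
  expression.\<close>

lemma SUP_affine_le:
  fixes a b B :: ennreal
  assumes "A \<noteq> {}" "\<And>i. i \<in> A \<Longrightarrow> a + b * S i \<le> B" shows "a + b * (SUP i\<in>A. S i) \<le> B"
proof -
  have "a + b * (SUP i\<in>A. S i) = (SUP i\<in>A. a + b * S i)"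
    by (simp add: SUP_mult_left_ennreal ennreal_SUP_add_right[OF assms(1)])
  then show ?thesis using assms(2) by (simp add: SUP_le_iff)
qed

lemma nn_integral_shift_le:
  fixes f :: "real \<Rightarrow> ennreal"
  assumes f: "f \<in> borel_measurable borel" and h: "0 \<le> h"
  shows "(\<integral>\<^sup>+u\<in>{0..}. f (h + u) \<partial>lborel) \<le> (\<integral>\<^sup>+t\<in>{0..}. f t \<partial>lborel)"
proof -
  have "(\<integral>\<^sup>+t\<in>{h..}. f t \<partial>lborel) = (\<integral>\<^sup>+u. f (h + u) * indicator {h..} (h + u) \<partial>lborel)"
    using f nn_integral_real_affine[of "\<lambda>t. f t * indicator {h..} t" 1 h] by simp
  also have "\<dots> = (\<integral>\<^sup>+u\<in>{0..}. f (h + u) \<partial>lborel)" by (intro nn_integral_cong) (simp add: indicator_def)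
  finally have "(\<integral>\<^sup>+u\<in>{0..}. f (h + u) \<partial>lborel) = (\<integral>\<^sup>+t\<in>{h..}. f t \<partial>lborel)" ..
  also have "\<dots> \<le> (\<integral>\<^sup>+t\<in>{0..}. f t \<partial>lborel)"
    using h by (intro nn_integral_mono mult_left_mono) (auto simp: indicator_def)
  finally show ?thesis .
qed

lemma nat_floor_shift: "0 < (h :: real) \<Longrightarrow> 0 \<le> u \<Longrightarrow> nat \<lfloor>(h + u) / h\<rfloor> = Suc (nat \<lfloor>u / h\<rfloor>)"
proof -
  assume h: "0 < h" and u: "0 \<le> u"
  have "(h + u) / h = u / h + 1" using h by (simp add: add_divide_distrib)
  then have "\<lfloor>(h + u) / h\<rfloor> = \<lfloor>u / h\<rfloor> + 1" by simp
  then show ?thesis using h u by (simp add: Suc_nat_eq_nat_zadd1)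
qed

lemma pos_variation_measurable:
  assumes fin: "\<And>t. pos_variation f t < \<infinity>" shows "(\<lambda>s. pos_variation f s) \<in> borel_measurable borel"
proof -
  have "mono (\<lambda>s. enn2real (pos_variation f s))"
    using fin by (auto simp: mono_def intro!: enn2real_mono pos_variation_mono)
  from measurable_compose[OF borel_measurable_mono[OF this] measurable_ennreal]
  moreover have "(\<lambda>s. ennreal (enn2real (pos_variation f s))) = (\<lambda>s. pos_variation f s)" using fin by simp
  ultimately show ?thesis by (simp only:)
qed

lemma measurable_floor_comp:
  fixes a :: "nat \<Rightarrow> real" shows "(\<lambda>t :: real. a (nat \<lfloor>t / h\<rfloor>)) \<in> borel_measurable borel"
proof -
  have "(\<lambda>t :: real. nat \<lfloor>t / h\<rfloor>) \<in> measurable borel (count_space UNIV)" by measurable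
  then show ?thesis by (rule measurable_compose) simp
qed

context capacity_problem
begin

text \<open>The summand \<open>2\<close> keeps \<open>eta j\<close> at most \<open>1 / 2\<close>, so
  that twice the tolerance \<open>eta j * min q0p q0m\<close> stays below
  \<open>q0p + q0m\<close>.\<close>

definition eta :: "nat \<Rightarrow> real" where "eta j = 1 / (real j + 2)"

text \<open>The tolerance is at most \<open>eta j * q0p\<close> and at most
  \<open>eta j * q0m\<close>, as \<open>pol_near_optimal\<close> demands. \<open>fst p\<close>
  governs the relaxation, \<open>snd p\<close> the mesh and the range of levels.\<close>

definition Y :: "real \<Rightarrow> real \<Rightarrow> nat \<times> nat \<Rightarrow> nat \<Rightarrow> 'a \<Rightarrow> real" where
  "Y c d p = pol (hn (snd p)) (real (snd p)) (eta (fst p) * min q0p q0m) d c"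

lemma eta_bounds: "0 < eta j" "eta j < 1" by (auto simp: eta_def)

lemma eta_lim: "eta \<longlonglongrightarrow> 0"
  using LIMSEQ_ignore_initial_segment[OF hn_lim, of 1] unfolding eta_def hn_def by (simp add: add.commute add.left_commute)

lemma hn_snd_lim: "((\<lambda>p. hn (snd p)) \<longlongrightarrow> 0) iter_seq"
  by (rule filterlim_compose[OF hn_lim filterlim_snd_iter_seq])

lemma Y_grid: "d \<in> Ob \<Longrightarrow> grid_control (hn (snd p)) (real (snd p)) (Y c d p)"
  unfolding Y_def by (rule pol_grid[OF hn_pos]) auto

text \<open>
  Reading the policy one grid step late makes its limit right-continuous in time.
\<close>

definition shifted_control :: "real \<Rightarrow> real \<Rightarrow> nat \<times> nat \<Rightarrow> real \<Rightarrow> 'a \<Rightarrow> real" where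
  "shifted_control c d p s \<omega> = Y c d p (Suc (nat \<lfloor>s / hn (snd p)\<rfloor>)) \<omega> - c"

lemma shifted_control_jump: "extend0 (\<lambda>s. shifted_control c d p s \<omega>) t = jump_value c (Y c d p) \<omega> (jump_count 1 (hn (snd p)) t)"
  by (auto simp: extend0_def shifted_control_def jump_value_def jump_count_def)

text \<open>At time \<open>s\<close> the shifted path has already made the jump of the next grid
  time, hence the second \<open>Suc\<close>.\<close>

definition var_up :: "real \<Rightarrow> real \<Rightarrow> nat \<times> nat \<Rightarrow> real \<Rightarrow> 'a \<Rightarrow> real" where
  "var_up c d p s \<omega> = (\<Sum>k<Suc (Suc (nat \<lfloor>s / hn (snd p)\<rfloor>)). max 0 (Y c d p k \<omega> - prev c (Y c d p) k \<omega>))"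

definition var_down :: "real \<Rightarrow> real \<Rightarrow> nat \<times> nat \<Rightarrow> real \<Rightarrow> 'a \<Rightarrow> real" where
  "var_down c d p s \<omega> = (\<Sum>k<Suc (Suc (nat \<lfloor>s / hn (snd p)\<rfloor>)). max 0 (prev c (Y c d p) k \<omega> - Y c d p k \<omega>))"

lemma shifted_control_variation:
  assumes s: "0 \<le> s"
  shows "pos_variation (\<lambda>s. shifted_control c d p s \<omega>) s \<le> ennreal (var_up c d p s \<omega>)"
    "neg_variation (\<lambda>s. shifted_control c d p s \<omega>) s \<le> ennreal (var_down c d p s \<omega>)"
proof -
  let ?h = "hn (snd p)"
  have J3: "jump_value c C \<omega> k - jump_value c C \<omega> (Suc k) = prev c C k \<omega> - C k \<omega>" for C k
    using jump_value_diff[of c C \<omega> k] by linarith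
  have jc: "jump_count 1 ?h s = Suc (Suc (nat \<lfloor>s / ?h\<rfloor>))" using s by (simp add: jump_count_def)
  show "pos_variation (\<lambda>s. shifted_control c d p s \<omega>) s \<le> ennreal (var_up c d p s \<omega>)"
    using pos_variation_jump_path[OF mono_jump_count[OF hn_pos] shifted_control_jump, of c d p \<omega> s] unfolding jump_value_diff jc var_up_def .
  show "neg_variation (\<lambda>s. shifted_control c d p s \<omega>) s \<le> ennreal (var_down c d p s \<omega>)"
    using neg_variation_jump_path[OF mono_jump_count[OF hn_pos] shifted_control_jump, of c d p \<omega> s] unfolding J3 jc var_down_def .
qed

text \<open>Capacity and demand are shifted together, so a translation in time leads back to
  \<open>gpath\<close>; discounting then contributes only the factor
  \<open>exp (\<rho> * hn (snd p))\<close>, which tends to \<open>1\<close>.\<close>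

definition run_density :: "real \<Rightarrow> real \<Rightarrow> nat \<times> nat \<Rightarrow> 'a \<Rightarrow> real \<Rightarrow> ennreal" where
  "run_density c d p \<omega> s = ennreal (exp (- \<rho> * s) * g (c + shifted_control c d p s \<omega>) (X d (hn (snd p) + s) \<omega>))"

definition variation_density :: "real \<Rightarrow> real \<Rightarrow> nat \<times> nat \<Rightarrow> 'a \<Rightarrow> real \<Rightarrow> ennreal" where
  "variation_density c d p \<omega> s = ennreal (\<rho> * exp (- \<rho> * s)) *
     (ennreal q0p * ennreal (var_up c d p s \<omega>) + ennreal q0m * ennreal (var_down c d p s \<omega>))"

lemma run_density_meas:
  assumes d: "d \<in> Ob" and w: "\<omega> \<in> space M" shows "run_density c d p \<omega> \<in> borel_measurable borel"
proof -
  have "(\<lambda>s. X d (hn (snd p) + s) \<omega>) \<in> borel_measurable borel"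
    by (intro borel_measurable_continuous_onI continuous_on_compose2[OF X_cont[OF d w]] continuous_intros) auto
  then have "(\<lambda>s. g (c + shifted_control c d p s \<omega>) (X d (hn (snd p) + s) \<omega>)) \<in> borel_measurable borel"
    unfolding shifted_control_def using X_in[OF d w] measurable_floor_comp[of "\<lambda>k. Y c d p (Suc k) \<omega>" "hn (snd p)"]
    by (intro measurable_comp_continuous_on[OF g_cont, of "\<lambda>s. c + (Y c d p (Suc (nat \<lfloor>s / hn (snd p)\<rfloor>)) \<omega> - c)"]) auto
  then show ?thesis unfolding run_density_def by measurable
qed

lemma variation_density_meas: "variation_density c d p \<omega> \<in> borel_measurable borel"
proof -
  have "(\<lambda>s. var_up c d p s \<omega>) \<in> borel_measurable borel" unfolding var_up_def
    by (rule measurable_floor_comp[of "\<lambda>m. \<Sum>k<Suc (Suc m). max 0 (Y c d p k \<omega> - prev c (Y c d p) k \<omega>)"])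
  moreover have "(\<lambda>s. var_down c d p s \<omega>) \<in> borel_measurable borel" unfolding var_down_def
    by (rule measurable_floor_comp[of "\<lambda>m. \<Sum>k<Suc (Suc m). max 0 (prev c (Y c d p) k \<omega> - Y c d p k \<omega>)"])
  ultimately show ?thesis unfolding variation_density_def by measurable
qed

lemma run_density_gpath:
  assumes d: "d \<in> Ob" and w: "\<omega> \<in> space M"
  shows "(\<integral>\<^sup>+s\<in>{0..}. run_density c d p \<omega> s \<partial>lborel) \<le> ennreal (exp (\<rho> * hn (snd p))) * gpath (hn (snd p)) d (Y c d p) \<omega>"
proof -
  let ?h = "hn (snd p)"
  let ?f = "\<lambda>t. ennreal (exp (- \<rho> * t) * g (Y c d p (nat \<lfloor>t / ?h\<rfloor>) \<omega>) (X d t \<omega>))"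
  have m: "?f \<in> borel_measurable borel"
  proof -
    have "(\<lambda>t. X d t \<omega>) \<in> borel_measurable borel"
      by (rule borel_measurable_continuous_onI[OF X_cont[OF d w]])
    then have "(\<lambda>t. g (Y c d p (nat \<lfloor>t / ?h\<rfloor>) \<omega>) (X d t \<omega>)) \<in> borel_measurable borel"
      using X_in[OF d w] measurable_floor_comp[of "\<lambda>k. Y c d p k \<omega>" ?h]
      by (intro measurable_comp_continuous_on[OF g_cont, of "\<lambda>t. Y c d p (nat \<lfloor>t / ?h\<rfloor>) \<omega>"]) auto
    then show ?thesis by measurable
  qed
  have "(\<integral>\<^sup>+s\<in>{0..}. run_density c d p \<omega> s \<partial>lborel) = (\<integral>\<^sup>+s. ennreal (exp (\<rho> * ?h)) * (?f (?h + s) * indicator {0..} s) \<partial>lborel)"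
  proof (intro nn_integral_cong)
    fix s :: real
    show "run_density c d p \<omega> s * indicator {0..} s = ennreal (exp (\<rho> * ?h)) * (?f (?h + s) * indicator {0..} s)"
    proof (cases "0 \<le> s")
      case True
      have "exp (- \<rho> * s) = exp (\<rho> * ?h) * exp (- \<rho> * (?h + s))" by (simp add: exp_add[symmetric] algebra_simps)
      then show ?thesis using True
        by (simp add: run_density_def shifted_control_def nat_floor_shift[OF hn_pos] ennreal_mult'[symmetric] mult.assoc)
    qed simp
  qed
  also have "\<dots> = ennreal (exp (\<rho> * ?h)) * (\<integral>\<^sup>+s\<in>{0..}. ?f (?h + s) \<partial>lborel)"
  proof (rule nn_integral_cmult)
    have "(\<lambda>s. ?f (?h + s)) \<in> borel_measurable borel" by (rule measurable_compose[OF _ m]) measurable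
    then show "(\<lambda>s. ?f (?h + s) * indicator {0..} s) \<in> borel_measurable lborel" by simp
  qed
  also have "\<dots> \<le> ennreal (exp (\<rho> * ?h)) * (\<integral>\<^sup>+s\<in>{0..}. ?f s \<partial>lborel)"
    using hn_pos[of "snd p"] by (intro mult_left_mono nn_integral_shift_le[OF m]) auto
  also have "(\<integral>\<^sup>+s\<in>{0..}. ?f s \<partial>lborel) = gpath ?h d (Y c d p) \<omega>"
    unfolding gpath_def by (intro nn_integral_cong) (auto simp: indicator_def X_eq)
  finally show ?thesis .
qed

lemma variation_density_vpath: "(\<integral>\<^sup>+s\<in>{0..}. variation_density c d p \<omega> s \<partial>lborel) \<le> ennreal (exp (\<rho> * hn (snd p))) * vpath (hn (snd p)) c (Y c d p) \<omega>"
proof -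
  let ?h = "hn (snd p)" and ?C = "Y c d p"
  let ?u = "\<lambda>m. \<Sum>k<Suc m. max 0 (?C k \<omega> - prev c ?C k \<omega>)" and ?v = "\<lambda>m. \<Sum>k<Suc m. max 0 (prev c ?C k \<omega> - ?C k \<omega>)"
  let ?f = "\<lambda>t. ennreal (\<rho> * exp (- \<rho> * t)) * (ennreal q0p * ennreal (?u (nat \<lfloor>t / ?h\<rfloor>)) + ennreal q0m * ennreal (?v (nat \<lfloor>t / ?h\<rfloor>)))"
  have m: "?f \<in> borel_measurable borel"
    using measurable_floor_comp[of ?u ?h] measurable_floor_comp[of ?v ?h] by measurable
  have "(\<integral>\<^sup>+s\<in>{0..}. variation_density c d p \<omega> s \<partial>lborel) = (\<integral>\<^sup>+s. ennreal (exp (\<rho> * ?h)) * (?f (?h + s) * indicator {0..} s) \<partial>lborel)"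
  proof (intro nn_integral_cong)
    fix s :: real
    show "variation_density c d p \<omega> s * indicator {0..} s = ennreal (exp (\<rho> * ?h)) * (?f (?h + s) * indicator {0..} s)"
    proof (cases "0 \<le> s")
      case True
      have "\<rho> * exp (- \<rho> * s) = exp (\<rho> * ?h) * (\<rho> * exp (- \<rho> * (?h + s)))" by (simp add: exp_add[symmetric] algebra_simps)
      then have "ennreal (\<rho> * exp (- \<rho> * s)) = ennreal (exp (\<rho> * ?h)) * ennreal (\<rho> * exp (- \<rho> * (?h + s)))"
        by (simp only: ennreal_mult' exp_ge_zero)
      then show ?thesis using True
        unfolding variation_density_def var_up_def var_down_def nat_floor_shift[OF hn_pos True] by (simp only: mult.assoc)
    qed simp
  qed
  also have "\<dots> = ennreal (exp (\<rho> * ?h)) * (\<integral>\<^sup>+s\<in>{0..}. ?f (?h + s) \<partial>lborel)"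
  proof (rule nn_integral_cmult)
    have "(\<lambda>s. ?f (?h + s)) \<in> borel_measurable borel" by (rule measurable_compose[OF _ m]) measurable
    then show "(\<lambda>s. ?f (?h + s) * indicator {0..} s) \<in> borel_measurable lborel" by simp
  qed
  also have "\<dots> \<le> ennreal (exp (\<rho> * ?h)) * (\<integral>\<^sup>+s\<in>{0..}. ?f s \<partial>lborel)"
    using hn_pos[of "snd p"] by (intro mult_left_mono nn_integral_shift_le[OF m]) auto
  also have "(\<integral>\<^sup>+s\<in>{0..}. ?f s \<partial>lborel) = vpath ?h c ?C \<omega>" by (rule vpath_eq_integral[OF hn_pos, symmetric])
  finally show ?thesis .
qed

lemma Y_bound:
  assumes reg: "value_regularity Ob (value_fun M F D g \<rho> q0p q0m) vc q0p q0m"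
    and d: "d \<in> Ob" and \<delta>: "0 < \<delta>"
  shows "eventually (\<lambda>p. (\<integral>\<^sup>+\<omega>. ennreal (exp (\<rho> * hn (snd p))) * (gpath (hn (snd p)) d (Y c d p) \<omega> + vpath (hn (snd p)) c (Y c d p) \<omega>) \<partial>M)
    \<le> ennreal (exp (\<rho> * hn (snd p)) * ((val c d + \<delta>) / (1 - eta (fst p))))) iter_seq"
proof -
  from near_value[OF reg d \<delta>, of c] obtain n0 where n0: "\<And>n. n0 \<le> n \<Longrightarrow> \<exists>C. grid_control (hn n) (real n) C \<and>
    (\<forall>N. grid_cost (hn n) d c C N \<le> val c d + \<delta>)" by blast
  obtain n1 :: nat where n1: "\<bar>c\<bar> \<le> real n1" using real_arch_simple by blast
  have "(\<integral>\<^sup>+\<omega>. ennreal (exp (\<rho> * hn n)) * (gpath (hn n) d (Y c d (j, n)) \<omega> + vpath (hn n) c (Y c d (j, n)) \<omega>) \<partial>M)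
    \<le> ennreal (exp (\<rho> * hn n) * ((val c d + \<delta>) / (1 - eta j)))" if n: "max n0 n1 \<le> n" for j n
  proof -
    obtain C where C: "grid_control (hn n) (real n) C" "\<And>N. grid_cost (hn n) d c C N \<le> val c d + \<delta>"
      using n0[of n] n by auto
    have cn: "\<bar>c\<bar> \<le> real n" using n n1 by auto
    let ?e = "eta j * min q0p q0m" and ?C = "Y c d (j, n)"
    have e: "0 < eta j" "eta j < 1" by (rule eta_bounds)+
    have "2 * eta j \<le> 1" by (simp add: eta_def field_simps)
    then have "2 * eta j * min q0p q0m \<le> 1 * min q0p q0m" using q0p_pos q0m_pos by (intro mult_right_mono) auto
    also have "1 * min q0p q0m < q0p + q0m" using q0p_pos q0m_pos by simp
    finally have e2: "2 * ?e < q0p + q0m" by (simp only: mult.assoc)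
    have e3: "0 \<le> ?e" "?e \<le> eta j * q0p" "?e \<le> eta j * q0m" using e q0p_pos q0m_pos by auto
    have gc: "grid_control (hn n) (real n) ?C" using Y_grid[OF d, of "(j, n)"] by simp
    have le: "grid_cost (hn n) d c ?C N \<le> (val c d + \<delta>) / (1 - eta j)" for N
    proof -
      \<comment> \<open>Both initial capacities are \<open>c\<close>, so the \<open>Psi\<close>
        terms cancel.\<close>
      have "(1 - eta j) * grid_cost (hn n) d c ?C N \<le> (val c d + \<delta>) + (Psi (hn n) (real n) c d - Psi (hn n) (real n) c d)"
        unfolding Y_def fst_conv snd_conv
        by (rule pol_near_optimal[OF hn_pos d cn cn e3(1) e2 less_imp_le[OF e(1)] less_imp_le[OF e(2)] e3(2,3) C])
      then show ?thesis using e by (simp add: pos_le_divide_eq mult.commute)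
    qed
    have m: "gpath (hn n) d ?C \<in> borel_measurable M" "vpath (hn n) c ?C \<in> borel_measurable M"
      by (rule gpath_meas[OF hn_pos d gc] vpath_meas[OF hn_pos gc])+
    have "(\<integral>\<^sup>+\<omega>. ennreal (exp (\<rho> * hn n)) * (gpath (hn n) d ?C \<omega> + vpath (hn n) c ?C \<omega>) \<partial>M)
      = ennreal (exp (\<rho> * hn n)) * ((\<integral>\<^sup>+\<omega>. gpath (hn n) d ?C \<omega> \<partial>M) + (\<integral>\<^sup>+\<omega>. vpath (hn n) c ?C \<omega> \<partial>M))"
      using m by (simp add: nn_integral_cmult nn_integral_add)
    also have "\<dots> \<le> ennreal (exp (\<rho> * hn n)) * ennreal ((val c d + \<delta>) / (1 - eta j))"
      unfolding grid_cost_nn[OF hn_pos d gc cn] using le by (intro mult_left_mono SUP_least ennreal_leI) auto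
    finally show ?thesis by (simp only: ennreal_mult' exp_ge_zero)
  qed
  then show ?thesis unfolding eventually_iter_seq fst_conv snd_conv eventually_sequentially by blast
qed

lemma Y_bound_lim: "((\<lambda>p. ennreal (exp (\<rho> * hn (snd p)) * (B / (1 - eta (fst p))))) \<longlongrightarrow> ennreal B) iter_seq"
proof -
  have "((\<lambda>p. eta (fst p)) \<longlongrightarrow> 0) iter_seq" by (rule filterlim_compose[OF eta_lim filterlim_fst_iter_seq])
  then have "((\<lambda>p. exp (\<rho> * hn (snd p)) * (B / (1 - eta (fst p)))) \<longlongrightarrow> exp (\<rho> * 0) * (B / (1 - 0))) iter_seq"
    by (intro tendsto_intros hn_snd_lim) auto
  then show ?thesis by (intro tendsto_ennrealI) simp
qed

context
  assumes reg: "value_regularity Ob (value_fun M F D g \<rho> q0p q0m) vc q0p q0m"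
    and breg: "boundary_regularity Ob bp bm"
begin

text \<open>\<open>pol_upper\<close> and \<open>pol_lower\<close> hold for all small tolerances and,
  given the tolerance, for all fine meshes, which is convergence along
  \<open>iter_seq\<close>.\<close>

lemma Y_tendsto:
  assumes d: "d \<in> Ob" and w: "\<omega> \<in> space M" and t: "0 \<le> t"
  shows "((\<lambda>p. Y c d p (Suc (nat \<lfloor>t / hn (snd p)\<rfloor>)) \<omega>) \<longlongrightarrow> Cs c d t \<omega>) iter_seq"
proof -
  have m: "0 < min q0p q0m" using q0p_pos q0m_pos by simp
  have ev: "eventually P iter_seq"
    if ex: "\<exists>e0>0. \<forall>\<epsilon>. 0 < \<epsilon> \<and> \<epsilon> < e0 \<longrightarrow> eventually (\<lambda>n. Q \<epsilon> n) sequentially"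
      and Q: "\<And>j n. Q (eta j * min q0p q0m) n \<Longrightarrow> P (j, n)" for P Q
  proof -
    obtain e0 where e0: "0 < e0" "\<And>\<epsilon>. 0 < \<epsilon> \<Longrightarrow> \<epsilon> < e0 \<Longrightarrow> eventually (\<lambda>n. Q \<epsilon> n) sequentially" using ex by blast
    have "(\<lambda>j. eta j * min q0p q0m) \<longlonglongrightarrow> 0 * min q0p q0m" by (intro tendsto_intros eta_lim)
    then have "eventually (\<lambda>j. eta j * min q0p q0m < e0) sequentially" using order_tendstoD(2) e0(1) by fastforce
    then show ?thesis unfolding eventually_iter_seq
    proof eventually_elim
      case (elim j)
      have "0 < eta j * min q0p q0m" using eta_bounds m by simp
      from e0(2)[OF this elim] show ?case by eventually_elim (rule Q)
    qed
  qed
  show ?thesis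
  proof (rule order_tendstoI)
    fix a assume "a < Cs c d t \<omega>"
    then obtain z where z: "a < z" "z < Cs c d t \<omega>" using dense by blast
    show "eventually (\<lambda>p. a < Y c d p (Suc (nat \<lfloor>t / hn (snd p)\<rfloor>)) \<omega>) iter_seq"
      by (rule ev[OF pol_lower[OF reg breg d w t z(2)]]) (use z(1) in \<open>simp add: Y_def\<close>)
  next
    fix a assume "Cs c d t \<omega> < a"
    then obtain z where z: "z < a" "Cs c d t \<omega> < z" using dense by blast
    show "eventually (\<lambda>p. Y c d p (Suc (nat \<lfloor>t / hn (snd p)\<rfloor>)) \<omega> < a) iter_seq"
      by (rule ev[OF pol_upper[OF reg breg d w t z(2)]]) (use z(1) in \<open>simp add: Y_def\<close>)
  qed
qed

text \<open>The policy is read up to one mesh width after \<open>t\<close>, so measurability is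
  obtained at strictly later times; \<open>Cs_adapted\<close> removes the delay by right-continuity
  of the filtration.\<close>

lemma Cs_measurable_later:
  assumes d: "d \<in> Ob" and t: "0 \<le> t" "t < s"
  shows "Cs c d t \<in> borel_measurable (F s)"
proof -
  \<comment> \<open>The default \<open>0\<close> replaces readings that might use information after
    \<open>s\<close>; once the mesh is fine enough it no longer occurs.\<close>
  define f where "f = (\<lambda>p \<omega>. if t + hn (snd p) \<le> s then ereal (Y c d p (Suc (nat \<lfloor>t / hn (snd p)\<rfloor>)) \<omega>) else 0)"
  have fm: "f p \<in> borel_measurable (F s)" for p
  proof (cases "t + hn (snd p) \<le> s")
    case True
    let ?k = "Suc (nat \<lfloor>t / hn (snd p)\<rfloor>)"
    have "real ?k * hn (snd p) \<le> t + hn (snd p)" by (rule grid_bracket(4)[OF hn_pos t(1) order_refl])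
    then have k: "real ?k * hn (snd p) \<le> s" using True by (rule order_trans)
    have "Y c d p ?k \<in> borel_measurable (F (real ?k * hn (snd p)))" using Y_grid[OF d, of p c] unfolding grid_control_def by blast
    then have "Y c d p ?k \<in> borel_measurable (F s)" using hn_pos[of "snd p"] k by (intro measurable_F_mono[of "real ?k * hn (snd p)" s]) auto
    then show ?thesis using True unfolding f_def by simp
  qed (simp add: f_def)
  have eq: "ereal (Cs c d t \<omega>) = iter_liminf (\<lambda>p. f p \<omega>)" if w: "\<omega> \<in> space M" for \<omega>
  proof (rule iter_liminf_eq[symmetric])
    have "((\<lambda>p. ereal (Y c d p (Suc (nat \<lfloor>t / hn (snd p)\<rfloor>)) \<omega>)) \<longlongrightarrow> ereal (Cs c d t \<omega>)) iter_seq"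
      using Y_tendsto[OF d w t(1)] by (rule tendsto_ereal)
    moreover have "eventually (\<lambda>p. hn (snd p) < s - t) iter_seq" using order_tendstoD(2)[OF hn_snd_lim] t(2) by simp
    then have "eventually (\<lambda>p. ereal (Y c d p (Suc (nat \<lfloor>t / hn (snd p)\<rfloor>)) \<omega>) = f p \<omega>) iter_seq"
      by eventually_elim (simp add: f_def)
    ultimately show "((\<lambda>p. f p \<omega>) \<longlongrightarrow> ereal (Cs c d t \<omega>)) iter_seq" by (rule Lim_transform_eventually)
  qed
  have "(\<lambda>\<omega>. iter_liminf (\<lambda>p. f p \<omega>)) \<in> borel_measurable (F s)" using fm by measurable
  then have "(\<lambda>\<omega>. ereal (Cs c d t \<omega>)) \<in> borel_measurable (F s)"
    by (rule measurable_cong[THEN iffD1, rotated]) (use t in \<open>simp add: space_F eq\<close>)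
  then show ?thesis by (simp add: borel_measurable_ereal_iff)
qed

lemma Cs_adapted:
  assumes d: "d \<in> Ob" and t: "0 \<le> t" shows "Cs c d t \<in> borel_measurable (F t)"
proof (rule measurableI)
  fix A :: "real set" assume A: "A \<in> sets borel"
  have "Cs c d t -` A \<inter> space M \<in> sets (F s)" if "t < s" for s
    using measurable_sets[OF Cs_measurable_later[OF d t that, of c] A] t that by (simp add: space_F)
  moreover have "sets (F t) = (\<Inter>s\<in>{t<..}. sets (F s))" using filtration t unfolding usual_filtration_def by blast
  ultimately show "Cs c d t -` A \<inter> space (F t) \<in> sets (F t)" using t by (simp add: space_F)
qed simp

lemma Cs_control: assumes d: "d \<in> Ob" shows "(\<lambda>t \<omega>. Cs c d t \<omega> - c) \<in> controls M F"
  unfolding controls_def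
proof (intro CollectI conjI ballI allI impI)
  show "adapted F (\<lambda>t \<omega>. Cs c d t \<omega> - c)" unfolding adapted_def using Cs_adapted[OF d] by simp
  fix \<omega> assume w: "\<omega> \<in> space M"
  interpret hy: hysteresis Ob bp bm c "\<lambda>s. D d s \<omega>" by (rule hysteresis_path[OF reg breg d w])
  have C: "Cs c d t \<omega> = hy.C t" for t unfolding Cs_def hy.C_def ..
  show "cadlag (\<lambda>t. Cs c d t \<omega> - c)" unfolding C by (rule hy.C_cadlag)
  show "total_variation (\<lambda>s. Cs c d s \<omega> - c) t < \<infinity>" for t unfolding C by (rule hy.C_total_variation)
qed

lemma Cs_real: assumes "d \<in> Ob" "\<omega> \<in> space M" "0 \<le> t" shows "ereal (Cs c d t \<omega>) = C_star bp bm c (\<lambda>s. D d s \<omega>) t"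
proof -
  interpret hy: hysteresis Ob bp bm c "\<lambda>s. D d s \<omega>" by (rule hysteresis_path[OF reg breg assms(1,2)])
  show ?thesis using hy.C_star_real[OF assms(3)] by (simp add: Cs_def)
qed

lemma shifted_control_tendsto:
  assumes d: "d \<in> Ob" and w: "\<omega> \<in> space M"
  shows "((\<lambda>p. extend0 (\<lambda>s. shifted_control c d p s \<omega>) t) \<longlongrightarrow> extend0 (\<lambda>s. Cs c d s \<omega> - c) t) iter_seq"
proof (cases "t < 0")
  case False
  then have "((\<lambda>p. shifted_control c d p t \<omega>) \<longlongrightarrow> Cs c d t \<omega> - c) iter_seq"
    unfolding shifted_control_def by (intro tendsto_intros Y_tendsto[OF d w]) simp
  then show ?thesis using False by (simp add: extend0_def)
qed (simp add: extend0_def)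

lemma run_density_tendsto:
  assumes d: "d \<in> Ob" and w: "\<omega> \<in> space M" and s: "0 \<le> s"
  shows "((\<lambda>p. run_density c d p \<omega> s) \<longlongrightarrow> ennreal (exp (- \<rho> * s) * g (Cs c d s \<omega>) (X d s \<omega>))) iter_seq"
proof -
  have "isCont (\<lambda>t. X d t \<omega>) (0 + s)" using X_cont[OF d w] by (simp add: continuous_on_eq_continuous_at)
  moreover have "((\<lambda>p. hn (snd p) + s) \<longlongrightarrow> 0 + s) iter_seq" by (intro tendsto_intros hn_snd_lim)
  ultimately have X: "((\<lambda>p. X d (hn (snd p) + s) \<omega>) \<longlongrightarrow> X d (0 + s) \<omega>) iter_seq" by (rule isCont_tendsto_compose)
  have C: "((\<lambda>p. c + shifted_control c d p s \<omega>) \<longlongrightarrow> c + (Cs c d s \<omega> - c)) iter_seq"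
    unfolding shifted_control_def by (intro tendsto_intros Y_tendsto[OF d w s])
  have "((\<lambda>p. (case (c + shifted_control c d p s \<omega>, X d (hn (snd p) + s) \<omega>) of (c, d) \<Rightarrow> g c d)) \<longlongrightarrow>
      (case (c + (Cs c d s \<omega> - c), X d (0 + s) \<omega>) of (c, d) \<Rightarrow> g c d)) iter_seq"
    by (rule continuous_on_tendsto_compose[OF g_cont tendsto_Pair[OF C X]]) (use X_in[OF d w] in auto)
  then have "((\<lambda>p. g (c + shifted_control c d p s \<omega>) (X d (hn (snd p) + s) \<omega>)) \<longlongrightarrow> g (Cs c d s \<omega>) (X d s \<omega>)) iter_seq" by simp
  then show ?thesis unfolding run_density_def by (intro tendsto_ennrealI tendsto_mult tendsto_const)
qed

text \<open>Sums over fixed partitions converge, and each is bounded by the variation of the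
  approximating path. Independent partitions are used for increases and decreases, and the suprema
  over them are taken only after the limit.\<close>

lemma lower_limit:
  assumes d: "d \<in> Ob" and w: "\<omega> \<in> space M" and s: "0 \<le> s"
  shows "ennreal (exp (- \<rho> * s) * g (Cs c d s \<omega>) (X d s \<omega>))
      + ennreal (\<rho> * exp (- \<rho> * s)) * (ennreal q0p * pos_variation (\<lambda>s. Cs c d s \<omega> - c) s
          + ennreal q0m * neg_variation (\<lambda>s. Cs c d s \<omega> - c) s)
    \<le> iter_liminf (\<lambda>p. run_density c d p \<omega> s + variation_density c d p \<omega> s)"
proof -
  define f where "f = extend0 (\<lambda>s. Cs c d s \<omega> - c)"
  define fp where "fp = (\<lambda>p. extend0 (\<lambda>s. shifted_control c d p s \<omega>))"
  let ?up = "\<lambda>f :: real \<Rightarrow> real. \<lambda>(n, r). \<Sum>i<n. ennreal (max 0 (f (r (Suc i)) - f (r i)))"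
  let ?dn = "\<lambda>f :: real \<Rightarrow> real. \<lambda>(n, r). \<Sum>i<n. ennreal (max 0 (f (r i) - f (r (Suc i))))"
  let ?G = "ennreal (exp (- \<rho> * s) * g (Cs c d s \<omega>) (X d s \<omega>))" and ?w = "ennreal (\<rho> * exp (- \<rho> * s))"
  let ?L = "iter_liminf (\<lambda>p. run_density c d p \<omega> s + variation_density c d p \<omega> s)"
  have lim: "((\<lambda>p. fp p r) \<longlongrightarrow> f r) iter_seq" for r unfolding f_def fp_def by (rule shifted_control_tendsto[OF d w])
  have part: "?G + ?w * (ennreal q0p * ?up f P + ennreal q0m * ?dn f Q) \<le> ?L"
    if P: "P \<in> partitions_upto s" and Q: "Q \<in> partitions_upto s" for P Q
  proof -
    have up: "((\<lambda>p. ?up (fp p) P) \<longlongrightarrow> ?up f P) iter_seq"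
      unfolding case_prod_beta by (intro tendsto_sum tendsto_ennrealI tendsto_max tendsto_const tendsto_diff lim)
    have dn: "((\<lambda>p. ?dn (fp p) Q) \<longlongrightarrow> ?dn f Q) iter_seq"
      unfolding case_prod_beta by (intro tendsto_sum tendsto_ennrealI tendsto_max tendsto_const tendsto_diff lim)
    have "((\<lambda>p. run_density c d p \<omega> s + ?w * (ennreal q0p * ?up (fp p) P + ennreal q0m * ?dn (fp p) Q))
      \<longlongrightarrow> ?G + ?w * (ennreal q0p * ?up f P + ennreal q0m * ?dn f Q)) iter_seq"
      by (intro tendsto_add ennreal_tendsto_cmult run_density_tendsto[OF d w s] up dn) auto
    from iter_liminf_ge[OF this]
    have "?G + ?w * (ennreal q0p * ?up f P + ennreal q0m * ?dn f Q)
      \<le> iter_liminf (\<lambda>p. run_density c d p \<omega> s + ?w * (ennreal q0p * ?up (fp p) P + ennreal q0m * ?dn (fp p) Q))" .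
    also have "\<dots> \<le> ?L"
    proof (intro iter_liminf_mono always_eventually allI)
      fix p
      have "?up (fp p) P \<le> pos_variation (\<lambda>s. shifted_control c d p s \<omega>) s"
        unfolding pos_variation_def fp_def by (rule SUP_upper[OF P])
      then have u: "?up (fp p) P \<le> ennreal (var_up c d p s \<omega>)" using shifted_control_variation(1)[OF s] by (rule order_trans)
      have "?dn (fp p) Q \<le> neg_variation (\<lambda>s. shifted_control c d p s \<omega>) s"
        unfolding neg_variation_def fp_def by (rule SUP_upper[OF Q])
      then have v: "?dn (fp p) Q \<le> ennreal (var_down c d p s \<omega>)" using shifted_control_variation(2)[OF s] by (rule order_trans)
      show "run_density c d p \<omega> s + ?w * (ennreal q0p * ?up (fp p) P + ennreal q0m * ?dn (fp p) Q) \<le> run_density c d p \<omega> s + variation_density c d p \<omega> s"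
        unfolding variation_density_def by (intro add_left_mono mult_left_mono add_mono u v) auto
    qed
    finally show ?thesis .
  qed
  have ne: "partitions_upto s \<noteq> {}" by (force simp: partitions_upto_def)
  have half: "?G + ?w * (ennreal q0p * ?up f P + ennreal q0m * (SUP Q\<in>partitions_upto s. ?dn f Q)) \<le> ?L"
    if P: "P \<in> partitions_upto s" for P
  proof -
    have "(?G + ?w * (ennreal q0p * ?up f P)) + (?w * ennreal q0m) * (SUP Q\<in>partitions_upto s. ?dn f Q) \<le> ?L"
      using part[OF P] by (intro SUP_affine_le[OF ne]) (simp only: distrib_left add.assoc mult.assoc)
    then show ?thesis by (simp only: distrib_left add.assoc mult.assoc)
  qed
  let ?N = "SUP Q\<in>partitions_upto s. ?dn f Q"
  have "(?G + ?w * (ennreal q0m * ?N)) + (?w * ennreal q0p) * (SUP P\<in>partitions_upto s. ?up f P) \<le> ?L"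
    using half by (intro SUP_affine_le[OF ne]) (simp only: distrib_left add.assoc mult.assoc add.commute[of "?w * (ennreal q0m * ?N)"])
  then show ?thesis unfolding pos_variation_def neg_variation_def f_def[symmetric]
    by (simp only: distrib_left add.assoc mult.assoc add.commute[of "?w * (ennreal q0m * ?N)"])
qed

text \<open>Because the control cost is an integral of the variation over time, the bound
  \<open>lower_limit\<close> can be integrated and Fatou's lemma applied to each path.\<close>

lemma path_cost_le:
  fixes c d :: real and \<omega> :: 'a
  assumes d: "d \<in> Ob" and w: "\<omega> \<in> space M"
  defines "I \<equiv> \<lambda>t \<omega>. Cs c d t \<omega> - c"
  shows "(\<integral>\<^sup>+t\<in>{0..}. ennreal (exp (- \<rho> * t) * g (capacity c I t \<omega>) (D d t \<omega>)) \<partial>lborel)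
      + (\<integral>\<^sup>+t\<in>{0..}. ennreal (exp (- \<rho> * t) * q0p) \<partial>(dI_plus I \<omega>))
      + (\<integral>\<^sup>+t\<in>{0..}. ennreal (exp (- \<rho> * t) * q0m) \<partial>(dI_minus I \<omega>))
    \<le> iter_liminf (\<lambda>p. ennreal (exp (\<rho> * hn (snd p))) * (gpath (hn (snd p)) d (Y c d p) \<omega> + vpath (hn (snd p)) c (Y c d p) \<omega>))"
proof -
  have I: "I \<in> controls M F" unfolding I_def by (rule Cs_control[OF d])
  let ?pv = "pos_variation (\<lambda>s. I s \<omega>)" and ?nv = "neg_variation (\<lambda>s. I s \<omega>)"
  let ?a = "\<lambda>s. ennreal (exp (- \<rho> * s) * g (c + I (max 0 s) \<omega>) (X d s \<omega>)) * indicator {0..} s"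
  let ?b = "\<lambda>s. ennreal (\<rho> * exp (- \<rho> * s)) * (ennreal q0p * ?pv s) * indicator {0..} s"
  let ?c = "\<lambda>s. ennreal (\<rho> * exp (- \<rho> * s)) * (ennreal q0m * ?nv s) * indicator {0..} s"
  have am: "?a \<in> borel_measurable lborel"
  proof -
    have "(\<lambda>(t, \<omega>). c + I (max 0 t) \<omega>) \<in> borel_measurable (lborel \<Otimes>\<^sub>M M)"
      using borel_measurable_add[OF borel_measurable_const[of c] control_joint[OF I]] by (simp add: case_prod_beta)
    from measurable_compose[OF measurable_Pair2'[OF w] g_joint[OF d this]] show ?thesis by simp
  qed
  have tv: "total_variation (\<lambda>s. I s \<omega>) t < \<infinity>" for t
  proof (cases "0 \<le> t")
    case True then show ?thesis using I w unfolding controls_def by blast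
  next
    case False
    then have "total_variation (\<lambda>s. I s \<omega>) t \<le> ennreal 0"
      by (intro total_variation_le[where p = "\<lambda>_. 0"]) (auto simp: extend0_def)
    then show ?thesis by (simp add: le_less_trans)
  qed
  have "?pv \<in> borel_measurable borel"
    by (rule pos_variation_measurable) (rule le_less_trans[OF pos_variation_le_total tv])
  then have bm': "?b \<in> borel_measurable lborel" by measurable
  have "pos_variation (\<lambda>s. - I s \<omega>) \<in> borel_measurable borel"
    by (rule pos_variation_measurable, rule le_less_trans[OF pos_variation_le_total]) (use tv in \<open>simp add: total_variation_neg\<close>)
  moreover have "?nv = pos_variation (\<lambda>s. - I s \<omega>)" by (rule ext) (rule neg_variation_eq)
  ultimately have "?nv \<in> borel_measurable borel" by (simp only:)
  then have cm': "?c \<in> borel_measurable lborel" by measurable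
  have "(\<integral>\<^sup>+t\<in>{0..}. ennreal (exp (- \<rho> * t) * g (capacity c I t \<omega>) (D d t \<omega>)) \<partial>lborel) = (\<integral>\<^sup>+s. ?a s \<partial>lborel)"
    by (intro nn_integral_cong) (auto simp: indicator_def X_eq capacity_def max_absorb2)
  then have "(\<integral>\<^sup>+t\<in>{0..}. ennreal (exp (- \<rho> * t) * g (capacity c I t \<omega>) (D d t \<omega>)) \<partial>lborel)
      + (\<integral>\<^sup>+t\<in>{0..}. ennreal (exp (- \<rho> * t) * q0p) \<partial>(dI_plus I \<omega>))
      + (\<integral>\<^sup>+t\<in>{0..}. ennreal (exp (- \<rho> * t) * q0m) \<partial>(dI_minus I \<omega>))
    = (\<integral>\<^sup>+s. ?a s \<partial>lborel) + ((\<integral>\<^sup>+s. ?b s \<partial>lborel) + (\<integral>\<^sup>+s. ?c s \<partial>lborel))"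
    using controls_var_cost[OF I w] by (simp only: add.assoc)
  also have "\<dots> = (\<integral>\<^sup>+s. ?a s + (?b s + ?c s) \<partial>lborel)"
  proof -
    have "(\<integral>\<^sup>+s. ?b s \<partial>lborel) + (\<integral>\<^sup>+s. ?c s \<partial>lborel) = (\<integral>\<^sup>+s. ?b s + ?c s \<partial>lborel)"
      by (rule nn_integral_add[symmetric]) (use bm' cm' in auto)
    moreover have "(\<integral>\<^sup>+s. ?a s \<partial>lborel) + (\<integral>\<^sup>+s. ?b s + ?c s \<partial>lborel) = (\<integral>\<^sup>+s. ?a s + (?b s + ?c s) \<partial>lborel)"
      by (rule nn_integral_add[symmetric]) (use am bm' cm' in auto)
    ultimately show ?thesis by simp
  qed
  also have "\<dots> \<le> (\<integral>\<^sup>+s. iter_liminf (\<lambda>p. (run_density c d p \<omega> s + variation_density c d p \<omega> s) * indicator {0..} s) \<partial>lborel)"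
  proof (intro nn_integral_mono)
    fix s :: real
    show "?a s + (?b s + ?c s) \<le> iter_liminf (\<lambda>p. (run_density c d p \<omega> s + variation_density c d p \<omega> s) * indicator {0..} s)"
    proof (cases "0 \<le> s")
      case True
      then have "?a s + (?b s + ?c s) = ennreal (exp (- \<rho> * s) * g (Cs c d s \<omega>) (X d s \<omega>))
        + ennreal (\<rho> * exp (- \<rho> * s)) * (ennreal q0p * ?pv s + ennreal q0m * ?nv s)"
        by (simp add: I_def max_absorb2 distrib_left)
      also have "\<dots> \<le> iter_liminf (\<lambda>p. run_density c d p \<omega> s + variation_density c d p \<omega> s)" unfolding I_def by (rule lower_limit[OF d w True])
      finally show ?thesis using True by simp
    qed simp
  qed
  also have "\<dots> \<le> iter_liminf (\<lambda>p. \<integral>\<^sup>+s. (run_density c d p \<omega> s + variation_density c d p \<omega> s) * indicator {0..} s \<partial>lborel)"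
    by (rule nn_integral_iter_liminf) (use run_density_meas[OF d w] variation_density_meas in simp)
  also have "\<dots> \<le> iter_liminf (\<lambda>p. ennreal (exp (\<rho> * hn (snd p))) * (gpath (hn (snd p)) d (Y c d p) \<omega> + vpath (hn (snd p)) c (Y c d p) \<omega>))"
  proof (intro iter_liminf_mono always_eventually allI)
    fix p
    have "(\<integral>\<^sup>+s. (run_density c d p \<omega> s + variation_density c d p \<omega> s) * indicator {0..} s \<partial>lborel)
      = (\<integral>\<^sup>+s\<in>{0..}. run_density c d p \<omega> s \<partial>lborel) + (\<integral>\<^sup>+s\<in>{0..}. variation_density c d p \<omega> s \<partial>lborel)"
      unfolding distrib_right by (rule nn_integral_add) (use run_density_meas[OF d w] variation_density_meas in simp)+
    also have "\<dots> \<le> ennreal (exp (\<rho> * hn (snd p))) * (gpath (hn (snd p)) d (Y c d p) \<omega> + vpath (hn (snd p)) c (Y c d p) \<omega>)"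
      unfolding distrib_left by (intro add_mono run_density_gpath[OF d w] variation_density_vpath)
    finally show "(\<integral>\<^sup>+s. (run_density c d p \<omega> s + variation_density c d p \<omega> s) * indicator {0..} s \<partial>lborel)
      \<le> ennreal (exp (\<rho> * hn (snd p))) * (gpath (hn (snd p)) d (Y c d p) \<omega> + vpath (hn (snd p)) c (Y c d p) \<omega>)" .
  qed
  finally show ?thesis .
qed

text \<open>Fatou's lemma in \<open>\<omega>\<close> bounds the cost by the nested lower limit of
  the policies' costs; the factors \<open>exp (\<rho> * hn (snd p))\<close> and
  \<open>1 / (1 - eta (fst p))\<close> tend to \<open>1\<close>, and the remaining excess
  \<open>\<delta>\<close> is arbitrary.\<close>

lemma Cs_optimal:
  assumes d: "d \<in> Ob"
  shows "cost M D g \<rho> q0p q0m c d (\<lambda>t \<omega>. Cs c d t \<omega> - c) = value_fun M F D g \<rho> q0p q0m c d"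
proof (rule antisym)
  let ?I = "\<lambda>t \<omega>. Cs c d t \<omega> - c"
  let ?\<psi> = "\<lambda>p \<omega>. ennreal (exp (\<rho> * hn (snd p))) * (gpath (hn (snd p)) d (Y c d p) \<omega> + vpath (hn (snd p)) c (Y c d p) \<omega>)"
  have m: "?\<psi> p \<in> borel_measurable M" for p
    using gpath_meas[OF hn_pos d Y_grid[OF d, of p c]] vpath_meas[OF hn_pos Y_grid[OF d, of p c], of c] by measurable
  have fin: "value_fun M F D g \<rho> q0p q0m c d < \<infinity>" using reg d unfolding value_regularity_def by blast
  show "cost M D g \<rho> q0p q0m c d ?I \<le> value_fun M F D g \<rho> q0p q0m c d"
  proof (rule ennreal_le_epsilon)
    fix \<delta> :: real assume \<delta>: "0 < \<delta>"
    have "cost M D g \<rho> q0p q0m c d ?I \<le> (\<integral>\<^sup>+\<omega>. iter_liminf (\<lambda>p. ?\<psi> p \<omega>) \<partial>M)"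
      unfolding cost_def by (intro nn_integral_mono path_cost_le[OF d])
    also have "\<dots> \<le> iter_liminf (\<lambda>p. \<integral>\<^sup>+\<omega>. ?\<psi> p \<omega> \<partial>M)" by (rule nn_integral_iter_liminf[OF m])
    also have "\<dots> \<le> iter_liminf (\<lambda>p. ennreal (exp (\<rho> * hn (snd p)) * ((val c d + \<delta>) / (1 - eta (fst p)))))"
      by (rule iter_liminf_mono[OF Y_bound[OF reg d \<delta>]])
    also have "\<dots> \<le> ennreal (val c d + \<delta>)" by (rule iter_liminf_le[OF Y_bound_lim])
    also have "\<dots> = value_fun M F D g \<rho> q0p q0m c d + ennreal \<delta>" using fin \<delta> by (subst ennreal_plus) auto
    finally show "cost M D g \<rho> q0p q0m c d ?I \<le> value_fun M F D g \<rho> q0p q0m c d + ennreal \<delta>" .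
  qed
  show "value_fun M F D g \<rho> q0p q0m c d \<le> cost M D g \<rho> q0p q0m c d ?I"
    unfolding value_fun_def by (rule INF_lower[OF Cs_control[OF d]])
qed

end

end

theorem theorem4p2:
  fixes M :: "'a measure" and F :: "real \<Rightarrow> 'a measure" and W :: "real \<Rightarrow> 'a \<Rightarrow> real"
    and dmin dmax :: ereal and \<mu> \<sigma> :: "real \<Rightarrow> real"
    and D :: "real \<Rightarrow> real \<Rightarrow> 'a \<Rightarrow> real" and g :: "real \<Rightarrow> real \<Rightarrow> real"
    and \<gamma>0 \<eta>0 :: "real \<Rightarrow> real" and \<nu> K0 K1 \<rho> q0p q0m c d :: real
  assumes "capacity_problem M F W dmin dmax \<mu> \<sigma> D g \<gamma>0 \<eta>0 \<nu> K0 K1 \<rho> q0p q0m"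
    and "value_regularity (demand_space dmin dmax)
           (value_fun M F D g \<rho> q0p q0m) (value_c M F D g \<rho> q0p q0m) q0p q0m"
    and "boundary_regularity (demand_space dmin dmax)
           (boundary_plus (value_c M F D g \<rho> q0p q0m) q0p)
           (boundary_minus (value_c M F D g \<rho> q0p q0m) q0m)"
    and "d \<in> demand_space dmin dmax"
  shows "let cp = boundary_plus (value_c M F D g \<rho> q0p q0m) q0p;
             cm = boundary_minus (value_c M F D g \<rho> q0p q0m) q0m;
             Cs = (\<lambda>t \<omega>. C_star cp cm c (\<lambda>s. D d s \<omega>) t);
             Is = (\<lambda>t \<omega>. real_of_ereal (Cs t \<omega>) - c)
         in Is \<in> controls M F \<and>
            (\<forall>\<omega>\<in>space M. \<forall>t\<ge>0. ereal (capacity c Is t \<omega>) = Cs t \<omega>) \<and>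
            cost M D g \<rho> q0p q0m c d Is = value_fun M F D g \<rho> q0p q0m c d"
proof -
  interpret cp: capacity_problem M F W dmin dmax \<mu> \<sigma> D g \<gamma>0 \<eta>0 \<nu> K0 K1 \<rho> q0p q0m by (rule assms(1))
  show ?thesis
    using cp.Cs_control[OF assms(2-4), of c] cp.Cs_optimal[OF assms(2-4), of c] cp.Cs_real[OF assms(2-4), of _ _ c]
    unfolding Let_def cp.Cs_def capacity_def by auto
qed

end
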